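(* Let $\mathcal{K}$ be a compact subset of the phase space $\mathbb{R}^4$ containing the solution trajectory of $\dot{\mathbf z}=J\nabla_{\mathbf z}H_0(\mathbf z)$, where $H_0(\mathbf z)=K(\mathbf p)+\varepsilon V(\mathbf q)$, and let $V$ be analytic in $B_r\mathcal{K}$ for some $r>0$. Then, for all sufficiently small $\varepsilon>0$, there exists a near-identity change of coordinates $\Psi_\varepsilon$, symplectic with respect to $J$, such that $$\tilde H = H_0\circ\Psi_\varepsilon = K+\varepsilon\,G+e^{-c/\varepsilon}\,R,$$ where $$\{G,K\}=0,$$ $G$ and $R$ have $\varepsilon$-independent bounds on $\mathcal{K}$, and $c>0$ is some constant (independent of $\varepsilon$).
   Context: Phase space variable: $\mathbf z=(\mathbf p^T,\mathbf q^T)^T\in\mathbb{R}^4$ with $\mathbf p,\mathbf q\in\mathbb{R}^2$. Set $$J_2=\begin{pmatrix}0&1\\-1&0\end{pmatrix},\qquad J=\begin{pmatrix}J_2&-I_2\\ I_2&0_2\end{pmatrix}\in\mathbb{R}^{4\times4}.$$ The Hamiltonian is $H_0(\mathbf z)=K(\mathbf p)+\varepsilon V(\mathbf q)$ with $K(\mathbf p)=\tfrac12\mathbf p^T\mathbf p$, a given ($\varepsilon$-independent) potential $V$, and a small parameter $\varepsilon>0$ (the limit $\varepsilon\to0$ is considered). Equations of motion: $\dot{\mathbf z}=J\nabla_{\mathbf z}H_0(\mathbf z)$, i.e. $\dot{\mathbf p}=J_2\mathbf p-\varepsilon\nabla_{\mathbf q}V(\mathbf q)$, $\dot{\mathbf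 q}=\mathbf p$. The Poisson bracket is the one obtained from $J$: $\{f,g\}=(\nabla_{\mathbf z}f)^TJ\,\nabla_{\mathbf z}g$. A change of coordinates $\Psi$ is symplectic with respect to $J$ if $D\Psi\,J\,D\Psi^T=J$; it is near-identity if $\Psi_\varepsilon=\mathrm{Id}+\mathcal{O}(\varepsilon)$. For $\mathcal{K}\subset\mathbb{R}^4$ compact, $B_r\mathcal{K}\subset\mathbb{C}^4$ is the union of the complex balls of radius $r$ with centres in $\mathcal{K}$; $V$ is regarded as a function of $\mathbf z$ (depending only on $\mathbf q$). *)

theory Defs
  imports "HOL-Analysis.Analysis"
begin

text \<open>Phase space points are \<open>z = (p\<^sub>1, p\<^sub>2, q\<^sub>1, q\<^sub>2)\<close>. The projections are polymorphic
  because they are also used on \<open>\<complex>\<^sup>4\<close>.\<close>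

definition p_part :: "'a::zero ^ 4 \<Rightarrow> 'a ^ 2" where
  "p_part z = vector [z $ 1, z $ 2]"

definition q_part :: "'a::zero ^ 4 \<Rightarrow> 'a ^ 2" where
  "q_part z = vector [z $ 3, z $ 4]"

definition J2 :: "real ^ 2 ^ 2" where
  "J2 = vector [vector [0, 1], vector [-1, 0]]"

definition J :: "real ^ 4 ^ 4" where
  "J = vector [vector [ 0, 1, -1,  0],
               vector [-1, 0,  0, -1],
               vector [ 1, 0,  0,  0],
               vector [ 0, 1,  0,  0]]"

text \<open>The block form of \<open>J\<close>, with rows \<open>(J\<^sub>2, -I\<^sub>2)\<close> and \<open>(I\<^sub>2, 0)\<close>.\<close>

lemma J_blocks:
  "p_part (J *v z) = J2 *v p_part z - q_part z"
  "q_part (J *v z) = p_part z"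
proof -
  have U4: "(UNIV :: 4 set) = {1, 2, 3, 4}"
  proof -
    have "card {1, 2, 3, 4 :: 4} = card (UNIV :: 4 set)" by simp
    then show ?thesis by (metis card_subset_eq finite subset_UNIV)
  qed
  have s4: "sum f (UNIV :: 4 set) = f 1 + f 2 + f 3 + f 4" for f :: "4 \<Rightarrow> real"
    unfolding U4 by (simp add: add.assoc)
  have v4: "(vector [a, b, c, d] :: 'b::zero ^ 4) $ 1 = a"
    "(vector [a, b, c, d] :: 'b ^ 4) $ 2 = b"
    "(vector [a, b, c, d] :: 'b ^ 4) $ 3 = c"
    "(vector [a, b, c, d] :: 'b ^ 4) $ 4 = d" for a b c d
    by (simp_all add: vector_def)
  show "p_part (J *v z) = J2 *v p_part z - q_part z" "q_part (J *v z) = p_part z"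
    by (simp_all add: vec_eq_iff forall_2 matrix_vector_mult_def p_part_def q_part_def
        J_def J2_def s4 sum_2 v4)
qed

definition kinetic :: "real ^ 4 \<Rightarrow> real" where
  "kinetic z = (p_part z \<bullet> p_part z) / 2"

definition H0 :: "(real ^ 2 \<Rightarrow> real) \<Rightarrow> real \<Rightarrow> real ^ 4 \<Rightarrow> real" where
  "H0 V \<epsilon> z = kinetic z + \<epsilon> * V (q_part z)"

definition gradient :: "('a::real_inner \<Rightarrow> real) \<Rightarrow> 'a \<Rightarrow> 'a" where
  "gradient f z = (THE D. GDERIV f z :> D)"

definition poisson :: "(real ^ 4 \<Rightarrow> real) \<Rightarrow> (real ^ 4 \<Rightarrow> real) \<Rightarrow> real ^ 4 \<Rightarrow> real" where
  "poisson f g z = gradient f z \<bullet> (J *v gradient g z)"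

definition solves_motion ::
  "(real ^ 2 \<Rightarrow> real) \<Rightarrow> real \<Rightarrow> real set \<Rightarrow> (real \<Rightarrow> real ^ 4) \<Rightarrow> bool" where
  "solves_motion V \<epsilon> T z \<longleftrightarrow>
     (\<forall>t\<in>T. (z has_vector_derivative J *v gradient (H0 V \<epsilon>) (z t)) (at t within T))"

definition complexify :: "real ^ 'n \<Rightarrow> complex ^ 'n" where
  "complexify x = (\<chi> i. complex_of_real (x $ i))"

definition complex_nbhd :: "real \<Rightarrow> (real ^ 'n) set \<Rightarrow> (complex ^ 'n) set" where
  "complex_nbhd r S = (\<Union>x\<in>S. ball (complexify x) r)"

text \<open>Analyticity in several complex variables, for use on open sets: Frechet differentiability
  with a complex-linear derivative.\<close>

definition mv_holomorphic_on :: "(complex ^ 'n \<Rightarrow> complex) \<Rightarrow> (complex ^ 'n) set \<Rightarrow> bool" where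
  "mv_holomorphic_on f S \<longleftrightarrow>
     (\<forall>z\<in>S. \<exists>D. (f has_derivative D) (at z) \<and> (\<forall>c v. D (c *s v) = c * D v))"

text \<open>\<open>V\<close>, viewed as a function of \<open>z\<close> that depends only on \<open>q\<close>, is analytic in the complex
  neighbourhood of \<open>S\<close>: it is the restriction to real points of a holomorphic \<open>W\<close>.\<close>

definition potential_analytic_in :: "(real ^ 2 \<Rightarrow> real) \<Rightarrow> real \<Rightarrow> (real ^ 4) set \<Rightarrow> bool" where
  "potential_analytic_in V r S \<longleftrightarrow>
     (\<exists>W :: complex ^ 2 \<Rightarrow> complex.
        mv_holomorphic_on (\<lambda>z. W (q_part z)) (complex_nbhd r S) \<and>
        (\<forall>x. complexify x \<in> complex_nbhd r S \<longrightarrow>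
             W (q_part (complexify x)) = complex_of_real (V (q_part x))))"

definition C1_map_on :: "(real ^ 4 \<Rightarrow> real ^ 4) \<Rightarrow> (real ^ 4) set \<Rightarrow> bool" where
  "C1_map_on \<Psi> U \<longleftrightarrow>
     (\<forall>z\<in>U. \<Psi> differentiable (at z)) \<and> continuous_on U (\<lambda>z. jacobian \<Psi> (at z))"

definition C1_function_on :: "(real ^ 4 \<Rightarrow> real) \<Rightarrow> (real ^ 4) set \<Rightarrow> bool" where
  "C1_function_on f U \<longleftrightarrow>
     (\<forall>z\<in>U. f differentiable (at z)) \<and> continuous_on U (gradient f)"

text \<open>A change of coordinates on the open set \<open>U\<close> is a \<open>C\<^sup>1\<close> diffeomorphism onto its open image.
  The Jacobian of a symplectic map is invertible, since \<open>J\<close> is, so by the inverse function theorem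
  it is enough here to demand injectivity.\<close>

definition symplectic_change_on :: "(real ^ 4 \<Rightarrow> real ^ 4) \<Rightarrow> (real ^ 4) set \<Rightarrow> bool" where
  "symplectic_change_on \<Psi> U \<longleftrightarrow>
     C1_map_on \<Psi> U \<and> inj_on \<Psi> U \<and>
     (\<forall>z\<in>U. jacobian \<Psi> (at z) ** J ** transpose (jacobian \<Psi> (at z)) = J)"

end

theory Submission
  imports Defs "HOL-Complex_Analysis.Complex_Analysis"
begin

text \<open>The flow of \<open>K\<close> rotates \<open>p\<close> and moves \<open>q\<close> along circles, with period \<open>2 * pi\<close>. Where the whole circle
  through a point stays in the domain of \<open>V\<close>, the potential can be averaged over it: iterating the
  averaging about \<open>1 / \<epsilon>\<close> times, with a loss of domain of order \<open>\<epsilon>\<close> at each step, gives a midpoint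
  generating function whose symplectic map leaves an error of size \<open>exp (- c / \<epsilon>)\<close>. Rotation-invariant
  cutoffs extend this map to the phase space, with \<open>G = 0\<close> where a circle leaves the domain.

  Near such cut circles a perturbation \<open>\<epsilon> * E\<close> remains that is not small. There it is removed exactly:
  \<open>V\<close> may be replaced by a potential that vanishes near finitely many points \<open>y\<close> outside
  the domain, and every cut circle passes near one of them. Flowing backwards with the wanted
  Hamiltonian until the circle reaches this vacuum and then forwards with the given one is a
  near-identity symplectic map that transforms one Hamiltonian into the other.\<close>

text \<open>\<open>V\<close> is analytic only near \<open>K\<close>, while averaging needs whole
  circles, and the circle of a point of \<open>K\<close> may leave the controlled region. Near
  \<open>K\<close>, however, the transformed Hamiltonian evaluates \<open>V\<close> only near
  \<open>K\<close>; the values of \<open>V\<close>, and of every later Hamiltonian, far from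
  \<open>K\<close> are free, and this freedom creates the vacuum. The removal is exact because each
  flow conserves its own Hamiltonian and the two agree at the turning point. The turning time is
  merely continuous, but it may be varied as long as the turn stays where both vector fields agree.
  Locally the map is therefore a composition of two flows at a fixed time, hence symplectic.
  Midpoint generating functions are used because their maps stay exactly symplectic when the
  function is truncated or cut off, and because \<open>K\<close> is quadratic: its increment equals
  its derivative at the midpoint, so the error is the defect of one scalar equation on a complex
  domain. A step loses \<open>800 * L * \<epsilon>\<close> of domain and halves the error bound,
  which gives the exponential rate. Bounds uniform in \<epsilon> are carried through by estimating
  whole families of functions at once.\<close>

unbundle no fps_syntax
no_notation fps_nth (infixl "$" 75)

section \<open>Linear algebra of the rotation flow, of \<open>J\<close> and of the symplectic
  form\<close>

lemma vector_4 [simp]: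
  "(vector [a, b, c, d] :: 'a::zero ^ 4) $ 1 = a"
  "(vector [a, b, c, d] :: 'a::zero ^ 4) $ 2 = b"
  "(vector [a, b, c, d] :: 'a::zero ^ 4) $ 3 = c"
  "(vector [a, b, c, d] :: 'a::zero ^ 4) $ 4 = d"
  by (simp_all add: vector_def)

lemma p_part_nth [simp]: "p_part z $ 1 = z $ 1" "p_part z $ 2 = z $ 2"
  and q_part_nth [simp]: "q_part z $ 1 = z $ 3" "q_part z $ 2 = z $ 4"
  by (simp_all add: p_part_def q_part_def)

text \<open>The flow of \<open>K\<close> in closed form. The entries lie in any real vector space,
  so that one definition serves real and complex points.\<close>

definition rot :: "real \<Rightarrow> 'a::real_vector ^ 4 \<Rightarrow> 'a ^ 4" where
  "rot t z = vector [cos t *\<^sub>R z $ 1 + sin t *\<^sub>R z $ 2,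
                     cos t *\<^sub>R z $ 2 - sin t *\<^sub>R z $ 1,
                     z $ 3 + sin t *\<^sub>R z $ 1 + (1 - cos t) *\<^sub>R z $ 2,
                     z $ 4 + sin t *\<^sub>R z $ 2 - (1 - cos t) *\<^sub>R z $ 1]"

text \<open>The generator of \<open>rot\<close>, that is, the Hamiltonian vector field of
  \<open>kinetic\<close>.\<close>

definition kgen :: "'a::real_vector ^ 4 \<Rightarrow> 'a ^ 4" where
  "kgen z = vector [z $ 2, - z $ 1, z $ 1, z $ 2]"

text \<open>Multiplication by \<open>J\<close>, available for complex vectors as well;
  \<open>J_mult\<close> is the link.\<close>

definition jmul :: "'a::ab_group_add ^ 4 \<Rightarrow> 'a ^ 4" where
  "jmul v = vector [v $ 2 - v $ 3, - v $ 1 - v $ 4, v $ 1, v $ 2]"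

text \<open>The symplectic form with matrix \<open>J\<^sup>-\<^sup>1\<close>.\<close>

definition om :: "real ^ 4 \<Rightarrow> real ^ 4 \<Rightarrow> real" where
  "om h k = h $ 1 * k $ 3 + h $ 2 * k $ 4 - h $ 3 * k $ 1 + h $ 3 * k $ 4 - h $ 4 * k $ 2 - h $ 4 * k $ 3"

lemma rot_nth [simp]:
  "rot t z $ 1 = cos t *\<^sub>R z $ 1 + sin t *\<^sub>R z $ 2"
  "rot t z $ 2 = cos t *\<^sub>R z $ 2 - sin t *\<^sub>R z $ 1"
  "rot t z $ 3 = z $ 3 + sin t *\<^sub>R z $ 1 + (1 - cos t) *\<^sub>R z $ 2"
  "rot t z $ 4 = z $ 4 + sin t *\<^sub>R z $ 2 - (1 - cos t) *\<^sub>R z $ 1"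
  by (simp_all add: rot_def)

lemma kgen_nth [simp]: "kgen z $ 1 = z $ 2" "kgen z $ 2 = - z $ 1" "kgen z $ 3 = z $ 1" "kgen z $ 4 = z $ 2"
  by (simp_all add: kgen_def)

lemma jmul_nth [simp]: "jmul z $ 1 = z $ 2 - z $ 3" "jmul z $ 2 = - z $ 1 - z $ 4" "jmul z $ 3 = z $ 1" "jmul z $ 4 = z $ 2"
  by (simp_all add: jmul_def)

lemma vec4_eq_iff: "(x :: 'a ^ 4) = y \<longleftrightarrow> x $ 1 = y $ 1 \<and> x $ 2 = y $ 2 \<and> x $ 3 = y $ 3 \<and> x $ 4 = y $ 4"
  by (simp add: vec_eq_iff forall_4)

lemma rot_0 [simp]: "rot 0 z = z" and rot_2pi [simp]: "rot (2 * pi) z = z"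
  by (simp_all add: vec4_eq_iff)

lemma rot_rot: "rot s (rot t z) = rot (s + t) z"
  by (simp add: vec4_eq_iff sin_add cos_add algebra_simps)

lemma rot_add: "rot t (x + y) = rot t x + rot t y"
  and rot_diff: "rot t (x - y) = rot t x - rot t y"
  and rot_scaleR: "rot t (c *\<^sub>R x) = c *\<^sub>R rot t x"
  by (simp_all add: vec4_eq_iff algebra_simps)

lemma rot_cmul: "rot t (c *s x) = c *s rot t (x :: complex ^ 4)"
  by (simp add: vec4_eq_iff algebra_simps)

lemma kgen_add: "kgen (x + y) = kgen x + kgen y"
  and kgen_scaleR: "kgen (c *\<^sub>R x) = c *\<^sub>R kgen x"
  by (simp_all add: vec4_eq_iff algebra_simps)

lemma jmul_add: "jmul (x + y) = jmul x + jmul y"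
  and jmul_diff: "jmul (x - y) = jmul x - jmul y"
  by (simp_all add: vec4_eq_iff algebra_simps)

lemma jmul_scaleR: "jmul (c *\<^sub>R x) = c *\<^sub>R jmul (x :: 'a::real_vector ^ 4)"
  by (simp add: vec4_eq_iff algebra_simps)

lemma norm_le_sum_4:
  "norm (x :: 'a::real_normed_vector ^ 4) \<le> norm (x $ 1) + norm (x $ 2) + norm (x $ 3) + norm (x $ 4)"
  using L2_set_le_sum[of UNIV "\<lambda>i. norm (x $ i)"] by (simp add: norm_vec_def sum_4)

lemma norm_cos_sin_le:
  "norm (cos t *\<^sub>R a + sin t *\<^sub>R b) \<le> norm a + norm (b :: 'a::real_normed_vector)"
  "norm (cos t *\<^sub>R a - sin t *\<^sub>R b) \<le> norm a + norm b"
  "norm (c + sin t *\<^sub>R a + (1 - cos t) *\<^sub>R b) \<le> norm c + norm a + 2 * norm b"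
  "norm (c + sin t *\<^sub>R a - (1 - cos t) *\<^sub>R b) \<le> norm c + norm a + 2 * norm b"
proof -
  have c: "norm (cos t *\<^sub>R v) \<le> norm v" and s: "norm (sin t *\<^sub>R v) \<le> norm v"
    and d: "norm ((1 - cos t) *\<^sub>R v) \<le> 2 * norm v" for v :: 'a
  proof -
    show "norm (cos t *\<^sub>R v) \<le> norm v" "norm (sin t *\<^sub>R v) \<le> norm v"
      by (simp_all add: mult_left_le_one_le)
    have "\<bar>1 - cos t\<bar> \<le> 2" using cos_ge_minus_one[of t] cos_le_one[of t] by linarith
    then show "norm ((1 - cos t) *\<^sub>R v) \<le> 2 * norm v" by (simp add: mult_right_mono)
  qed
  show "norm (cos t *\<^sub>R a + sin t *\<^sub>R b) \<le> norm a + norm b"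
    using c s by (meson add_mono norm_triangle_le)
  show "norm (cos t *\<^sub>R a - sin t *\<^sub>R b) \<le> norm a + norm b"
    using c s by (meson add_mono norm_triangle_le_diff)
  have "norm (c + sin t *\<^sub>R a) \<le> norm c + norm a"
    using s[of a] norm_triangle_ineq[of c "sin t *\<^sub>R a"] by linarith
  then show "norm (c + sin t *\<^sub>R a + (1 - cos t) *\<^sub>R b) \<le> norm c + norm a + 2 * norm b"
   "norm (c + sin t *\<^sub>R a - (1 - cos t) *\<^sub>R b) \<le> norm c + norm a + 2 * norm b"
    using d[of b] norm_triangle_ineq[of "c + sin t *\<^sub>R a" "(1 - cos t) *\<^sub>R b"]
      norm_triangle_ineq4[of "c + sin t *\<^sub>R a" "(1 - cos t) *\<^sub>R b"] by linarith+
qed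

text \<open>The constant adds the coefficients of the four component bounds: 5 + 5 + 1 + 1.\<close>

lemma norm_rot_le: "norm (rot t z) \<le> 12 * norm (z :: 'a::real_normed_vector ^ 4)"
  using norm_le_sum_4[of "rot t z"] norm_cos_sin_le(1)[of t "z$1" "z$2"]
    norm_cos_sin_le(2)[of t "z$2" "z$1"] norm_cos_sin_le(3)[of "z$3" t "z$1" "z$2"]
    norm_cos_sin_le(4)[of "z$4" t "z$2" "z$1"]
    Finite_Cartesian_Product.norm_nth_le[of z 1] Finite_Cartesian_Product.norm_nth_le[of z 2] Finite_Cartesian_Product.norm_nth_le[of z 3] Finite_Cartesian_Product.norm_nth_le[of z 4]
  unfolding rot_nth by linarith

lemma norm_vec2_le: "norm (x :: 'a::real_normed_vector ^ 2) \<le> norm (x $ 1) + norm (x $ 2)"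
  using L2_set_le_sum[of UNIV "\<lambda>i. norm (x $ i)"] by (simp add: norm_vec_def sum_2)

lemma norm_q_part_le: "norm (q_part z) \<le> 2 * norm (z :: 'a::real_normed_vector ^ 4)"
  using norm_vec2_le[of "q_part z"] Finite_Cartesian_Product.norm_nth_le[of z 3] Finite_Cartesian_Product.norm_nth_le[of z 4] by simp

text \<open>Only the last two components count here: 3 + 3 + 1 + 1. The same 8 scales the domains
  \<open>Om\<close> of the averaging.\<close>

lemma norm_q_part_rot_le: "norm (q_part (rot t z)) \<le> 8 * norm (z :: 'a::real_normed_vector ^ 4)"
  using norm_vec2_le[of "q_part (rot t z)"] norm_cos_sin_le(3)[of "z$3" t "z$1" "z$2"]
    norm_cos_sin_le(4)[of "z$4" t "z$2" "z$1"]
    Finite_Cartesian_Product.norm_nth_le[of z 1] Finite_Cartesian_Product.norm_nth_le[of z 2] Finite_Cartesian_Product.norm_nth_le[of z 3] Finite_Cartesian_Product.norm_nth_le[of z 4]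
  unfolding rot_nth q_part_nth by linarith

lemma norm_jmul_le: "norm (jmul z) \<le> 6 * norm (z :: 'a::real_normed_vector ^ 4)"
proof -
  have "norm (jmul z) \<le> norm (z$2 - z$3) + norm (- z$1 - z$4) + norm (z$1) + norm (z$2)"
    using norm_le_sum_4[of "jmul z"] by simp
  moreover have "norm (z$2 - z$3) \<le> norm (z$2) + norm (z$3)" "norm (- z$1 - z$4) \<le> norm (z$1) + norm (z$4)"
    using norm_triangle_ineq4[of "z$2" "z$3"] norm_triangle_ineq4[of "- z$1" "z$4"] by auto
  ultimately show ?thesis using Finite_Cartesian_Product.norm_nth_le[of z 1] Finite_Cartesian_Product.norm_nth_le[of z 2] Finite_Cartesian_Product.norm_nth_le[of z 3] Finite_Cartesian_Product.norm_nth_le[of z 4]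
    by linarith
qed

lemma norm_kgen_le: "norm (kgen z) \<le> 4 * norm (z :: 'a::real_normed_vector ^ 4)"
  using norm_le_sum_4[of "kgen z"]  Finite_Cartesian_Product.norm_nth_le[of z 1] Finite_Cartesian_Product.norm_nth_le[of z 2] by simp

lemma q_part_add: "q_part (x + y) = q_part x + q_part y"
  and q_part_diff: "q_part (x - y) = q_part x - q_part y" for x y :: "'a::ab_group_add ^ 4"
  by (simp_all add: vec_eq_iff forall_2)

lemma bounded_linear_rot: "bounded_linear (rot t :: 'a::real_normed_vector ^ 4 \<Rightarrow> _)"
  by (rule bounded_linear_intro[where K = 12]) (simp_all add: rot_add rot_scaleR norm_rot_le mult.commute[of _ 12])

lemma bounded_linear_jmul: "bounded_linear (jmul :: 'a::real_normed_vector ^ 4 \<Rightarrow> _)"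
  by (rule bounded_linear_intro[where K = 6]) (simp_all add: jmul_add jmul_scaleR norm_jmul_le mult.commute[of _ 6])

lemma bounded_linear_kgen: "bounded_linear (kgen :: 'a::real_normed_vector ^ 4 \<Rightarrow> _)"
  by (rule bounded_linear_intro[where K = 4]) (simp_all add: kgen_add kgen_scaleR norm_kgen_le mult.commute[of _ 4])

lemma bounded_linear_q_part: "bounded_linear (q_part :: 'a::real_normed_vector ^ 4 \<Rightarrow> _)"
  by (rule bounded_linear_intro[where K = 2])
    (simp_all add: q_part_add vec_eq_iff forall_2 norm_q_part_le mult.commute[of _ 2])

lemma has_vector_derivative_vec4:
  assumes "\<And>i. ((\<lambda>t. f t $ i) has_vector_derivative (f' $ i)) F"
  shows "((f :: real \<Rightarrow> 'a::real_normed_vector ^ 4) has_vector_derivative f') F"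
proof -
  have e: "(\<chi> i. g i) = (\<Sum>i\<in>UNIV. axis i (g i))" for g :: "4 \<Rightarrow> 'a"
    by (simp add: vec_eq_iff sum_component axis_def sum.delta if_distrib cong: if_cong)
  have bl: "bounded_linear (\<lambda>a :: 'a. axis i a :: 'a ^ 4)" for i
  proof (rule bounded_linear_intro[where K = 4])
    show "norm (axis i a :: 'a ^ 4) \<le> norm a * 4" for a
    proof -
      have "norm (axis i a :: 'a ^ 4) \<le> norm a"
        using norm_le_sum_4[of "axis i a"] exhaust_4[of i] by (auto simp: axis_def)
      then show ?thesis using norm_ge_zero[of a] by linarith
    qed
  qed (simp_all add: vec_eq_iff axis_def)
  have "((\<lambda>t. \<Sum>i\<in>UNIV. axis i (f t $ i)) has_vector_derivative (\<Sum>i\<in>UNIV. axis i (f' $ i))) F"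
    by (intro has_vector_derivative_sum bounded_linear.has_vector_derivative[OF bl] assms)
  then show ?thesis by (simp flip: e)
qed

lemma rot_has_vector_derivative:
  "((\<lambda>t. rot t z) has_vector_derivative kgen (rot t z)) (at t within S)"
  for z :: "'a::real_normed_vector ^ 4"
proof (rule has_vector_derivative_vec4)
  fix i :: 4
  have c: "((\<lambda>t. cos t *\<^sub>R a) has_vector_derivative (- sin t) *\<^sub>R a) (at t within S)"
    and s: "((\<lambda>t. sin t *\<^sub>R a) has_vector_derivative cos t *\<^sub>R a) (at t within S)"
    and d: "((\<lambda>t. (1 - cos t) *\<^sub>R a) has_vector_derivative sin t *\<^sub>R a) (at t within S)" for a :: 'a
    unfolding has_vector_derivative_def
    by (auto intro!: derivative_eq_intros)
  show "((\<lambda>t. rot t z $ i) has_vector_derivative kgen (rot t z) $ i) (at t within S)"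
    using exhaust_4[of i]
    by (auto intro!: has_vector_derivative_eq_rhs[OF has_vector_derivative_add]
      has_vector_derivative_eq_rhs[OF has_vector_derivative_diff] c s d has_vector_derivative_const)
qed

lemma kgen_rot: "kgen (rot t z) = rot t (kgen z)"
  by (simp add: vec4_eq_iff algebra_simps)

lemma complexify_nth [simp]: "complexify x $ i = complex_of_real (x $ i)"
  by (simp add: complexify_def)

lemma complexify_rot: "complexify (rot t z) = rot t (complexify z)"
  by (simp add: vec4_eq_iff scaleR_conv_of_real)

lemma complexify_add: "complexify (x + y) = complexify x + complexify y"
  and complexify_diff: "complexify (x - y) = complexify x - complexify y"
  and complexify_scaleR: "complexify (c *\<^sub>R x) = c *\<^sub>R complexify x"
  by (simp_all add: vec_eq_iff)(simp add: scaleR_conv_of_real)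

lemma norm_complexify [simp]: "norm (complexify x) = norm x"
  by (simp add: norm_vec_def)

lemma bounded_linear_complexify: "bounded_linear complexify"
  by (rule bounded_linear_intro[where K = 1]) (simp_all add: complexify_add complexify_scaleR)

lemma complexify_jmul: "complexify (jmul z) = jmul (complexify z)"
  and complexify_kgen: "complexify (kgen z) = kgen (complexify z)"
  by (simp_all add: vec4_eq_iff)

lemma q_part_complexify: "q_part (complexify z) = complexify (q_part z)"
  by (simp add: vec_eq_iff forall_2)

lemma J_mult: "J *v z = jmul z"
  by (simp add: vec4_eq_iff matrix_vector_mult_def J_def sum_4)

lemma om_bilinear:
  "om (a + b) k = om a k + om b k" "om k (a + b) = om k a + om k b"
  "om (a - b) k = om a k - om b k" "om k (a - b) = om k a - om k b"
  "om (c *\<^sub>R a) k = c * om a k" "om k (c *\<^sub>R a) = c * om k a"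
  by (simp_all add: om_def algebra_simps)

lemma inner_4: "x \<bullet> y = x $ 1 * y $ 1 + x $ 2 * y $ 2 + x $ 3 * y $ 3 + x $ 4 * y $ 4" for x y :: "real ^ 4"
  by (simp add: inner_vec_def sum_4)

lemma om_jmul: "om (jmul a) k = - (a \<bullet> k)" "om k (jmul a) = a \<bullet> k"
  by (simp_all add: om_def inner_4 algebra_simps)

text \<open>Symplecticity of the flow of \<open>K\<close> in infinitesimal form.\<close>

lemma om_kgen: "om (kgen a) b + om a (kgen b) = 0"
  by (simp add: om_def algebra_simps)

definition symp :: "(real ^ 4 \<Rightarrow> real ^ 4) \<Rightarrow> bool" where
  "symp D \<longleftrightarrow> linear D \<and> (\<forall>h k. om (D h) (D k) = om h k)"

text \<open>Preserving \<open>om\<close> means \<open>transpose M ** W ** M = W\<close> with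
  \<open>W\<close> the inverse of \<open>J\<close>. So \<open>J ** transpose M ** W\<close> is a
  left inverse of \<open>M\<close>, hence also a right inverse, and multiplying by \<open>J\<close>
  on the right gives the identity with the transpose on the other side.\<close>

lemma symp_matrix:
  assumes "symp D"
  shows "matrix D ** J ** transpose (matrix D) = J"
proof -
  define M where "M = matrix D"
  define W :: "real ^ 4 ^ 4" where "W = vector [vector [0, 0, 1, 0], vector [0, 0, 0, 1],
    vector [-1, 0, 0, 1], vector [0, -1, -1, 0]]"
  have lin: "linear D" and o: "\<And>h k. om (D h) (D k) = om h k"
    using assms by (auto simp: symp_def)
  have MD: "M *v h = D h" for h unfolding M_def by (simp add: matrix_works lin linear_matrix_vector_mul_eq)
  have om_W: "om h k = h \<bullet> (W *v k)" for h k
    by (simp add: om_def inner_4 W_def matrix_vector_mult_def sum_4 algebra_simps)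
  have "h \<bullet> ((transpose M ** W ** M) *v k) = h \<bullet> (W *v k)" for h k
    using o[of h k] unfolding om_W MD[symmetric]
    by (metis dot_lmul_matrix matrix_vector_mul_assoc transpose_matrix_vector vector_transpose_matrix)
  then have "(transpose M ** W ** M) *v k = W *v k" for k by (metis vector_eq_ldot)
  then have e: "transpose M ** W ** M = W" by (simp add: matrix_eq)
  have JW: "J ** W = mat 1" and WJ: "W ** J = mat 1"
    by (simp_all add: vec_eq_iff forall_4 matrix_matrix_mult_def sum_4 J_def W_def mat_def)
  have "(J ** transpose M ** W) ** M = mat 1"
    using e JW by (metis matrix_mul_assoc)
  then have "M ** (J ** transpose M ** W) = mat 1" by (simp add: matrix_left_right_inverse)
  then have "M ** (J ** transpose M ** W) ** J = J" by simp
  then show ?thesis unfolding M_def[symmetric]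
    by (metis WJ matrix_mul_assoc matrix_mul_rid)
qed

section \<open>Holomorphic functions of several variables\<close>

definition fd :: "(complex ^ 'n \<Rightarrow> complex) \<Rightarrow> complex ^ 'n \<Rightarrow> complex ^ 'n \<Rightarrow> complex" where
  "fd f z = frechet_derivative f (at z)"

lemma mvh_D:
  assumes "mv_holomorphic_on f S" "z \<in> S"
  shows "(f has_derivative fd f z) (at z)" "fd f z (c *s v) = c * fd f z v"
proof -
  obtain D where D: "(f has_derivative D) (at z)" "\<forall>c v. D (c *s v) = c * D v"
    using assms unfolding mv_holomorphic_on_def by blast
  have "D = fd f z" unfolding fd_def using frechet_derivative_at[OF D(1)] .
  with D show "(f has_derivative fd f z) (at z)" "fd f z (c *s v) = c * fd f z v" by auto
qed

lemma mvhI: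
  assumes "\<And>z. z \<in> S \<Longrightarrow> (f has_derivative D z) (at z)" "\<And>z c v. z \<in> S \<Longrightarrow> D z (c *s v) = c * D z v"
  shows "mv_holomorphic_on f S"
  unfolding mv_holomorphic_on_def using assms by blast

lemma fd_eq: "(f has_derivative D) (at z) \<Longrightarrow> fd f z = D"
  unfolding fd_def using frechet_derivative_at by metis

lemma mvh_subset: "mv_holomorphic_on f S \<Longrightarrow> T \<subseteq> S \<Longrightarrow> mv_holomorphic_on f T"
  unfolding mv_holomorphic_on_def by blast

lemma mvh_continuous_on: "mv_holomorphic_on f S \<Longrightarrow> continuous_on S f"
  by (meson continuous_at_imp_continuous_on has_derivative_continuous mvh_D(1))

lemma linear_fd:
  assumes "mv_holomorphic_on f S" "z \<in> S"
  shows "linear (fd f z)"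
  using mvh_D(1)[OF assms] has_derivative_linear by blast

lemma norm_smult: "norm (c *s x) = norm c * norm (x :: complex ^ 'n)"
  by (simp add: norm_vec_def L2_set_right_distrib norm_mult)

lemma smult_sum_axis: "(\<Sum>j\<in>UNIV. v $ j *s axis j 1) = (v :: complex ^ 'n)"
  by (simp add: vec_eq_iff sum_component axis_def if_distrib[of "(*) _"] sum.delta cong: if_cong)

lemma fd_expand:
  assumes "mv_holomorphic_on f S" "z \<in> S"
  shows "fd f z v = (\<Sum>j\<in>UNIV. v $ j * fd f z (axis j 1))"
proof -
  have "fd f z v = fd f z (\<Sum>j\<in>UNIV. v $ j *s axis j 1)" by (simp add: smult_sum_axis)
  also have "\<dots> = (\<Sum>j\<in>UNIV. fd f z (v $ j *s axis j 1))"
    using linear_sum[OF linear_fd[OF assms]] by blast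
  finally show ?thesis using mvh_D(2)[OF assms] by simp
qed

lemma bounded_linear_smult_left: "bounded_linear (\<lambda>h. h *s (v :: complex ^ 'n))"
  by (rule bounded_linear_intro[where K = "norm v"])
    (simp_all add: norm_smult vec_eq_iff algebra_simps)

lemma line_deriv:
  assumes "mv_holomorphic_on f S" "z + l *s v \<in> S"
  shows "((\<lambda>l. f (z + l *s v)) has_field_derivative fd f (z + l *s v) v) (at l)"
proof -
  have "((\<lambda>l. z + l *s v) has_derivative (\<lambda>h. h *s v)) (at l)"
    using bounded_linear.has_derivative[OF bounded_linear_smult_left has_derivative_ident]
    by (auto intro!: derivative_eq_intros)
  then have "((\<lambda>l. f (z + l *s v)) has_derivative (\<lambda>h. fd f (z + l *s v) (h *s v))) (at l)"
    using has_derivative_compose mvh_D(1)[OF assms] by blast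
  then show ?thesis unfolding has_field_derivative_def
    by (simp add: mvh_D(2)[OF assms] mult_commute_abs)
qed

lemma slice_holomorphic:
  assumes "mv_holomorphic_on f S" "\<And>l. l \<in> T \<Longrightarrow> z + l *s v \<in> S"
  shows "(\<lambda>l. f (z + l *s v)) holomorphic_on T"
  unfolding holomorphic_on_def field_differentiable_def
  using line_deriv[OF assms(1)] assms(2) has_field_derivative_at_within by blast

text \<open>Cauchy's inequality in one variable, on the complex disc through \<open>z\<close> in
  direction \<open>v\<close>; \<open>cauchy_bound\<close> rescales \<open>v\<close>.\<close>

lemma cauchy_unit:
  assumes h: "mv_holomorphic_on f S"
    and b: "\<And>l. norm l \<le> 1 \<Longrightarrow> z + l *s v \<in> S \<and> norm (f (z + l *s v)) \<le> B"
  shows "norm (fd f z v) \<le> B"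
proof -
  let ?g = "\<lambda>l. f (z + l *s v)"
  have hol: "?g holomorphic_on cball 0 1"
    by (rule slice_holomorphic[OF h]) (use b in auto)
  have "norm ((deriv ^^ 1) ?g 0) \<le> fact 1 * B / 1 ^ 1"
    by (rule Cauchy_inequality)
      (use hol b in \<open>auto intro: holomorphic_on_subset holomorphic_on_imp_continuous_on\<close>)
  moreover have "deriv ?g 0 = fd f z v"
    using line_deriv[OF h, of z 0 v] b[of 0] by (simp add: DERIV_imp_deriv)
  ultimately show ?thesis by simp
qed

lemma cauchy_bound:
  assumes h: "mv_holomorphic_on f S" and d: "d > 0"
    and b: "\<And>w. norm w \<le> d \<Longrightarrow> z + w \<in> S \<and> norm (f (z + w)) \<le> B"
  shows "norm (fd f z v) \<le> B * norm v / d"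
proof (cases "v = 0")
  case True
  then show ?thesis using linear_0[OF linear_fd[OF h, of z]] b[of 0] d by simp
next
  case False
  define c where "c = complex_of_real (d / norm v)"
  have n: "norm (c *s v) = d" using False d by (simp add: c_def norm_smult norm_divide)
  have "norm (fd f z (c *s v)) \<le> B"
  proof (rule cauchy_unit[OF h])
    fix l :: complex assume "norm l \<le> 1"
    then have "norm (l *s (c *s v)) \<le> d" unfolding norm_smult[of l] n using d by (simp add: mult_left_le_one_le)
    then show "z + l *s (c *s v) \<in> S \<and> norm (f (z + l *s (c *s v))) \<le> B" using b by blast
  qed
  moreover have "fd f z (c *s v) = c * fd f z v" using mvh_D(2)[OF h, of z] b[of 0] d by simp
  ultimately have "norm c * norm (fd f z v) \<le> B" by (simp add: norm_mult)
  moreover have "norm c = d / norm v" using d by (simp add: c_def norm_divide)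
  ultimately show ?thesis using False d by (simp add: field_simps)
qed

text \<open>Taylor's formula on the complex line through \<open>z\<close>. The constant is Cauchy's
  bound \<open>2 * B / (1/2)^2\<close> for the second derivative on the disc of radius 1/2.\<close>

lemma quad_unit:
  assumes h: "mv_holomorphic_on f S"
    and b: "\<And>l. norm l \<le> 1 \<Longrightarrow> z + l *s v \<in> S \<and> norm (f (z + l *s v)) \<le> B"
    and l: "norm l \<le> 1 / 2"
  shows "norm (f (z + l *s v) - f z - l * fd f z v) \<le> 8 * B * (norm l)\<^sup>2"
proof -
  let ?g = "\<lambda>l. f (z + l *s v)"
  define F where "F i = (deriv ^^ i) ?g" for i
  have hol: "?g holomorphic_on cball 0 1"
    by (rule slice_holomorphic[OF h]) (use b in auto)
  then have hob: "?g holomorphic_on ball 0 1" by (rule holomorphic_on_subset) auto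
  have "norm (F 0 l - (\<Sum>i\<le>1. F i 0 * (l - 0) ^ i / fact i)) \<le> 8 * B * norm (l - 0) ^ Suc 1 / fact 1"
  proof (rule complex_Taylor[of "cball 0 (1/2)"])
    fix i :: nat and x assume x: "x \<in> cball (0::complex) (1/2)"
    have "F i holomorphic_on ball 0 1" unfolding F_def by (intro holomorphic_higher_deriv hob) auto
    moreover have "x \<in> ball 0 1" using x by auto
    ultimately have "(F i has_field_derivative deriv (F i) x) (at x)"
      using holomorphic_derivI open_ball by blast
    then show "(F i has_field_derivative F (Suc i) x) (at x within cball 0 (1 / 2))"
      unfolding F_def by (auto intro: has_field_derivative_at_within)
  next
    fix x assume x: "x \<in> cball (0::complex) (1/2)"
    have sub: "cball x (1/2) \<subseteq> cball 0 1"
      using x by (auto simp: dist_norm) (smt (verit) norm_triangle_ineq4 norm_minus_commute norm_triangle_sub field_sum_of_halves)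
    have "norm ((deriv ^^ 2) ?g x) \<le> fact 2 * B / (1/2) ^ 2"
    proof (rule Cauchy_inequality)
      show "?g holomorphic_on ball x (1/2)" using hol sub by (meson ball_subset_cball holomorphic_on_subset order.trans)
      show "continuous_on (cball x (1/2)) ?g" using hol sub by (meson holomorphic_on_imp_continuous_on holomorphic_on_subset)
      fix y assume "norm (x - y) = 1/2"
      then have "y \<in> cball x (1/2)" by (simp add: dist_norm)
      then have "y \<in> cball 0 1" using sub by blast
      then show "norm (?g y) \<le> B" using b by auto
    qed auto
    then show "norm (F (Suc 1) x) \<le> 8 * B" unfolding F_def numeral_2_eq_2[symmetric] Suc_1 by (simp add: power2_eq_square fact_2)
  qed (use l in auto)
  moreover have "F 1 0 = fd f z v"
    using line_deriv[OF h, of z 0 v] b[of 0] by (simp add: DERIV_imp_deriv F_def)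
  ultimately show ?thesis by (simp add: F_def power2_eq_square algebra_simps)
qed

lemma quad_bound:
  assumes h: "mv_holomorphic_on f S" and d: "d > 0"
    and b: "\<And>w. norm w \<le> d \<Longrightarrow> z + w \<in> S \<and> norm (f (z + w)) \<le> B" and v: "norm v \<le> d / 2"
  shows "norm (f (z + v) - f z - fd f z v) \<le> 8 * B * (norm v / d)\<^sup>2"
proof (cases "v = 0")
  case True
  then show ?thesis using linear_0[OF linear_fd[OF h, of z]] b[of 0] d by simp
next
  case False
  define c where "c = complex_of_real (d / norm v)"
  have n: "norm (c *s v) = d" using False d by (simp add: c_def norm_smult norm_divide)
  have c0: "c \<noteq> 0" "norm (1 / c) = norm v / d" using False d by (auto simp: c_def norm_divide)
  have "norm (f (z + (1/c) *s (c *s v)) - f z - (1/c) * fd f z (c *s v)) \<le> 8 * B * (norm (1/c))\<^sup>2"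
  proof (rule quad_unit[OF h])
    fix l :: complex assume "norm l \<le> 1"
    then have "norm (l *s (c *s v)) \<le> d" unfolding norm_smult[of l] n using d by (simp add: mult_left_le_one_le)
    then show "z + l *s (c *s v) \<in> S \<and> norm (f (z + l *s (c *s v))) \<le> B" using b by blast
  qed (use v d in \<open>simp add: c0 field_simps\<close>)
  moreover have "fd f z (c *s v) = c * fd f z v" using mvh_D(2)[OF h, of z] b[of 0] d by simp
  moreover have "(1/c) *s (c *s v) = v" using c0 by (simp add: vector_smult_assoc)
  ultimately show ?thesis using c0 by simp
qed

text \<open>With \<open>w\<close> parallel to \<open>e\<close> and as long as \<open>a\<close>, the
  value at \<open>z + a + w\<close> is expanded about \<open>z + a\<close> and about
  \<open>z\<close>. The three quadratic remainders cost 32, 32 and 8 times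
  \<open>B * (norm a / d)^2\<close>, which add up to 72.\<close>

lemma fd_lipschitz:
  assumes h: "mv_holomorphic_on f S" and d: "d > 0"
    and b: "\<And>w. norm w \<le> d \<Longrightarrow> z + w \<in> S \<and> norm (f (z + w)) \<le> B" and a: "norm a \<le> d / 4"
  shows "norm (fd f (z + a) e - fd f z e) \<le> 72 * B * norm a * norm e / d\<^sup>2"
proof (cases "a = 0 \<or> e = 0")
  case True
  have "z \<in> S" "z + a \<in> S" using b[of 0] b[of a] a d by auto
  then show ?thesis using True linear_0[OF linear_fd[OF h, of z]] linear_0[OF linear_fd[OF h, of "z + a"]] by auto
next
  case False
  define c where "c = complex_of_real (norm a / norm e)"
  define w where "w = c *s e"
  have n: "norm w = norm a" using False by (simp add: w_def c_def norm_smult norm_divide)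
  have zS: "z \<in> S" "z + a \<in> S" using b[of 0] b[of a] a d by auto
  have "norm (f z) \<le> B" using b[of 0] d by simp
  then have B0: "B \<ge> 0" using norm_ge_zero[of "f z"] by linarith
  have "norm (f (z + (a + w)) - f z - fd f z (a + w)) \<le> 8 * B * (norm (a + w) / d)\<^sup>2"
    by (rule quad_bound[OF h d]) (use a b n norm_triangle_ineq[of a w] in auto)
  also have "\<dots> \<le> 8 * B * (2 * norm a / d)\<^sup>2"
    using norm_triangle_ineq[of a w] n d B0
    by (intro mult_left_mono power_mono divide_right_mono) auto
  finally have R2: "norm (f (z + (a + w)) - f z - fd f z (a + w)) \<le> 8 * B * (2 * norm a / d)\<^sup>2" .
  have R3: "norm (f (z + a) - f z - fd f z a) \<le> 8 * B * (norm a / d)\<^sup>2"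
    by (rule quad_bound[OF h d b]) (use a d in auto)
  have R1: "norm (f ((z + a) + w) - f (z + a) - fd f (z + a) w) \<le> 8 * B * (norm w / (d / 2))\<^sup>2"
  proof (rule quad_bound[OF h])
    fix u :: "complex ^ 'a" assume u: "norm u \<le> d / 2"
    have "norm (a + u) \<le> d" using norm_triangle_ineq[of a u] u a d by linarith
    then show "z + a + u \<in> S \<and> norm (f (z + a + u)) \<le> B" using b[of "a + u"] by (simp add: add.assoc)
  qed (use a d n in auto)
  have "fd f (z + a) w - fd f z w = - (f ((z + a) + w) - f (z + a) - fd f (z + a) w)
     + (f (z + (a + w)) - f z - fd f z (a + w)) - (f (z + a) - f z - fd f z a)"
    by (simp add: linear_add[OF linear_fd[OF h zS(1)]] add.assoc)
  also have "norm \<dots> \<le> 8 * B * (norm w / (d / 2))\<^sup>2 + 8 * B * (2 * norm a / d)\<^sup>2 + 8 * B * (norm a / d)\<^sup>2"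
    using R1 R2 R3 by (smt (verit) norm_triangle_ineq norm_triangle_ineq4 norm_minus_cancel)
  also have "\<dots> = 72 * B * (norm a)\<^sup>2 / d\<^sup>2" using d n by (simp add: field_simps power2_eq_square)
  finally have "norm (fd f (z + a) w - fd f z w) \<le> 72 * B * (norm a)\<^sup>2 / d\<^sup>2" .
  moreover have "fd f (z + a) w - fd f z w = c * (fd f (z + a) e - fd f z e)"
    using mvh_D(2)[OF h zS(1)] mvh_D(2)[OF h zS(2)] by (simp add: w_def algebra_simps)
  ultimately have "norm a / norm e * norm (fd f (z + a) e - fd f z e) \<le> 72 * B * (norm a)\<^sup>2 / d\<^sup>2"
    by (simp add: norm_mult c_def norm_divide)
  then show ?thesis using False d by (simp add: field_simps power2_eq_square)
qed

lemma compact_mvh_bounds: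
  assumes h: "mv_holomorphic_on f S" and S: "open S" and K: "compact K" "K \<subseteq> S"
  obtains d B where "d > 0" "B > 0" "\<And>z w. z \<in> K \<Longrightarrow> norm w \<le> d \<Longrightarrow> z + w \<in> S \<and> norm (f (z + w)) \<le> B"
proof -
  obtain e where e: "e > 0" "(\<Union>x\<in>K. ball x e) \<subseteq> S"
    using compact_subset_open_imp_ball_epsilon_subset[OF K(1) S K(2)] by blast
  define T where "T = {x + y |x y. x \<in> K \<and> y \<in> cball 0 (e / 2)}"
  have T: "compact T" unfolding T_def using K(1) by (intro compact_sums) auto
  have "T \<subseteq> S" using e by (force simp: T_def dist_norm subset_iff)
  then have "continuous_on T f" using mvh_continuous_on[OF h] continuous_on_subset by blast
  then obtain B where B: "B > 0" "\<And>x. x \<in> T \<Longrightarrow> norm (f x) \<le> B"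
    using compact_imp_bounded[OF compact_continuous_image[OF _ T]] by (metis bounded_pos imageI)
  show ?thesis
  proof (rule that[of "e / 2" B])
    fix z w :: "complex ^ 'a" assume "z \<in> K" "norm w \<le> e / 2"
    then have "z + w \<in> T" unfolding T_def by auto
    then show "z + w \<in> S \<and> norm (f (z + w)) \<le> B" using B \<open>T \<subseteq> S\<close> by auto
  qed (use e B in auto)
qed

lemma fd_continuous_on:
  assumes h: "mv_holomorphic_on f S" and S: "open S"
  shows "continuous_on S (\<lambda>z. fd f z e)"
proof (rule continuous_at_imp_continuous_on, rule ballI)
  fix z assume z: "z \<in> S"
  obtain d B where d: "d > 0" "B > 0" and b: "\<And>w. norm w \<le> d \<Longrightarrow> z + w \<in> S \<and> norm (f (z + w)) \<le> B"
    using compact_mvh_bounds[OF h S, of "{z}"] z by (metis compact_sing empty_subsetI insert_subset singletonI)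
  have lim: "((\<lambda>a :: complex ^ 'a. 72 * B * norm a * norm e / d\<^sup>2) \<longlongrightarrow> 72 * B * norm (0 :: complex ^ 'a) * norm e / d\<^sup>2) (at 0)"
    using tendsto_mult[OF tendsto_const[of "72 * B * norm e / d\<^sup>2"] tendsto_norm[OF tendsto_ident_at[of "0 :: complex ^ 'a" UNIV]]]
    by (simp add: mult_ac)
  have "((\<lambda>a. fd f (z + a) e - fd f z e) \<longlongrightarrow> 0) (at 0)"
  proof (rule Lim_null_comparison[where g = "\<lambda>a. 72 * B * norm a * norm e / d\<^sup>2"])
    show "\<forall>\<^sub>F a in at 0. norm (fd f (z + a) e - fd f z e) \<le> 72 * B * norm a * norm e / d\<^sup>2"
      unfolding eventually_at
    proof (intro exI[of _ "d / 4"] conjI ballI impI)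
      fix a :: "complex ^ 'a" assume "a \<noteq> 0 \<and> dist a 0 < d / 4"
      then have "norm a \<le> d / 4" by (simp add: dist_norm)
      from fd_lipschitz[OF h d(1) b this] show "norm (fd f (z + a) e - fd f z e) \<le> 72 * B * norm a * norm e / d\<^sup>2" .
    qed (use d in simp)
    show "(\<lambda>a :: complex ^ 'a. 72 * B * norm a * norm e / d\<^sup>2) \<midarrow>0\<rightarrow> 0" using lim by simp
  qed
  then have "((\<lambda>a. fd f (z + a) e) \<longlongrightarrow> fd f z e) (at 0)" using Lim_null by metis
  then show "isCont (\<lambda>z. fd f z e) z" unfolding isCont_def by (subst LIM_offset_zero_iff) auto
qed

text \<open>Differentiation under the integral sign along a family of affine maps \<open>g t\<close>
  with linear parts \<open>L t\<close>. The quadratic remainder is uniform because the points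
  \<open>g t z\<close> form a compact set. It serves both the averages over circles and Cauchy's
  formula for derivatives.\<close>

lemma mvh_integral:
  fixes g L :: "real \<Rightarrow> complex ^ 'n \<Rightarrow> complex ^ 'n" and k :: "real \<Rightarrow> complex"
  assumes h: "mv_holomorphic_on f S" and S: "open S"
    and g: "\<And>t z v. g t (z + v) = g t z + L t v"
    and L: "\<And>t u v. L t (u + v) = L t u + L t v" "\<And>t c v. L t (c *s v) = c *s L t v"
      "\<And>t v. norm (L t v) \<le> C * norm v"
    and cg: "\<And>z. continuous_on {a..b} (\<lambda>t. g t z)" and ck: "continuous_on {a..b} k"
    and sub: "\<And>t. t \<in> {a..b} \<Longrightarrow> g t z \<in> S"
  shows "((\<lambda>z. integral {a..b} (\<lambda>t. k t * f (g t z))) has_derivative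
      (\<lambda>v. integral {a..b} (\<lambda>t. k t * fd f (g t z) (L t v)))) (at z)" (is "(?F has_derivative ?D) _")
    and "integral {a..b} (\<lambda>t. k t * fd f (g t z) (L t (c *s v)))
      = c * integral {a..b} (\<lambda>t. k t * fd f (g t z) (L t v))"
proof -
  have C: "C \<ge> 0" using L(3)[of 0 1] norm_ge_zero[of "L 0 1"] by (smt (verit) mult_neg_pos norm_eq_zero one_neq_zero zero_less_norm_iff vec_eq_iff zero_index one_index)
  have cL: "continuous_on {a..b} (\<lambda>t. L t v)" for v
  proof -
    have "L t v = g t v - g t 0" for t using g[of t 0 v] by simp
    then show ?thesis using continuous_on_diff[OF cg[of v] cg[of 0]] by simp
  qed
  define K where "K = (\<lambda>t. g t z) ` {a..b}"
  have K: "compact K" "K \<subseteq> S" unfolding K_def using sub by (auto intro!: compact_continuous_image cg)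
  obtain d B where d: "d > 0" "B > 0"
    and b: "\<And>y w. y \<in> K \<Longrightarrow> norm w \<le> d \<Longrightarrow> y + w \<in> S \<and> norm (f (y + w)) \<le> B"
    using compact_mvh_bounds[OF h S K] by blast
  obtain kb where kb: "kb > 0" "\<And>t. t \<in> {a..b} \<Longrightarrow> norm (k t) \<le> kb"
    using compact_imp_bounded[OF compact_continuous_image[OF ck]] by (metis bounded_pos compact_Icc imageI)
  have cD: "continuous_on {a..b} (\<lambda>t. k t * fd f (g t z) (L t v))" for v
  proof -
    have "continuous_on {a..b} (\<lambda>t. fd f (g t z) (axis j 1))" for j
      using continuous_on_compose2[OF fd_continuous_on[OF h S] cg] sub by blast
    then have "continuous_on {a..b} (\<lambda>t. \<Sum>j\<in>UNIV. L t v $ j * fd f (g t z) (axis j 1))"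
      by (intro continuous_intros cL)
    then have "continuous_on {a..b} (\<lambda>t. fd f (g t z) (L t v))"
      by (rule continuous_on_eq) (use fd_expand[OF h sub] in auto)
    then show ?thesis by (intro continuous_intros ck)
  qed
  have iD: "(\<lambda>t. k t * fd f (g t z) (L t v)) integrable_on {a..b}" for v
    by (rule integrable_continuous_interval[OF cD])
  have lin: "fd f (g t z) (L t (u + v)) = fd f (g t z) (L t u) + fd f (g t z) (L t v)"
     "fd f (g t z) (L t (c *s v)) = c * fd f (g t z) (L t v)" if "t \<in> {a..b}" for t u v c
    using linear_add[OF linear_fd[OF h sub[OF that]]] mvh_D(2)[OF h sub[OF that]] L by auto
  show cl: "?D (c *s v) = c * ?D v" for c v
  proof -
    have "?D (c *s v) = integral {a..b} (\<lambda>t. c * (k t * fd f (g t z) (L t v)))"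
      by (rule integral_cong) (simp add: lin)
    then show ?thesis by (simp only: integral_mult_right)
  qed
  have bl: "bounded_linear ?D"
  proof (rule linear_conv_bounded_linear[THEN iffD1], rule linearI)
    fix u v :: "complex ^ 'n"
    have "?D (u + v) = integral {a..b} (\<lambda>t. k t * fd f (g t z) (L t u) + k t * fd f (g t z) (L t v))"
      by (rule integral_cong) (simp add: lin algebra_simps)
    then show "?D (u + v) = ?D u + ?D v" by (simp only: integral_add[OF iD iD])
  next
    fix r :: real and v :: "complex ^ 'n"
    have "r *\<^sub>R v = complex_of_real r *s v" by (simp add: vec_eq_iff scaleR_conv_of_real[where 'a = complex])
    then show "?D (r *\<^sub>R v) = r *\<^sub>R ?D v" by (simp only: cl scaleR_conv_of_real)
  qed
  have key: "norm (?F (z + v) - ?F z - ?D v) \<le> (norm v)\<^sup>2 * (kb * (8 * B) * (C / d)\<^sup>2 * measure lborel (cbox a b))"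
    if v: "C * norm v \<le> d / 2" for v
  proof -
    have inS: "g t (z + v) \<in> S" if "t \<in> {a..b}" for t
    proof -
      have "norm (L t v) \<le> d" using L(3)[of t v] v d by linarith
      then show ?thesis unfolding g using b[of "g t z" "L t v"] that by (auto simp: K_def)
    qed
    have i1: "(\<lambda>t. k t * f (g t y)) integrable_on {a..b}" if "\<And>t. t \<in> {a..b} \<Longrightarrow> g t y \<in> S" for y
      by (intro integrable_continuous_interval continuous_intros ck
         continuous_on_compose2[OF mvh_continuous_on[OF h] cg]) (use that in auto)
    have "((\<lambda>t. k t * f (g t (z + v)) - k t * f (g t z) - k t * fd f (g t z) (L t v)) has_integral (?F (z + v) - ?F z - ?D v)) (cbox a b)"
      unfolding cbox_interval
      by (intro has_integral_diff integrable_integral i1 iD inS sub)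
    then have "norm (?F (z + v) - ?F z - ?D v) \<le> (norm v)\<^sup>2 * (kb * (8 * B) * (C / d)\<^sup>2) * measure lborel (cbox a b)"
    proof (rule has_integral_bound[rotated])
      fix t assume "t \<in> cbox a b"
      then have t: "t \<in> {a..b}" by simp
      have "norm (f (g t z + L t v) - f (g t z) - fd f (g t z) (L t v)) \<le> 8 * B * (norm (L t v) / d)\<^sup>2"
        by (rule quad_bound[OF h d(1)]) (use b t L(3)[of t v] v in \<open>auto simp: K_def\<close>)
      also have "\<dots> \<le> 8 * B * (C * norm v / d)\<^sup>2"
        using L(3)[of t v] d by (intro mult_left_mono power_mono divide_right_mono) auto
      finally have "norm (k t * (f (g t z + L t v) - f (g t z) - fd f (g t z) (L t v))) \<le> kb * (8 * B * (C * norm v / d)\<^sup>2)"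
        unfolding norm_mult using kb t by (intro mult_mono) auto
      then show "norm (k t * f (g t (z + v)) - k t * f (g t z) - k t * fd f (g t z) (L t v)) \<le> (norm v)\<^sup>2 * (kb * (8 * B) * (C / d)\<^sup>2)"
        unfolding g by (simp add: algebra_simps power_mult_distrib power_divide)
    qed (use kb d in auto)
    then show ?thesis by (simp add: mult.assoc)
  qed
  define M where "M = kb * (8 * B) * (C / d)\<^sup>2 * measure lborel (cbox a b)"
  show "(?F has_derivative ?D) (at z)"
    unfolding has_derivative_at
  proof (intro conjI bl)
    have lim: "((\<lambda>v :: complex ^ 'n. norm v * M) \<longlongrightarrow> norm (0 :: complex ^ 'n) * M) (at 0)"
      by (rule tendsto_mult[OF tendsto_norm[OF tendsto_ident_at] tendsto_const])
    show "(\<lambda>h. norm (?F (z + h) - ?F z - ?D h) / norm h) \<midarrow>0\<rightarrow> 0"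
    proof (rule Lim_null_comparison[where g = "\<lambda>v. norm v * M"])
      have "\<exists>e>0. \<forall>v::complex^'n. norm v < e \<longrightarrow> C * norm v \<le> d / 2"
      proof (intro exI[of _ "d / (2 * (C + 1))"] conjI allI impI)
        fix v :: "complex ^ 'n" assume "norm v < d / (2 * (C + 1))"
        then have "(C + 1) * norm v \<le> d / 2" using C by (simp add: field_simps)
        moreover have "C * norm v \<le> (C + 1) * norm v" by (simp add: mult_right_mono)
        ultimately show "C * norm v \<le> d / 2" by linarith
      qed (use C d in auto)
      then obtain e where e: "e > 0" "\<And>v::complex^'n. norm v < e \<Longrightarrow> C * norm v \<le> d / 2" by blast
      show "\<forall>\<^sub>F v in at 0. norm (norm (?F (z + v) - ?F z - ?D v) / norm v) \<le> norm v * M"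
        unfolding eventually_at
      proof (intro exI[of _ e] conjI ballI impI)
        fix v :: "complex ^ 'n" assume v: "v \<noteq> 0 \<and> dist v 0 < e"
        then show "norm (norm (?F (z + v) - ?F z - ?D v) / norm v) \<le> norm v * M"
        proof -
          have "norm (?F (z + v) - ?F z - ?D v) \<le> (norm v)\<^sup>2 * M"
            using key[OF e(2)] v unfolding M_def by (simp add: dist_norm)
          moreover have "norm v > 0" using v by simp
          ultimately show ?thesis by (simp add: divide_le_eq power2_eq_square mult_ac)
        qed
      qed (rule e)
    qed (use lim in simp)
  qed
qed

text \<open>Near \<open>z\<close> the directional derivative is Cauchy's integral of
  \<open>f\<close> over a circle of fixed radius \<open>d\<close> in direction \<open>e\<close>, and
  this integral may be differentiated by \<open>mvh_integral\<close>.\<close>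

lemma fd_mvh:
  assumes h: "mv_holomorphic_on f S" and S: "open S"
  shows "mv_holomorphic_on (\<lambda>z. fd f z e) S"
proof -
  have "\<exists>D. ((\<lambda>z. fd f z e) has_derivative D) (at z) \<and> (\<forall>c v. D (c *s v) = c * D v)" if z: "z \<in> S" for z
  proof -
    obtain r where r: "r > 0" "cball z r \<subseteq> S" using S z open_contains_cball by blast
    \<comment> \<open>The added 1 covers \<open>e = 0\<close>; the circle of radius \<open>d\<close>
      stays within \<open>r / 2\<close> of its centre.\<close>
    define d where "d = r / (2 * (norm e + 1))"
    have "2 * (norm e + 1) > 0" by (smt (verit) norm_ge_zero)
    then have d: "d > 0" "d * norm e \<le> r / 2" using r unfolding d_def
      by (simp_all only: zero_less_divide_iff) (simp_all add: field_simps)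
    define E where "E t = exp (2 * of_real pi * \<i> * of_real t)" for t
    have nE: "norm (E t) = 1" for t unfolding E_def by (simp add: norm_exp_eq_Re)
    have inS: "y + (of_real d * E t) *s e \<in> S" if "dist z y < r / 2" for y t
    proof -
      have "norm ((of_real d * E t) *s e) \<le> r / 2" using d by (simp add: norm_smult norm_mult nE)
      then have "dist z (y + (of_real d * E t) *s e) \<le> r"
        using that by (simp add: dist_norm) (smt (verit) field_sum_of_halves norm_triangle_ineq4 diff_diff_eq)
      then show ?thesis using r by auto
    qed
    have eq: "fd f y e = integral {0..1} (\<lambda>t. (1 / (of_real d * E t)) * f (y + (of_real d * E t) *s e))"
      if y: "dist z y < r / 2" for y
    proof -
      let ?g = "\<lambda>l. f (y + l *s e)"
      have hol: "?g holomorphic_on cball 0 d"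
      proof (rule slice_holomorphic[OF h])
        fix l assume "l \<in> cball (0::complex) d"
        then have "norm (l *s e) \<le> d * norm e" by (simp add: norm_smult mult_right_mono)
        then have "dist z (y + l *s e) \<le> r"
          using y d(2) by (simp add: dist_norm) (smt (verit) field_sum_of_halves norm_triangle_ineq4 diff_diff_eq)
        then show "y + l *s e \<in> S" using r by auto
      qed
      have "contour_integral (circlepath 0 d) (\<lambda>u. ?g u / (u - 0)^2) = (2 * pi * \<i>) * deriv ?g 0"
        by (rule Cauchy_contour_integral_circlepath_2)
          (use hol d in \<open>auto intro: holomorphic_on_subset holomorphic_on_imp_continuous_on\<close>)
      also have "deriv ?g 0 = fd f y e"
        using line_deriv[OF h, of y 0 e] r y by (auto simp: DERIV_imp_deriv subset_iff)
      finally have "integral {0..1} (\<lambda>t. f (y + circlepath 0 d t *s e) / (circlepath 0 d t)^2 * vector_derivative (circlepath 0 d) (at t))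
         = (2 * pi * \<i>) * fd f y e"
        by (simp add: contour_integral_integral)
      also have "(\<lambda>t. f (y + circlepath 0 d t *s e) / (circlepath 0 d t)^2 * vector_derivative (circlepath 0 d) (at t))
        = (\<lambda>t. (2 * pi * \<i>) * ((1 / (of_real d * E t)) * f (y + (of_real d * E t) *s e)))"
      proof
        fix t
        have c: "circlepath 0 d t = of_real d * E t" by (simp add: circlepath E_def mult_ac)
        have v: "vector_derivative (circlepath 0 d) (at t) = 2 * pi * \<i> * (of_real d * E t)"
          by (simp add: vector_derivative_circlepath E_def mult_ac)
        have "of_real d * E t \<noteq> 0" using d nE[of t] by auto
        then show "f (y + circlepath 0 d t *s e) / (circlepath 0 d t)^2 * vector_derivative (circlepath 0 d) (at t)
          = (2 * pi * \<i>) * ((1 / (of_real d * E t)) * f (y + (of_real d * E t) *s e))"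
          unfolding c v by (simp add: power2_eq_square)
      qed
      finally show ?thesis unfolding integral_mult_right by simp
    qed
    let ?F = "\<lambda>z. integral {0..1} (\<lambda>t. (1 / (of_real d * E t)) * f (z + (of_real d * E t) *s e))"
    let ?D = "\<lambda>v. integral {0..1} (\<lambda>t. (1 / (of_real d * E t)) * fd f (z + (of_real d * E t) *s e) v)"
    have cE: "continuous_on A E" for A unfolding E_def by (intro continuous_intros)
    have nz: "E t \<noteq> 0" for t using nE[of t] by auto
    have c1: "continuous_on {0..1} (\<lambda>t. z + (of_real d * E t) *s e)" for z
      by (intro continuous_intros bounded_linear.continuous_on[OF bounded_linear_smult_left] cE)
    have c2: "continuous_on {0..1} (\<lambda>t. 1 / (of_real d * E t))"
      by (intro continuous_intros cE) (use d nz in auto)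
    have D: "(?F has_derivative ?D) (at z)"
      by (rule mvh_integral(1)[OF h S, where g = "\<lambda>t z. z + (of_real d * E t) *s e" and L = "\<lambda>t v. v" and C = 1])
        (use inS[of z] r in \<open>auto simp: c1 c2\<close>)
    have D2: "?D (c *s v) = c * ?D v" for c v
      by (rule mvh_integral(2)[OF h S, where g = "\<lambda>t z. z + (of_real d * E t) *s e" and L = "\<lambda>t v. v" and C = 1])
        (use inS[of z] r in \<open>auto simp: c1 c2\<close>)
    have "((\<lambda>z. fd f z e) has_derivative ?D) (at z)"
      by (rule has_derivative_transform_within_open[OF D, of "ball z (r/2)"]) (use r eq in auto)
    with D2 show ?thesis by blast
  qed
  then show ?thesis unfolding mv_holomorphic_on_def by blast
qed

section \<open>The normal form on a scale of complex domains\<close>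

definition grad :: "(complex ^ 4 \<Rightarrow> complex) \<Rightarrow> complex ^ 4 \<Rightarrow> complex ^ 4" where
  "grad f z = (\<chi> j. fd f z (axis j 1))"

text \<open>Half of the Hamiltonian displacement: the midpoint map generated by \<open>f\<close>
  sends \<open>z - half_ham f z\<close> to \<open>z + half_ham f z\<close>.\<close>

definition half_ham :: "(complex ^ 4 \<Rightarrow> complex) \<Rightarrow> complex ^ 4 \<Rightarrow> complex ^ 4" where
  "half_ham f z = (1 / 2) *\<^sub>R jmul (grad f z)"

definition avg :: "(complex ^ 4 \<Rightarrow> complex) \<Rightarrow> complex ^ 4 \<Rightarrow> complex" where
  "avg f z = integral {0..2 * pi} (\<lambda>t. of_real (1 / (2 * pi)) * f (rot t z))"

text \<open>A kernel that rises linearly by 1 over the period inverts the derivative along the flow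
  up to the mean; centring it at \<pi> bounds it by 1/2.\<close>

definition solve :: "(complex ^ 4 \<Rightarrow> complex) \<Rightarrow> complex ^ 4 \<Rightarrow> complex" where
  "solve f z = integral {0..2 * pi} (\<lambda>t. of_real ((t - pi) / (2 * pi)) * f (rot t z))"

lemma norm_axis_le: "norm (axis j 1 :: complex ^ 4) \<le> 1"
  using norm_le_sum_4[of "axis j 1 :: complex ^ 4"] exhaust_4[of j] by (auto simp: axis_def)

lemma norm_grad_le:
  assumes "\<And>v. norm (fd f z v) \<le> b * norm v"
  shows "norm (grad f z) \<le> 4 * b"
proof -
  have "norm (fd f z 0) \<le> 0" using assms[of 0] by simp
  have "b \<ge> 0" using assms[of 1] norm_ge_zero[of "fd f z 1"]
    by (smt (verit) mult_neg_pos norm_eq_zero one_neq_zero zero_less_norm_iff vec_eq_iff zero_index one_index)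
  then have "norm (fd f z (axis j 1)) \<le> b" for j
    using assms[of "axis j 1"] norm_axis_le[of j] by (meson mult_left_le order.trans)
  then show ?thesis using norm_le_sum_4[of "grad f z"] by (simp add: grad_def) (smt (verit))
qed

lemma norm_half_ham_le:
  assumes "\<And>v. norm (fd f z v) \<le> b * norm v"
  shows "norm (half_ham f z) \<le> 12 * b"
  using norm_jmul_le[of "grad f z"] norm_grad_le[OF assms] by (simp add: half_ham_def)

lemma fd_diff:
  assumes "mv_holomorphic_on f S" "mv_holomorphic_on g S" "z \<in> S"
  shows "fd (\<lambda>z. f z - g z) z v = fd f z v - fd g z v"
  using fd_eq[OF has_derivative_diff[OF mvh_D(1)[OF assms(1,3)] mvh_D(1)[OF assms(2,3)]]] by metis

lemma half_ham_diff:
  assumes "mv_holomorphic_on f S" "mv_holomorphic_on g S" "z \<in> S"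
  shows "half_ham (\<lambda>z. f z - g z) z = half_ham f z - half_ham g z"
proof -
  have "grad (\<lambda>z. f z - g z) z = grad f z - grad g z"
    using fd_diff[OF assms] by (simp add: grad_def vec_eq_iff)
  then show ?thesis by (simp add: half_ham_def jmul_diff scaleR_diff_right)
qed

lemma mvh_diff:
  assumes "mv_holomorphic_on f S" "mv_holomorphic_on g S"
  shows "mv_holomorphic_on (\<lambda>z. f z - g z) S"
  by (rule mvhI[OF has_derivative_diff[OF mvh_D(1)[OF assms(1)] mvh_D(1)[OF assms(2)]]])
    (simp_all add: mvh_D(2)[OF assms(1)] mvh_D(2)[OF assms(2)] algebra_simps)

lemma mvh_add:
  assumes "mv_holomorphic_on f S" "mv_holomorphic_on g S"
  shows "mv_holomorphic_on (\<lambda>z. f z + g z) S"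
  by (rule mvhI[OF has_derivative_add[OF mvh_D(1)[OF assms(1)] mvh_D(1)[OF assms(2)]]])
    (simp_all add: mvh_D(2)[OF assms(1)] mvh_D(2)[OF assms(2)] algebra_simps)

lemma mvh_cmult:
  assumes "mv_holomorphic_on f S"
  shows "mv_holomorphic_on (\<lambda>z. c * f z) S"
  by (rule mvhI[OF has_derivative_mult_right[OF mvh_D(1)[OF assms]]])
    (simp_all add: mvh_D(2)[OF assms] algebra_simps)

lemma fd_cmult:
  assumes "mv_holomorphic_on f S" "z \<in> S"
  shows "fd (\<lambda>z. c * f z) z v = c * fd f z v"
  using fd_eq[OF has_derivative_mult_right[OF mvh_D(1)[OF assms]]] by metis

lemma mvh_lipschitz:
  assumes h: "mv_holomorphic_on f S"
    and b: "\<And>t. t \<in> {0..1} \<Longrightarrow> z + t *\<^sub>R v \<in> S \<and> norm (fd f (z + t *\<^sub>R v) v) \<le> b"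
  shows "norm (f (z + v) - f z) \<le> b"
proof -
  have "norm ((\<lambda>t. f (z + t *\<^sub>R v)) 1 - (\<lambda>t. f (z + t *\<^sub>R v)) (0::real)) \<le> b * norm (1 - 0 :: real)"
  proof (rule differentiable_bound[where S = "{0..1}" and f' = "\<lambda>t h. h *\<^sub>R fd f (z + t *\<^sub>R v) v"])
    fix t :: real assume t: "t \<in> {0..1}"
    have l: "linear (fd f (z + t *\<^sub>R v))" using linear_fd[OF h] b[OF t] by blast
    have "((\<lambda>t. z + t *\<^sub>R v) has_derivative (\<lambda>h. h *\<^sub>R v)) (at t within {0..1})"
      by (auto intro!: derivative_eq_intros)
    then have "((\<lambda>t. f (z + t *\<^sub>R v)) has_derivative (\<lambda>h. fd f (z + t *\<^sub>R v) (h *\<^sub>R v))) (at t within {0..1})"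
      using has_derivative_compose mvh_D(1)[OF h] b[OF t] by blast
    then show "((\<lambda>t. f (z + t *\<^sub>R v)) has_derivative (\<lambda>h. h *\<^sub>R fd f (z + t *\<^sub>R v) v)) (at t within {0..1})"
      by (simp add: linear_scale[OF l])
    show "onorm (\<lambda>h. h *\<^sub>R fd f (z + t *\<^sub>R v) v) \<le> b"
      using b[OF t] by (intro onorm_bound) (auto simp: mult.commute[of b] mult_left_mono intro: order_trans[OF norm_ge_zero])
  qed auto
  then show ?thesis by simp
qed

text \<open>The imaginary part vanishes at all real points near \<open>x\<close>, so its derivative
  along a real line is zero.\<close>

lemma fd_real:
  assumes h: "mv_holomorphic_on f S" and S: "open S" and x: "complexify x \<in> S"
    and re: "\<And>x. complexify x \<in> S \<Longrightarrow> f (complexify x) \<in> \<real>"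
  shows "fd f (complexify x) (complexify e) \<in> \<real>"
proof -
  let ?g = "\<lambda>t::real. complexify x + t *\<^sub>R complexify e"
  have g0: "?g 0 \<in> S" using x by simp
  have "(?g has_derivative (\<lambda>h. h *\<^sub>R complexify e)) (at 0)"
    by (auto intro!: derivative_eq_intros)
  then have "((\<lambda>t. f (?g t)) has_derivative (\<lambda>h. fd f (?g 0) (h *\<^sub>R complexify e))) (at 0)"
    using has_derivative_compose[of ?g _ _ _ f] mvh_D(1)[OF h g0] by blast
  then have d: "((\<lambda>t. Im (f (?g t))) has_derivative (\<lambda>h. Im (fd f (?g 0) (h *\<^sub>R complexify e)))) (at 0)"
    by (rule has_derivative_Im)
  have "continuous_on UNIV ?g" by (intro continuous_intros)
  then have "open (?g -` S)" using S by (simp add: open_vimage)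
  have "((\<lambda>t. Im (f (?g t))) has_derivative (\<lambda>h. 0)) (at 0)"
  proof (rule has_derivative_transform_within_open[of "\<lambda>_. 0"])
    show "open (?g -` S)" by fact
    show "0 \<in> ?g -` S" using g0 by simp
    fix t assume t: "t \<in> ?g -` S"
    have "?g t = complexify (x + t *\<^sub>R e)" by (simp add: complexify_add complexify_scaleR)
    then show "0 = Im (f (?g t))" using re t by (metis complex_is_Real_iff vimageE)
  qed simp
  from has_derivative_unique[OF this d] have "Im (fd f (?g 0) (1 *\<^sub>R complexify e)) = 0" by metis
  then show ?thesis by (simp add: complex_is_Real_iff)
qed

lemma grad_real:
  assumes "mv_holomorphic_on f S" "open S" "complexify x \<in> S"
    "\<And>x. complexify x \<in> S \<Longrightarrow> f (complexify x) \<in> \<real>"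
  shows "grad f (complexify x) = complexify (\<chi> j. Re (fd f (complexify x) (axis j 1)))"
proof -
  have "axis j 1 = complexify (axis j 1)" for j :: 4 by (simp add: vec_eq_iff axis_def)
  then have "fd f (complexify x) (axis j 1) \<in> \<real>" for j using fd_real[OF assms] by metis
  then show ?thesis by (simp add: grad_def vec_eq_iff)
qed

lemma half_ham_real:
  assumes "mv_holomorphic_on f S" "open S" "complexify x \<in> S"
    "\<And>x. complexify x \<in> S \<Longrightarrow> f (complexify x) \<in> \<real>"
  shows "half_ham f (complexify x) = complexify ((1 / 2) *\<^sub>R jmul (\<chi> j. Re (fd f (complexify x) (axis j 1))))"
proof -
  have "grad f (complexify x) = complexify (\<chi> j. Re (fd f (complexify x) (axis j 1)))"
    by (rule grad_real[OF assms])
  then show ?thesis by (simp only: half_ham_def complexify_scaleR complexify_jmul)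
qed

lemma continuous_on_rot: "continuous_on A (\<lambda>t. rot t z)" for z :: "complex ^ 4"
  by (rule continuous_on_vector_derivative[OF rot_has_vector_derivative])

section \<open>Averages over circles and the homological equation\<close>

locale rot_mean =
  fixes S :: "(complex ^ 4) set" and f :: "complex ^ 4 \<Rightarrow> complex"
  assumes S_open: "open S" and S_rot: "\<And>z t. z \<in> S \<Longrightarrow> rot t z \<in> S"
    and f_hol: "mv_holomorphic_on f S"
begin

lemma kernel_hol:
  assumes k: "continuous_on {0..2 * pi} k"
  shows "mv_holomorphic_on (\<lambda>z. integral {0..2 * pi} (\<lambda>t. k t * f (rot t z))) S"
    and "z \<in> S \<Longrightarrow> fd (\<lambda>z. integral {0..2 * pi} (\<lambda>t. k t * f (rot t z))) z v
       = integral {0..2 * pi} (\<lambda>t. k t * fd f (rot t z) (rot t v))"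
proof -
  have 1: "((\<lambda>z. integral {0..2 * pi} (\<lambda>t. k t * f (rot t z))) has_derivative
      (\<lambda>v. integral {0..2 * pi} (\<lambda>t. k t * fd f (rot t z) (rot t v)))) (at z)" if "z \<in> S" for z
    by (rule mvh_integral(1)[OF f_hol S_open, where C = 12])
      (auto simp: rot_add rot_cmul norm_rot_le continuous_on_rot k S_rot that)
  have 2: "integral {0..2 * pi} (\<lambda>t. k t * fd f (rot t z) (rot t (c *s v)))
      = c * integral {0..2 * pi} (\<lambda>t. k t * fd f (rot t z) (rot t v))" if "z \<in> S" for z c v
    by (rule mvh_integral(2)[OF f_hol S_open, where C = 12])
      (auto simp: rot_add rot_cmul norm_rot_le continuous_on_rot k S_rot that)
  show "mv_holomorphic_on (\<lambda>z. integral {0..2 * pi} (\<lambda>t. k t * f (rot t z))) S"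
    by (rule mvhI[OF 1]) (use 2 in auto)
  show "fd (\<lambda>z. integral {0..2 * pi} (\<lambda>t. k t * f (rot t z))) z v
       = integral {0..2 * pi} (\<lambda>t. k t * fd f (rot t z) (rot t v))" if "z \<in> S"
    by (simp add: fd_eq[OF 1[OF that]])
qed

lemma avg_hol: "mv_holomorphic_on (avg f) S"
  using kernel_hol(1)[of "\<lambda>t. of_real (1 / (2 * pi))"] unfolding avg_def by simp

lemma solve_hol: "mv_holomorphic_on (solve f) S"
  using kernel_hol(1)[of "\<lambda>t. of_real ((t - pi) / (2 * pi))"]
  unfolding solve_def by (simp add: continuous_intros)

lemma f_rot_cont: "z \<in> S \<Longrightarrow> continuous_on A (\<lambda>t. f (rot t z))"
  by (rule continuous_on_compose2[OF mvh_continuous_on[OF f_hol] continuous_on_rot]) (auto intro: S_rot)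

lemma f_rot_deriv:
  assumes "z \<in> S"
  shows "((\<lambda>t. f (rot t z)) has_vector_derivative fd f (rot t z) (rot t (kgen z))) (at t within A)"
proof -
  have l: "linear (fd f (rot t z))" using linear_fd[OF f_hol] S_rot[OF assms] by blast
  have "((\<lambda>t. rot t z) has_derivative (\<lambda>h. h *\<^sub>R rot t (kgen z))) (at t within A)"
    using rot_has_vector_derivative[of z t A] unfolding has_vector_derivative_def kgen_rot .
  from has_derivative_compose[OF this mvh_D(1)[OF f_hol S_rot[OF assms]]]
  show ?thesis unfolding has_vector_derivative_def by (simp add: linear_scale[OF l])
qed

text \<open>The integrand is the time derivative of \<open>f\<close> along the circle, and the
  circle closes after \<open>2 * pi\<close>.\<close>

lemma fd_avg: "z \<in> S \<Longrightarrow> fd (avg f) z (kgen z) = 0"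
proof -
  assume z: "z \<in> S"
  have "fd (avg f) z (kgen z) = integral {0..2 * pi} (\<lambda>t. of_real (1 / (2 * pi)) * fd f (rot t z) (rot t (kgen z)))"
    using kernel_hol(2)[of "\<lambda>t. of_real (1 / (2 * pi))", OF _ z] unfolding avg_def by simp
  also have "((\<lambda>t. fd f (rot t z) (rot t (kgen z))) has_integral (f (rot (2 * pi) z) - f (rot 0 z))) {0..2 * pi}"
    by (rule fundamental_theorem_of_calculus) (auto intro: f_rot_deriv[OF z])
  then have "integral {0..2 * pi} (\<lambda>t. of_real (1 / (2 * pi)) * fd f (rot t z) (rot t (kgen z))) = 0"
    by (subst integral_mult_right) (simp add: integral_unique)
  finally show ?thesis .
qed

text \<open>Integration by parts: the rise of the kernel by 1 over the period produces
  \<open>f z\<close>, its slope \<open>1 / (2 * pi)\<close> the average.\<close>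

lemma fd_solve: "z \<in> S \<Longrightarrow> fd (solve f) z (kgen z) = f z - avg f z"
proof -
  assume z: "z \<in> S"
  let ?h = "\<lambda>t. f (rot t z)" and ?h' = "\<lambda>t. fd f (rot t z) (rot t (kgen z))"
  let ?k = "\<lambda>t::real. complex_of_real ((t - pi) / (2 * pi))"
  have E: "fd (solve f) z (kgen z) = integral {0..2 * pi} (\<lambda>t. ?k t * ?h' t)"
    using kernel_hol(2)[of ?k, OF _ z] unfolding solve_def by (simp add: continuous_intros)
  moreover have A1: "((\<lambda>t. ?k t * ?h' t + of_real (1 / (2 * pi)) * ?h t) has_integral (?k (2 * pi) * ?h (2 * pi) - ?k 0 * ?h 0)) {0..2 * pi}"
  proof (rule fundamental_theorem_of_calculus)
    fix t :: real assume "t \<in> {0..2 * pi}"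
    have "(?k has_vector_derivative of_real (1 / (2 * pi))) (at t within {0..2 * pi})"
      unfolding has_vector_derivative_def by (auto intro!: derivative_eq_intros simp: scaleR_conv_of_real field_simps)
    from has_vector_derivative_mult[OF this f_rot_deriv[OF z]]
    show "((\<lambda>t. ?k t * ?h t) has_vector_derivative ?k t * ?h' t + of_real (1 / (2 * pi)) * ?h t) (at t within {0..2 * pi})" .
  qed simp
  moreover have A2: "((\<lambda>t. of_real (1 / (2 * pi)) * ?h t) has_integral avg f z) {0..2 * pi}"
    unfolding avg_def by (intro integrable_integral integrable_continuous_interval continuous_intros f_rot_cont[OF z])
  ultimately have A3: "((\<lambda>t. ?k t * ?h' t) has_integral (?k (2 * pi) * ?h (2 * pi) - ?k 0 * ?h 0 - avg f z)) {0..2 * pi}"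
    using has_integral_diff[OF A1 A2] by (simp only: add_diff_cancel_right')
  moreover have A4: "?k (2 * pi) * ?h (2 * pi) - ?k 0 * ?h 0 = f z" by simp
  show ?thesis unfolding E integral_unique[OF A3] A4 ..
qed

lemma kernel_bound:
  assumes z: "z \<in> S" and k: "continuous_on {0..2 * pi} k" "\<And>t. t \<in> {0..2 * pi} \<Longrightarrow> norm (k t) \<le> kb"
    and b: "\<And>t. norm (f (rot t z)) \<le> B"
  shows "norm (integral {0..2 * pi} (\<lambda>t. k t * f (rot t z))) \<le> kb * B * (2 * pi)"
proof -
  have "norm (integral {0..2 * pi} (\<lambda>t. k t * f (rot t z))) \<le> kb * B * (2 * pi - 0)"
  proof (rule integral_bound)
    show "continuous_on {0..2 * pi} (\<lambda>t. k t * f (rot t z))"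
      by (intro continuous_intros k f_rot_cont z)
    fix t assume "t \<in> {0..2 * pi}"
    then show "norm (k t * f (rot t z)) \<le> kb * B"
      unfolding norm_mult using k(2) b by (intro mult_mono) (auto intro: order_trans[OF norm_ge_zero])
  qed simp
  then show ?thesis by simp
qed

lemma avg_bound: "z \<in> S \<Longrightarrow> (\<And>t. norm (f (rot t z)) \<le> B) \<Longrightarrow> norm (avg f z) \<le> B"
  using kernel_bound[of z "\<lambda>_. of_real (1 / (2 * pi))" "1 / (2 * pi)" B] unfolding avg_def
  by (simp add: norm_divide)

lemma solve_bound:
  assumes z: "z \<in> S" and b: "\<And>t. norm (f (rot t z)) \<le> B"
  shows "norm (solve f z) \<le> 4 * B"
proof -
  have "norm (solve f z) \<le> (1 / 2) * B * (2 * pi)"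
    unfolding solve_def
  proof (rule kernel_bound[OF z _ _ b])
    fix t assume "t \<in> {0..2 * pi}"
    then have "\<bar>t - pi\<bar> \<le> pi" by auto
    then have "\<bar>(t - pi) / (2 * pi)\<bar> \<le> 1 / 2" by (simp add: abs_divide field_simps)
    then show "norm (complex_of_real ((t - pi) / (2 * pi))) \<le> 1 / 2" unfolding norm_of_real .
  qed (auto intro!: continuous_intros)
  also have "\<dots> = pi * B" by simp
  also have "\<dots> \<le> 4 * B"
    using pi_less_4 order_trans[OF norm_ge_zero b[of 0]] by (intro mult_right_mono) auto
  finally show ?thesis .
qed

lemma kernel_real:
  assumes re: "\<And>x. complexify x \<in> S \<Longrightarrow> f (complexify x) \<in> \<real>" and x: "complexify x \<in> S"
    and k: "continuous_on {0..2 * pi} k"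
  shows "integral {0..2 * pi} (\<lambda>t. of_real (k t) * f (rot t (complexify x))) \<in> \<real>"
proof -
  have "(\<lambda>t. of_real (k t) * f (rot t (complexify x))) integrable_on {0..2 * pi}"
    by (intro integrable_continuous_interval continuous_intros k f_rot_cont x)
  then have "Im (integral {0..2 * pi} (\<lambda>t. of_real (k t) * f (rot t (complexify x))))
    = integral {0..2 * pi} (\<lambda>t. Im (of_real (k t) * f (rot t (complexify x))))"
    using integral_linear[OF _ bounded_linear_Im, unfolded o_def, symmetric] by blast
  also have "\<dots> = integral {0..2 * pi} (\<lambda>t. 0)"
  proof (rule integral_cong)
    fix t
    have "f (rot t (complexify x)) \<in> \<real>" using re[of "rot t x"] S_rot[OF x, of t] by (simp add: complexify_rot)
    then show "Im (of_real (k t) * f (rot t (complexify x))) = 0" by (simp add: complex_is_Real_iff)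
  qed
  finally show ?thesis by (simp add: complex_is_Real_iff)
qed

lemma avg_real:
  assumes "\<And>x. complexify x \<in> S \<Longrightarrow> f (complexify x) \<in> \<real>" "complexify x \<in> S"
  shows "avg f (complexify x) \<in> \<real>"
  unfolding avg_def by (rule kernel_real[OF assms, where k = "\<lambda>_. 1 / (2 * pi)"]) auto

lemma solve_real:
  assumes "\<And>x. complexify x \<in> S \<Longrightarrow> f (complexify x) \<in> \<real>" "complexify x \<in> S"
  shows "solve f (complexify x) \<in> \<real>"
  unfolding solve_def by (rule kernel_real[OF assms, where k = "\<lambda>t. (t - pi) / (2 * pi)"]) (auto intro!: continuous_intros)

end

section \<open>The iteration on a shrinking scale of domains\<close>

lemma mvh_compose_half_ham:
  assumes f: "mv_holomorphic_on f T" and S: "mv_holomorphic_on g S" "open S"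
    and sub: "\<And>z. z \<in> S \<Longrightarrow> z + c *\<^sub>R half_ham g z \<in> T"
  shows "mv_holomorphic_on (\<lambda>z. f (z + c *\<^sub>R half_ham g z)) S"
proof -
  have gh: "mv_holomorphic_on (\<lambda>z. fd g z (axis j 1)) S" for j by (rule fd_mvh[OF S])
  define D where "D z v = v + c *\<^sub>R ((1/2) *\<^sub>R jmul (\<Sum>j\<in>UNIV. axis j (fd (\<lambda>z. fd g z (axis j 1)) z v)))" for z v
  have vs: "(\<chi> j. x j) = (\<Sum>j\<in>UNIV. axis j (x j))" for x :: "4 \<Rightarrow> complex"
    by (simp add: vec_eq_iff sum_component axis_def sum.delta if_distrib cong: if_cong)
  have bl: "bounded_linear (\<lambda>a :: complex. axis i a :: complex ^ 4)" for i
    by (rule bounded_linear_intro[where K = 1]) (simp_all add: vec_eq_iff axis_def norm_vec_def L2_set_def if_distrib[of norm] if_distrib[of "\<lambda>x. x^2"] cong: if_cong)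
  have d: "((\<lambda>z. z + c *\<^sub>R half_ham g z) has_derivative D z) (at z)" if z: "z \<in> S" for z
    unfolding half_ham_def grad_def vs D_def
    by (intro has_derivative_add has_derivative_ident has_derivative_scaleR_right
        bounded_linear.has_derivative[OF bounded_linear_jmul] has_derivative_sum
        bounded_linear.has_derivative[OF bl] mvh_D(1)[OF gh z])
  have D: "D z (r *s v) = r *s D z v" if z: "z \<in> S" for z r v
  proof -
    have e: "(\<Sum>j\<in>UNIV. axis j (fd (\<lambda>z. fd g z (axis j 1)) z (r *s v))) = r *s (\<Sum>j\<in>UNIV. axis j (fd (\<lambda>z. fd g z (axis j 1)) z v))"
      unfolding vs[symmetric] by (simp add: vec_eq_iff mvh_D(2)[OF gh z])
    show ?thesis unfolding D_def e by (simp add: vec4_eq_iff algebra_simps)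
  qed
  show ?thesis
    by (rule mvhI[OF has_derivative_compose[OF d mvh_D(1)[OF f sub]]])
      (auto simp: D mvh_D(2)[OF f sub])
qed

text \<open>The index is a loss: \<open>Om s\<close> shrinks as \<open>s\<close> grows, and a shift
  by at most \<open>s - s'\<close> leads from \<open>Om s\<close> into \<open>Om s'\<close>.
  Invariance under \<open>rot\<close> makes averaging free of loss; only shifts and Cauchy estimates
  use up domain.\<close>

locale analytic_scale =
  fixes Om :: "real \<Rightarrow> (complex ^ 4) set" and V :: "complex ^ 4 \<Rightarrow> complex" and B0 :: real
  assumes open_Om: "open (Om s)"
    and Om_shift: "z \<in> Om s \<Longrightarrow> norm v \<le> s - s' \<Longrightarrow> z + v \<in> Om s'"
    and Om_rot: "z \<in> Om s \<Longrightarrow> rot t z \<in> Om s"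
    and V_hol: "mv_holomorphic_on V (Om 0)" and B0: "B0 > 0"
    and V_bound: "z \<in> Om 0 \<Longrightarrow> norm (V z) \<le> B0"
    and V_real: "complexify x \<in> Om 0 \<Longrightarrow> V (complexify x) \<in> \<real>"
begin

lemma Om_mono: "s' \<le> s \<Longrightarrow> Om s \<subseteq> Om s'"
  using Om_shift[of _ s 0 s'] by auto

lemma rot_meanI: "mv_holomorphic_on f (Om s) \<Longrightarrow> rot_mean (Om s) f"
  by unfold_locales (auto simp: open_Om Om_rot)

lemma fd_bound:
  assumes h: "mv_holomorphic_on f (Om s')" and b: "\<And>z. z \<in> Om s' \<Longrightarrow> norm (f z) \<le> B"
    and "s' < s" "z \<in> Om s"
  shows "norm (fd f z v) \<le> (B / (s - s')) * norm v"
  using cauchy_bound[OF h, of "s - s'" z B v] Om_shift[OF assms(4)] b assms(3) by simp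

text \<open>For \<open>G = avg (rhs S G)\<close> the midpoint equation
  \<open>fd S z (kgen z) = \<epsilon> * (V (z + half_ham S z) - G (z - half_ham S z))\<close> reads
  \<open>fd S z (kgen z) = \<epsilon> * (rhs S G z - avg (rhs S G) z)\<close>, and \<open>solve\<close> inverts the left-hand side.\<close>

definition rhs :: "(complex ^ 4 \<Rightarrow> complex) \<Rightarrow> (complex ^ 4 \<Rightarrow> complex) \<Rightarrow> complex ^ 4 \<Rightarrow> complex" where
  "rhs S G z = V (z + half_ham S z) - G (z - half_ham S z) + G z"

text \<open>Fixed-point iteration for the midpoint equation. The start is the solution with the
  shifts by \<open>half_ham\<close> dropped, for which \<open>rhs\<close> reduces to
  \<open>V\<close>.\<close>

fun genS :: "real \<Rightarrow> nat \<Rightarrow> complex ^ 4 \<Rightarrow> complex" and genG :: "real \<Rightarrow> nat \<Rightarrow> complex ^ 4 \<Rightarrow> complex" where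
  "genS e 0 = (\<lambda>z. of_real e * solve V z)"
| "genG e 0 = avg V"
| "genS e (Suc n) = (\<lambda>z. of_real e * solve (rhs (genS e n) (genG e n)) z)"
| "genG e (Suc n) = avg (rhs (genS e n) (genG e n))"

text \<open>\<open>L\<close> is twice the Cauchy bound \<open>4 * B0 / \<sigma>\<close> of the
  derivative of \<open>S 0 / \<epsilon>\<close>, which leaves room for all later increments. With
  800 in the loss \<delta> the increment of the derivative bound is \<open>192 / 800\<close>, just
  below 1/4, of \<open>L / 2 ^ n\<close>, and the change of \<open>rhs\<close> contracts by the
  factor required in \<open>rhs_diff\<close>.\<close>

context
  fixes \<sigma> L \<epsilon> \<delta> :: real
  assumes sig: "\<sigma> > 0" and L_def: "L = 8 * B0 / \<sigma>" and eps: "\<epsilon> > 0" and del: "\<delta> = 800 * L * \<epsilon>"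
begin

abbreviation "s n \<equiv> \<sigma> + real n * \<delta>"
abbreviation "S n \<equiv> genS \<epsilon> n"
abbreviation "G n \<equiv> genG \<epsilon> n"
abbreviation "f n \<equiv> rhs (S n) (G n)"

text \<open>Derivative bound at step \<open>n\<close>: it starts at \<open>L / 2\<close>, and its
  increments \<open>L / 2 ^ (n + 2)\<close> keep it below \<open>L\<close>.\<close>

definition ell :: "nat \<Rightarrow> real" where "ell n = L * (1 - 1 / 2 ^ Suc n)"
text \<open>Size of the \<open>n\<close>-th correction. Here 96 is 4 * 24: two Lipschitz estimates
  over a shift of length \<open>12 * \<epsilon> * L\<close> give 24, and \<open>solve\<close>
  contributes 4.\<close>

definition dd :: "nat \<Rightarrow> real" where "dd n = 96 * L\<^sup>2 * \<epsilon> / 2 ^ n"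

definition level :: "nat \<Rightarrow> bool" where
  "level n \<longleftrightarrow> mv_holomorphic_on (S n) (Om (s n)) \<and> mv_holomorphic_on (G n) (Om (s n)) \<and>
     (\<forall>z v. z \<in> Om (s n) \<longrightarrow> norm (fd (S n) z v) \<le> (\<epsilon> * ell n) * norm v \<and> norm (fd (G n) z v) \<le> ell n * norm v) \<and>
     (\<forall>x. complexify x \<in> Om (s n) \<longrightarrow> S n (complexify x) \<in> \<real> \<and> G n (complexify x) \<in> \<real>)"

text \<open>The loss \<delta> is spent in two halves: the shift by \<open>half_ham\<close> takes the
  first one, the Cauchy estimate for the corrections the second.\<close>

definition step :: "nat \<Rightarrow> bool" where
  "step n \<longleftrightarrow> (\<forall>z. z \<in> Om (s n + \<delta> / 2) \<longrightarrow> norm (S (Suc n) z - S n z) \<le> \<epsilon> * dd n \<and> norm (G (Suc n) z - G n z) \<le> dd n)"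

lemma L_pos: "L > 0" using B0 sig by (simp add: L_def)
lemma del_pos: "\<delta> > 0" using L_pos eps by (simp add: del)
lemma s_Suc: "s (Suc n) = s n + \<delta>" by (simp add: algebra_simps)
lemma ell_le: "ell n \<le> L" "ell n \<ge> 0"
proof -
  have "(1::real) \<le> 2 ^ Suc n" by (rule one_le_power) simp
  then have "(0::real) \<le> 1 - 1 / 2 ^ Suc n \<and> 1 - 1 / 2 ^ Suc n \<le> (1::real)" by (simp add: divide_le_eq_1)
  then show "ell n \<le> L" "ell n \<ge> 0" using L_pos unfolding ell_def by (auto simp: mult_left_le simp del: power_Suc)
qed

lemma s_ge: "s n \<ge> \<sigma>" using del_pos by simp

lemma half_ham_S_le:
  assumes "level n" "z \<in> Om (s n)"
  shows "norm (half_ham (S n) z) \<le> 12 * \<epsilon> * L" "norm (half_ham (S n) z) \<le> \<delta> / 2"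
proof -
  have "norm (half_ham (S n) z) \<le> 12 * (\<epsilon> * ell n)"
    by (rule norm_half_ham_le) (use assms in \<open>auto simp: level_def\<close>)
  also have "\<dots> \<le> 12 * (\<epsilon> * L)" using ell_le eps by simp
  finally show "norm (half_ham (S n) z) \<le> 12 * \<epsilon> * L" by simp
  also have "\<dots> \<le> \<delta> / 2" using L_pos eps by (simp add: del)
  finally show "norm (half_ham (S n) z) \<le> \<delta> / 2" .
qed

lemma level_0: "level 0"
proof -
  interpret rot_mean "Om 0" V by (rule rot_meanI[OF V_hol])
  have hS: "mv_holomorphic_on (S 0) (Om 0)" by (simp add: mvh_cmult solve_hol)
  have hG: "mv_holomorphic_on (G 0) (Om 0)" by (simp add: avg_hol)
  have bS: "norm (S 0 z) \<le> \<epsilon> * (4 * B0)" if "z \<in> Om 0" for z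
    using solve_bound[OF that V_bound[OF Om_rot[OF that]]] eps by (simp add: norm_mult)
  have bG: "norm (G 0 z) \<le> B0" if "z \<in> Om 0" for z
    using avg_bound[OF that V_bound[OF Om_rot[OF that]]] by simp
  have sub: "Om \<sigma> \<subseteq> Om 0" using sig by (intro Om_mono) simp
  show ?thesis unfolding level_def
  proof (intro conjI allI impI)
    show "mv_holomorphic_on (S 0) (Om (s 0))" "mv_holomorphic_on (G 0) (Om (s 0))"
      using hS hG sub mvh_subset by auto
    fix z v assume z: "z \<in> Om (s 0)"
    have "norm (fd (S 0) z v) \<le> (\<epsilon> * (4 * B0) / (\<sigma> - 0)) * norm v"
      by (rule fd_bound[OF hS bS]) (use sig z in auto)
    also have "\<epsilon> * (4 * B0) / (\<sigma> - 0) = \<epsilon> * ell 0" unfolding ell_def by (simp add: L_def)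
    finally show "norm (fd (S 0) z v) \<le> (\<epsilon> * ell 0) * norm v" .
    have "norm (fd (G 0) z v) \<le> (B0 / (\<sigma> - 0)) * norm v"
      by (rule fd_bound[OF hG bG]) (use sig z in auto)
    also have "\<dots> \<le> ell 0 * norm v" unfolding ell_def using sig B0 by (intro mult_right_mono) (auto simp: L_def field_simps)
    finally show "norm (fd (G 0) z v) \<le> ell 0 * norm v" .
  next
    fix x assume "complexify x \<in> Om (s 0)"
    then have x: "complexify x \<in> Om 0" using sub by auto
    show "S 0 (complexify x) \<in> \<real>" using solve_real[OF V_real x] by simp
    show "G 0 (complexify x) \<in> \<real>" using avg_real[OF V_real x] by simp
  qed
qed

lemma V_fd: "z \<in> Om \<sigma> \<Longrightarrow> norm (fd V z v) \<le> L * norm v"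
proof -
  assume z: "z \<in> Om \<sigma>"
  have "norm (fd V z v) \<le> (B0 / (\<sigma> - 0)) * norm v"
    by (rule fd_bound[OF V_hol V_bound]) (use sig z in auto)
  also have "\<dots> \<le> L * norm v" using sig B0 by (intro mult_right_mono) (auto simp: L_def field_simps)
  finally show ?thesis .
qed

lemma V_lip:
  assumes "\<And>t. t \<in> {0..1} \<Longrightarrow> z + t *\<^sub>R v \<in> Om \<sigma>"
  shows "norm (V (z + v) - V z) \<le> L * norm v"
  by (rule mvh_lipschitz[OF V_hol]) (use assms V_fd Om_mono[of 0 \<sigma>] sig in auto)

lemma G_lip:
  assumes "level n" "\<And>t. t \<in> {0..1} \<Longrightarrow> z + t *\<^sub>R v \<in> Om (s n)"
  shows "norm (G n (z + v) - G n z) \<le> L * norm v"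
proof (rule mvh_lipschitz[of _ "Om (s n)"])
  show "mv_holomorphic_on (G n) (Om (s n))" using assms(1) by (simp add: level_def)
  fix t :: real assume t: "t \<in> {0..1}"
  have "norm (fd (G n) (z + t *\<^sub>R v) v) \<le> ell n * norm v" using assms(1) assms(2)[OF t] by (auto simp: level_def)
  also have "\<dots> \<le> L * norm v" using ell_le by (intro mult_right_mono) auto
  finally show "z + t *\<^sub>R v \<in> Om (s n) \<and> norm (fd (G n) (z + t *\<^sub>R v) v) \<le> L * norm v"
    using assms(2)[OF t] by auto
qed

lemma rhs_hol:
  assumes n: "level n"
  shows "mv_holomorphic_on (f n) (Om (s n + \<delta> / 2))"
proof -
  have sub: "Om (s n + \<delta> / 2) \<subseteq> Om (s n)" using del_pos by (intro Om_mono) simp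
  have hS: "mv_holomorphic_on (S n) (Om (s n + \<delta> / 2))" and hG: "mv_holomorphic_on (G n) (Om (s n))"
    using n sub mvh_subset by (auto simp: level_def)
  have V: "mv_holomorphic_on V (Om (s n))" using mvh_subset[OF V_hol Om_mono] s_ge[of n] sig by auto
  have p: "z + c *\<^sub>R half_ham (S n) z \<in> Om (s n)" if "z \<in> Om (s n + \<delta> / 2)" "\<bar>c\<bar> = 1" for z c
    by (rule Om_shift[OF that(1)]) (use half_ham_S_le(2)[OF n] sub that in auto)
  have "mv_holomorphic_on (\<lambda>z. V (z + 1 *\<^sub>R half_ham (S n) z)) (Om (s n + \<delta> / 2))"
    by (rule mvh_compose_half_ham[OF V hS open_Om]) (use p[of _ 1] in auto)
  moreover have "mv_holomorphic_on (\<lambda>z. G n (z + (-1) *\<^sub>R half_ham (S n) z)) (Om (s n + \<delta> / 2))"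
    by (rule mvh_compose_half_ham[OF hG hS open_Om]) (use p[of _ "-1"] in auto)
  ultimately have "mv_holomorphic_on (\<lambda>z. V (z + 1 *\<^sub>R half_ham (S n) z) - G n (z + (-1) *\<^sub>R half_ham (S n) z) + G n z) (Om (s n + \<delta> / 2))"
    by (intro mvh_add mvh_diff mvh_subset[OF hG sub])
  then show ?thesis by (simp add: rhs_def[abs_def])
qed

lemma rhs_real:
  assumes n: "level n" and x: "complexify x \<in> Om (s n + \<delta> / 2)"
  shows "f n (complexify x) \<in> \<real>"
proof -
  have sub: "Om (s n + \<delta> / 2) \<subseteq> Om (s n)" using del_pos by (intro Om_mono) simp
  have x': "complexify x \<in> Om (s n)" using x sub by auto
  obtain y where y: "half_ham (S n) (complexify x) = complexify y"
    using half_ham_real[of "S n" "Om (s n)" x] n x' open_Om by (auto simp: level_def)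
  have p: "complexify x + complexify y \<in> Om (s n)" "complexify x - complexify y \<in> Om (s n)"
    using Om_shift[OF x, of "complexify y" "s n"] Om_shift[OF x, of "- complexify y" "s n"]
      half_ham_S_le(2)[OF n x'] unfolding y by auto
  have p0: "complexify (x + y) \<in> Om 0" using p(1) Om_mono[of 0 "s n"] s_ge[of n] sig by (auto simp: complexify_add)
  have "V (complexify (x + y)) - G n (complexify (x - y)) + G n (complexify x) \<in> \<real>"
    using n p(2) x' V_real[OF p0] unfolding level_def complexify_diff[symmetric] by (intro Reals_add Reals_diff) blast+
  then show ?thesis by (simp add: rhs_def y complexify_add complexify_diff)
qed

lemma rhs_0_close:
  assumes z: "z \<in> Om (s 0 + \<delta> / 2)"
  shows "norm (f 0 z - V z) \<le> dd 0 / 4"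
proof -
  have z0: "z \<in> Om (s 0)" using z Om_mono[of "s 0" "s 0 + \<delta> / 2"] del_pos by auto
  let ?a = "half_ham (S 0) z"
  note a = half_ham_S_le[OF level_0 z0]
  have seg: "z + t *\<^sub>R ?a \<in> Om (s 0)" "(z - ?a) + t *\<^sub>R ?a \<in> Om (s 0)" if "t \<in> {0..1}" for t
  proof -
    have "norm (t *\<^sub>R ?a) \<le> norm ?a" using that by (simp add: mult_left_le_one_le)
    then show "z + t *\<^sub>R ?a \<in> Om (s 0)" using Om_shift[OF z, of "t *\<^sub>R ?a" "s 0"] a(2) by auto
    have "norm ((1 - t) *\<^sub>R ?a) \<le> norm ?a" using that by (simp add: mult_left_le_one_le)
    then have "z + (- ((1 - t) *\<^sub>R ?a)) \<in> Om (s 0)" using Om_shift[OF z, of "- ((1 - t) *\<^sub>R ?a)" "s 0"] a(2) by auto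
    then show "(z - ?a) + t *\<^sub>R ?a \<in> Om (s 0)" by (simp add: algebra_simps)
  qed
  have 1: "norm (V (z + ?a) - V z) \<le> L * norm ?a" by (rule V_lip) (use seg(1) in auto)
  have 2: "norm (G 0 ((z - ?a) + ?a) - G 0 (z - ?a)) \<le> L * norm ?a" by (rule G_lip[OF level_0 seg(2)])
  have "f 0 z - V z = (V (z + ?a) - V z) + (G 0 ((z - ?a) + ?a) - G 0 (z - ?a))" by (simp add: rhs_def)
  then have "norm (f 0 z - V z) \<le> L * norm ?a + L * norm ?a" using 1 2 norm_triangle_mono by metis
  also have "\<dots> \<le> 2 * L * (12 * \<epsilon> * L)" using a(1) L_pos by (simp add: mult_ac)
  also have "\<dots> = dd 0 / 4" by (simp add: dd_def power2_eq_square)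
  finally show ?thesis .
qed

lemma next_hol:
  assumes n: "level n"
  shows "mv_holomorphic_on (S (Suc n)) (Om (s n + \<delta> / 2))" "mv_holomorphic_on (G (Suc n)) (Om (s n + \<delta> / 2))"
proof -
  interpret rot_mean "Om (s n + \<delta> / 2)" "f n" by (rule rot_meanI[OF rhs_hol[OF n]])
  show "mv_holomorphic_on (S (Suc n)) (Om (s n + \<delta> / 2))" "mv_holomorphic_on (G (Suc n)) (Om (s n + \<delta> / 2))"
    by (simp_all add: mvh_cmult solve_hol avg_hol)
qed

lemma next_level:
  assumes n: "level n" and st: "step n"
  shows "level (Suc n)"
    and "z \<in> Om (s (Suc n)) \<Longrightarrow> norm (fd (\<lambda>z. S (Suc n) z - S n z) z v) \<le> (\<epsilon> * (2 * dd n / \<delta>)) * norm v"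
    and "z \<in> Om (s (Suc n)) \<Longrightarrow> norm (fd (\<lambda>z. G (Suc n) z - G n z) z v) \<le> (2 * dd n / \<delta>) * norm v"
proof -
  interpret F: rot_mean "Om (s n + \<delta> / 2)" "f n" by (rule rot_meanI[OF rhs_hol[OF n]])
  have sub: "Om (s n + \<delta> / 2) \<subseteq> Om (s n)" and sub2: "Om (s (Suc n)) \<subseteq> Om (s n + \<delta> / 2)"
    using del_pos unfolding s_Suc by (auto intro!: Om_mono)
  note h = next_hol[OF n]
  have hn: "mv_holomorphic_on (S n) (Om (s n + \<delta> / 2))" "mv_holomorphic_on (G n) (Om (s n + \<delta> / 2))"
    using n sub mvh_subset by (auto simp: level_def)
  have gap: "s n + \<delta> / 2 < s (Suc n)" "s (Suc n) - (s n + \<delta> / 2) = \<delta> / 2" using del_pos unfolding s_Suc by auto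
  show dS: "norm (fd (\<lambda>z. S (Suc n) z - S n z) z v) \<le> (\<epsilon> * (2 * dd n / \<delta>)) * norm v" if "z \<in> Om (s (Suc n))" for z v
    using fd_bound[OF mvh_diff[OF h(1) hn(1)] _ gap(1) that, of "\<epsilon> * dd n" v] st unfolding gap(2)
    by (auto simp: step_def mult_ac)
  show dG: "norm (fd (\<lambda>z. G (Suc n) z - G n z) z v) \<le> (2 * dd n / \<delta>) * norm v" if "z \<in> Om (s (Suc n))" for z v
    using fd_bound[OF mvh_diff[OF h(2) hn(2)] _ gap(1) that, of "dd n" v] st unfolding gap(2)
    by (auto simp: step_def mult_ac)
  have ell: "ell n + 2 * dd n / \<delta> \<le> ell (Suc n)"
  proof -
    have "2 * dd n / \<delta> = 192 / 800 * (L / 2 ^ n)" using L_pos eps by (simp add: dd_def del power2_eq_square)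
    also have "\<dots> \<le> 1 / 4 * (L / 2 ^ n)" using L_pos by (intro mult_right_mono) auto
    also have "\<dots> = ell (Suc n) - ell n" by (simp add: ell_def field_simps)
    finally show ?thesis by linarith
  qed
  show "level (Suc n)" unfolding level_def
  proof (intro conjI allI impI)
    show "mv_holomorphic_on (S (Suc n)) (Om (s (Suc n)))" "mv_holomorphic_on (G (Suc n)) (Om (s (Suc n)))"
      using h sub2 mvh_subset by blast+
    fix z v assume z: "z \<in> Om (s (Suc n))"
    then have z': "z \<in> Om (s n + \<delta> / 2)" "z \<in> Om (s n)" using sub sub2 by auto
    have "fd (S (Suc n)) z v = fd (\<lambda>z. S (Suc n) z - S n z) z v + fd (S n) z v"
      using fd_diff[OF h(1) hn(1) z'(1)] by simp
    then have "norm (fd (S (Suc n)) z v) \<le> (\<epsilon> * (2 * dd n / \<delta>)) * norm v + (\<epsilon> * ell n) * norm v"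
      using norm_triangle_mono[OF dS[OF z]] n z'(2) by (auto simp: level_def)
    also have "\<dots> = \<epsilon> * (ell n + 2 * dd n / \<delta>) * norm v" by (simp add: algebra_simps)
    also have "\<dots> \<le> (\<epsilon> * ell (Suc n)) * norm v" using ell eps by (intro mult_right_mono mult_left_mono) auto
    finally show "norm (fd (S (Suc n)) z v) \<le> (\<epsilon> * ell (Suc n)) * norm v" .
    have "fd (G (Suc n)) z v = fd (\<lambda>z. G (Suc n) z - G n z) z v + fd (G n) z v"
      using fd_diff[OF h(2) hn(2) z'(1)] by simp
    then have "norm (fd (G (Suc n)) z v) \<le> (2 * dd n / \<delta>) * norm v + ell n * norm v"
      using norm_triangle_mono[OF dG[OF z]] n z'(2) by (auto simp: level_def)
    also have "\<dots> = (ell n + 2 * dd n / \<delta>) * norm v" by (simp add: algebra_simps)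
    also have "\<dots> \<le> ell (Suc n) * norm v" using ell by (intro mult_right_mono) auto
    finally show "norm (fd (G (Suc n)) z v) \<le> ell (Suc n) * norm v" .
  next
    fix x assume "complexify x \<in> Om (s (Suc n))"
    then have x: "complexify x \<in> Om (s n + \<delta> / 2)" using sub2 by auto
    show "S (Suc n) (complexify x) \<in> \<real>" using F.solve_real[OF rhs_real[OF n] x] by simp
    show "G (Suc n) (complexify x) \<in> \<real>" using F.avg_real[OF rhs_real[OF n] x] by simp
  qed
qed

text \<open>\<open>G\<close> enters \<open>rhs\<close> only through a difference over a shift of
  order \<epsilon>, so every term carries a factor \<epsilon>. The derivatives of the corrections
  are of size \<open>2 * dd n / \<delta>\<close>; since \<delta> is proportional to \<epsilon>, the
  quotient is a fixed factor \<open>72 / 800\<close>, less than 1/8.\<close>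

lemma rhs_diff:
  assumes n: "level n" and st: "step n" and z: "z \<in> Om (s (Suc n) + \<delta> / 2)"
  shows "norm (f (Suc n) z - f n z) \<le> dd (Suc n) / 4"
proof -
  note n1 = next_level[OF n st]
  let ?a = "half_ham (S (Suc n)) z" and ?b = "half_ham (S n) z"
  have sub: "Om (s (Suc n)) \<subseteq> Om (s n)" "Om (s (Suc n)) \<subseteq> Om \<sigma>" using del_pos by (auto intro!: Om_mono)
  have z1: "z \<in> Om (s (Suc n))" using z Om_mono[of "s (Suc n)" "s (Suc n) + \<delta> / 2"] del_pos by auto
  have z0: "z \<in> Om (s n)" using z1 sub by auto
  note a = half_ham_S_le[OF n1(1) z1] and b = half_ham_S_le[OF n z0]
  define \<rho> where "\<rho> = 2 * dd n / \<delta>"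
  have rho: "\<rho> \<ge> 0" using L_pos eps del_pos by (simp add: \<rho>_def dd_def)
  have hS: "mv_holomorphic_on (S (Suc n)) (Om (s (Suc n)))" "mv_holomorphic_on (S n) (Om (s (Suc n)))"
    and hG: "mv_holomorphic_on (G (Suc n)) (Om (s (Suc n)))" "mv_holomorphic_on (G n) (Om (s (Suc n)))"
    using n n1(1) mvh_subset[OF _ sub(1)] unfolding level_def by blast+
  have ab: "norm (?a - ?b) \<le> 12 * (\<epsilon> * \<rho>)"
    unfolding half_ham_diff[OF hS z1, symmetric] \<rho>_def by (rule norm_half_ham_le) (rule n1(2)[OF z1])
  have conv: "norm ((1 - t) *\<^sub>R ?b + t *\<^sub>R ?a) \<le> \<delta> / 2" if "t \<in> {0..1}" for t
  proof -
    have "norm ((1 - t) *\<^sub>R ?b + t *\<^sub>R ?a) \<le> (1 - t) * norm ?b + t * norm ?a"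
      using that norm_triangle_ineq[of "(1 - t) *\<^sub>R ?b" "t *\<^sub>R ?a"] by simp
    also have "\<dots> \<le> (1 - t) * (\<delta> / 2) + t * (\<delta> / 2)" using that a b by (intro add_mono mult_left_mono) auto
    also have "\<dots> = \<delta> / 2" by (simp only: distrib_right[symmetric]) simp
    finally show ?thesis .
  qed
  have seg: "(z + ?b) + t *\<^sub>R (?a - ?b) \<in> Om (s (Suc n))" "(z - ?a) + t *\<^sub>R (?a - ?b) \<in> Om (s (Suc n))"
    "(z - ?a) + t *\<^sub>R ?a \<in> Om (s (Suc n))" if t: "t \<in> {0..1}" for t
  proof -
    have "z + ((1 - t) *\<^sub>R ?b + t *\<^sub>R ?a) \<in> Om (s (Suc n))" using conv[OF t] by (intro Om_shift[OF z]) auto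
    then show "(z + ?b) + t *\<^sub>R (?a - ?b) \<in> Om (s (Suc n))" by (simp add: algebra_simps)
    have t1: "1 - t \<in> {0..1}" using t by auto
    have c: "norm (- ((1 - (1 - t)) *\<^sub>R ?b + (1 - t) *\<^sub>R ?a)) \<le> \<delta> / 2"
      unfolding norm_minus_cancel by (rule conv[OF t1])
    have "z + (- ((1 - (1 - t)) *\<^sub>R ?b + (1 - t) *\<^sub>R ?a)) \<in> Om (s (Suc n))"
      by (rule Om_shift[OF z], rule order_trans[OF c]) simp
    then show "(z - ?a) + t *\<^sub>R (?a - ?b) \<in> Om (s (Suc n))" by (simp add: algebra_simps)
    have "norm ((1 - t) *\<^sub>R ?a) \<le> norm ?a" using t by (simp add: mult_left_le_one_le)
    then have "z + (- ((1 - t) *\<^sub>R ?a)) \<in> Om (s (Suc n))" using Om_shift[OF z, of "- ((1 - t) *\<^sub>R ?a)" "s (Suc n)"] a(2) by auto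
    then show "(z - ?a) + t *\<^sub>R ?a \<in> Om (s (Suc n))" by (simp add: algebra_simps)
  qed
  have 1: "norm (V ((z + ?b) + (?a - ?b)) - V (z + ?b)) \<le> L * norm (?a - ?b)"
    by (rule V_lip) (use seg(1) sub in auto)
  have 2: "norm (G n ((z - ?a) + (?a - ?b)) - G n (z - ?a)) \<le> L * norm (?a - ?b)"
    by (rule G_lip[OF n]) (use seg(2) sub in auto)
  let ?D = "\<lambda>z. G (Suc n) z - G n z"
  have 3: "norm (?D ((z - ?a) + ?a) - ?D (z - ?a)) \<le> \<rho> * norm ?a"
    by (rule mvh_lipschitz[OF mvh_diff[OF hG]]) (use seg(3) n1(3) in \<open>auto simp: \<rho>_def\<close>)
  have "f (Suc n) z - f n z = (V ((z + ?b) + (?a - ?b)) - V (z + ?b)) +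
      ((?D ((z - ?a) + ?a) - ?D (z - ?a)) + (G n ((z - ?a) + (?a - ?b)) - G n (z - ?a)))"
    by (simp add: rhs_def algebra_simps)
  then have "norm (f (Suc n) z - f n z) \<le> L * norm (?a - ?b) + (\<rho> * norm ?a + L * norm (?a - ?b))"
    using 1 2 3 norm_triangle_mono by metis
  also have "\<dots> \<le> L * (12 * (\<epsilon> * \<rho>)) + (\<rho> * (12 * \<epsilon> * L) + L * (12 * (\<epsilon> * \<rho>)))"
    using ab a(1) L_pos rho by (intro add_mono mult_left_mono) auto
  also have "\<dots> = 36 * L * \<epsilon> * \<rho>" by simp
  also have "\<dots> = 72 / 800 * dd n" using L_pos eps by (simp add: \<rho>_def del)
  also have "\<dots> \<le> dd (Suc n) / 4"
  proof -
    have "dd (Suc n) = dd n / 2" "dd n \<ge> 0" using L_pos eps by (simp_all add: dd_def)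
    then show ?thesis by simp
  qed
  finally show ?thesis .
qed

lemma Tv_diff:
  assumes f: "mv_holomorphic_on g (Om t)" and h: "mv_holomorphic_on h (Om t)"
    and b: "\<And>z. z \<in> Om t \<Longrightarrow> norm (g z - h z) \<le> B" and z: "z \<in> Om t"
  shows "norm (solve g z - solve h z) \<le> 4 * B" "norm (avg g z - avg h z) \<le> B"
proof -
  interpret D: rot_mean "Om t" "\<lambda>z. g z - h z" by (rule rot_meanI[OF mvh_diff[OF f h]])
  interpret F: rot_mean "Om t" g by (rule rot_meanI[OF f])
  interpret H: rot_mean "Om t" h by (rule rot_meanI[OF h])
  have "solve (\<lambda>z. g z - h z) z = solve g z - solve h z"
    unfolding solve_def right_diff_distrib
    by (intro integral_diff integrable_continuous_interval continuous_intros F.f_rot_cont H.f_rot_cont z) auto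
  then show "norm (solve g z - solve h z) \<le> 4 * B"
    using D.solve_bound[OF z b[OF Om_rot[OF z]]] by simp
  have "avg (\<lambda>z. g z - h z) z = avg g z - avg h z"
    unfolding avg_def right_diff_distrib
    by (intro integral_diff integrable_continuous_interval continuous_intros F.f_rot_cont H.f_rot_cont z)
  then show "norm (avg g z - avg h z) \<le> B"
    using D.avg_bound[OF z b[OF Om_rot[OF z]]] by simp
qed

lemma dd_nonneg: "dd n \<ge> 0" using L_pos eps by (simp add: dd_def)

lemma level_step: "level n \<and> step n"
proof (induction n)
  case 0
  have V: "mv_holomorphic_on V (Om (s 0 + \<delta> / 2))" using mvh_subset[OF V_hol Om_mono] sig del_pos by auto
  have "step 0" unfolding step_def
  proof (intro allI impI)
    fix z assume z: "z \<in> Om (s 0 + \<delta> / 2)"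
    note d = Tv_diff[OF rhs_hol[OF level_0] V rhs_0_close z]
    have "S (Suc 0) z - S 0 z = of_real \<epsilon> * (solve (f 0) z - solve V z)" by (simp add: algebra_simps)
    then show "norm (S (Suc 0) z - S 0 z) \<le> \<epsilon> * dd 0 \<and> norm (G (Suc 0) z - G 0 z) \<le> dd 0"
      using d eps dd_nonneg[of 0] by (auto simp: norm_mult)
  qed
  then show ?case using level_0 by simp
next
  case (Suc n)
  then have l: "level (Suc n)" using next_level by blast
  have "step (Suc n)" unfolding step_def
  proof (intro allI impI)
    fix z assume z: "z \<in> Om (s (Suc n) + \<delta> / 2)"
    have sub: "Om (s (Suc n) + \<delta> / 2) \<subseteq> Om (s n + \<delta> / 2)" using del_pos by (intro Om_mono) simp
    have h: "mv_holomorphic_on (f n) (Om (s (Suc n) + \<delta> / 2))" using mvh_subset[OF rhs_hol sub] Suc by auto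
    note d = Tv_diff[OF rhs_hol[OF l] h rhs_diff z]
    have "S (Suc (Suc n)) z - S (Suc n) z = of_real \<epsilon> * (solve (f (Suc n)) z - solve (f n) z)" by (simp add: algebra_simps)
    then show "norm (S (Suc (Suc n)) z - S (Suc n) z) \<le> \<epsilon> * dd (Suc n) \<and> norm (G (Suc (Suc n)) z - G (Suc n) z) \<le> dd (Suc n)"
      using d Suc eps dd_nonneg[of "Suc n"] by (auto simp: norm_mult)
  qed
  then show ?case using l by simp
qed

lemma level_all: "level n" and step_all: "step n" using level_step by auto

text \<open>\<open>level\<close> bounds derivatives only; this gives bounds for \<open>S\<close> and
  \<open>G\<close> themselves that are uniform in the number of steps.\<close>

lemma rhs_bound:
  assumes z: "z \<in> Om (s n + \<delta> / 2)"
  shows "norm (f n z) \<le> B0 + 12 * \<epsilon> * L\<^sup>2"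
proof -
  have z0: "z \<in> Om (s n)" using z Om_mono[of "s n" "s n + \<delta> / 2"] del_pos by auto
  let ?a = "half_ham (S n) z"
  note a = half_ham_S_le[OF level_all z0]
  have "(z - ?a) + t *\<^sub>R ?a \<in> Om (s n)" if "t \<in> {0..1}" for t
  proof -
    have "norm ((1 - t) *\<^sub>R ?a) \<le> norm ?a" using that by (simp add: mult_left_le_one_le)
    then have "z + (- ((1 - t) *\<^sub>R ?a)) \<in> Om (s n)" using Om_shift[OF z, of "- ((1 - t) *\<^sub>R ?a)" "s n"] a(2) by auto
    then show ?thesis by (simp add: algebra_simps)
  qed
  from G_lip[OF level_all this] have "norm (G n z - G n (z - ?a)) \<le> L * norm ?a" by simp
  also have "\<dots> \<le> L * (12 * \<epsilon> * L)" using a(1) L_pos by simp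
  finally have 1: "norm (G n z - G n (z - ?a)) \<le> 12 * \<epsilon> * L\<^sup>2" by (simp add: power2_eq_square mult_ac)
  have "z + ?a \<in> Om (s n)" using Om_shift[OF z, of ?a "s n"] a(2) by auto
  then have "z + ?a \<in> Om 0" using Om_mono[of 0 "s n"] s_ge[of n] sig by auto
  from V_bound[OF this] 1 have "norm (V (z + ?a) + (G n z - G n (z - ?a))) \<le> B0 + 12 * \<epsilon> * L\<^sup>2"
    by (rule norm_triangle_mono)
  then show ?thesis by (simp add: rhs_def algebra_simps)
qed

text \<open>\<open>S (Suc n)\<close> solves the homological equation for \<open>f n\<close>, so the
  defect in the midpoint equation is \<epsilon> times \<open>f n - f (Suc n)\<close>, the last
  increment of the iteration.\<close>

lemma residual:
  assumes z: "z \<in> Om (s (Suc n) + \<delta> / 2)"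
  shows "norm (fd (S (Suc n)) z (kgen z) - of_real \<epsilon> * (V (z + half_ham (S (Suc n)) z) - G (Suc n) (z - half_ham (S (Suc n)) z)))
     \<le> \<epsilon> * (24 * L\<^sup>2 * \<epsilon> / 2 ^ Suc n)"
proof -
  interpret F: rot_mean "Om (s n + \<delta> / 2)" "f n" by (rule rot_meanI[OF rhs_hol[OF level_all]])
  have z': "z \<in> Om (s n + \<delta> / 2)" using z Om_mono[of "s n + \<delta> / 2" "s (Suc n) + \<delta> / 2"] del_pos by auto
  have "fd (S (Suc n)) z (kgen z) = of_real \<epsilon> * (f n z - G (Suc n) z)"
    using fd_cmult[OF F.solve_hol z', of "of_real \<epsilon>" "kgen z"] F.fd_solve[OF z'] by simp
  then have "fd (S (Suc n)) z (kgen z) - of_real \<epsilon> * (V (z + half_ham (S (Suc n)) z) - G (Suc n) (z - half_ham (S (Suc n)) z))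
     = of_real \<epsilon> * (f n z - f (Suc n) z)" unfolding rhs_def[of "S (Suc n)"] by (simp add: algebra_simps)
  also have "norm \<dots> \<le> \<epsilon> * (dd (Suc n) / 4)"
    using rhs_diff[OF level_all step_all z] eps by (simp add: norm_mult norm_minus_commute)
  finally show ?thesis by (simp add: dd_def)
qed

end

theorem approximate_normal_form:
  assumes sig: "\<sigma> > 0"
  shows "\<exists>C c \<epsilon>0. C > 0 \<and> c > 0 \<and> \<epsilon>0 > 0 \<and> (\<forall>\<epsilon>. 0 < \<epsilon> \<and> \<epsilon> < \<epsilon>0 \<longrightarrow> (\<exists>S G.
     mv_holomorphic_on S (Om (2 * \<sigma>)) \<and> mv_holomorphic_on G (Om (2 * \<sigma>)) \<and>
     (\<forall>z \<in> Om (2 * \<sigma>). norm (S z) \<le> C * \<epsilon> \<and> norm (G z) \<le> C \<and> norm (half_ham S z) \<le> C * \<epsilon> \<and> fd G z (kgen z) = 0 \<and>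
        norm (fd S z (kgen z) - of_real \<epsilon> * (V (z + half_ham S z) - G (z - half_ham S z))) \<le> C * \<epsilon> * exp (- c / \<epsilon>)) \<and>
     (\<forall>x. complexify x \<in> Om (2 * \<sigma>) \<longrightarrow> S (complexify x) \<in> \<real> \<and> G (complexify x) \<in> \<real>)))"
proof -
  define L where "L = 8 * B0 / \<sigma>"
  have L: "L > 0" using B0 sig by (simp add: L_def)
  \<comment> \<open>This makes \<open>exp (- c / \<epsilon>)\<close> equal to 2 to the power
    \<open>- \<sigma> / \<delta>\<close>, so the rate is the number of steps that fit into the
    domain.\<close>
  define c where "c = ln 2 * \<sigma> / (800 * L)"
  define \<epsilon>0 where "\<epsilon>0 = min 1 (\<sigma> / (1600 * L))"
  define C where "C = 4 * (B0 + 12 * L\<^sup>2) + 12 * L + 96 * L\<^sup>2"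
  show ?thesis
  proof (rule exI[of _ C], rule exI[of _ c], rule exI[of _ \<epsilon>0], intro conjI allI impI)
    show "C > 0" using B0 L by (simp add: C_def add_pos_pos)
    show "c > 0" using L sig by (simp add: c_def)
    show "\<epsilon>0 > 0" using L sig by (simp add: \<epsilon>0_def)
    fix \<epsilon> assume e: "0 < \<epsilon> \<and> \<epsilon> < \<epsilon>0"
    then have e0: "\<epsilon> > 0" "\<epsilon> < 1" "\<epsilon> < \<sigma> / (1600 * L)" by (auto simp: \<epsilon>0_def)
    define \<delta> where "\<delta> = 800 * L * \<epsilon>"
    have d: "\<delta> > 0" "2 * \<delta> < \<sigma>" using L e0 by (auto simp: \<delta>_def field_simps)
    \<comment> \<open>The subtracted 3/2 accounts for one further step and the half step in
      \<open>residual\<close>: \<open>\<sigma> + (n + 1) * \<delta> + \<delta> / 2\<close> must not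
      exceed \<open>2 * \<sigma>\<close>. Rounding down costs at most one more, which is where the
      factor 4 in \<open>pow\<close> comes from.\<close>
    define n where "n = nat \<lfloor>\<sigma> / \<delta> - 3 / 2\<rfloor>"
    have "2 < \<sigma> / \<delta>" using d by (simp add: field_simps)
    then have "0 \<le> \<lfloor>\<sigma> / \<delta> - 3 / 2\<rfloor>" by (simp only: zero_le_floor)
    then have "real n = of_int \<lfloor>\<sigma> / \<delta> - 3 / 2\<rfloor>" unfolding n_def by (rule of_nat_nat)
    then have n: "real n \<le> \<sigma> / \<delta> - 3 / 2" "real n > \<sigma> / \<delta> - 5 / 2" by linarith+
    have "real n * \<delta> \<le> (\<sigma> / \<delta> - 3 / 2) * \<delta>" using n(1) d by (intro mult_right_mono) auto
    also have "\<dots> = \<sigma> - 3 / 2 * \<delta>" using d by (simp add: field_simps)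
    finally have top: "\<sigma> + real (Suc n) * \<delta> + \<delta> / 2 \<le> 2 * \<sigma>" by (simp add: algebra_simps)
    have sub: "Om (2 * \<sigma>) \<subseteq> Om (\<sigma> + real (Suc n) * \<delta> + \<delta> / 2)" using top by (intro Om_mono)
    have sub1: "Om (2 * \<sigma>) \<subseteq> Om (\<sigma> + real (Suc n) * \<delta>)" "Om (2 * \<sigma>) \<subseteq> Om (\<sigma> + real n * \<delta> + \<delta> / 2)"
      using top d by (auto intro!: Om_mono simp: algebra_simps)
    let ?S = "genS \<epsilon> (Suc n)" and ?G = "genG \<epsilon> (Suc n)" and ?f = "rhs (genS \<epsilon> n) (genG \<epsilon> n)"
    note A = sig L_def e0(1) \<delta>_def
    note lev = level_all[OF A, of "Suc n", unfolded level_def[OF A]]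
    interpret F: rot_mean "Om (\<sigma> + real n * \<delta> + \<delta> / 2)" ?f by (rule rot_meanI[OF rhs_hol[OF A level_all[OF A]]])
    have pow: "1 / 2 ^ Suc n \<le> 4 * exp (- c / \<epsilon>)"
    proof -
      have "- c / \<epsilon> = - ln 2 * (\<sigma> / \<delta>)" using L e0 by (simp add: c_def \<delta>_def)
      also have "\<dots> \<ge> - ln 2 * (real n + 5 / 2)"
        using mult_left_mono[of "\<sigma> / \<delta>" "real n + 5 / 2" "ln 2"] n(2) by simp
      finally have "- ln 2 * (real n + 5 / 2) \<le> - c / \<epsilon>" .
      moreover have "real (n + 3) * (- ln 2) \<le> - ln 2 * (real n + 5 / 2)" by (simp add: field_simps)
      ultimately have "exp (real (n + 3) * (- ln 2)) \<le> exp (- c / \<epsilon>)" unfolding exp_le_cancel_iff by linarith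
      moreover have "exp (real (n + 3) * (- ln 2)) = (1 / 2) ^ (n + 3)"
        unfolding exp_of_nat_mult by (simp add: exp_minus inverse_eq_divide)
      ultimately have "(1 / 2) ^ (n + 3) \<le> exp (- c / \<epsilon>)" by linarith
      then show ?thesis by (simp add: power_add power_divide)
    qed
    show "\<exists>S G. mv_holomorphic_on S (Om (2 * \<sigma>)) \<and> mv_holomorphic_on G (Om (2 * \<sigma>)) \<and>
     (\<forall>z \<in> Om (2 * \<sigma>). norm (S z) \<le> C * \<epsilon> \<and> norm (G z) \<le> C \<and> norm (half_ham S z) \<le> C * \<epsilon> \<and> fd G z (kgen z) = 0 \<and>
        norm (fd S z (kgen z) - of_real \<epsilon> * (V (z + half_ham S z) - G (z - half_ham S z))) \<le> C * \<epsilon> * exp (- c / \<epsilon>)) \<and>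
     (\<forall>x. complexify x \<in> Om (2 * \<sigma>) \<longrightarrow> S (complexify x) \<in> \<real> \<and> G (complexify x) \<in> \<real>)"
    proof (rule exI[of _ ?S], rule exI[of _ ?G], intro conjI ballI allI impI)
      show "mv_holomorphic_on ?S (Om (2 * \<sigma>))" "mv_holomorphic_on ?G (Om (2 * \<sigma>))"
        using lev mvh_subset[OF _ sub1(1)] by blast+
      show "?S (complexify x) \<in> \<real>" "?G (complexify x) \<in> \<real>" if "complexify x \<in> Om (2 * \<sigma>)" for x
        using lev sub1(1) that by blast+
      fix z assume z: "z \<in> Om (2 * \<sigma>)"
      have zf: "norm (?f (rot t z)) \<le> B0 + 12 * L\<^sup>2" for t
      proof -
        have "norm (?f (rot t z)) \<le> B0 + 12 * \<epsilon> * L\<^sup>2"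
          using rhs_bound[OF A] Om_rot[OF z] sub1(2) by blast
        also have "\<dots> \<le> B0 + 12 * 1 * L\<^sup>2" using e0 by (intro add_left_mono mult_right_mono) auto
        finally show ?thesis by simp
      qed
      have z1: "z \<in> Om (\<sigma> + real n * \<delta> + \<delta> / 2)" using z sub1 by blast
      have "norm (?S z) \<le> \<epsilon> * (4 * (B0 + 12 * L\<^sup>2))"
        using F.solve_bound[OF z1 zf] e0 by (simp add: norm_mult)
      also have "\<dots> \<le> \<epsilon> * C" using L e0 by (intro mult_left_mono) (auto simp: C_def)
      finally show "norm (?S z) \<le> C * \<epsilon>" by (simp add: mult_ac)
      have "norm (?G z) \<le> B0 + 12 * L\<^sup>2" using F.avg_bound[OF z1 zf] by simp
      also have "\<dots> \<le> C" using L B0 by (simp add: C_def)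
      finally show "norm (?G z) \<le> C" .
      have "norm (half_ham ?S z) \<le> 12 * \<epsilon> * L" using half_ham_S_le(1)[OF A level_all[OF A]] z sub1 by blast
      also have "\<dots> \<le> C * \<epsilon>" using L B0 e0 by (simp add: C_def algebra_simps)
      finally show "norm (half_ham ?S z) \<le> C * \<epsilon>" .
      show "fd ?G z (kgen z) = 0" using F.fd_avg[OF z1] by simp
      have "norm (fd ?S z (kgen z) - of_real \<epsilon> * (V (z + half_ham ?S z) - ?G (z - half_ham ?S z))) \<le> \<epsilon> * (24 * L\<^sup>2 * \<epsilon> / 2 ^ Suc n)"
        using residual[OF A] z sub by blast
      also have "\<dots> = 24 * L\<^sup>2 * \<epsilon> * \<epsilon> * (1 / 2 ^ Suc n)" by simp
      also have "\<dots> \<le> 24 * L\<^sup>2 * 1 * \<epsilon> * (4 * exp (- c / \<epsilon>))" using e0 pow by (intro mult_mono) auto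
      also have "\<dots> = (96 * L\<^sup>2) * (\<epsilon> * exp (- c / \<epsilon>))" by simp
      also have "\<dots> \<le> C * (\<epsilon> * exp (- c / \<epsilon>))" using L B0 e0 by (intro mult_right_mono) (auto simp: C_def)
      finally show "norm (fd ?S z (kgen z) - of_real \<epsilon> * (V (z + half_ham ?S z) - ?G (z - half_ham ?S z))) \<le> C * \<epsilon> * exp (- c / \<epsilon>)"
        by (simp add: mult.assoc)
    qed
  qed
qed

end

section \<open>Families of smooth functions with locally uniform bounds\<close>

definition pd :: "4 \<Rightarrow> (real ^ 4 \<Rightarrow> real) \<Rightarrow> real ^ 4 \<Rightarrow> real" where
  "pd j f x = frechet_derivative f (at x) (axis j 1)"

lemma pd_eq: "(f has_derivative D) (at x) \<Longrightarrow> pd j f x = D (axis j 1)"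
  unfolding pd_def using frechet_derivative_at by metis

lemma sum_axis: "(\<Sum>j\<in>UNIV. h $ j *\<^sub>R axis j 1) = (h :: real ^ 'n)"
  by (simp add: vec_eq_iff sum_component axis_def if_distrib[of "(*) _"] sum.delta cong: if_cong)

lemma linear_expand:
  fixes D :: "real ^ 'n \<Rightarrow> 'b::real_vector"
  assumes "linear D"
  shows "D h = (\<Sum>j\<in>UNIV. h $ j *\<^sub>R D (axis j 1))"
proof -
  have "D h = D (\<Sum>j\<in>UNIV. h $ j *\<^sub>R axis j 1)" by (simp only: sum_axis)
  also have "\<dots> = (\<Sum>j\<in>UNIV. D (h $ j *\<^sub>R axis j 1))" using linear_sum[OF assms] by blast
  finally show ?thesis by (simp add: linear_scale[OF assms])
qed

lemma has_derivative_pd: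
  assumes "f differentiable (at x)"
  shows "(f has_derivative (\<lambda>h. \<Sum>j\<in>UNIV. h $ j * pd j f x)) (at x)"
proof -
  have d: "(f has_derivative frechet_derivative f (at x)) (at x)"
    using assms frechet_derivative_works by blast
  have "frechet_derivative f (at x) h = (\<Sum>j\<in>UNIV. h $ j * pd j f x)" for h
    using linear_expand[OF has_derivative_linear[OF d], of h] by (simp only: pd_def real_scaleR_def)
  then have "frechet_derivative f (at x) = (\<lambda>h. \<Sum>j\<in>UNIV. h $ j * pd j f x)" by (rule ext)
  with d show ?thesis by (simp only:)
qed

text \<open>\<open>UC k I f\<close>: the functions \<open>f i\<close> are \<open>C\<^sup>k\<close>, and on each ball their derivatives up to order \<open>k\<close> are
  bounded uniformly in \<open>i \<in> I\<close>.\<close>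

primrec UC :: "nat \<Rightarrow> 'i set \<Rightarrow> ('i \<Rightarrow> real ^ 4 \<Rightarrow> real) \<Rightarrow> bool" where
  "UC 0 I f \<longleftrightarrow> (\<forall>r. \<exists>B. \<forall>i\<in>I. \<forall>x. norm x \<le> r \<longrightarrow> \<bar>f i x\<bar> \<le> B) \<and> (\<forall>i\<in>I. continuous_on UNIV (f i))"
| "UC (Suc k) I f \<longleftrightarrow> (\<forall>r. \<exists>B. \<forall>i\<in>I. \<forall>x. norm x \<le> r \<longrightarrow> \<bar>f i x\<bar> \<le> B) \<and> (\<forall>i\<in>I. continuous_on UNIV (f i)) \<and>
     (\<forall>i\<in>I. \<forall>x. f i differentiable (at x)) \<and> (\<forall>j. UC k I (\<lambda>i. pd j (f i)))"

lemma UC_Suc: "UC (Suc k) I f \<longleftrightarrow> UC 0 I f \<and> (\<forall>i\<in>I. \<forall>x. f i differentiable (at x)) \<and> (\<forall>j. UC k I (\<lambda>i. pd j (f i)))"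
  by simp

declare UC.simps(2) [simp del]

lemma UC_0: "UC k I f \<Longrightarrow> UC 0 I f"
  by (cases k) (auto simp: UC_Suc)

lemma UC_cong:
  assumes "\<And>i x. i \<in> I \<Longrightarrow> f i x = g i x"
  shows "UC k I f \<longleftrightarrow> UC k I g"
proof (cases k)
  case 0
  have "f i = g i" if "i \<in> I" for i using assms that by blast
  then show ?thesis unfolding 0 by simp
next
  have *: "UC k I f \<longleftrightarrow> UC k I g" if "\<And>i. i \<in> I \<Longrightarrow> f i = g i" for k and f g :: "'a \<Rightarrow> real ^ 4 \<Rightarrow> real"
    using that
  proof (induction k arbitrary: f g)
    case (Suc k)
    have "UC k I (\<lambda>i. pd j (f i)) = UC k I (\<lambda>i. pd j (g i))" for j
      by (rule Suc.IH) (simp add: Suc.prems)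
    then show ?case using Suc.prems by (simp add: UC_Suc)
  qed simp
  show ?thesis by (rule *) (use assms in blast)
qed

lemma UC_SucD: "UC (Suc k) I f \<Longrightarrow> UC k I f"
  by (induction k arbitrary: f) (auto simp: UC_Suc)

lemma UC_mono: "UC k I f \<Longrightarrow> m \<le> k \<Longrightarrow> UC m I f"
  by (induction k) (auto simp: le_Suc_eq dest: UC_SucD)

lemma UC_bound: "UC k I f \<Longrightarrow> \<exists>B. \<forall>i\<in>I. \<forall>x. norm x \<le> r \<longrightarrow> \<bar>f i x\<bar> \<le> B"
  using UC_0[of k I f] unfolding UC.simps(1) by blast

lemma UC_continuous: "UC k I f \<Longrightarrow> i \<in> I \<Longrightarrow> continuous_on UNIV (f i)"
  using UC_0[of k I f] unfolding UC.simps(1) by blast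

lemma UC_pd: "UC (Suc k) I f \<Longrightarrow> UC k I (\<lambda>i. pd j (f i))"
  by (simp add: UC_Suc)

lemma UC_deriv: "UC (Suc k) I f \<Longrightarrow> i \<in> I \<Longrightarrow> (f i has_derivative (\<lambda>h. \<Sum>j\<in>UNIV. h $ j * pd j (f i) x)) (at x)"
  by (rule has_derivative_pd) (simp add: UC_Suc)

lemma UC_SucI:
  assumes b: "\<And>r. \<exists>B. \<forall>i\<in>I. \<forall>x. norm x \<le> r \<longrightarrow> \<bar>f i x\<bar> \<le> B"
    and d: "\<And>i x. i \<in> I \<Longrightarrow> (f i has_derivative D i x) (at x)"
    and u: "\<And>j. UC k I (\<lambda>i x. D i x (axis j 1))"
  shows "UC (Suc k) I f"
proof -
  have "UC k I (\<lambda>i. pd j (f i))" for j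
    using u[of j] by (subst UC_cong[of I _ "\<lambda>i x. D i x (axis j 1)"]) (auto simp: pd_eq[OF d])
  moreover have "continuous_on UNIV (f i)" if "i \<in> I" for i
    using d[OF that] by (meson continuous_at_imp_continuous_on has_derivative_continuous)
  ultimately show ?thesis using b d unfolding UC_Suc differentiable_def by simp blast
qed

lemma UC_const:
  assumes "\<And>i. i \<in> I \<Longrightarrow> \<bar>a i\<bar> \<le> B"
  shows "UC k I (\<lambda>i x. a i)"
  using assms
proof (induction k arbitrary: a B)
  case (Suc k)
  have "UC k I (\<lambda>i x. 0)" by (rule Suc.IH[of _ 0]) simp
  then show ?case by (intro UC_SucI[where D = "\<lambda>_ _ _. 0"]) (use Suc.prems in auto)
qed auto

lemma UC_const': "UC k I (\<lambda>i x. c)"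
  by (rule UC_const[of _ _ "\<bar>c\<bar>"]) simp

lemma UC_coord: "UC k I (\<lambda>i x. x $ j)"
proof (cases k)
  case 0
  have "\<bar>x $ j\<bar> \<le> r" if "norm x \<le> r" for x :: "real ^ 4" and r
    using component_le_norm_cart[of x j] that by linarith
  then show ?thesis unfolding 0 by (auto intro!: continuous_intros)
next
  case (Suc m)
  have "\<bar>x $ j\<bar> \<le> r" if "norm x \<le> r" for x :: "real ^ 4" and r
    using component_le_norm_cart[of x j] that by linarith
  moreover have "((\<lambda>x. x $ j) has_derivative (\<lambda>h. h $ j)) (at x)" for x :: "real ^ 4"
    by (rule bounded_linear_imp_has_derivative[OF bounded_linear_vec_nth])
  ultimately show ?thesis unfolding Suc
    by (intro UC_SucI[where D = "\<lambda>i x h. h $ j"]) (auto intro: UC_const')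
qed

lemma axis_sum: "(\<Sum>l\<in>UNIV. axis j 1 $ l * a l) = (a j :: real)"
  by (simp add: axis_def if_distrib[of "\<lambda>a. a * _"] cong: if_cong)

lemma bound_add_mult:
  fixes f g :: "'i \<Rightarrow> real ^ 4 \<Rightarrow> real"
  assumes f: "\<exists>B. \<forall>i\<in>I. \<forall>x. norm x \<le> r \<longrightarrow> \<bar>f i x\<bar> \<le> B"
    and g: "\<exists>B. \<forall>i\<in>I. \<forall>x. norm x \<le> r \<longrightarrow> \<bar>g i x\<bar> \<le> B"
  shows "\<exists>B. \<forall>i\<in>I. \<forall>x. norm x \<le> r \<longrightarrow> \<bar>f i x + g i x\<bar> \<le> B"
    and "\<exists>B. \<forall>i\<in>I. \<forall>x. norm x \<le> r \<longrightarrow> \<bar>f i x * g i x\<bar> \<le> B"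
proof -
  obtain B1 B2 where B: "\<And>i x. i \<in> I \<Longrightarrow> norm x \<le> r \<Longrightarrow> \<bar>f i x\<bar> \<le> B1"
    "\<And>i x. i \<in> I \<Longrightarrow> norm x \<le> r \<Longrightarrow> \<bar>g i x\<bar> \<le> B2" using f g by blast
  have "\<bar>f i x + g i x\<bar> \<le> B1 + B2" if "i \<in> I" "norm x \<le> r" for i x
    using B(1)[OF that] B(2)[OF that] by linarith
  then show "\<exists>B. \<forall>i\<in>I. \<forall>x. norm x \<le> r \<longrightarrow> \<bar>f i x + g i x\<bar> \<le> B" by blast
  have "\<bar>f i x * g i x\<bar> \<le> B1 * B2" if "i \<in> I" "norm x \<le> r" for i x
    using B(1)[OF that] B(2)[OF that] unfolding abs_mult by (intro mult_mono) linarith+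
  then show "\<exists>B. \<forall>i\<in>I. \<forall>x. norm x \<le> r \<longrightarrow> \<bar>f i x * g i x\<bar> \<le> B" by blast
qed

lemma UC_add: "UC k I f \<Longrightarrow> UC k I g \<Longrightarrow> UC k I (\<lambda>i x. f i x + g i x)"
proof (induction k arbitrary: f g)
  case 0
  then show ?case using bound_add_mult(1)[of I _ f g] by (auto intro!: continuous_intros)
next
  case (Suc k)
  show ?case
  proof (rule UC_SucI[OF bound_add_mult(1)[OF UC_bound[OF Suc.prems(1)] UC_bound[OF Suc.prems(2)]]
        has_derivative_add[OF UC_deriv[OF Suc.prems(1)] UC_deriv[OF Suc.prems(2)]]])
    show "UC k I (\<lambda>i x. (\<Sum>l\<in>UNIV. axis j 1 $ l * pd l (f i) x) + (\<Sum>l\<in>UNIV. axis j 1 $ l * pd l (g i) x))" for j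
      unfolding axis_sum by (rule Suc.IH[OF UC_pd[OF Suc.prems(1)] UC_pd[OF Suc.prems(2)]])
  qed
qed

lemma UC_mult: "UC k I f \<Longrightarrow> UC k I g \<Longrightarrow> UC k I (\<lambda>i x. f i x * g i x)"
proof (induction k arbitrary: f g)
  case 0
  then show ?case using bound_add_mult(2)[of I _ f g] by (auto intro!: continuous_intros)
next
  case (Suc k)
  show ?case
  proof (rule UC_SucI[OF bound_add_mult(2)[OF UC_bound[OF Suc.prems(1)] UC_bound[OF Suc.prems(2)]]
        has_derivative_mult[OF UC_deriv[OF Suc.prems(1)] UC_deriv[OF Suc.prems(2)]]])
    show "UC k I (\<lambda>i x. f i x * (\<Sum>l\<in>UNIV. axis j 1 $ l * pd l (g i) x) + (\<Sum>l\<in>UNIV. axis j 1 $ l * pd l (f i) x) * g i x)" for j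
      unfolding axis_sum
      by (rule UC_add[OF Suc.IH[OF UC_SucD[OF Suc.prems(1)] UC_pd[OF Suc.prems(2), of j]]
          Suc.IH[OF UC_pd[OF Suc.prems(1), of j] UC_SucD[OF Suc.prems(2)]]])
  qed
qed

lemma UC_cmult: "UC k I f \<Longrightarrow> UC k I (\<lambda>i x. c * f i x)"
  by (rule UC_mult[OF UC_const'])

lemma UC_diff: "UC k I f \<Longrightarrow> UC k I g \<Longrightarrow> UC k I (\<lambda>i x. f i x - g i x)"
  using UC_add[of k I f "\<lambda>i x. (-1) * g i x"] UC_cmult[of k I g "-1"] by simp

lemma UC_sum: "finite A \<Longrightarrow> (\<And>a. a \<in> A \<Longrightarrow> UC k I (f a)) \<Longrightarrow> UC k I (\<lambda>i x. \<Sum>a\<in>A. f a i x)"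
  by (induction A rule: finite_induct) (auto intro: UC_add UC_const')

lemma UC_prod: "finite A \<Longrightarrow> (\<And>a. a \<in> A \<Longrightarrow> UC k I (f a)) \<Longrightarrow> UC k I (\<lambda>i x. \<Prod>a\<in>A. f a i x)"
  by (induction A rule: finite_induct) (auto intro: UC_mult UC_const')

lemma UC_power: "UC k I f \<Longrightarrow> UC k I (\<lambda>i x. f i x ^ n)"
  by (induction n) (auto intro: UC_mult UC_const')

lemma UC_inverse:
  assumes f: "UC k I f" and c: "\<And>r. \<exists>c>0. \<forall>i\<in>I. \<forall>x. norm x \<le> r \<longrightarrow> c \<le> \<bar>f i x\<bar>"
  shows "UC k I (\<lambda>i x. 1 / f i x)"
  using f
proof (induction k)
  have nz: "f i x \<noteq> 0" if "i \<in> I" for i x using c[of "norm x"] that by force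
  have b: "\<exists>B. \<forall>i\<in>I. \<forall>x. norm x \<le> r \<longrightarrow> \<bar>1 / f i x\<bar> \<le> B" for r
  proof -
    obtain a where a: "a > 0" "\<And>i x. i \<in> I \<Longrightarrow> norm x \<le> r \<Longrightarrow> a \<le> \<bar>f i x\<bar>" using c[of r] by blast
    have "\<bar>1 / f i x\<bar> \<le> 1 / a" if "i \<in> I" "norm x \<le> r" for i x
      using a(1) a(2)[OF that] by (auto simp: abs_divide intro: frac_le)
    then show ?thesis by blast
  qed
  {
  case 0
  show ?case using b 0 nz by (auto intro!: continuous_intros)
  next
  case (Suc k)
  have d: "((\<lambda>x. 1 / f i x) has_derivative (\<lambda>h. - (\<Sum>l\<in>UNIV. h $ l * pd l (f i) x) * ((1 / f i x) * (1 / f i x)))) (at x)"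
    if "i \<in> I" for i x
    using Deriv.has_derivative_inverse[OF nz[OF that] UC_deriv[OF Suc.prems that]]
    by (simp add: inverse_eq_divide mult_ac)
  show ?case
  proof (rule UC_SucI[OF b d])
    have 1: "UC k I (\<lambda>i x. 1 / f i x)" by (rule Suc.IH[OF UC_SucD[OF Suc.prems]])
    show "UC k I (\<lambda>i x. - (\<Sum>l\<in>UNIV. axis j 1 $ l * pd l (f i) x) * ((1 / f i x) * (1 / f i x)))" for j
      using UC_mult[OF UC_cmult[OF UC_pd[OF Suc.prems, of j], of "-1"] UC_mult[OF 1 1]]
      by (simp add: axis_sum)
  qed
}
qed

lemma has_derivative_pos_power:
  "((\<lambda>t. (max 0 t) ^ Suc (Suc n)) has_real_derivative (real (Suc (Suc n)) * (max 0 t) ^ Suc n)) (at (t::real))"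
proof (cases t "0 :: real" rule: linorder_cases)
  case less
  have "((\<lambda>t. 0) has_real_derivative 0) (at t)" by simp
  then show ?thesis
    by (rule DERIV_cong[OF has_field_derivative_transform_within_open[of _ _ _ "{..<0}"]]) (use less in auto)
next
  case greater
  have "((\<lambda>t. t ^ Suc (Suc n)) has_real_derivative (real (Suc (Suc n)) * (max 0 t) ^ Suc n)) (at t)"
    using DERIV_pow[of "Suc (Suc n)" t] greater by (simp add: max_def)
  then show ?thesis
    by (rule has_field_derivative_transform_within_open[of _ _ _ "{0<..}"]) (use greater in \<open>auto simp: max_def\<close>)
next
  case equal
  have "((\<lambda>h. (max 0 h) ^ Suc (Suc n) / h) \<longlongrightarrow> 0) (at (0::real))"
  proof (rule Lim_null_comparison[where g = "\<lambda>h. \<bar>h\<bar> ^ Suc n"])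
    show "\<forall>\<^sub>F h in at (0::real). norm (max 0 h ^ Suc (Suc n) / h) \<le> \<bar>h\<bar> ^ Suc n"
    proof (intro eventuallyI)
      fix h :: real
      show "norm (max 0 h ^ Suc (Suc n) / h) \<le> \<bar>h\<bar> ^ Suc n"
      proof (cases "h > 0")
        case False
        then have m: "max 0 h = 0" by simp
        show ?thesis using zero_le_power_abs[of h "Suc n"] unfolding m power_0_Suc by (simp del: power_Suc)
      qed (simp add: max_def)
    qed
    have "((\<lambda>h::real. \<bar>h\<bar> ^ Suc n) \<longlongrightarrow> \<bar>0\<bar> ^ Suc n) (at 0)" by (intro tendsto_intros)
    then show "((\<lambda>h::real. \<bar>h\<bar> ^ Suc n) \<longlongrightarrow> 0) (at 0)" by simp
  qed
  then show ?thesis unfolding equal DERIV_def by simp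
qed

text \<open>Truncated powers are the source of cutoffs: their finite smoothness suffices and every
  derivative is again of the same kind.\<close>

lemma UC_pos_power:
  "UC k I f \<Longrightarrow> k < n \<Longrightarrow> UC k I (\<lambda>i x. (max 0 (f i x)) ^ n)"
proof (induction k arbitrary: n)
  have b: "\<exists>B. \<forall>i\<in>I. \<forall>x. norm x \<le> r \<longrightarrow> \<bar>max 0 (f i x) ^ n\<bar> \<le> B" if u: "UC 0 I f" for r n
  proof -
    obtain B where "\<forall>i\<in>I. \<forall>x. norm x \<le> r \<longrightarrow> \<bar>f i x\<bar> \<le> B" using UC_bound[OF u] by blast
    then have "\<bar>max 0 (f i x) ^ n\<bar> \<le> (max 0 B) ^ n" if "i \<in> I" "norm x \<le> r" for i x
      using that by (fastforce simp: power_abs intro!: power_mono)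
    then show ?thesis by blast
  qed
  {
  case 0
  then show ?case using b by (auto intro!: continuous_intros)
  next
  case (Suc k)
  obtain m where n: "n = Suc (Suc m)" using that[of "n - 2"] Suc.prems(2) by simp
  have d: "((\<lambda>x. (max 0 (f i x)) ^ n) has_derivative (\<lambda>h. (real n * (max 0 (f i x)) ^ Suc m) * (\<Sum>l\<in>UNIV. h $ l * pd l (f i) x))) (at x)"
    if "i \<in> I" for i x
    using has_derivative_compose[OF UC_deriv[OF Suc.prems(1) that] has_derivative_pos_power[of m, unfolded has_field_derivative_def]]
    unfolding n .
  show ?case
  proof (rule UC_SucI[OF b d])
    show "UC 0 I f" using Suc.prems UC_0 by blast
    have 1: "UC k I (\<lambda>i x. real n * (max 0 (f i x)) ^ Suc m)"
      by (intro UC_cmult Suc.IH[OF UC_SucD[OF Suc.prems(1)]]) (use Suc.prems n in auto)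
    show "UC k I (\<lambda>i x. (real n * (max 0 (f i x)) ^ Suc m) * (\<Sum>l\<in>UNIV. axis j 1 $ l * pd l (f i) x))" for j
      using UC_mult[OF 1 UC_pd[OF Suc.prems(1), of j]]
      by (simp add: axis_sum)
  qed
}
qed

lemma has_derivative_vec4:
  assumes "\<And>i. ((\<lambda>t. f t $ i) has_derivative (\<lambda>h. f' h $ i)) F"
  shows "((f :: 'b::real_normed_vector \<Rightarrow> real ^ 4) has_derivative f') F"
proof -
  have "((\<lambda>t. \<Sum>i\<in>UNIV. f t $ i *\<^sub>R (axis i 1 :: real ^ 4)) has_derivative (\<lambda>h. \<Sum>i\<in>UNIV. f' h $ i *\<^sub>R (axis i 1 :: real ^ 4))) F"
    by (intro has_derivative_sum has_derivative_scaleR_left assms)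
  then show ?thesis by (simp only: sum_axis)
qed

lemma UC_local_bound_vec:
  assumes "\<And>l. UC k I (\<lambda>i x. c i x $ l)"
  shows "\<exists>R. \<forall>i\<in>I. \<forall>x. norm x \<le> r \<longrightarrow> norm (c i x :: real ^ 4) \<le> R"
proof -
  have "\<exists>B. \<forall>i\<in>I. \<forall>x. norm x \<le> r \<longrightarrow> \<bar>c i x $ l\<bar> \<le> B" for l by (rule UC_bound[OF assms])
  then obtain B where B: "\<And>l i x. i \<in> I \<Longrightarrow> norm x \<le> r \<Longrightarrow> \<bar>c i x $ l\<bar> \<le> B l" by metis
  have "norm (c i x) \<le> B 1 + B 2 + B 3 + B 4" if "i \<in> I" "norm x \<le> r" for i x
    using norm_le_sum_4[of "c i x"] B[OF that, of 1] B[OF that, of 2] B[OF that, of 3] B[OF that, of 4] by simp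
  then show ?thesis by blast
qed

lemma UC_compose:
  assumes "UC k I P" "\<And>l. UC k I (\<lambda>i x. c i x $ l)"
  shows "UC k I (\<lambda>i x. P i (c i x))"
  using assms
proof (induction k arbitrary: P)
  have b: "\<exists>B. \<forall>i\<in>I. \<forall>x. norm x \<le> r \<longrightarrow> \<bar>P i (c i x)\<bar> \<le> B"
    if P: "UC 0 I P" and c: "\<And>l. UC 0 I (\<lambda>i x. c i x $ l)" for r P
  proof -
    obtain R where "\<forall>i\<in>I. \<forall>x. norm x \<le> r \<longrightarrow> norm (c i x) \<le> R" using UC_local_bound_vec[OF c] by blast
    then show ?thesis using UC_bound[OF P, of R] by blast
  qed
  {
  case 0
  have c: "continuous_on UNIV (c i)" if "i \<in> I" for i
  proof -
    have "continuous_on UNIV (\<lambda>x. \<chi> l. c i x $ l)"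
      by (intro continuous_on_vec_lambda UC_continuous[OF 0(2) that])
    then show ?thesis by simp
  qed
  have "continuous_on UNIV (\<lambda>x. P i (c i x))" if "i \<in> I" for i
    by (rule continuous_on_compose2[OF UC_continuous[OF 0(1) that] c[OF that]]) simp
  then show ?case using b[OF 0] by simp
  next
  case (Suc k)
  have c: "(c i has_derivative (\<lambda>h. \<chi> m. \<Sum>l\<in>UNIV. h $ l * pd l (\<lambda>x. c i x $ m) x)) (at x)" if "i \<in> I" for i x
    by (rule has_derivative_vec4) (use UC_deriv[OF Suc.prems(2) that] in simp)
  have d: "((\<lambda>x. P i (c i x)) has_derivative (\<lambda>h. \<Sum>m\<in>UNIV. (\<Sum>l\<in>UNIV. h $ l * pd l (\<lambda>x. c i x $ m) x) * pd m (P i) (c i x))) (at x)"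
    if "i \<in> I" for i x
    using has_derivative_compose[OF c[OF that] UC_deriv[OF Suc.prems(1) that]] by simp
  show ?case
  proof (rule UC_SucI[OF b d])
    show "UC 0 I P" "UC 0 I (\<lambda>i x. c i x $ l)" for l using Suc.prems UC_0 by blast+
    have "UC k I (\<lambda>i x. pd m (P i) (c i x))" for m
      by (rule Suc.IH[OF UC_pd[OF Suc.prems(1)] UC_SucD[OF Suc.prems(2)]])
    then have "UC k I (\<lambda>i x. \<Sum>m\<in>UNIV. pd j (\<lambda>x. c i x $ m) x * pd m (P i) (c i x))" for j
      by (intro UC_sum UC_mult UC_pd[OF Suc.prems(2)]) auto
    then show "UC k I (\<lambda>i x. \<Sum>m\<in>UNIV. (\<Sum>l\<in>UNIV. axis j 1 $ l * pd l (\<lambda>x. c i x $ m) x) * pd m (P i) (c i x))" for j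
      by (simp add: axis_sum)
  qed
}
qed

text \<open>For holomorphic families a sup bound alone controls all derivatives, by Cauchy's
  estimate. The support of \<rho> lies in \<open>T\<close>, at a fixed distance from the boundary of
  \<open>S\<close>, so the product extends by zero.\<close>

lemma UC_holomorphic:
  assumes "UC k I (\<lambda>_. \<rho>)" "closed T" "\<And>x. x \<notin> T \<Longrightarrow> \<rho> x = 0" "\<delta> > 0"
    "\<And>x. x \<in> T \<Longrightarrow> cball (complexify x) \<delta> \<subseteq> S" "open S"
    "\<And>i. i \<in> I \<Longrightarrow> mv_holomorphic_on (F i) S" "\<And>i z. i \<in> I \<Longrightarrow> z \<in> S \<Longrightarrow> norm (F i z) \<le> B"
  shows "UC k I (\<lambda>i x. \<rho> x * Re (F i (complexify x)))"
  using assms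
proof (induction k arbitrary: \<rho> F \<delta> S B)
  have b: "\<exists>B'. \<forall>i\<in>I. \<forall>x. norm x \<le> r \<longrightarrow> \<bar>\<rho> x * Re (F i (complexify x))\<bar> \<le> B'"
    if u: "UC 0 I (\<lambda>_. \<rho>)" and z: "\<And>x. x \<notin> T \<Longrightarrow> \<rho> x = 0" and d: "\<delta> > 0"
      and s: "\<And>x. x \<in> T \<Longrightarrow> cball (complexify x) \<delta> \<subseteq> S"
      and F: "\<And>i z. i \<in> I \<Longrightarrow> z \<in> S \<Longrightarrow> norm (F i z) \<le> B" for r \<rho> and F :: "'a \<Rightarrow> complex ^ 4 \<Rightarrow> complex" and S \<delta> B
  proof -
    obtain R where R: "\<forall>i\<in>I. \<forall>x. norm x \<le> r \<longrightarrow> \<bar>\<rho> x\<bar> \<le> R" using UC_bound[OF u] by blast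
    have "\<bar>\<rho> x * Re (F i (complexify x))\<bar> \<le> max 0 (R * B)" if i: "i \<in> I" "norm x \<le> r" for i x
    proof (cases "x \<in> T")
      case True
      then have "complexify x \<in> S" using s d by force
      then have "\<bar>Re (F i (complexify x))\<bar> \<le> B" using F[OF i(1)] abs_Re_le_cmod order_trans by blast
      moreover have "\<bar>\<rho> x\<bar> \<le> R" using R i by blast
      ultimately have "\<bar>\<rho> x * Re (F i (complexify x))\<bar> \<le> R * B" unfolding abs_mult by (intro mult_mono) auto
      then show ?thesis by simp
    qed (simp add: z)
    then show ?thesis by blast
  qed
  {
    case 0
    have "continuous_on UNIV (\<lambda>x. \<rho> x * Re (F i (complexify x)))" if i: "i \<in> I" for i
    proof -
      have op: "open (complexify -` S)"
        using 0(6) bounded_linear_complexify by (intro open_vimage) (auto intro: linear_continuous_on)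
      have c1: "continuous_on (complexify -` S) (\<lambda>x. \<rho> x * Re (F i (complexify x)))"
        by (intro continuous_on_mult continuous_on_Re continuous_on_subset[OF UC_continuous[OF 0(1) i] subset_UNIV]
          continuous_on_compose2[OF mvh_continuous_on[OF 0(7)[OF i]]]
          linear_continuous_on bounded_linear_complexify) auto
      have c2: "continuous_on (- T) (\<lambda>x. \<rho> x * Re (F i (complexify x)))"
        by (rule continuous_on_eq[of _ "\<lambda>_. 0"]) (auto simp: 0(3))
      have "UNIV = complexify -` S \<union> - T" using 0(4,5) by force
      then show ?thesis using continuous_on_open_Un[OF op _ c1 c2] 0(2) by (metis open_Compl)
    qed
    then show ?case using b[where \<rho> = \<rho> and F = F and S = S and \<delta> = \<delta> and B = B, OF 0(1,3,4,5,8)] by simp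
  next
    case (Suc k)
    have cx: "complexify x \<in> S" if "x \<in> T" for x using Suc.prems(4) Suc.prems(5)[OF that] by force
    define Dr where "Dr x h = (\<Sum>l\<in>UNIV. h $ l * pd l \<rho> x)" for x h :: "real ^ 4"
    have dr: "(\<rho> has_derivative Dr x) (at x)" if "i \<in> I" for x i unfolding Dr_def using UC_deriv[OF Suc.prems(1) that] .
    have pd0: "pd j \<rho> x = 0" if "x \<notin> T" for x j
    proof -
      have "(\<rho> has_derivative (\<lambda>h. 0)) (at x)"
        by (rule has_derivative_transform_within_open[of "\<lambda>_. 0" _ _ _ "- T"]) (use that Suc.prems(2,3) in auto)
      then show ?thesis by (simp add: pd_eq)
    qed
    have d: "((\<lambda>x. \<rho> x * Re (F i (complexify x))) has_derivative
       (\<lambda>h. \<rho> x * Re (fd (F i) (complexify x) (complexify h)) + Dr x h * Re (F i (complexify x)))) (at x)"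
      if i: "i \<in> I" for i x
    proof (cases "x \<in> T")
      case True
      have "((\<lambda>x. F i (complexify x)) has_derivative (\<lambda>h. fd (F i) (complexify x) (complexify h))) (at x)"
        by (rule has_derivative_compose[OF bounded_linear_imp_has_derivative[OF bounded_linear_complexify] mvh_D(1)[OF Suc.prems(7)[OF i] cx[OF True]]])
      from has_derivative_mult[OF dr[OF i] has_derivative_Re[OF this]] show ?thesis .
    next
      case False
      have "((\<lambda>x. \<rho> x * Re (F i (complexify x))) has_derivative (\<lambda>h. 0)) (at x)"
        by (rule has_derivative_transform_within_open[of "\<lambda>_. 0" _ _ _ "- T"]) (use False Suc.prems(2,3) in auto)
      then show ?thesis using False by (simp add: Suc.prems(3) Dr_def pd0[OF False])
    qed
    \<comment> \<open>Half of the margin \<delta> pays for the Cauchy estimate of the derivative; in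
      the rest a margin \<open>\<delta> / 4\<close> remains for the induction.\<close>
    define S' where "S' = (\<Union>x\<in>T. ball (complexify x) (\<delta> / 2))"
    have S': "open S'" "S' \<subseteq> S" unfolding S'_def using Suc.prems(4,5) by (auto simp: subset_iff)
    have cb: "norm (fd (F i) z (axis j 1)) \<le> B / (\<delta> / 2) * norm (axis j 1 :: complex ^ 4)" if zi: "z \<in> S'" "i \<in> I" for i z j
    proof -
      obtain x where x: "x \<in> T" "dist (complexify x) z < \<delta> / 2" using zi(1) by (auto simp: S'_def)
      have "z + w \<in> S" if "norm w \<le> \<delta> / 2" for w
      proof -
        have "dist (complexify x) (z + w) \<le> dist (complexify x) z + norm w"
          by (metis dist_triangle dist_norm norm_minus_commute add_diff_cancel_left')
        then show ?thesis using Suc.prems(5)[OF x(1)] x(2) that by auto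
      qed
      then show ?thesis
        using cauchy_bound[OF Suc.prems(7)[OF zi(2)], of "\<delta> / 2" z B "axis j 1"] Suc.prems(4,8) zi by simp
    qed
    have u1: "UC k I (\<lambda>i x. pd j \<rho> x * Re (F i (complexify x)))" for j
      by (rule Suc.IH[OF UC_pd[OF Suc.prems(1)] Suc.prems(2) _ Suc.prems(4-8)])
        (use pd0 in auto)
    have u2: "UC k I (\<lambda>i x. \<rho> x * Re (fd (F i) (complexify x) (axis j 1)))" for j
    proof (rule Suc.IH[OF UC_SucD[OF Suc.prems(1)] Suc.prems(2,3)])
      show "\<delta> / 4 > 0" using Suc.prems(4) by simp
      show "cball (complexify x) (\<delta> / 4) \<subseteq> S'" if "x \<in> T" for x unfolding S'_def using that Suc.prems(4) by (force simp: subset_iff)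
      show "mv_holomorphic_on (\<lambda>z. fd (F i) z (axis j 1)) S'" if "i \<in> I" for i
        using fd_mvh[OF Suc.prems(7)[OF that] Suc.prems(6)] mvh_subset S'(2) by blast
    qed (use S' cb in auto)
    have ax: "complexify (axis j 1) = axis j 1" for j :: 4 by (simp add: vec_eq_iff axis_def)
    show ?case
    proof (rule UC_SucI[OF b[where \<rho> = \<rho> and F = F and S = S and \<delta> = \<delta> and B = B, OF UC_0[OF Suc.prems(1)] Suc.prems(3,4,5,8)] d])
      have "Dr x (axis j 1) = pd j \<rho> x" for x j
        by (simp add: Dr_def axis_def if_distrib[of "\<lambda>a. a * _"] cong: if_cong)
      then show "UC k I (\<lambda>i x. \<rho> x * Re (fd (F i) (complexify x) (complexify (axis j 1))) + Dr x (axis j 1) * Re (F i (complexify x)))" for j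
        using UC_add[OF u2 u1] by (simp add: ax)
    qed
  }
qed

section \<open>Symmetry of second derivatives\<close>

lemma line_pd:
  assumes "f differentiable (at (y + s *\<^sub>R axis i 1))"
  shows "((\<lambda>s. f (y + s *\<^sub>R axis i 1)) has_real_derivative pd i f (y + s *\<^sub>R axis i 1)) (at s)"
proof -
  have "((\<lambda>s. y + s *\<^sub>R axis i 1) has_derivative (\<lambda>h. h *\<^sub>R axis i 1)) (at s)"
    by (auto intro!: derivative_eq_intros)
  from has_derivative_compose[OF this has_derivative_pd[OF assms]]
  show ?thesis unfolding has_field_derivative_def
    by (simp add: axis_def if_distrib[of "\<lambda>a. _ * a"] if_distrib[of "\<lambda>a. a * _"] mult_commute_abs cong: if_cong)
qed

lemma second_difference:
  assumes f: "UC (Suc (Suc 0)) {()} (\<lambda>_. f)" and h: "h > 0"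
  shows "\<exists>a b. 0 < a \<and> a < h \<and> 0 < b \<and> b < h \<and>
    f (x + h *\<^sub>R axis i 1 + h *\<^sub>R axis j 1) - f (x + h *\<^sub>R axis i 1) - f (x + h *\<^sub>R axis j 1) + f x
      = h * (h * pd j (pd i f) (x + a *\<^sub>R axis i 1 + b *\<^sub>R axis j 1))"
proof -
  have d: "f differentiable (at y)" "pd i f differentiable (at y)" for y using f by (auto simp: UC_Suc)
  let ?\<phi> = "\<lambda>s. f ((x + h *\<^sub>R axis j 1) + s *\<^sub>R axis i 1) - f (x + s *\<^sub>R axis i 1)"
  have "\<exists>a>0. a < h \<and> ?\<phi> h - ?\<phi> 0 = (h - 0) * (pd i f ((x + h *\<^sub>R axis j 1) + a *\<^sub>R axis i 1) - pd i f (x + a *\<^sub>R axis i 1))"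
    by (rule MVT2[OF h]) (intro DERIV_diff line_pd d)
  then obtain a where a: "0 < a" "a < h"
    "?\<phi> h - ?\<phi> 0 = h * (pd i f ((x + h *\<^sub>R axis j 1) + a *\<^sub>R axis i 1) - pd i f (x + a *\<^sub>R axis i 1))" by auto
  let ?\<psi> = "\<lambda>t. pd i f ((x + a *\<^sub>R axis i 1) + t *\<^sub>R axis j 1)"
  have "\<exists>b>0. b < h \<and> ?\<psi> h - ?\<psi> 0 = (h - 0) * pd j (pd i f) ((x + a *\<^sub>R axis i 1) + b *\<^sub>R axis j 1)"
    by (rule MVT2[OF h]) (intro line_pd d)
  then obtain b where b: "0 < b" "b < h" "?\<psi> h - ?\<psi> 0 = h * pd j (pd i f) ((x + a *\<^sub>R axis i 1) + b *\<^sub>R axis j 1)" by auto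
  have "?\<phi> h - ?\<phi> 0 = h * (?\<psi> h - ?\<psi> 0)" unfolding a(3) by (simp add: add_ac)
  then have "?\<phi> h - ?\<phi> 0 = h * (h * pd j (pd i f) (x + a *\<^sub>R axis i 1 + b *\<^sub>R axis j 1))" unfolding b(3) .
  then show ?thesis using a b by (intro exI[of _ a] exI[of _ b]) (simp add: add_ac)
qed

text \<open>The second difference is symmetric in the two directions, and by
  \<open>second_difference\<close> it equals the squared step times either mixed derivative at a
  point close to \<open>x\<close>. Continuity at \<open>x\<close> excludes different values.\<close>

lemma mixed_partials:
  assumes f: "UC (Suc (Suc 0)) {()} (\<lambda>_. f)"
  shows "pd i (pd j f) x = pd j (pd i f) x"
proof (rule ccontr)
  define A where "A = pd i (pd j f)"
  define B where "B = pd j (pd i f)"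
  assume "pd i (pd j f) x \<noteq> pd j (pd i f) x"
  define e where "e = \<bar>A x - B x\<bar> / 2"
  have e: "e > 0" using \<open>pd i (pd j f) x \<noteq> pd j (pd i f) x\<close> by (simp add: e_def A_def B_def)
  have "continuous_on UNIV A" "continuous_on UNIV B"
    using UC_continuous[OF UC_pd[OF UC_pd[OF f]], of "()"] unfolding A_def B_def by auto
  then have "isCont A x" "isCont B x" by (auto simp: continuous_on_eq_continuous_at)
  then obtain d1 d2 where d: "d1 > 0" "\<And>y. dist y x < d1 \<Longrightarrow> dist (A y) (A x) < e"
     "d2 > 0" "\<And>y. dist y x < d2 \<Longrightarrow> dist (B y) (B x) < e"
    using e unfolding continuous_at_eps_delta by metis
  define h where "h = min d1 d2 / 4"
  have h: "h > 0" "2 * h < d1" "2 * h < d2" using d by (auto simp: h_def)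
  have cl: "dist (x + a *\<^sub>R axis k 1 + b *\<^sub>R axis l 1) x < 2 * h" if "0 < a" "a < h" "0 < b" "b < h" for a b and k l :: 4
  proof -
    have "norm (a *\<^sub>R axis k 1 + b *\<^sub>R axis l (1::real)) \<le> a + b"
      using norm_triangle_ineq[of "a *\<^sub>R axis k (1::real)" "b *\<^sub>R axis l 1"] that by simp
    then show ?thesis using that by (simp add: dist_norm add.assoc)
  qed
  obtain a b where ab: "0 < a" "a < h" "0 < b" "b < h"
    "f (x + h *\<^sub>R axis i 1 + h *\<^sub>R axis j 1) - f (x + h *\<^sub>R axis i 1) - f (x + h *\<^sub>R axis j 1) + f x
      = h * (h * B (x + a *\<^sub>R axis i 1 + b *\<^sub>R axis j 1))"
    using second_difference[OF f h(1), of x i j] unfolding B_def by blast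
  obtain a' b' where ab': "0 < a'" "a' < h" "0 < b'" "b' < h"
    "f (x + h *\<^sub>R axis j 1 + h *\<^sub>R axis i 1) - f (x + h *\<^sub>R axis j 1) - f (x + h *\<^sub>R axis i 1) + f x
      = h * (h * A (x + a' *\<^sub>R axis j 1 + b' *\<^sub>R axis i 1))"
    using second_difference[OF f h(1), of x j i] unfolding A_def by blast
  have "h * (h * B (x + a *\<^sub>R axis i 1 + b *\<^sub>R axis j 1)) = h * (h * A (x + a' *\<^sub>R axis j 1 + b' *\<^sub>R axis i 1))"
    unfolding ab(5)[symmetric] ab'(5)[symmetric] by (simp add: add_ac)
  then have "B (x + a *\<^sub>R axis i 1 + b *\<^sub>R axis j 1) = A (x + a' *\<^sub>R axis j 1 + b' *\<^sub>R axis i 1)" using h by simp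
  moreover have "dist (B (x + a *\<^sub>R axis i 1 + b *\<^sub>R axis j 1)) (B x) < e" "dist (A (x + a' *\<^sub>R axis j 1 + b' *\<^sub>R axis i 1)) (A x) < e"
    using d(2,4) cl[OF ab(1-4), of i j] cl[OF ab'(1-4), of j i] h by auto
  ultimately show False unfolding e_def dist_real_def by argo
qed

section \<open>Perturbations of the identity and flows\<close>

text \<open>Banach's fixed point theorem for the map from \<open>x\<close> to
  \<open>y + N x\<close>; thus \<open>g\<close> inverts the identity minus \<open>N\<close>.\<close>

lemma near_identity_inverse:
  fixes N :: "'b::{real_normed_vector,complete_space} \<Rightarrow> 'b"
  assumes lip: "\<And>x y. norm (N x - N y) \<le> norm (x - y) / 2"
  obtains g where "\<And>y. g y = y + N (g y)" "\<And>x y. x = y + N x \<Longrightarrow> x = g y"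
    "\<And>y y'. norm (g y - g y') \<le> 2 * norm (y - y')"
proof -
  have "\<exists>!x. y + N x = x" for y
    by (rule banach_fix_type[of "1/2"]) (use lip in \<open>auto simp: dist_norm\<close>)
  then obtain g where g: "\<And>y. y + N (g y) = g y" "\<And>x y. y + N x = x \<Longrightarrow> x = g y" by metis
  have "norm (g y - g y') \<le> 2 * norm (y - y')" for y y'
  proof -
    have "norm (g y - g y') = norm ((y - y') + (N (g y) - N (g y')))"
      using g(1)[of y] g(1)[of y'] by (metis add_diff_add)
    also have "\<dots> \<le> norm (y - y') + norm (g y - g y') / 2"
      using norm_triangle_ineq[of "y - y'" "N (g y) - N (g y')"] lip[of "g y" "g y'"] by linarith
    finally show ?thesis by linarith
  qed
  show ?thesis
  proof (rule that[of g])
    show "g y = y + N (g y)" for y by (rule g(1)[symmetric])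
    show "x = g y" if "x = y + N x" for x y by (rule g(2)) (rule that[symmetric])
  qed fact
qed

text \<open>The derivative is the inverse of the identity minus \<open>N'\<close>, obtained by
  applying \<open>near_identity_inverse\<close> to the linear map \<open>N'\<close> itself.\<close>

lemma near_identity_inverse_deriv:
  fixes N g :: "'b::{real_normed_vector,complete_space} \<Rightarrow> 'b"
  assumes g: "\<And>y. g y = y + N (g y)" "\<And>y y'. norm (g y - g y') \<le> 2 * norm (y - y')"
    and d: "(N has_derivative N') (at (g y))" and b: "\<And>h. norm (N' h) \<le> norm h / 2"
  shows "\<exists>D. (g has_derivative D) (at y) \<and> (\<forall>h. D h = h + N' (D h)) \<and> (\<forall>h. norm (D h) \<le> 2 * norm h)"
proof -
  have lin: "linear N'" using d has_derivative_linear by blast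
  have "norm (N' x - N' y) \<le> norm (x - y) / 2" for x y using b[of "x - y"] linear_diff[OF lin] by simp
  from near_identity_inverse[of N', OF this] obtain D where D: "\<And>h. D h = h + N' (D h)"
    "\<And>x h. x = h + N' x \<Longrightarrow> x = D h" "\<And>y y'. norm (D y - D y') \<le> 2 * norm (y - y')" by blast
  have D0: "D 0 = 0" using D(2)[of 0 0] linear_0[OF lin] by simp
  have bl: "bounded_linear D"
  proof (rule bounded_linear_intro[where K = 2])
    fix x y r
    have "D x + D y = (x + N' (D x)) + (y + N' (D y))" by (simp only: D(1)[symmetric])
    also have "\<dots> = (x + y) + N' (D x + D y)" by (simp add: linear_add[OF lin])
    finally have "D x + D y = (x + y) + N' (D x + D y)" .
    then show "D (x + y) = D x + D y" using D(2) by metis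
    have "r *\<^sub>R D x = r *\<^sub>R (x + N' (D x))" by (simp only: D(1)[symmetric])
    also have "\<dots> = r *\<^sub>R x + N' (r *\<^sub>R D x)" by (simp add: linear_scale[OF lin] scaleR_add_right)
    finally have "r *\<^sub>R D x = r *\<^sub>R x + N' (r *\<^sub>R D x)" .
    then show "D (r *\<^sub>R x) = r *\<^sub>R D x" using D(2) by metis
    show "norm (D x) \<le> norm x * 2" using D(3)[of x 0] by (simp add: D0)
  qed
  have "(g has_derivative D) (at y)"
  proof (rule has_derivative_inverse_basic[where f = "\<lambda>x. x - N x" and f' = "\<lambda>h. h - N' h" and T = UNIV])
    show "((\<lambda>x. x - N x) has_derivative (\<lambda>h. h - N' h)) (at (g y))"
      by (intro has_derivative_diff has_derivative_ident d)
    show "D \<circ> (\<lambda>h. h - N' h) = id"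
    proof
      fix h have "h = (h - N' h) + N' h" by simp
      then show "(D \<circ> (\<lambda>h. h - N' h)) h = id h" using D(2) by (metis comp_apply id_apply)
    qed
    show "continuous (at y) g" unfolding continuous_at_eps_delta dist_norm
    proof (intro allI impI)
      fix e :: real assume "e > 0"
      then show "\<exists>da>0. \<forall>x'. norm (x' - y) < da \<longrightarrow> norm (g x' - g y) < e"
        by (intro exI[of _ "e / 2"]) (use g(2) in \<open>auto, smt (verit)\<close>)
    qed
    show "g z - N (g z) = z" for z using g(1)[of z] by (metis add_diff_cancel_right')
  qed (use bl in auto)
  moreover have "norm (D h) \<le> 2 * norm h" for h using D(3)[of h 0] by (simp add: D0)
  ultimately show ?thesis using D(1) by blast
qed

section \<open>Differentiable dependence on initial values by Picard's method\<close>

lemma has_derivative_quadratic: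
  fixes f :: "'a::real_normed_vector \<Rightarrow> 'b::real_normed_vector"
  assumes D: "bounded_linear D" and q: "\<And>h. norm (f (x + h) - f x - D h) \<le> C * (norm h)\<^sup>2"
  shows "(f has_derivative D) (at x)"
  unfolding has_derivative_at
proof (intro conjI D)
  show "(\<lambda>h. norm (f (x + h) - f x - D h) / norm h) \<midarrow>0\<rightarrow> 0"
  proof (rule Lim_null_comparison[where g = "\<lambda>h. C * norm h"])
    show "\<forall>\<^sub>F h in at 0. norm (norm (f (x + h) - f x - D h) / norm h) \<le> C * norm h"
    proof (rule eventually_at_topological[THEN iffD2], intro exI[of _ UNIV] conjI ballI impI)
      fix h :: 'a assume "h \<noteq> 0"
      then show "norm (norm (f (x + h) - f x - D h) / norm h) \<le> C * norm h"
        using q[of h] by (simp add: divide_le_eq power2_eq_square mult_ac)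
    qed auto
    have "((\<lambda>h::'a. C * norm h) \<longlongrightarrow> C * norm (0::'a)) (at 0)"
      by (intro tendsto_mult tendsto_const tendsto_norm tendsto_ident_at)
    then show "(\<lambda>h::'a. C * norm h) \<midarrow>0\<rightarrow> 0" by simp
  qed
qed

lemma quadratic_remainder:
  fixes G :: "'a::real_normed_vector \<Rightarrow> 'b::real_normed_vector"
  assumes d: "\<And>x. (G has_derivative G' x) (at x)"
    and l: "\<And>x y h. norm (G' x h - G' y h) \<le> M * norm (x - y) * norm h" and M: "M \<ge> 0"
  shows "norm (G (x + h) - G x - G' x h) \<le> M * (norm h)\<^sup>2"
proof -
  have "norm ((\<lambda>y. G y - G' x y) (x + h) - (\<lambda>y. G y - G' x y) x) \<le> (M * norm h) * norm ((x + h) - x)"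
  proof (rule differentiable_bound[where S = "closed_segment x (x + h)" and f' = "\<lambda>y k. G' y k - G' x k"])
    fix y assume y: "y \<in> closed_segment x (x + h)"
    show "((\<lambda>y. G y - G' x y) has_derivative (\<lambda>k. G' y k - G' x k)) (at y within closed_segment x (x + h))"
      by (intro has_derivative_diff has_derivative_at_withinI[OF d] bounded_linear.has_derivative[OF has_derivative_bounded_linear[OF d]] has_derivative_ident)
    have "norm (y - x) \<le> norm h" using segment_bound(1)[OF y] by simp
    then show "onorm (\<lambda>k. G' y k - G' x k) \<le> M * norm h"
      by (intro onorm_bound order_trans[OF l] mult_right_mono mult_left_mono) (use M in auto)
  qed auto
  moreover have "G' x (x + h) - G' x x = G' x h"
    using linear_add[OF has_derivative_linear[OF d]] by simp
  ultimately show ?thesis by (simp add: algebra_simps power2_eq_square)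
qed

text \<open>Freezing time outside \<open>[0, 8]\<close> turns solution curves into bounded
  continuous functions on the whole line, a Banach space. The length 8 exceeds the period
  \<open>2 * pi\<close>.\<close>

abbreviation clip :: "real \<Rightarrow> real" where "clip t \<equiv> max 0 (min 8 t)"

text \<open>The derivative bound 1/16 times the length 8 gives the contraction constant 1/2 on the
  whole interval at once.\<close>

locale picard =
  fixes G :: "real \<Rightarrow> real ^ 4 \<Rightarrow> real ^ 4" and G' :: "real \<Rightarrow> real ^ 4 \<Rightarrow> real ^ 4 \<Rightarrow> real ^ 4" and b M :: real
  assumes G_cont: "\<And>y. continuous_on UNIV y \<Longrightarrow> continuous_on UNIV (\<lambda>s. G s (y s))"
    and G'_cont: "\<And>y h. continuous_on UNIV y \<Longrightarrow> continuous_on UNIV h \<Longrightarrow> continuous_on UNIV (\<lambda>s. G' s (y s) (h s))"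
    and G_deriv: "\<And>s x. (G s has_derivative G' s x) (at x)"
    and G_bound: "\<And>s x. norm (G s x) \<le> b" and G'_bound: "\<And>s x h. norm (G' s x h) \<le> norm h / 16"
    and G'_lip: "\<And>s x y h. norm (G' s x h - G' s y h) \<le> M * norm (x - y) * norm h" and M: "M \<ge> 0"
begin

lemma integral_bcontfun:
  fixes f :: "real \<Rightarrow> real ^ 4"
  assumes f: "continuous_on UNIV f" and B: "\<And>s. norm (f s) \<le> B"
  shows "(\<lambda>t. integral {0..clip t} f) \<in> bcontfun" "norm (integral {0..clip t} f) \<le> 8 * B"
proof -
  have B0: "B \<ge> 0" using order_trans[OF norm_ge_zero B] .
  have c: "continuous_on {0..8} (\<lambda>t. integral {0..t} f)"
    by (intro indefinite_integral_continuous_1 integrable_continuous_interval continuous_on_subset[OF f]) auto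
  have cc: "continuous_on UNIV (\<lambda>t. integral {0..clip t} f)"
    by (rule continuous_on_compose2[OF c]) (auto intro!: continuous_intros)
  show bd: "norm (integral {0..clip t} f) \<le> 8 * B" for t
  proof -
    have "norm (integral {0..clip t} f) \<le> B * (clip t - 0)"
      by (rule integral_bound) (auto intro: continuous_on_subset[OF f] B)
    also have "\<dots> \<le> B * 8" using B0 by (intro mult_left_mono) auto
    finally show ?thesis by simp
  qed
  show "(\<lambda>t. integral {0..clip t} f) \<in> bcontfun"
    by (rule bcontfun_normI[OF cc bd])
qed

text \<open>Picard's integral operator without the initial value. The solution starting at
  \<open>z\<close> is \<open>g (const_bcontfun z)\<close> with \<open>g\<close> from
  \<open>near_identity_inverse\<close>, so differentiability in \<open>z\<close> is
  differentiability of \<open>g\<close> between Banach spaces.\<close>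

definition NB :: "(real \<Rightarrow>\<^sub>C (real ^ 4)) \<Rightarrow> (real \<Rightarrow>\<^sub>C (real ^ 4))" where
  "NB y = Bcontfun (\<lambda>t. integral {0..clip t} (\<lambda>s. G s (y s)))"

definition DNB :: "(real \<Rightarrow>\<^sub>C (real ^ 4)) \<Rightarrow> (real \<Rightarrow>\<^sub>C (real ^ 4)) \<Rightarrow> (real \<Rightarrow>\<^sub>C (real ^ 4))" where
  "DNB y h = Bcontfun (\<lambda>t. integral {0..clip t} (\<lambda>s. G' s (y s) (h s)))"

lemma cont_apply: "continuous_on UNIV (apply_bcontfun y)"
  using apply_bcontfun[of y] by (simp add: bcontfun_def)

lemma NB_apply: "NB y t = integral {0..clip t} (\<lambda>s. G s (y s))"
  unfolding NB_def by (simp add: Bcontfun_inverse[OF integral_bcontfun(1)[OF G_cont[OF cont_apply] G_bound]])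

lemma G'_bound': "norm (G' s (y s) (h s)) \<le> norm h / 16" for h :: "real \<Rightarrow>\<^sub>C (real ^ 4)"
  using G'_bound[of s "y s" "h s"] norm_bounded[of h s] by linarith

lemma DNB_apply: "DNB y h t = integral {0..clip t} (\<lambda>s. G' s (y s) (h s))"
  unfolding DNB_def
  by (simp add: Bcontfun_inverse[OF integral_bcontfun(1)[OF G'_cont[OF cont_apply cont_apply] G'_bound'[of _ y h]]])

lemma G_lip: "norm (G s x - G s y) \<le> norm (x - y) / 16"
proof -
  have "norm (G s x - G s y) \<le> (1/16) * norm (x - y)"
  proof (rule differentiable_bound[where S = UNIV and f' = "G' s"])
    show "onorm (G' s z) \<le> 1 / 16" for z by (rule onorm_bound) (use G'_bound in auto)
  qed (auto intro: G_deriv)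
  then show ?thesis by simp
qed

lemma int_G: "(\<lambda>s. G s (apply_bcontfun y s)) integrable_on {0..t}"
  and int_G': "(\<lambda>s. G' s (apply_bcontfun y s) (apply_bcontfun h s)) integrable_on {0..t}"
  by (rule integrable_continuous_interval,
      rule continuous_on_subset[OF G_cont[OF cont_apply] subset_UNIV] continuous_on_subset[OF G'_cont[OF cont_apply cont_apply] subset_UNIV])+

lemma NB_lip: "norm (NB x - NB y) \<le> norm (x - y) / 2"
proof (rule norm_bound)
  fix t
  have "(NB x - NB y) t = integral {0..clip t} (\<lambda>s. G s (x s) - G s (y s))"
    by (simp add: NB_apply integral_diff[OF int_G int_G])
  also have "norm \<dots> \<le> 8 * (norm (x - y) / 16)"
  proof (rule integral_bcontfun(2))
    show "continuous_on UNIV (\<lambda>s. G s (x s) - G s (y s))" by (intro continuous_intros G_cont cont_apply)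
    show "norm (G s (x s) - G s (y s)) \<le> norm (x - y) / 16" for s
      using G_lip[of s "x s" "y s"] norm_bounded[of "x - y" s] by simp
  qed
  finally show "norm ((NB x - NB y) t) \<le> norm (x - y) / 2" by simp
qed

lemma DNB_bound: "norm (DNB y h) \<le> norm h / 2"
proof (rule norm_bound)
  fix t
  have "norm (DNB y h t) \<le> 8 * (norm h / 16)" unfolding DNB_apply
    by (rule integral_bcontfun(2)[OF G'_cont[OF cont_apply cont_apply] G'_bound'[of _ y h]])
  then show "norm (DNB y h t) \<le> norm h / 2" by simp
qed

lemma DNB_linear: "DNB y (h + k) = DNB y h + DNB y k" "DNB y (c *\<^sub>R h) = c *\<^sub>R DNB y h" "DNB y (h - k) = DNB y h - DNB y k"
proof -
  have l: "linear (G' s x)" for s x using G_deriv has_derivative_linear by blast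
  show "DNB y (h + k) = DNB y h + DNB y k"
    by (rule bcontfun_eqI) (simp add: DNB_apply linear_add[OF l] integral_add[OF int_G' int_G'])
  show "DNB y (h - k) = DNB y h - DNB y k"
    by (rule bcontfun_eqI) (simp add: DNB_apply linear_diff[OF l] integral_diff[OF int_G' int_G'])
  show "DNB y (c *\<^sub>R h) = c *\<^sub>R DNB y h"
    by (rule bcontfun_eqI) (simp add: DNB_apply linear_scale[OF l])
qed

lemma NB_deriv: "(NB has_derivative DNB y) (at y)"
proof (rule has_derivative_quadratic[where C = "8 * M"])
  show "bounded_linear (DNB y)"
  proof (rule bounded_linear_intro[where K = "1/2"])
    show "norm (DNB y h) \<le> norm h * (1/2)" for h using DNB_bound[of y h] by simp
  qed (simp_all add: DNB_linear)
  fix h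
  show "norm (NB (y + h) - NB y - DNB y h) \<le> 8 * M * (norm h)\<^sup>2"
  proof (rule norm_bound)
    fix t
    have i: "(\<lambda>s. G s (apply_bcontfun y s + apply_bcontfun h s)) integrable_on {0..t}" for t
      using int_G[of "y + h"] by simp
    have "(NB (y + h) - NB y - DNB y h) t = integral {0..clip t} (\<lambda>s. G s (y s + h s) - G s (y s) - G' s (y s) (h s))"
      by (simp add: NB_apply DNB_apply integral_diff[OF i int_G] integral_diff[OF integrable_diff[OF i int_G] int_G'])
    also have "norm \<dots> \<le> 8 * (M * (norm h)\<^sup>2)"
    proof (rule integral_bcontfun(2))
      show "continuous_on UNIV (\<lambda>s. G s (y s + h s) - G s (y s) - G' s (y s) (h s))"
        by (intro continuous_intros G_cont G'_cont cont_apply)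
      fix s
      have "norm (G s (y s + h s) - G s (y s) - G' s (y s) (h s)) \<le> M * (norm (h s))\<^sup>2"
        by (rule quadratic_remainder[OF G_deriv G'_lip M])
      also have "\<dots> \<le> M * (norm h)\<^sup>2" using M norm_bounded[of h s] by (intro mult_left_mono power_mono) auto
      finally show "norm (G s (y s + h s) - G s (y s) - G' s (y s) (h s)) \<le> M * (norm h)\<^sup>2" .
    qed
    finally show "norm ((NB (y + h) - NB y - DNB y h) t) \<le> 8 * M * (norm h)\<^sup>2" by simp
  qed
qed

lemma DNB_lip: "norm (DNB x h - DNB y h) \<le> 8 * M * norm (x - y) * norm h"
proof (rule norm_bound)
  fix t
  have "(DNB x h - DNB y h) t = integral {0..clip t} (\<lambda>s. G' s (x s) (h s) - G' s (y s) (h s))"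
    by (simp add: DNB_apply integral_diff[OF int_G' int_G'])
  also have "norm \<dots> \<le> 8 * (M * norm (x - y) * norm h)"
  proof (rule integral_bcontfun(2))
    show "continuous_on UNIV (\<lambda>s. G' s (x s) (h s) - G' s (y s) (h s))" by (intro continuous_intros G'_cont cont_apply)
    fix s
    have "norm (G' s (x s) (h s) - G' s (y s) (h s)) \<le> M * norm (x s - y s) * norm (h s)" by (rule G'_lip)
    also have "\<dots> \<le> M * norm (x - y) * norm h"
      using M norm_bounded[of h s] norm_bounded[of "x - y" s] by (intro mult_mono) auto
    finally show "norm (G' s (x s) (h s) - G' s (y s) (h s)) \<le> M * norm (x - y) * norm h" .
  qed
  finally show "norm ((DNB x h - DNB y h) t) \<le> 8 * M * norm (x - y) * norm h" by simp
qed

lemma bounded_linear_const_bcontfun: "bounded_linear (const_bcontfun :: real ^ 4 \<Rightarrow> (real \<Rightarrow>\<^sub>C (real ^ 4)))"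
  by (rule bounded_linear_intro[where K = 1]) (auto intro!: bcontfun_eqI norm_bound)

lemma bounded_linear_eval: "bounded_linear (\<lambda>y :: real \<Rightarrow>\<^sub>C (real ^ 4). y t)"
  by (rule bounded_linear_intro[where K = 1]) (auto intro: norm_bounded)

lemma indef_deriv:
  fixes f y :: "real \<Rightarrow> real ^ 4"
  assumes "continuous_on UNIV f" "\<And>t. y t = z + integral {0..clip t} f" "t \<in> {0..8}"
  shows "(y has_vector_derivative f t) (at t within {0..8})"
proof -
  have "((\<lambda>t. integral {0..t} f) has_vector_derivative f t) (at t within {0..8})"
    by (rule integral_has_vector_derivative) (use assms(3) in \<open>auto intro: continuous_on_subset[OF assms(1)]\<close>)
  then have "((\<lambda>t. z + integral {0..t} f) has_vector_derivative 0 + f t) (at t within {0..8})"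
    by (intro has_vector_derivative_add has_vector_derivative_const)
  then have "((\<lambda>t. z + integral {0..t} f) has_vector_derivative f t) (at t within {0..8})" by simp
  then show ?thesis
    by (rule has_vector_derivative_transform[rotated 2]) (use assms in auto)
qed

theorem solution:
  obtains Y D where "\<And>z. Y z 0 = z" "\<And>z t. t \<in> {0..8} \<Longrightarrow> (Y z has_vector_derivative G t (Y z t)) (at t within {0..8})"
    "\<And>z t. norm (Y z t - z) \<le> 8 * b" "\<And>z t. ((\<lambda>z. Y z t) has_derivative (\<lambda>h. D z h t)) (at z)"
    "\<And>z h. D z h 0 = h" "\<And>z h t. t \<in> {0..8} \<Longrightarrow> (D z h has_vector_derivative G' t (Y z t) (D z h t)) (at t within {0..8})"
    "\<And>h t. continuous_on UNIV (\<lambda>z. D z h t)"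
proof -
  obtain g where g: "\<And>y. g y = y + NB (g y)" "\<And>y y'. norm (g y - g y') \<le> 2 * norm (y - y')"
    using near_identity_inverse[of NB, OF NB_lip] by metis
  have "\<exists>D. (g has_derivative D) (at y) \<and> (\<forall>h. D h = h + DNB (g y) (D h)) \<and> (\<forall>h. norm (D h) \<le> 2 * norm h)" for y
    by (rule near_identity_inverse_deriv[OF g NB_deriv DNB_bound])
  then obtain E where E: "\<And>y. (g has_derivative E y) (at y)" "\<And>y h. E y h = h + DNB (g y) (E y h)"
     "\<And>y h. norm (E y h) \<le> 2 * norm h" by metis
  define Y where "Y z = apply_bcontfun (g (const_bcontfun z))" for z
  define D where "D z h = apply_bcontfun (E (const_bcontfun z) (const_bcontfun h))" for z h
  have Y: "Y z t = z + integral {0..clip t} (\<lambda>s. G s (Y z s))" for z t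
    using arg_cong[OF g(1)[of "const_bcontfun z"], of "\<lambda>y. y t"] by (simp add: Y_def NB_apply)
  have D: "D z h t = h + integral {0..clip t} (\<lambda>s. G' s (Y z s) (D z h s))" for z h t
    using arg_cong[OF E(2)[of "const_bcontfun z" "const_bcontfun h"], of "\<lambda>y. y t"] by (simp add: D_def Y_def DNB_apply)
  have cY: "continuous_on UNIV (Y z)" for z unfolding Y_def by (rule cont_apply)
  have cD: "continuous_on UNIV (D z h)" for z h unfolding D_def by (rule cont_apply)
  show ?thesis
  proof (rule that[of Y D])
    show "Y z 0 = z" for z using Y[of z 0] by simp
    show "D z h 0 = h" for z h using D[of z h 0] by simp
    show "(Y z has_vector_derivative G t (Y z t)) (at t within {0..8})" if "t \<in> {0..8}" for z t
      by (rule indef_deriv[OF G_cont[OF cY] Y that])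
    show "(D z h has_vector_derivative G' t (Y z t) (D z h t)) (at t within {0..8})" if "t \<in> {0..8}" for z h t
      by (rule indef_deriv[OF G'_cont[OF cY cD] D that])
    show "norm (Y z t - z) \<le> 8 * b" for z t
      unfolding Y[of z t] using integral_bcontfun(2)[OF G_cont[OF cY] G_bound] by simp
    show "((\<lambda>z. Y z t) has_derivative (\<lambda>h. D z h t)) (at z)" for z t
      unfolding Y_def D_def
      by (rule bounded_linear.has_derivative[OF bounded_linear_eval
          has_derivative_compose[OF bounded_linear_imp_has_derivative[OF bounded_linear_const_bcontfun] E(1)]])
    fix h :: "real ^ 4" and t :: real
    have nc: "norm (const_bcontfun v :: real \<Rightarrow>\<^sub>C (real ^ 4)) \<le> norm v" for v :: "real ^ 4" by (rule norm_bound) simp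
    have lip: "norm (D z h t - D z' h t) \<le> (64 * M * norm h) * norm (z - z')" for z z'
    proof -
      let ?c = "const_bcontfun :: real ^ 4 \<Rightarrow> (real \<Rightarrow>\<^sub>C (real ^ 4))"
      let ?e = "E (?c z) (?c h)" and ?e' = "E (?c z') (?c h)" and ?g = "g (?c z)" and ?g' = "g (?c z')"
      \<comment> \<open>The first term is absorbed by the contraction 1/2; the second is small
        because \<open>DNB\<close> is Lipschitz in its base point.\<close>
      have "?e - ?e' = DNB ?g (?e - ?e') + (DNB ?g ?e' - DNB ?g' ?e')"
      proof -
        have "?e - ?e' = (?c h + DNB ?g ?e) - (?c h + DNB ?g' ?e')" by (simp only: E(2)[symmetric])
        also have "\<dots> = DNB ?g (?e - ?e') + (DNB ?g ?e' - DNB ?g' ?e')" by (simp add: DNB_linear)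
        finally show ?thesis .
      qed
      then have "norm (?e - ?e') \<le> norm (DNB ?g (?e - ?e')) + norm (DNB ?g ?e' - DNB ?g' ?e')"
        by (metis norm_triangle_ineq)
      also have "\<dots> \<le> norm (?e - ?e') / 2 + 8 * M * norm (?g - ?g') * norm ?e'"
        by (intro add_mono DNB_bound DNB_lip)
      finally have "norm (?e - ?e') \<le> 16 * M * norm (?g - ?g') * norm ?e'" by simp
      also have "\<dots> \<le> 16 * M * (2 * norm (z - z')) * (2 * norm h)"
      proof (intro mult_mono)
        have "norm (?g - ?g') \<le> 2 * norm (?c z - ?c z')" by (rule g(2))
        also have "?c z - ?c z' = ?c (z - z')" by (rule bcontfun_eqI) simp
        finally show "norm (?g - ?g') \<le> 2 * norm (z - z')" using nc[of "z - z'"] by linarith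
        show "norm ?e' \<le> 2 * norm h" using E(3)[of "?c z'" "?c h"] nc[of h] by linarith
      qed (use M in auto)
      finally have "norm (?e - ?e') \<le> (64 * M * norm h) * norm (z - z')" by (simp add: mult_ac)
      then show ?thesis using norm_bounded[of "?e - ?e'" t] by (simp add: D_def)
    qed
    show "continuous_on UNIV (\<lambda>z. D z h t)"
      by (rule lipschitz_on_continuous_on[of "64 * M * norm h"])
        (auto simp: lipschitz_on_def dist_norm lip M)
  qed
qed

end

section \<open>Uniqueness of solutions and symplectic maps of class C1\<close>

lemma ode_unique:
  fixes u v :: "real \<Rightarrow> real ^ 4"
  assumes X: "\<And>x y. norm (X x - X y) \<le> L * norm (x - y)"
    and u: "\<And>t. t \<in> {0..T} \<Longrightarrow> (u has_vector_derivative X (u t)) (at t within {0..T})"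
    and v: "\<And>t. t \<in> {0..T} \<Longrightarrow> (v has_vector_derivative X (v t)) (at t within {0..T})"
    and "u 0 = v 0" "t \<in> {0..T}"
  shows "u t = v t"
proof -
  \<comment> \<open>Gronwall's argument: the exponential weight makes the squared distance
    nonincreasing.\<close>
  define w where "w s = exp (- 2 * L * s) * ((u s - v s) \<bullet> (u s - v s))" for s
  define w' where "w' s = exp (- 2 * L * s) * (2 * ((u s - v s) \<bullet> (X (u s) - X (v s))) - 2 * L * ((u s - v s) \<bullet> (u s - v s)))" for s
  have d: "(w has_derivative (\<lambda>h. h * w' s)) (at s within {0..t})" if s: "s \<in> {0..t}" for s
  proof -
    have sT: "s \<in> {0..T}" and sub: "{0..t} \<subseteq> {0..T}" using s assms(5) by auto
    have "((\<lambda>s. u s - v s) has_vector_derivative (X (u s) - X (v s))) (at s within {0..t})"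
      by (intro has_vector_derivative_diff has_vector_derivative_within_subset[OF u sub] has_vector_derivative_within_subset[OF v sub] sT)
    then have 1: "((\<lambda>s. u s - v s) has_derivative (\<lambda>h. h *\<^sub>R (X (u s) - X (v s)))) (at s within {0..t})"
      by (simp add: has_vector_derivative_def)
    have 2: "((\<lambda>s. (u s - v s) \<bullet> (u s - v s)) has_derivative (\<lambda>h. h * (2 * ((u s - v s) \<bullet> (X (u s) - X (v s)))))) (at s within {0..t})"
      using has_derivative_inner[OF 1 1] by (simp add: inner_commute algebra_simps)
    have 3: "((\<lambda>s. exp (- 2 * L * s)) has_derivative (\<lambda>h. h * (- 2 * L * exp (- 2 * L * s)))) (at s within {0..t})"
      by (auto intro!: derivative_eq_intros)
    show ?thesis unfolding w_def w'_def using has_derivative_mult[OF 3 2] by (simp add: algebra_simps)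
  qed
  have neg: "w' s \<le> 0" for s
  proof -
    have "(u s - v s) \<bullet> (X (u s) - X (v s)) \<le> norm (u s - v s) * norm (X (u s) - X (v s))" by (rule norm_cauchy_schwarz)
    also have "\<dots> \<le> norm (u s - v s) * (L * norm (u s - v s))" by (intro mult_left_mono X) auto
    also have "\<dots> = L * ((u s - v s) \<bullet> (u s - v s))" by (simp add: dot_square_norm power2_eq_square)
    finally show ?thesis unfolding w'_def by (simp add: mult_le_0_iff)
  qed
  have t0: "0 \<le> t" using assms(5) by simp
  obtain s where "s \<in> {0..t}" "w t - w 0 = (t - 0) * w' s"
    using mvt_very_simple[OF t0 d] by auto
  then have "w t \<le> 0" using neg[of s] t0 assms(4) by (simp add: w_def mult_nonneg_nonpos)
  then have "(u t - v t) \<bullet> (u t - v t) \<le> 0" by (simp add: w_def mult_le_0_iff)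
  then show ?thesis by (metis eq_iff_diff_eq_0 inner_eq_zero_iff inner_ge_zero order_antisym)
qed

text \<open>A form that is stable under composition: \<open>om\<close> replaces the matrix identity,
  and in finite dimension it is enough that the derivative be continuous for each fixed
  direction.\<close>

definition sympC1 :: "(real ^ 4 \<Rightarrow> real ^ 4) \<Rightarrow> (real ^ 4) set \<Rightarrow> bool" where
  "sympC1 \<Psi> U \<longleftrightarrow> (\<exists>D. (\<forall>z\<in>U. (\<Psi> has_derivative D z) (at z) \<and> symp (D z)) \<and> (\<forall>h. continuous_on U (\<lambda>z. D z h)))"

lemma continuous_on_vec4:
  assumes "\<And>i. continuous_on A (\<lambda>s. f s $ i)"
  shows "continuous_on A (f :: 'a::topological_space \<Rightarrow> real ^ 4)"
proof -
  have "continuous_on A (\<lambda>s. \<chi> i. f s $ i)" by (intro continuous_on_vec_lambda assms)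
  then show ?thesis by simp
qed

lemma continuous_on_linear_family:
  fixes D :: "'a::topological_space \<Rightarrow> real ^ 4 \<Rightarrow> real ^ 4" and k :: "'b::topological_space \<Rightarrow> real ^ 4"
  assumes D: "\<And>h. continuous_on U (\<lambda>z. D z h)" and l: "\<And>z. z \<in> U \<Longrightarrow> linear (D z)"
    and f: "continuous_on A f" "f ` A \<subseteq> U" and k: "continuous_on A k"
  shows "continuous_on A (\<lambda>z. D (f z) (k z))"
proof -
  have "continuous_on A (\<lambda>z. \<Sum>j\<in>UNIV. k z $ j *\<^sub>R D (f z) (axis j 1))"
    by (intro continuous_on_sum continuous_on_scaleR continuous_on_component k
        continuous_on_compose2[OF D f(1)]) (use f in auto)
  then show ?thesis by (rule continuous_on_eq) (use linear_expand[OF l] f in auto)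
qed

lemma sympC1_continuous: "sympC1 \<Psi> U \<Longrightarrow> continuous_on U \<Psi>"
  unfolding sympC1_def by (meson continuous_at_imp_continuous_on has_derivative_continuous)

lemma sympC1_compose:
  assumes f: "sympC1 \<Phi> T" and g: "sympC1 \<Psi> U" and sub: "\<Psi> ` U \<subseteq> T"
  shows "sympC1 (\<lambda>z. \<Phi> (\<Psi> z)) U"
proof -
  obtain D where D: "\<And>z. z \<in> T \<Longrightarrow> (\<Phi> has_derivative D z) (at z)" "\<And>z. z \<in> T \<Longrightarrow> symp (D z)"
    "\<And>h. continuous_on T (\<lambda>z. D z h)" using f unfolding sympC1_def by blast
  obtain E where E: "\<And>z. z \<in> U \<Longrightarrow> (\<Psi> has_derivative E z) (at z)" "\<And>z. z \<in> U \<Longrightarrow> symp (E z)"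
    "\<And>h. continuous_on U (\<lambda>z. E z h)" using g unfolding sympC1_def by blast
  show ?thesis unfolding sympC1_def
  proof (intro exI[of _ "\<lambda>z h. D (\<Psi> z) (E z h)"] conjI ballI allI)
    fix z assume z: "z \<in> U"
    then have T: "\<Psi> z \<in> T" using sub by blast
    show "((\<lambda>z. \<Phi> (\<Psi> z)) has_derivative (\<lambda>h. D (\<Psi> z) (E z h))) (at z)"
      by (rule has_derivative_compose[OF E(1)[OF z] D(1)[OF T]])
    show "symp (\<lambda>h. D (\<Psi> z) (E z h))"
      using D(2)[OF T] E(2)[OF z] linear_compose[of "E z" "D (\<Psi> z)"] by (auto simp: symp_def comp_def)
  next
    fix h
    show "continuous_on U (\<lambda>z. D (\<Psi> z) (E z h))"
      by (rule continuous_on_linear_family[OF D(3) _ sympC1_continuous[OF g] sub E(3)])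
        (use D(2) in \<open>auto simp: symp_def\<close>)
  qed
qed

lemma sympC1_subset: "sympC1 \<Psi> U \<Longrightarrow> V \<subseteq> U \<Longrightarrow> sympC1 \<Psi> V"
  unfolding sympC1_def by (meson continuous_on_subset subsetD)

text \<open>Needed for maps that are a composition of flows at a fixed time only locally, with the
  time varying from place to place.\<close>

lemma sympC1_local:
  assumes U: "open U" and loc: "\<And>z. z \<in> U \<Longrightarrow> \<exists>T \<Phi>. open T \<and> z \<in> T \<and> sympC1 \<Phi> T \<and> (\<forall>x\<in>T. \<Psi> x = \<Phi> x)"
  shows "sympC1 \<Psi> U"
proof -
  define D where "D z = frechet_derivative \<Psi> (at z)" for z
  have *: "\<exists>T. open T \<and> z \<in> T \<and> (\<forall>x\<in>T. (\<Psi> has_derivative D x) (at x) \<and> symp (D x)) \<and> (\<forall>h. continuous_on T (\<lambda>z. D z h))"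
    if z: "z \<in> U" for z
  proof -
    obtain T \<Phi> where T: "open T" "z \<in> T" "sympC1 \<Phi> T" "\<forall>x\<in>T. \<Psi> x = \<Phi> x" using loc[OF z] by blast
    obtain E where E: "\<And>z. z \<in> T \<Longrightarrow> (\<Phi> has_derivative E z) (at z)" "\<And>z. z \<in> T \<Longrightarrow> symp (E z)"
      "\<And>h. continuous_on T (\<lambda>z. E z h)" using T(3) unfolding sympC1_def by blast
    have d: "(\<Psi> has_derivative E x) (at x)" if "x \<in> T" for x
      by (rule has_derivative_transform_within_open[OF E(1)[OF that] T(1) that]) (use T(4) in auto)
    have DE: "D x = E x" if "x \<in> T" for x unfolding D_def using frechet_derivative_at[OF d[OF that]] by simp
    have "continuous_on T (\<lambda>z. D z h)" for h by (rule continuous_on_eq[OF E(3)]) (simp add: DE)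
    then show ?thesis using T d E(2) DE by (intro exI[of _ T]) auto
  qed
  have c: "continuous_on U (\<lambda>z. D z h)" for h
  proof (rule continuous_at_imp_continuous_on, rule ballI)
    fix z assume "z \<in> U"
    then show "isCont (\<lambda>z. D z h) z" using *[of z] continuous_on_eq_continuous_at by blast
  qed
  show ?thesis unfolding sympC1_def by (rule exI[of _ D]) (use * c in blast)
qed

lemma symplectic_changeI:
  assumes s: "sympC1 \<Psi> U" and inj: "inj_on \<Psi> U"
  shows "symplectic_change_on \<Psi> U"
proof -
  obtain D where D: "\<And>z. z \<in> U \<Longrightarrow> (\<Psi> has_derivative D z) (at z)" "\<And>z. z \<in> U \<Longrightarrow> symp (D z)"
    "\<And>h. continuous_on U (\<lambda>z. D z h)" using s unfolding sympC1_def by blast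
  have j: "jacobian \<Psi> (at z) = matrix (D z)" if "z \<in> U" for z
    unfolding jacobian_def using frechet_derivative_at[OF D(1)[OF that]] by simp
  have "continuous_on U (\<lambda>z. \<chi> i j. D z (axis j 1) $ i)"
    by (intro continuous_on_vec_lambda continuous_on_component D(3))
  then have "continuous_on U (\<lambda>z. matrix (D z))" by (simp add: matrix_def)
  then have "continuous_on U (\<lambda>z. jacobian \<Psi> (at z))" by (rule continuous_on_eq) (simp add: j)
  then show ?thesis unfolding symplectic_change_on_def C1_map_on_def
    using inj D(1,2) symp_matrix j by (auto simp: differentiable_def)
qed

section \<open>Flows of small perturbations of the rotation\<close>

lemma continuous_on_rot2:
  assumes "continuous_on A r" "continuous_on A y"
  shows "continuous_on A (\<lambda>s. rot (r s) (y s :: real ^ 4))"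
proof (rule continuous_on_vec4)
  fix i :: 4
  have cs: "continuous_on A (\<lambda>s. cos (r s))" "continuous_on A (\<lambda>s. sin (r s))"
    and y: "continuous_on A (\<lambda>s. y s $ j)" for j
    using continuous_on_compose2[OF continuous_at_imp_continuous_on[of UNIV cos] assms(1)]
      continuous_on_compose2[OF continuous_at_imp_continuous_on[of UNIV sin] assms(1)]
    by (auto intro!: continuous_on_component assms)
  show "continuous_on A (\<lambda>s. rot (r s) (y s) $ i)"
    using exhaust_4[of i]
    by (elim disjE; simp only: rot_nth;
        intro continuous_on_add continuous_on_diff continuous_on_scaleR continuous_on_const cs y)
qed

lemma rot_product_derivative:
  fixes y :: "real \<Rightarrow> real ^ 4"
  assumes "(y has_vector_derivative y') (at t within S)"
  shows "((\<lambda>t. rot (c * t) (y t)) has_vector_derivative c *\<^sub>R kgen (rot (c * t) (y t)) + rot (c * t) y') (at t within S)"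
proof (rule has_vector_derivative_vec4)
  fix i :: 4
  have y: "((\<lambda>t. y t $ i) has_real_derivative y' $ i) (at t within S)" for i
    using bounded_linear.has_vector_derivative[OF bounded_linear_vec_nth assms]
    by (simp add: has_real_derivative_iff_has_vector_derivative)
  have co: "((\<lambda>t. cos (c * t)) has_real_derivative - sin (c * t) * c) (at t within S)"
    and si: "((\<lambda>t. sin (c * t)) has_real_derivative cos (c * t) * c) (at t within S)"
    by (auto intro!: derivative_eq_intros)
  show "((\<lambda>t. rot (c * t) (y t) $ i) has_vector_derivative (c *\<^sub>R kgen (rot (c * t) (y t)) + rot (c * t) y') $ i) (at t within S)"
    unfolding has_real_derivative_iff_has_vector_derivative[symmetric]
  proof (rule DERIV_cong)
    show "((\<lambda>t. rot (c * t) (y t) $ i) has_real_derivative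
      (if i = 1 then (- sin (c * t) * c) * y t $ 1 + cos (c * t) * y' $ 1 + ((cos (c * t) * c) * y t $ 2 + sin (c * t) * y' $ 2)
       else if i = 2 then (- sin (c * t) * c) * y t $ 2 + cos (c * t) * y' $ 2 - ((cos (c * t) * c) * y t $ 1 + sin (c * t) * y' $ 1)
       else if i = 3 then y' $ 3 + ((cos (c * t) * c) * y t $ 1 + sin (c * t) * y' $ 1) + ((sin (c * t) * c) * y t $ 2 + (1 - cos (c * t)) * y' $ 2)
       else y' $ 4 + ((cos (c * t) * c) * y t $ 2 + sin (c * t) * y' $ 2) - ((sin (c * t) * c) * y t $ 1 + (1 - cos (c * t)) * y' $ 1))) (at t within S)"
      using exhaust_4[of i] by (auto intro!: derivative_eq_intros y co si)
    show "(if i = 1 then (- sin (c * t) * c) * y t $ 1 + cos (c * t) * y' $ 1 + ((cos (c * t) * c) * y t $ 2 + sin (c * t) * y' $ 2)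
       else if i = 2 then (- sin (c * t) * c) * y t $ 2 + cos (c * t) * y' $ 2 - ((cos (c * t) * c) * y t $ 1 + sin (c * t) * y' $ 1)
       else if i = 3 then y' $ 3 + ((cos (c * t) * c) * y t $ 1 + sin (c * t) * y' $ 1) + ((sin (c * t) * c) * y t $ 2 + (1 - cos (c * t)) * y' $ 2)
       else y' $ 4 + ((cos (c * t) * c) * y t $ 2 + sin (c * t) * y' $ 2) - ((sin (c * t) * c) * y t $ 1 + (1 - cos (c * t)) * y' $ 1))
       = (c *\<^sub>R kgen (rot (c * t) (y t)) + rot (c * t) y') $ i"
      using exhaust_4[of i] by (auto simp: algebra_simps)
  qed
qed

lemma linear_kgen: "linear (kgen :: real ^ 4 \<Rightarrow> real ^ 4)"
  using bounded_linear_kgen bounded_linear.linear by blast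

text \<open>\<open>1 / 2304\<close> is \<open>1 / (16 * 12 * 12)\<close>: passing to rotating
  coordinates multiplies the derivative bound by at most 12 * 12, and \<open>picard\<close> asks for
  1/16. The assumption \<open>ham\<close> makes \<open>g'\<close> infinitesimally symplectic;
  \<open>sg\<close> is the direction of time.\<close>

locale small_field =
  fixes g :: "real ^ 4 \<Rightarrow> real ^ 4" and g' :: "real ^ 4 \<Rightarrow> real ^ 4 \<Rightarrow> real ^ 4" and b M sg :: real
  assumes g_deriv: "\<And>x. (g has_derivative g' x) (at x)"
    and g_bound: "\<And>x. norm (g x) \<le> b" and g'_bound: "\<And>x h. norm (g' x h) \<le> b * norm h"
    and g'_lip: "\<And>x y h. norm (g' x h - g' y h) \<le> M * norm (x - y) * norm h"
    and b: "b \<le> 1 / 2304" and M: "M \<ge> 0"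
    and ham: "\<And>x h k. om (g' x h) k + om h (g' x k) = 0"
    and sg: "sg = 1 \<or> sg = -1"
begin

definition X :: "real ^ 4 \<Rightarrow> real ^ 4" where "X x = sg *\<^sub>R (kgen x + g x)"

lemma b0: "b \<ge> 0" using order_trans[OF norm_ge_zero g_bound] .

lemma linear_g': "linear (g' x)" using g_deriv has_derivative_linear by blast

lemma g_lip: "norm (g x - g y) \<le> b * norm (x - y)"
proof (rule differentiable_bound[where S = UNIV and f' = g'])
  show "onorm (g' z) \<le> b" for z by (rule onorm_bound) (use g'_bound b0 in auto)
qed (auto intro: g_deriv)

lemma X_lip: "norm (X x - X y) \<le> 5 * norm (x - y)"
proof -
  have "X x - X y = sg *\<^sub>R (kgen (x - y) + (g x - g y))"
    by (simp add: X_def linear_diff[OF linear_kgen] algebra_simps)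
  then have "norm (X x - X y) = norm (kgen (x - y) + (g x - g y))" using sg by auto
  also have "\<dots> \<le> 4 * norm (x - y) + b * norm (x - y)"
    by (intro norm_triangle_mono norm_kgen_le g_lip)
  also have "\<dots> \<le> 5 * norm (x - y)" using mult_right_mono[of b 1 "norm (x - y)"] b by simp
  finally show ?thesis .
qed

text \<open>The field in coordinates that rotate with the flow of \<open>K\<close>. This removes
  \<open>kgen\<close>, which is not small, and leaves a field of order \<open>b\<close>, for which
  one contraction covers all of \<open>[0, 8]\<close>.\<close>

definition Gr :: "real \<Rightarrow> real ^ 4 \<Rightarrow> real ^ 4" where
  "Gr s x = sg *\<^sub>R rot (- (sg * s)) (g (rot (sg * s) x))"
definition Gr' :: "real \<Rightarrow> real ^ 4 \<Rightarrow> real ^ 4 \<Rightarrow> real ^ 4" where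
  "Gr' s x h = sg *\<^sub>R rot (- (sg * s)) (g' (rot (sg * s) x) (rot (sg * s) h))"

lemma g_cont: "continuous_on A g"
  using g_deriv by (meson continuous_at_imp_continuous_on has_derivative_continuous)

lemma g'_cont: "continuous_on A (\<lambda>x. g' x h)"
  by (rule lipschitz_on_continuous_on[of "M * norm h"])
    (use g'_lip M in \<open>auto simp: lipschitz_on_def dist_norm mult_ac\<close>)

sublocale picard Gr Gr' "12 * b" "1728 * M"
proof
  have nsg: "norm (sg *\<^sub>R v) = norm v" for v :: "real ^ 4" using sg by auto
  show "continuous_on UNIV (\<lambda>s. Gr s (y s))" if "continuous_on UNIV y" for y
    unfolding Gr_def by (intro continuous_on_scaleR continuous_on_const continuous_on_rot2 continuous_intros
      continuous_on_compose2[OF g_cont[of UNIV]] that) auto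
  show "continuous_on UNIV (\<lambda>s. Gr' s (y s) (h s))" if "continuous_on UNIV y" "continuous_on UNIV h" for y h
    unfolding Gr'_def by (intro continuous_on_scaleR continuous_on_const continuous_on_rot2 continuous_intros
      continuous_on_linear_family[OF g'_cont[of UNIV] linear_g'] that) auto
  show "(Gr s has_derivative Gr' s x) (at x)" for s x
    unfolding Gr_def Gr'_def
    by (intro has_derivative_scaleR_right bounded_linear.has_derivative[OF bounded_linear_rot]
       has_derivative_compose[OF bounded_linear_imp_has_derivative[OF bounded_linear_rot] g_deriv])
  show "norm (Gr s x) \<le> 12 * b" for s x
    unfolding Gr_def nsg by (rule order_trans[OF norm_rot_le]) (use g_bound in simp)
  show "norm (Gr' s x h) \<le> norm h / 16" for s x h
  proof -
    have "norm (Gr' s x h) \<le> 12 * norm (g' (rot (sg * s) x) (rot (sg * s) h))"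
      unfolding Gr'_def nsg by (rule norm_rot_le)
    also have "\<dots> \<le> 12 * (b * (12 * norm h))"
      using b0 by (intro mult_left_mono order_trans[OF g'_bound] norm_rot_le) auto
    also have "\<dots> \<le> 12 * (1 / 2304 * (12 * norm h))" using b by (intro mult_left_mono mult_right_mono) auto
    finally show ?thesis by simp
  qed
  show "norm (Gr' s x h - Gr' s y h) \<le> 1728 * M * norm (x - y) * norm h" for s x y h
  proof -
    have "norm (Gr' s x h - Gr' s y h) \<le> 12 * norm (g' (rot (sg * s) x) (rot (sg * s) h) - g' (rot (sg * s) y) (rot (sg * s) h))"
      unfolding Gr'_def scaleR_diff_right[symmetric] nsg rot_diff[symmetric] by (rule norm_rot_le)
    also have "\<dots> \<le> 12 * (M * norm (rot (sg * s) x - rot (sg * s) y) * norm (rot (sg * s) h))"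
      by (intro mult_left_mono g'_lip) simp
    also have "\<dots> \<le> 12 * (M * (12 * norm (x - y)) * (12 * norm h))"
      unfolding rot_diff[symmetric] using M by (intro mult_left_mono mult_mono norm_rot_le) auto
    finally show ?thesis by simp
  qed
  show "1728 * M \<ge> 0" using M by simp
qed

text \<open>The linearised equation has an infinitesimally symplectic right-hand side, so
  \<open>om\<close> of two of its solutions is constant in time. The distance 1152 is 12 * 8 * 12:
  back to fixed coordinates, length of the interval, bound on \<open>Gr\<close>.\<close>

theorem flow:
  obtains \<Phi> where "\<And>z. \<Phi> z 0 = z"
    "\<And>z t. t \<in> {0..8} \<Longrightarrow> (\<Phi> z has_vector_derivative X (\<Phi> z t)) (at t within {0..8})"
    "\<And>z t. norm (\<Phi> z t - rot (sg * t) z) \<le> 1152 * b"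
    "\<And>t. t \<in> {0..8} \<Longrightarrow> sympC1 (\<lambda>z. \<Phi> z t) UNIV"
proof -
  obtain Y D where Y: "\<And>z. Y z 0 = z" "\<And>z t. t \<in> {0..8} \<Longrightarrow> (Y z has_vector_derivative Gr t (Y z t)) (at t within {0..8})"
    "\<And>z t. norm (Y z t - z) \<le> 8 * (12 * b)" "\<And>z t. ((\<lambda>z. Y z t) has_derivative (\<lambda>h. D z h t)) (at z)"
    "\<And>z h. D z h 0 = h" "\<And>z h t. t \<in> {0..8} \<Longrightarrow> (D z h has_vector_derivative Gr' t (Y z t) (D z h t)) (at t within {0..8})"
    "\<And>h t. continuous_on UNIV (\<lambda>z. D z h t)"
    using solution by blast
  define \<Phi> where "\<Phi> z t = rot (sg * t) (Y z t)" for z t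
  define E where "E z h t = rot (sg * t) (D z h t)" for z h t
  have canc: "rot (sg * t) (rot (- (sg * t)) v) = v" for t and v :: "real ^ 4" by (simp add: rot_rot)
  have E': "(E z h has_vector_derivative sg *\<^sub>R (kgen (E z h t) + g' (\<Phi> z t) (E z h t))) (at t within {0..8})"
    if "t \<in> {0..8}" for z h t
    using rot_product_derivative[OF Y(6)[OF that], of sg z h]
    unfolding E_def[symmetric] Gr'_def rot_scaleR canc \<Phi>_def[symmetric] by (simp add: scaleR_add_right)
  have om_const: "om (E z h t) (E z k t) = om h k" if t: "t \<in> {0..8}" for z h k t
  proof -
    have d: "((\<lambda>t. om (E z h t) (E z k t)) has_derivative (\<lambda>x. 0)) (at s within {0..8})" if s: "s \<in> {0..8}" for s
    proof -
      let ?a = "E z h s" and ?b = "E z k s"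
      let ?a' = "sg *\<^sub>R (kgen ?a + g' (\<Phi> z s) ?a)" and ?b' = "sg *\<^sub>R (kgen ?b + g' (\<Phi> z s) ?b)"
      have c: "((\<lambda>t. E z h t $ i) has_derivative (\<lambda>x. x * ?a' $ i)) (at s within {0..8})"
        "((\<lambda>t. E z k t $ i) has_derivative (\<lambda>x. x * ?b' $ i)) (at s within {0..8})" for i
        using bounded_linear.has_vector_derivative[OF bounded_linear_vec_nth[of i] E'[OF s, of z h]]
          bounded_linear.has_vector_derivative[OF bounded_linear_vec_nth[of i] E'[OF s, of z k]]
        by (simp_all add: has_vector_derivative_def)
      have "((\<lambda>t. om (E z h t) (E z k t)) has_derivative (\<lambda>x. x * (om ?a' ?b + om ?a ?b'))) (at s within {0..8})"
        unfolding om_def by (rule derivative_eq_intros c refl)+ (simp add: algebra_simps)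
      moreover have "om ?a' ?b + om ?a ?b' = sg * ((om (kgen ?a) ?b + om ?a (kgen ?b)) + (om (g' (\<Phi> z s) ?a) ?b + om ?a (g' (\<Phi> z s) ?b)))"
        by (simp add: om_bilinear algebra_simps)
      ultimately show ?thesis by (simp add: ham om_kgen)
    qed
    have "om (E z h t) (E z k t) = om (E z h 0) (E z k 0)"
      using has_derivative_zero_unique[of "{0..8::real}" "\<lambda>t. om (E z h t) (E z k t)", OF _ d, of 0 t] t by auto
    then show ?thesis by (simp add: E_def Y(5))
  qed
  show ?thesis
  proof (rule that[of \<Phi>])
    show "\<Phi> z 0 = z" for z by (simp add: \<Phi>_def Y(1))
    show "(\<Phi> z has_vector_derivative X (\<Phi> z t)) (at t within {0..8})" if "t \<in> {0..8}" for z t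
      using rot_product_derivative[OF Y(2)[OF that], of sg z]
      unfolding \<Phi>_def[symmetric] Gr_def rot_scaleR canc X_def by (simp add: scaleR_add_right)
    show "norm (\<Phi> z t - rot (sg * t) z) \<le> 1152 * b" for z t
    proof -
      have "norm (\<Phi> z t - rot (sg * t) z) \<le> 12 * norm (Y z t - z)" unfolding \<Phi>_def rot_diff[symmetric] by (rule norm_rot_le)
      also have "\<dots> \<le> 12 * (8 * (12 * b))" by (intro mult_left_mono Y(3)) simp
      finally show ?thesis by simp
    qed
    fix t :: real assume t: "t \<in> {0..8}"
    show "sympC1 (\<lambda>z. \<Phi> z t) UNIV" unfolding sympC1_def
    proof (intro exI[of _ "\<lambda>z h. E z h t"] conjI ballI allI)
      fix z
      show d: "((\<lambda>z. \<Phi> z t) has_derivative (\<lambda>h. E z h t)) (at z)"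
        unfolding \<Phi>_def E_def by (rule bounded_linear.has_derivative[OF bounded_linear_rot Y(4)])
      show "symp (\<lambda>h. E z h t)" using om_const[OF t] has_derivative_linear[OF d] by (auto simp: symp_def)
    next
      show "continuous_on UNIV (\<lambda>z. E z h t)" for h
        unfolding E_def by (intro continuous_on_rot2 continuous_on_const Y(7))
    qed
  qed
qed

end

section \<open>Hamiltonian flows of families\<close>

definition gr :: "(real ^ 4 \<Rightarrow> real) \<Rightarrow> real ^ 4 \<Rightarrow> real ^ 4" where
  "gr f x = (\<chi> j. pd j f x)"

definition hess :: "(real ^ 4 \<Rightarrow> real) \<Rightarrow> real ^ 4 \<Rightarrow> real ^ 4 \<Rightarrow> real ^ 4" where
  "hess f x h = (\<chi> j. \<Sum>l\<in>UNIV. h $ l * pd l (pd j f) x)"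

definition ham :: "(real ^ 4 \<Rightarrow> real) \<Rightarrow> real \<Rightarrow> real ^ 4 \<Rightarrow> real" where
  "ham f \<epsilon> z = kinetic z + \<epsilon> * f z"

text \<open>The Hamiltonian vector field of \<open>ham f \<epsilon>\<close>.\<close>

definition vf :: "(real ^ 4 \<Rightarrow> real) \<Rightarrow> real \<Rightarrow> real ^ 4 \<Rightarrow> real ^ 4" where
  "vf f \<epsilon> z = kgen z + \<epsilon> *\<^sub>R jmul (gr f z)"

lemma kinetic_eq: "kinetic z = ((z $ 1)\<^sup>2 + (z $ 2)\<^sup>2) / 2"
  by (simp add: kinetic_def inner_vec_def sum_2 power2_eq_square)

lemma kinetic_deriv: "(kinetic has_derivative (\<lambda>h. z $ 1 * h $ 1 + z $ 2 * h $ 2)) (at z)"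
proof -
  have c: "((\<lambda>z. z $ i) has_derivative (\<lambda>h. h $ i)) (at z)" for i :: 4 and z :: "real ^ 4"
    by (rule bounded_linear_imp_has_derivative[OF bounded_linear_vec_nth])
  show ?thesis unfolding kinetic_eq[abs_def]
    by ((rule derivative_eq_intros c refl | simp)+, simp add: fun_eq_iff add_divide_distrib)
qed

lemma inner_jmul_self: "w \<bullet> jmul w = 0" for w :: "real ^ 4"
  by (simp add: inner_4 algebra_simps)

lemma UC_global:
  assumes "UC k I f" and s: "\<And>i x. i \<in> I \<Longrightarrow> norm x > R \<Longrightarrow> f i x = 0"
  shows "\<exists>B\<ge>0. \<forall>i\<in>I. \<forall>x. \<bar>f i x\<bar> \<le> B"
proof -
  obtain B where B: "\<And>i x. i \<in> I \<Longrightarrow> norm x \<le> R \<Longrightarrow> \<bar>f i x\<bar> \<le> B" using UC_bound[OF assms(1), of R] by blast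
  have "\<bar>f i x\<bar> \<le> max 0 B" if "i \<in> I" for i x
    using B[OF that, of x] s[OF that, of x] by (cases "norm x \<le> R") auto
  then show ?thesis by (intro exI[of _ "max 0 B"]) auto
qed

lemma pd_support:
  assumes "\<And>x. norm x > R \<Longrightarrow> f x = 0" "norm x > R"
  shows "pd j f x = 0"
proof -
  have o: "open {x :: real ^ 4. norm x > R}" by (intro open_Collect_less continuous_intros)
  have "(f has_derivative (\<lambda>h. 0)) (at x)"
    by (rule has_derivative_transform_within_open[OF has_derivative_const o]) (use assms in auto)
  then show ?thesis by (simp add: pd_eq)
qed

lemma norm_le_4B:
  assumes "\<And>j. \<bar>v $ j\<bar> \<le> B" shows "norm (v :: real ^ 4) \<le> 4 * B"
  using norm_le_sum_4[of v] assms[of 1] assms[of 2] assms[of 3] assms[of 4] by simp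

lemma UC_global_lipschitz:
  assumes u: "UC (Suc k) I f" and s: "\<And>i x. i \<in> I \<Longrightarrow> norm x > R \<Longrightarrow> f i x = 0"
  shows "\<exists>B\<ge>0. \<forall>i\<in>I. \<forall>x y. \<bar>f i x - f i y\<bar> \<le> B * norm (x - y)"
proof -
  have "\<exists>B\<ge>0. \<forall>i\<in>I. \<forall>x. \<bar>pd j (f i) x\<bar> \<le> B" for j
    by (rule UC_global[OF UC_pd[OF u], of R]) (use pd_support s in blast)
  then obtain B where B: "\<And>j. B j \<ge> 0" "\<And>j i x. i \<in> I \<Longrightarrow> \<bar>pd j (f i) x\<bar> \<le> B j" by metis
  define C where "C = (\<Sum>j\<in>UNIV. B j)"
  have "\<bar>f i x - f i y\<bar> \<le> C * norm (x - y)" if i: "i \<in> I" for i x y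
  proof -
    have "norm (f i x - f i y) \<le> C * norm (x - y)"
    proof (rule differentiable_bound[where S = UNIV and f' = "\<lambda>x h. \<Sum>j\<in>UNIV. h $ j * pd j (f i) x"])
      fix z
      show "onorm (\<lambda>h. \<Sum>j\<in>UNIV. h $ j * pd j (f i) z) \<le> C"
      proof (rule onorm_bound)
        fix h :: "real ^ 4"
        have "norm (\<Sum>j\<in>UNIV. h $ j * pd j (f i) z) \<le> (\<Sum>j\<in>UNIV. norm h * B j)"
        proof (rule sum_norm_le)
          show "norm (h $ j * pd j (f i) z) \<le> norm h * B j" for j
            using component_le_norm_cart[of h j] B(2)[OF i, of j z] by (simp add: abs_mult mult_mono)
        qed
        then show "norm (\<Sum>j\<in>UNIV. h $ j * pd j (f i) z) \<le> C * norm h" by (simp add: C_def sum_distrib_left mult.commute)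
      qed (use B in \<open>auto simp: C_def intro: sum_nonneg\<close>)
    qed (auto intro: UC_deriv[OF u i])
    then show ?thesis by simp
  qed
  moreover have "C \<ge> 0" using B(1) by (simp add: C_def sum_nonneg)
  ultimately show ?thesis by blast
qed

lemma gr_deriv:
  assumes "UC (Suc (Suc k)) I f" "i \<in> I"
  shows "(gr (f i) has_derivative hess (f i) x) (at x)"
  unfolding gr_def[abs_def] hess_def[abs_def]
  by (rule has_derivative_vec4) (use UC_deriv[OF UC_pd[OF assms(1)] assms(2)] in simp)

text \<open>By \<open>om_jmul\<close> the two terms are the values of the Hessian at the pair
  \<open>(h, k')\<close> in either order, with opposite signs, and the Hessian is symmetric.\<close>

lemma om_hess:
  assumes "UC (Suc (Suc k)) I f" "i \<in> I"
  shows "om (jmul (hess (f i) x h)) k' + om h (jmul (hess (f i) x k')) = 0"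
proof -
  have "UC (Suc (Suc 0)) I f" using UC_mono[OF assms(1)] by simp
  then have "UC (Suc (Suc 0)) {()} (\<lambda>_. f i)"
    using assms(2) by (auto simp: UC_Suc; meson UC.simps(1))
  from mixed_partials[OF this] have sym: "pd a (pd b (f i)) x = pd b (pd a (f i)) x" for a b .
  show ?thesis unfolding om_jmul
    by (simp add: inner_4 hess_def sum_4 sym[of 2 1] sym[of 3 1] sym[of 4 1] sym[of 3 2] sym[of 4 2] sym[of 4 3] algebra_simps)
qed

lemma hess_bounds:
  assumes u: "UC (Suc (Suc (Suc 0))) I f" and s: "\<And>i x. i \<in> I \<Longrightarrow> norm x > R \<Longrightarrow> f i x = 0"
  shows "\<exists>C>0. \<forall>i\<in>I. \<forall>x y h. norm (jmul (gr (f i) x)) \<le> C \<and> norm (jmul (hess (f i) x h)) \<le> C * norm h \<and>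
     norm (jmul (hess (f i) x h) - jmul (hess (f i) y h)) \<le> C * norm (x - y) * norm h"
proof -
  have s1: "pd j (f i) x = 0" if "i \<in> I" "norm x > R" for i j x using pd_support s that by blast
  have s2: "pd l (pd j (f i)) x = 0" if "i \<in> I" "norm x > R" for i j l x using pd_support s1 that by blast
  have "\<exists>B\<ge>0. \<forall>i\<in>I. \<forall>x. \<bar>pd j (f i) x\<bar> \<le> B" for j
    by (rule UC_global[OF UC_pd[OF u] s1])
  then obtain B1 where B1: "\<And>j. B1 j \<ge> 0" "\<And>j i x. i \<in> I \<Longrightarrow> \<bar>pd j (f i) x\<bar> \<le> B1 j" by metis
  have "\<exists>B\<ge>0. \<forall>i\<in>I. \<forall>x. \<bar>pd l (pd j (f i)) x\<bar> \<le> B" for l j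
    by (rule UC_global[OF UC_pd[OF UC_pd[OF u]] s2])
  then obtain B2 where B2: "\<And>l j. B2 l j \<ge> 0" "\<And>l j i x. i \<in> I \<Longrightarrow> \<bar>pd l (pd j (f i)) x\<bar> \<le> B2 l j" by metis
  have "\<exists>B\<ge>0. \<forall>i\<in>I. \<forall>x y. \<bar>pd l (pd j (f i)) x - pd l (pd j (f i)) y\<bar> \<le> B * norm (x - y)" for l j
    by (rule UC_global_lipschitz[OF UC_pd[OF UC_pd[OF u]] s2])
  then obtain B3 where B3: "\<And>l j. B3 l j \<ge> 0"
    "\<And>l j i x y. i \<in> I \<Longrightarrow> \<bar>pd l (pd j (f i)) x - pd l (pd j (f i)) y\<bar> \<le> B3 l j * norm (x - y)" by metis
  define C where "C = 1 + (\<Sum>j\<in>UNIV. B1 j) + (\<Sum>j\<in>UNIV. \<Sum>l\<in>UNIV. B2 l j + B3 l j)"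
  have C1: "B1 j \<le> C" for j
  proof -
    have "B1 j \<le> (\<Sum>j\<in>UNIV. B1 j)" by (rule member_le_sum) (use B1 in auto)
    moreover have "0 \<le> (\<Sum>j\<in>UNIV. \<Sum>l\<in>UNIV. B2 l j + B3 l j)" by (intro sum_nonneg add_nonneg_nonneg B2 B3)
    ultimately show ?thesis unfolding C_def by linarith
  qed
  have C2: "(\<Sum>l\<in>UNIV. B2 l j + B3 l j) \<le> C" for j
  proof -
    have "(\<Sum>l\<in>UNIV. B2 l j + B3 l j) \<le> (\<Sum>j\<in>UNIV. \<Sum>l\<in>UNIV. B2 l j + B3 l j)"
      by (rule member_le_sum[where f = "\<lambda>j. \<Sum>l\<in>UNIV. B2 l j + B3 l j"]) (use B2 B3 in \<open>auto intro!: sum_nonneg\<close>)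
    then show ?thesis unfolding C_def using sum_nonneg[of UNIV B1] B1(1) by simp
  qed
  have "0 \<le> (\<Sum>j\<in>UNIV. B1 j) + (\<Sum>j\<in>UNIV. \<Sum>l\<in>UNIV. B2 l j + B3 l j)"
    by (intro sum_nonneg add_nonneg_nonneg B1 B2 B3)
  then have "C \<ge> 1" unfolding C_def by linarith
  \<comment> \<open>The factor 24 is 6 for \<open>jmul\<close> times 4 for the passage from
    components to the norm.\<close>
  have "norm (jmul (gr (f i) x)) \<le> 24 * C \<and> norm (jmul (hess (f i) x h)) \<le> 24 * C * norm h \<and>
     norm (jmul (hess (f i) x h) - jmul (hess (f i) y h)) \<le> 24 * C * norm (x - y) * norm h" if i: "i \<in> I" for i x y h
  proof (intro conjI)
    have "norm (gr (f i) x) \<le> 4 * C"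
      by (rule norm_le_4B) (use order_trans[OF B1(2)[OF i] C1] in \<open>simp add: gr_def\<close>)
    then show "norm (jmul (gr (f i) x)) \<le> 24 * C" using norm_jmul_le[of "gr (f i) x"] by linarith
    have hb: "\<bar>hess (f i) x h $ j\<bar> \<le> C * norm h" for j
    proof -
      have "\<bar>hess (f i) x h $ j\<bar> \<le> (\<Sum>l\<in>UNIV. norm h * (B2 l j + B3 l j))"
        unfolding hess_def vec_lambda_beta real_norm_def[symmetric]
      proof (rule sum_norm_le)
        fix l
        have "\<bar>pd l (pd j (f i)) x\<bar> \<le> B2 l j + B3 l j" using B2(2)[OF i, of l j x] B3(1)[of l j] by linarith
        then show "norm (h $ l * pd l (pd j (f i)) x) \<le> norm h * (B2 l j + B3 l j)"
          using component_le_norm_cart[of h l] by (simp add: abs_mult mult_mono)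
      qed
      also have "\<dots> = (\<Sum>l\<in>UNIV. B2 l j + B3 l j) * norm h" by (simp add: sum_distrib_left mult.commute)
      also have "\<dots> \<le> C * norm h" by (intro mult_right_mono C2) simp
      finally show ?thesis .
    qed
    show "norm (jmul (hess (f i) x h)) \<le> 24 * C * norm h"
      using norm_jmul_le[of "hess (f i) x h"] norm_le_4B[of "hess (f i) x h", OF hb] by linarith
    have hl: "\<bar>(hess (f i) x h - hess (f i) y h) $ j\<bar> \<le> C * norm (x - y) * norm h" for j
    proof -
      have "(hess (f i) x h - hess (f i) y h) $ j = (\<Sum>l\<in>UNIV. h $ l * (pd l (pd j (f i)) x - pd l (pd j (f i)) y))"
        by (simp add: hess_def sum_subtractf right_diff_distrib)
      also have "\<bar>\<dots>\<bar> \<le> (\<Sum>l\<in>UNIV. norm h * ((B2 l j + B3 l j) * norm (x - y)))"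
        unfolding real_norm_def[symmetric]
      proof (rule sum_norm_le)
        fix l
        have "\<bar>pd l (pd j (f i)) x - pd l (pd j (f i)) y\<bar> \<le> (B2 l j + B3 l j) * norm (x - y)"
          by (rule order_trans[OF B3(2)[OF i]], rule mult_right_mono) (use B2(1) in auto)
        then show "norm (h $ l * (pd l (pd j (f i)) x - pd l (pd j (f i)) y)) \<le> norm h * ((B2 l j + B3 l j) * norm (x - y))"
          using component_le_norm_cart[of h l] by (simp add: abs_mult mult_mono)
      qed
      also have "\<dots> = (\<Sum>l\<in>UNIV. B2 l j + B3 l j) * (norm (x - y) * norm h)" by (simp add: sum_distrib_left mult_ac)
      also have "\<dots> \<le> C * (norm (x - y) * norm h)" by (intro mult_right_mono C2) simp
      finally show ?thesis by (simp add: mult.assoc)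
    qed
    show "norm (jmul (hess (f i) x h) - jmul (hess (f i) y h)) \<le> 24 * C * norm (x - y) * norm h"
      using norm_jmul_le[of "hess (f i) x h - hess (f i) y h"] norm_le_4B[of "hess (f i) x h - hess (f i) y h", OF hl]
      unfolding jmul_diff by linarith
  qed
  then show ?thesis using \<open>C \<ge> 1\<close> by (intro exI[of _ "24 * C"]) auto
qed

text \<open>\<open>sg\<close> is the direction of time and \<open>d\<close> the allowed distance
  from the unperturbed motion; conservation of energy is part of the notion because it is what
  \<open>eliminate\<close> rests on.\<close>

definition is_flow :: "real \<Rightarrow> (real ^ 4 \<Rightarrow> real) \<Rightarrow> real \<Rightarrow> real \<Rightarrow> (real ^ 4 \<Rightarrow> real \<Rightarrow> real ^ 4) \<Rightarrow> bool" where
  "is_flow sg f \<epsilon> d \<Phi> \<longleftrightarrow> (\<forall>z. \<Phi> z 0 = z) \<and>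
     (\<forall>z. \<forall>t\<in>{0..8}. (\<Phi> z has_vector_derivative sg *\<^sub>R vf f \<epsilon> (\<Phi> z t)) (at t within {0..8})) \<and>
     (\<forall>z. \<forall>t\<in>{0..8}. norm (\<Phi> z t - rot (sg * t) z) \<le> d) \<and>
     (\<forall>t\<in>{0..8}. sympC1 (\<lambda>z. \<Phi> z t) UNIV) \<and> (\<forall>z. \<forall>t\<in>{0..8}. ham f \<epsilon> (\<Phi> z t) = ham f \<epsilon> z)"

text \<open>The velocity is a multiple of \<open>jmul w\<close> with \<open>w\<close> the gradient
  of the Hamiltonian, and \<open>w \<bullet> jmul w = 0\<close>.\<close>

lemma ham_conserved:
  assumes u: "\<And>t. t \<in> {0..8} \<Longrightarrow> (u has_vector_derivative sg *\<^sub>R vf f \<epsilon> (u t)) (at t within {0..8})"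
    and f: "\<And>x. f differentiable (at x)" and t: "t \<in> {0..8}"
  shows "ham f \<epsilon> (u t) = ham f \<epsilon> (u 0)"
proof -
  have d: "((\<lambda>t. ham f \<epsilon> (u t)) has_derivative (\<lambda>x. 0)) (at s within {0..8})" if s: "s \<in> {0..8}" for s
  proof -
    let ?w = "vector [u s $ 1, u s $ 2, 0, 0] + \<epsilon> *\<^sub>R gr f (u s) :: real ^ 4"
    have v: "vf f \<epsilon> (u s) = jmul ?w" by (simp add: vf_def vec4_eq_iff algebra_simps)
    have "(ham f \<epsilon> has_derivative (\<lambda>h. (u s $ 1 * h $ 1 + u s $ 2 * h $ 2) + \<epsilon> * (\<Sum>j\<in>UNIV. h $ j * pd j f (u s)))) (at (u s))"
      unfolding ham_def[abs_def] by (intro has_derivative_add kinetic_deriv has_derivative_mult_right has_derivative_pd f)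
    moreover have "(u s $ 1 * h $ 1 + u s $ 2 * h $ 2) + \<epsilon> * (\<Sum>j\<in>UNIV. h $ j * pd j f (u s)) = ?w \<bullet> h" for h
      by (simp add: inner_4 gr_def sum_4 algebra_simps)
    ultimately have "(ham f \<epsilon> has_derivative (\<lambda>h. ?w \<bullet> h)) (at (u s))" by simp
    from has_derivative_compose[OF u[OF s, unfolded has_vector_derivative_def] this]
    show ?thesis by (simp add: v inner_jmul_self)
  qed
  show ?thesis
    using has_derivative_zero_unique[of "{0..8::real}" "\<lambda>t. ham f \<epsilon> (u t)", OF _ d, of 0 t] t by auto
qed

theorem family_flow:
  assumes u: "UC (Suc (Suc (Suc 0))) I f" and s: "\<And>i x. i \<in> I \<Longrightarrow> norm x > R \<Longrightarrow> f i x = 0"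
    and I: "\<And>\<epsilon>. \<epsilon> \<in> I \<Longrightarrow> \<epsilon> > 0"
  shows "\<exists>C>0. \<exists>\<epsilon>1>0. \<forall>\<epsilon>\<in>I. \<epsilon> < \<epsilon>1 \<longrightarrow> (\<forall>x y. norm (vf (f \<epsilon>) \<epsilon> x - vf (f \<epsilon>) \<epsilon> y) \<le> 5 * norm (x - y)) \<and>
    (\<exists>\<Phi>. is_flow 1 (f \<epsilon>) \<epsilon> (C * \<epsilon>) \<Phi>) \<and> (\<exists>\<Phi>. is_flow (-1) (f \<epsilon>) \<epsilon> (C * \<epsilon>) \<Phi>)"
proof -
  have "\<exists>C>0. \<forall>i\<in>I. \<forall>x y h. norm (jmul (gr (f i) x)) \<le> C \<and> norm (jmul (hess (f i) x h)) \<le> C * norm h \<and>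
     norm (jmul (hess (f i) x h) - jmul (hess (f i) y h)) \<le> C * norm (x - y) * norm h"
    by (rule hess_bounds[OF u s])
  then obtain C where C: "C > 0" and b': "\<forall>i\<in>I. \<forall>x y h. norm (jmul (gr (f i) x)) \<le> C \<and> norm (jmul (hess (f i) x h)) \<le> C * norm h \<and>
     norm (jmul (hess (f i) x h) - jmul (hess (f i) y h)) \<le> C * norm (x - y) * norm h" by (elim exE conjE)
  have b: "norm (jmul (gr (f i) x)) \<le> C" "norm (jmul (hess (f i) x h)) \<le> C * norm h"
     "norm (jmul (hess (f i) x h) - jmul (hess (f i) y h)) \<le> C * norm (x - y) * norm h" if "i \<in> I" for i x y h
    using b' that by auto
  have main: "(\<forall>x y. norm (vf (f \<epsilon>) \<epsilon> x - vf (f \<epsilon>) \<epsilon> y) \<le> 5 * norm (x - y)) \<and> (\<exists>\<Phi>. is_flow sg (f \<epsilon>) \<epsilon> (1152 * C * \<epsilon>) \<Phi>)"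
    if e: "\<epsilon> \<in> I" "\<epsilon> < 1 / (2304 * C)" and sg: "sg = 1 \<or> sg = -1" for \<epsilon> sg
  proof -
    have e0: "\<epsilon> > 0" using I e by blast
    interpret small_field "\<lambda>x. \<epsilon> *\<^sub>R jmul (gr (f \<epsilon>) x)" "\<lambda>x h. \<epsilon> *\<^sub>R jmul (hess (f \<epsilon>) x h)" "\<epsilon> * C" "\<epsilon> * C" sg
    proof
      show "((\<lambda>x. \<epsilon> *\<^sub>R jmul (gr (f \<epsilon>) x)) has_derivative (\<lambda>h. \<epsilon> *\<^sub>R jmul (hess (f \<epsilon>) x h))) (at x)" for x
        by (intro has_derivative_scaleR_right bounded_linear.has_derivative[OF bounded_linear_jmul] gr_deriv[OF u e(1)])
      show "norm (\<epsilon> *\<^sub>R jmul (gr (f \<epsilon>) x)) \<le> \<epsilon> * C" for x using b(1)[OF e(1), of x] e0 by simp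
      show "norm (\<epsilon> *\<^sub>R jmul (hess (f \<epsilon>) x h)) \<le> \<epsilon> * C * norm h" for x h using b(2)[OF e(1), of x h] e0 by simp
      show "norm (\<epsilon> *\<^sub>R jmul (hess (f \<epsilon>) x h) - \<epsilon> *\<^sub>R jmul (hess (f \<epsilon>) y h)) \<le> \<epsilon> * C * norm (x - y) * norm h" for x y h
        unfolding scaleR_diff_right[symmetric] using b(3)[OF e(1), of x h y] e0 by (simp add: mult.assoc)
      show "\<epsilon> * C \<le> 1 / 2304" "0 \<le> \<epsilon> * C" using e e0 C by (auto simp: field_simps)
      show "om (\<epsilon> *\<^sub>R jmul (hess (f \<epsilon>) x h)) k + om h (\<epsilon> *\<^sub>R jmul (hess (f \<epsilon>) x k)) = 0" for x h k
        using om_hess[OF u e(1), of x h k] by (simp add: om_bilinear distrib_left[symmetric])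
    qed (rule sg)
    have X: "X x = sg *\<^sub>R vf (f \<epsilon>) \<epsilon> x" for x by (simp add: X_def vf_def)
    have "norm (vf (f \<epsilon>) \<epsilon> x - vf (f \<epsilon>) \<epsilon> y) \<le> 5 * norm (x - y)" for x y
      using X_lip[of x y] sg unfolding X scaleR_diff_right[symmetric] by auto
    moreover obtain \<Phi> where F: "\<And>z. \<Phi> z 0 = z"
      "\<And>z t. t \<in> {0..8} \<Longrightarrow> (\<Phi> z has_vector_derivative X (\<Phi> z t)) (at t within {0..8})"
      "\<And>z t. norm (\<Phi> z t - rot (sg * t) z) \<le> 1152 * (\<epsilon> * C)"
      "\<And>t. t \<in> {0..8} \<Longrightarrow> sympC1 (\<lambda>z. \<Phi> z t) UNIV" using flow by blast
    moreover have "ham (f \<epsilon>) \<epsilon> (\<Phi> z t) = ham (f \<epsilon>) \<epsilon> z" if "t \<in> {0..8}" for z t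
      using ham_conserved[of "\<Phi> z" sg "f \<epsilon>" \<epsilon> t] F(1,2) that u e(1) unfolding X by (simp add: UC_Suc)
    ultimately show ?thesis unfolding is_flow_def X by (intro conjI allI exI[of _ \<Phi>]) (auto simp: mult_ac)
  qed
  show ?thesis
    by (rule exI[of _ "1152 * C"], intro conjI, simp add: C, rule exI[of _ "1 / (2304 * C)"]) (use C main[of _ 1] main[of _ "-1"] in auto)
qed

section \<open>Midpoint generating functions\<close>

lemma UC_shrink: "UC k I f \<Longrightarrow> I' \<subseteq> I \<Longrightarrow> UC k I' f"
proof (induction k arbitrary: f)
  case 0
  then show ?case by (simp, meson subsetD)
next
  case (Suc k)
  have "UC 0 I' f" using UC_0[OF Suc.prems(1)] Suc.prems(2) by (simp, meson subsetD)
  then show ?case using Suc by (auto simp: UC_Suc)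
qed

lemma UC_det:
  fixes A :: "'i \<Rightarrow> real ^ 4 \<Rightarrow> real ^ 4 ^ 4"
  assumes "\<And>a b. UC k I (\<lambda>i x. A i x $ a $ b)"
  shows "UC k I (\<lambda>i x. det (A i x))"
  unfolding det_def
  by (intro UC_sum UC_cmult UC_prod assms) (auto intro: finite_permutations)

text \<open>A determinant bounded away from 0 lets Cramer's rule express inverse matrices within the
  classes \<open>UC\<close>.\<close>

lemma det_near_identity:
  "\<exists>\<eta>>0. \<forall>A :: real ^ 4 ^ 4. (\<forall>a b. \<bar>A $ a $ b - mat 1 $ a $ b\<bar> \<le> \<eta>) \<longrightarrow> 1 / 2 \<le> det A"
proof -
  have "continuous_on UNIV (det :: real ^ 4 ^ 4 \<Rightarrow> real)"
    unfolding det_def[abs_def] by (intro continuous_intros)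
  then have "isCont (det :: real ^ 4 ^ 4 \<Rightarrow> real) (mat 1)" by (simp add: continuous_on_eq_continuous_at)
  then obtain d where d: "d > 0" "\<And>A :: real ^ 4 ^ 4. dist A (mat 1) < d \<Longrightarrow> dist (det A) (det (mat 1 :: real ^ 4 ^ 4)) < 1 / 2"
    unfolding continuous_at_eps_delta by (metis half_gt_zero zero_less_one)
  \<comment> \<open>There are 16 entries, so 17 in the denominator makes the distance strictly less
    than \<open>d\<close>.\<close>
  have "1 / 2 \<le> det A" if A: "\<And>a b. \<bar>A $ a $ b - mat 1 $ a $ b\<bar> \<le> d / 17" for A :: "real ^ 4 ^ 4"
  proof -
    let ?E = "A - mat 1"
    have "norm (?E $ a) \<le> 4 * (d / 17)" for a
      by (rule norm_le_4B) (use A in simp)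
    then have "norm ?E \<le> 16 * (d / 17)"
      using norm_le_sum_4[of ?E] by (smt (verit))
    then have "dist A (mat 1) < d" using d(1) by (simp add: dist_norm)
    from d(2)[OF this] show ?thesis unfolding dist_real_def det_I by linarith
  qed
  then show ?thesis using d(1) by (intro exI[of _ "d / 17"]) auto
qed

text \<open>\<open>K\<close> is quadratic, so its increment between two points is exactly its
  derivative at their midpoint.\<close>

lemma kinetic_midpoint:
  "kinetic (2 *\<^sub>R m - z) - kinetic z = m $ 1 * (2 *\<^sub>R (m - z)) $ 1 + m $ 2 * (2 *\<^sub>R (m - z)) $ 2"
  by (simp add: kinetic_eq power2_eq_square field_simps)

text \<open>The map sending \<open>z\<close> to \<open>2 *\<^sub>R m \<epsilon> z - z\<close>
  displaces \<open>z\<close> by \<epsilon> times the Hamiltonian field of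
  \<open>s \<epsilon>\<close> at the midpoint. Its derivative is a Cayley transform of an
  infinitesimally symplectic map, hence symplectic for every \<open>s\<close>. By
  \<open>kinetic_midpoint\<close> the new Hamiltonian differs from
  \<open>kinetic z + \<epsilon> * g \<epsilon> z\<close> exactly by \<epsilon> times the defect of
  the midpoint equation.\<close>

theorem midpoint_map:
  fixes s v g :: "real \<Rightarrow> real ^ 4 \<Rightarrow> real"
  assumes us: "UC (Suc (Suc (Suc k))) I s" and sup: "\<And>i x. i \<in> I \<Longrightarrow> norm x > R \<Longrightarrow> s i x = 0"
    and uv: "UC k I v" and ug: "UC k I g" and I: "\<And>\<epsilon>. \<epsilon> \<in> I \<Longrightarrow> 0 < \<epsilon> \<and> \<epsilon> < 1"
  shows "\<exists>C>0. \<exists>\<epsilon>1>0. \<exists>m. UC k {\<epsilon>\<in>I. \<epsilon> < \<epsilon>1} (\<lambda>\<epsilon> z. v \<epsilon> (2 *\<^sub>R m \<epsilon> z - z) - g \<epsilon> z - kgen (m \<epsilon> z) \<bullet> gr (s \<epsilon>) (m \<epsilon> z)) \<and>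
    (\<forall>\<epsilon>\<in>I. \<epsilon> < \<epsilon>1 \<longrightarrow> (\<forall>z. m \<epsilon> z = z + (\<epsilon> / 2) *\<^sub>R jmul (gr (s \<epsilon>) (m \<epsilon> z)) \<and> norm (m \<epsilon> z - z) \<le> C * \<epsilon> \<and>
       ham (v \<epsilon>) \<epsilon> (2 *\<^sub>R m \<epsilon> z - z) = kinetic z + \<epsilon> * g \<epsilon> z + \<epsilon> * (v \<epsilon> (2 *\<^sub>R m \<epsilon> z - z) - g \<epsilon> z - kgen (m \<epsilon> z) \<bullet> gr (s \<epsilon>) (m \<epsilon> z))) \<and>
     sympC1 (\<lambda>z. 2 *\<^sub>R m \<epsilon> z - z) UNIV \<and> inj (\<lambda>z. 2 *\<^sub>R m \<epsilon> z - z))"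
proof -
  have us3: "UC (Suc (Suc (Suc 0))) I s" using UC_mono[OF us] by simp
  have "\<exists>C>0. \<forall>i\<in>I. \<forall>x y h. norm (jmul (gr (s i) x)) \<le> C \<and> norm (jmul (hess (s i) x h)) \<le> C * norm h \<and>
     norm (jmul (hess (s i) x h) - jmul (hess (s i) y h)) \<le> C * norm (x - y) * norm h"
    by (rule hess_bounds[OF us3 sup])
  then obtain C where C: "C > 0" and b': "\<forall>i\<in>I. \<forall>x y h. norm (jmul (gr (s i) x)) \<le> C \<and> norm (jmul (hess (s i) x h)) \<le> C * norm h \<and>
     norm (jmul (hess (s i) x h) - jmul (hess (s i) y h)) \<le> C * norm (x - y) * norm h" by (elim exE conjE)
  have b: "norm (jmul (gr (s i) x)) \<le> C" "norm (jmul (hess (s i) x h)) \<le> C * norm h" if "i \<in> I" for i x h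
    using b' that by auto
  obtain \<eta> where eta: "\<eta> > 0" "\<And>A :: real ^ 4 ^ 4. (\<forall>a b. \<bar>A $ a $ b - mat 1 $ a $ b\<bar> \<le> \<eta>) \<Longrightarrow> 1 / 2 \<le> det A"
    using det_near_identity by blast
  \<comment> \<open>The first bound makes \<open>N\<close> a contraction, the second keeps the
    determinant of its linearisation above 1/2.\<close>
  define \<epsilon>1 where "\<epsilon>1 = min (1 / C) (\<eta> / C)"
  define I1 where "I1 = {\<epsilon>\<in>I. \<epsilon> < \<epsilon>1}"
  have e1: "\<epsilon>1 > 0" using C eta by (simp add: \<epsilon>1_def)
  have I1: "\<epsilon> > 0" "\<epsilon> < 1" "\<epsilon> * C \<le> 1" "\<epsilon> * C \<le> \<eta>" "\<epsilon> \<in> I" if "\<epsilon> \<in> I1" for \<epsilon>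
  proof -
    have "\<epsilon> < 1 / C" "\<epsilon> < \<eta> / C" using that by (auto simp: I1_def \<epsilon>1_def)
    then show "\<epsilon> * C \<le> 1" "\<epsilon> * C \<le> \<eta>" using C by (auto simp: field_simps)
    show "\<epsilon> > 0" "\<epsilon> < 1" "\<epsilon> \<in> I" using that I by (auto simp: I1_def)
  qed
  define N where "N \<epsilon> x = (\<epsilon> / 2) *\<^sub>R jmul (gr (s \<epsilon>) x)" for \<epsilon> x
  define N' where "N' \<epsilon> x h = (\<epsilon> / 2) *\<^sub>R jmul (hess (s \<epsilon>) x h)" for \<epsilon> x h
  have Nd: "(N \<epsilon> has_derivative N' \<epsilon> x) (at x)" if "\<epsilon> \<in> I1" for \<epsilon> x
    unfolding N_def[abs_def] N'_def[abs_def]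
    by (intro has_derivative_scaleR_right bounded_linear.has_derivative[OF bounded_linear_jmul] gr_deriv[OF us3 I1(5)[OF that]])
  have linN: "linear (N' \<epsilon> x)" if "\<epsilon> \<in> I1" for \<epsilon> x using Nd[OF that] has_derivative_linear by blast
  have N'b0: "norm (N' \<epsilon> x h) \<le> (\<epsilon> * C) / 2 * norm h" if "\<epsilon> \<in> I1" for \<epsilon> x h
    using b(2)[OF I1(5)[OF that], of x h] I1(1)[OF that] unfolding N'_def by (simp add: mult.assoc)
  have N'b: "norm (N' \<epsilon> x h) \<le> norm h / 2" if "\<epsilon> \<in> I1" for \<epsilon> x h
    using N'b0[OF that, of x h] mult_right_mono[OF I1(3)[OF that], of "norm h / 2"] by simp
  have Nb: "norm (N \<epsilon> x) \<le> C * \<epsilon>" if "\<epsilon> \<in> I1" for \<epsilon> x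
  proof -
    have "norm (N \<epsilon> x) \<le> (\<epsilon> / 2) * C"
      using b(1)[OF I1(5)[OF that], of x] I1(1)[OF that] unfolding N_def by simp
    also have "\<dots> \<le> C * \<epsilon>" using C I1(1)[OF that] by simp
    finally show ?thesis .
  qed
  have Nl: "norm (N \<epsilon> x - N \<epsilon> y) \<le> norm (x - y) / 2" if e: "\<epsilon> \<in> I1" for \<epsilon> x y
  proof -
    have "norm (N \<epsilon> x - N \<epsilon> y) \<le> (1/2) * norm (x - y)"
    proof (rule differentiable_bound[where S = UNIV and f' = "N' \<epsilon>"])
      show "onorm (N' \<epsilon> z) \<le> 1 / 2" for z by (rule onorm_bound) (use N'b[OF e] in auto)
    qed (use Nd[OF e] in auto)
    then show ?thesis by simp
  qed
  have "\<exists>g. (\<forall>y. g y = y + N \<epsilon> (g y)) \<and> (\<forall>y y'. norm (g y - g y') \<le> 2 * norm (y - y'))" if "\<epsilon> \<in> I1" for \<epsilon>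
    using near_identity_inverse[of "N \<epsilon>", OF Nl[OF that]] by metis
  then obtain m where m: "\<And>\<epsilon> z. \<epsilon> \<in> I1 \<Longrightarrow> m \<epsilon> z = z + N \<epsilon> (m \<epsilon> z)"
    "\<And>\<epsilon> z z'. \<epsilon> \<in> I1 \<Longrightarrow> norm (m \<epsilon> z - m \<epsilon> z') \<le> 2 * norm (z - z')" by metis
  have mz: "norm (m \<epsilon> z - z) \<le> C * \<epsilon>" if "\<epsilon> \<in> I1" for \<epsilon> z
    using Nb[OF that, of "m \<epsilon> z"] m(1)[OF that, of z] by (metis add_diff_cancel_left')
  have "\<exists>D. (m \<epsilon> has_derivative D) (at z) \<and> (\<forall>h. D h = h + N' \<epsilon> (m \<epsilon> z) (D h)) \<and> (\<forall>h. norm (D h) \<le> 2 * norm h)"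
    if "\<epsilon> \<in> I1" for \<epsilon> z
    by (rule near_identity_inverse_deriv[OF m[OF that] Nd[OF that] N'b[OF that]])
  then obtain D where D: "\<And>\<epsilon> z. \<epsilon> \<in> I1 \<Longrightarrow> (m \<epsilon> has_derivative D \<epsilon> z) (at z)"
    "\<And>\<epsilon> z h. \<epsilon> \<in> I1 \<Longrightarrow> D \<epsilon> z h = h + N' \<epsilon> (m \<epsilon> z) (D \<epsilon> z h)" by metis
  define A :: "real \<Rightarrow> real ^ 4 \<Rightarrow> real ^ 4 ^ 4" where "A \<epsilon> x = matrix (\<lambda>h. h - N' \<epsilon> x h)" for \<epsilon> x
  \<comment> \<open>Cramer's rule for the inverse of \<open>A \<epsilon> x\<close>: a smooth
    expression in the second derivatives of \<open>s\<close> at \<open>x\<close>.\<close>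
  define q where "q \<epsilon> x l c = det (\<chi> i j. if j = c then axis l 1 $ i else A \<epsilon> x $ i $ j) / det (A \<epsilon> x)" for \<epsilon> x and l c :: 4
  have A_nth: "A \<epsilon> x $ a $ c = mat 1 $ a $ c - N' \<epsilon> x (axis c 1) $ a" for \<epsilon> x a c
    by (simp add: A_def matrix_def mat_def axis_def)
  have detA: "1 / 2 \<le> det (A \<epsilon> x)" if e: "\<epsilon> \<in> I1" for \<epsilon> x
  proof (rule eta(2), intro allI)
    fix a c
    have "\<bar>N' \<epsilon> x (axis c 1) $ a\<bar> \<le> \<epsilon> * C / 2 * norm (axis c 1 :: real ^ 4)"
      using component_le_norm_cart[of "N' \<epsilon> x (axis c 1)" a] N'b0[OF e, of x "axis c 1"] by linarith
    also have "\<dots> \<le> \<eta>" using I1(4)[OF e] eta(1) by simp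
    finally show "\<bar>A \<epsilon> x $ a $ c - mat 1 $ a $ c\<bar> \<le> \<eta>" by (simp add: A_nth)
  qed
  have Dq: "D \<epsilon> z (axis l 1) $ c = q \<epsilon> (m \<epsilon> z) l c" if e: "\<epsilon> \<in> I1" for \<epsilon> z l c
  proof -
    have l: "linear (\<lambda>h. h - N' \<epsilon> (m \<epsilon> z) h)" using linear_compose_sub[OF linear_id[unfolded id_def] linN[OF e]] by simp
    have "A \<epsilon> (m \<epsilon> z) *v D \<epsilon> z (axis l 1) = axis l 1"
      unfolding A_def using matrix_works[of "\<lambda>h. h - N' \<epsilon> (m \<epsilon> z) h"] l D(2)[OF e, of z "axis l 1"]
      by (simp add: linear_matrix_vector_mul_eq) (metis add_diff_cancel_right')
    then have "D \<epsilon> z (axis l 1) = (\<chi> c. q \<epsilon> (m \<epsilon> z) l c)"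
      unfolding q_def using cramer[of "A \<epsilon> (m \<epsilon> z)" "D \<epsilon> z (axis l 1)" "axis l 1"] detA[OF e, of "m \<epsilon> z"] by auto
    then show ?thesis by simp
  qed
  have sub: "I1 \<subseteq> I" by (auto simp: I1_def)
  have us1: "UC (Suc (Suc (Suc k))) I1 s" by (rule UC_shrink[OF us sub])
  have ue: "UC n I1 (\<lambda>\<epsilon> x. \<epsilon> / 2)" for n by (rule UC_const[of _ _ 1]) (use I1 in force)
  have uA: "UC (Suc k) I1 (\<lambda>\<epsilon> x. A \<epsilon> x $ a $ c)" for a c
  proof -
    have h: "hess (s \<epsilon>) x (axis c 1) $ j = pd c (pd j (s \<epsilon>)) x" for \<epsilon> x j by (simp add: hess_def axis_sum)
    have p: "UC (Suc k) I1 (\<lambda>\<epsilon> x. pd c (pd j (s \<epsilon>)) x)" for j by (rule UC_pd[OF UC_pd[OF us1]])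
    have p0: "UC (Suc k) I1 (\<lambda>\<epsilon> x. - pd c (pd j (s \<epsilon>)) x)" for j using UC_cmult[OF p, of "-1"] by simp
    have "UC (Suc k) I1 (\<lambda>\<epsilon> x. jmul (hess (s \<epsilon>) x (axis c 1)) $ a)"
      using exhaust_4[of a] by (auto simp: h intro!: UC_diff p p0)
    then have "UC (Suc k) I1 (\<lambda>\<epsilon> x. mat 1 $ a $ c - (\<epsilon> / 2) * jmul (hess (s \<epsilon>) x (axis c 1)) $ a)"
      by (intro UC_diff UC_mult ue UC_const')
    then show ?thesis by (simp add: A_nth N'_def)
  qed
  have uq: "UC (Suc k) I1 (\<lambda>\<epsilon> x. q \<epsilon> x l c)" for l c
  proof -
    have 1: "UC (Suc k) I1 (\<lambda>\<epsilon> x. det (\<chi> i j. if j = c then axis l 1 $ i else A \<epsilon> x $ i $ j))"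
    proof (rule UC_det)
      show "UC (Suc k) I1 (\<lambda>\<epsilon> x. (\<chi> i j. if j = c then axis l 1 $ i else A \<epsilon> x $ i $ j) $ a $ b)" for a b
        by (cases "b = c") (auto intro: UC_const' uA)
    qed
    have 2: "UC (Suc k) I1 (\<lambda>\<epsilon> x. 1 / det (A \<epsilon> x))"
    proof (rule UC_inverse[OF UC_det[OF uA]])
      show "\<exists>c>0. \<forall>i\<in>I1. \<forall>x. norm x \<le> r \<longrightarrow> c \<le> \<bar>det (A i x)\<bar>" for r
      proof (intro exI[of _ "1/2"] conjI ballI allI impI)
        show "1 / 2 \<le> \<bar>det (A i x)\<bar>" if "i \<in> I1" for i x using detA[OF that, of x] by linarith
      qed simp
    qed
    show ?thesis using UC_mult[OF 1 2] by (simp add: q_def)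
  qed
  have mb: "norm (m \<epsilon> z) \<le> r + C" if "\<epsilon> \<in> I1" "norm z \<le> r" for \<epsilon> z r
  proof -
    have "norm (m \<epsilon> z) \<le> norm z + norm (m \<epsilon> z - z)" using norm_triangle_ineq[of z "m \<epsilon> z - z"] by simp
    also have "\<dots> \<le> r + C * \<epsilon>" using that mz by (intro add_mono) auto
    also have "\<dots> \<le> r + C" using C I1(2)[OF that(1)] by (simp add: mult_left_le)
    finally show ?thesis .
  qed
  have bd: "\<exists>B. \<forall>i\<in>I1. \<forall>x. norm x \<le> r \<longrightarrow> \<bar>P i (m i x)\<bar> \<le> B" if "UC n I1 P" for r n P
    using UC_bound[OF that, of "r + C"] mb by meson
  have mcont: "continuous_on UNIV (m \<epsilon>)" if "\<epsilon> \<in> I1" for \<epsilon>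
    using D(1)[OF that] by (meson continuous_at_imp_continuous_on has_derivative_continuous)
  \<comment> \<open>The derivative of \<open>m\<close> is \<open>q\<close> composed with
    \<open>m\<close> itself. So the chain rule reproduces expressions of the form
    \<open>P \<epsilon> (m \<epsilon> z)\<close>, and the induction needs no smoothness of
    \<open>m\<close> in advance.\<close>
  have comp: "UC n I1 (\<lambda>\<epsilon> z. P \<epsilon> (m \<epsilon> z))" if "n \<le> Suc k" "UC n I1 P" for n P
    using that
  proof (induction n arbitrary: P)
    case 0
    have "continuous_on UNIV (\<lambda>z. P \<epsilon> (m \<epsilon> z))" if "\<epsilon> \<in> I1" for \<epsilon>
      by (rule continuous_on_compose2[OF UC_continuous[OF 0(2) that] mcont[OF that]]) simp
    then show ?case using bd[OF 0(2)] by simp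
  next
    case (Suc n)
    show ?case
    proof (rule UC_SucI[OF bd[OF Suc.prems(2)] has_derivative_compose[OF D(1) UC_deriv[OF Suc.prems(2)]]])
      show "UC n I1 (\<lambda>\<epsilon> z. \<Sum>j\<in>UNIV. D \<epsilon> z (axis l 1) $ j * pd j (P \<epsilon>) (m \<epsilon> z))" for l
      proof -
        have "UC n I1 (\<lambda>\<epsilon> z. \<Sum>j\<in>UNIV. q \<epsilon> (m \<epsilon> z) l j * pd j (P \<epsilon>) (m \<epsilon> z))"
          by (intro UC_sum UC_mult Suc.IH UC_pd[OF Suc.prems(2)] UC_mono[OF uq]) (use Suc.prems in auto)
        then show ?thesis by (subst UC_cong[of I1 _ "\<lambda>\<epsilon> z. \<Sum>j\<in>UNIV. q \<epsilon> (m \<epsilon> z) l j * pd j (P \<epsilon>) (m \<epsilon> z)"]) (auto simp: Dq)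
      qed
    qed
  qed
  have um: "UC k I1 (\<lambda>\<epsilon> z. m \<epsilon> z $ j)" for j by (rule comp[OF _ UC_coord]) simp
  have uw: "UC k I1 (\<lambda>\<epsilon> z. (2 *\<^sub>R m \<epsilon> z - z) $ j)" for j
    using UC_diff[OF UC_cmult[OF um, of 2 j] UC_coord[of k I1 j]] by simp
  have up: "UC k I1 (\<lambda>\<epsilon> z. pd j (s \<epsilon>) (m \<epsilon> z))" for j
    by (rule comp) (use UC_mono[OF UC_pd[OF us1]] in auto)
  have "UC k I1 (\<lambda>\<epsilon> z. v \<epsilon> (2 *\<^sub>R m \<epsilon> z - z) - g \<epsilon> z - (m \<epsilon> z $ 2 * pd 1 (s \<epsilon>) (m \<epsilon> z)
     - m \<epsilon> z $ 1 * pd 2 (s \<epsilon>) (m \<epsilon> z) + m \<epsilon> z $ 1 * pd 3 (s \<epsilon>) (m \<epsilon> z) + m \<epsilon> z $ 2 * pd 4 (s \<epsilon>) (m \<epsilon> z)))"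
    by (intro UC_diff UC_add UC_mult um up UC_compose[OF UC_shrink[OF uv sub] uw] UC_shrink[OF ug sub])
  then have E: "UC k I1 (\<lambda>\<epsilon> z. v \<epsilon> (2 *\<^sub>R m \<epsilon> z - z) - g \<epsilon> z - kgen (m \<epsilon> z) \<bullet> gr (s \<epsilon>) (m \<epsilon> z))"
    by (simp add: inner_4 gr_def)
  have main: "(\<forall>z. m \<epsilon> z = z + (\<epsilon> / 2) *\<^sub>R jmul (gr (s \<epsilon>) (m \<epsilon> z)) \<and> norm (m \<epsilon> z - z) \<le> C * \<epsilon> \<and>
       ham (v \<epsilon>) \<epsilon> (2 *\<^sub>R m \<epsilon> z - z) = kinetic z + \<epsilon> * g \<epsilon> z + \<epsilon> * (v \<epsilon> (2 *\<^sub>R m \<epsilon> z - z) - g \<epsilon> z - kgen (m \<epsilon> z) \<bullet> gr (s \<epsilon>) (m \<epsilon> z))) \<and>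
     sympC1 (\<lambda>z. 2 *\<^sub>R m \<epsilon> z - z) UNIV \<and> inj (\<lambda>z. 2 *\<^sub>R m \<epsilon> z - z)" if e: "\<epsilon> \<in> I1" for \<epsilon>
  proof (intro conjI allI)
    fix z
    show mm: "m \<epsilon> z = z + (\<epsilon> / 2) *\<^sub>R jmul (gr (s \<epsilon>) (m \<epsilon> z))" using m(1)[OF e] unfolding N_def .
    show "norm (m \<epsilon> z - z) \<le> C * \<epsilon>" by (rule mz[OF e])
    have "2 *\<^sub>R (m \<epsilon> z - z) = \<epsilon> *\<^sub>R jmul (gr (s \<epsilon>) (m \<epsilon> z))"
      using mm by (metis add_diff_cancel_left' mult.commute nonzero_mult_div_cancel_left scaleR_scaleR times_divide_eq_right zero_neq_numeral)
    then have "kinetic (2 *\<^sub>R m \<epsilon> z - z) = kinetic z + (m \<epsilon> z $ 1 * (\<epsilon> *\<^sub>R jmul (gr (s \<epsilon>) (m \<epsilon> z))) $ 1 + m \<epsilon> z $ 2 * (\<epsilon> *\<^sub>R jmul (gr (s \<epsilon>) (m \<epsilon> z))) $ 2)"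
      using kinetic_midpoint[of "m \<epsilon> z" z] by simp
    then show "ham (v \<epsilon>) \<epsilon> (2 *\<^sub>R m \<epsilon> z - z) = kinetic z + \<epsilon> * g \<epsilon> z + \<epsilon> * (v \<epsilon> (2 *\<^sub>R m \<epsilon> z - z) - g \<epsilon> z - kgen (m \<epsilon> z) \<bullet> gr (s \<epsilon>) (m \<epsilon> z))"
      by (simp add: ham_def inner_4 algebra_simps)
  next
    show "inj (\<lambda>z. 2 *\<^sub>R m \<epsilon> z - z)"
    proof (rule injI)
      fix z z' assume eq: "2 *\<^sub>R m \<epsilon> z - z = 2 *\<^sub>R m \<epsilon> z' - z'"
      have w: "2 *\<^sub>R m \<epsilon> y - y = m \<epsilon> y + N \<epsilon> (m \<epsilon> y)" for y using m(1)[OF e, of y] by (simp add: scaleR_2 algebra_simps)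
      have e': "m \<epsilon> z + N \<epsilon> (m \<epsilon> z) = m \<epsilon> z' + N \<epsilon> (m \<epsilon> z')" using eq unfolding w .
      have "m \<epsilon> z - m \<epsilon> z' = (m \<epsilon> z + N \<epsilon> (m \<epsilon> z)) - N \<epsilon> (m \<epsilon> z) - m \<epsilon> z'" by simp
      also have "\<dots> = N \<epsilon> (m \<epsilon> z') - N \<epsilon> (m \<epsilon> z)" unfolding e' by simp
      finally have "norm (m \<epsilon> z - m \<epsilon> z') = norm (N \<epsilon> (m \<epsilon> z') - N \<epsilon> (m \<epsilon> z))" by (rule arg_cong)
      also have "\<dots> \<le> norm (m \<epsilon> z - m \<epsilon> z') / 2" using Nl[OF e, of "m \<epsilon> z'" "m \<epsilon> z"] by (simp add: norm_minus_commute)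
      finally have "m \<epsilon> z = m \<epsilon> z'" by simp
      then show "z = z'" using eq by simp
    qed
    show "sympC1 (\<lambda>z. 2 *\<^sub>R m \<epsilon> z - z) UNIV" unfolding sympC1_def
    proof (intro exI[of _ "\<lambda>z h. 2 *\<^sub>R D \<epsilon> z h - h"] conjI ballI allI)
      fix z
      show d: "((\<lambda>z. 2 *\<^sub>R m \<epsilon> z - z) has_derivative (\<lambda>h. 2 *\<^sub>R D \<epsilon> z h - h)) (at z)"
        by (intro has_derivative_diff has_derivative_scaleR_right D(1)[OF e] has_derivative_ident)
      have "om (2 *\<^sub>R D \<epsilon> z h - h) (2 *\<^sub>R D \<epsilon> z h' - h') = om h h'" for h h'
      proof -
        let ?u = "D \<epsilon> z h" and ?v = "D \<epsilon> z h'" and ?M = "N' \<epsilon> (m \<epsilon> z)"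
        \<comment> \<open>In terms of \<open>?u\<close>, the direction \<open>h\<close> is
          \<open>?u - ?M ?u\<close> and its image is \<open>?u + ?M ?u\<close>; \<open>om\<close>
          agrees on both because its terms linear in \<open>?M\<close> cancel.\<close>
        have h: "h = ?u - ?M ?u" "h' = ?v - ?M ?v" by (rule eq_diff_eq[THEN iffD2], rule D(2)[OF e, symmetric])+
        have "2 *\<^sub>R a - b = a + c" if "b = a - c" for a b c :: "real ^ 4" using that by (simp add: scaleR_2)
        note w = this[OF h(1)] this[OF h(2)]
        have o: "om (?M ?u) ?v + om ?u (?M ?v) = 0"
          using om_hess[OF us3 I1(5)[OF e], of "m \<epsilon> z" ?u ?v] unfolding N'_def om_bilinear distrib_left[symmetric] by simp
        have "om (?u + ?M ?u) (?v + ?M ?v) - om (?u - ?M ?u) (?v - ?M ?v) = 2 * (om (?M ?u) ?v + om ?u (?M ?v))"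
          by (simp add: om_bilinear)
        then have "om (?u + ?M ?u) (?v + ?M ?v) = om (?u - ?M ?u) (?v - ?M ?v)" using o by simp
        then show ?thesis unfolding w by (simp only: h[symmetric])
      qed
      then show "symp (\<lambda>h. 2 *\<^sub>R D \<epsilon> z h - h)" using has_derivative_linear[OF d] by (auto simp: symp_def)
    next
      fix h
      have lD: "linear (D \<epsilon> z)" for z using D(1)[OF e] has_derivative_linear by blast
      have cq: "continuous_on UNIV (\<lambda>z. D \<epsilon> z (axis l 1))" for l
        by (rule continuous_on_vec4) (use UC_continuous[OF comp[OF le_refl uq] e] in \<open>simp add: Dq[OF e]\<close>)
      have "continuous_on UNIV (\<lambda>z. D \<epsilon> z h)"
        unfolding linear_expand[OF lD, of _ h] by (intro continuous_intros cq)
      then show "continuous_on UNIV (\<lambda>z. 2 *\<^sub>R D \<epsilon> z h - h)" by (intro continuous_intros)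
    qed
  qed
  show ?thesis
    by (rule exI[of _ C], intro conjI C, rule exI[of _ \<epsilon>1], intro conjI e1, rule exI[of _ m])
      (use E main in \<open>auto simp: I1_def\<close>)
qed

section \<open>Eliminating a perturbation along circles through an obstacle\<close>

text \<open>The curve \<open>t \<mapsto> q_part (rot t z)\<close> is a circle with centre \<open>ctr z\<close> and radius \<open>cmod (mom z)\<close>;
  the invariant \<open>uu y z\<close> vanishes iff it passes through \<open>y\<close>. At time \<open>- tau y z\<close> the point of the
  circle is the one in the direction of \<open>y\<close>.\<close>

definition uu :: "real ^ 2 \<Rightarrow> real ^ 4 \<Rightarrow> real" where
  "uu y z = (z $ 3 + z $ 2 - y $ 1)\<^sup>2 + (z $ 4 - z $ 1 - y $ 2)\<^sup>2 - (z $ 1)\<^sup>2 - (z $ 2)\<^sup>2"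

definition mom :: "real ^ 4 \<Rightarrow> complex" where "mom z = Complex (z $ 1) (z $ 2)"
definition ctr :: "real ^ 4 \<Rightarrow> complex" where "ctr z = Complex (z $ 3 + z $ 2) (z $ 4 - z $ 1)"
definition cpt :: "real ^ 2 \<Rightarrow> complex" where "cpt y = Complex (y $ 1) (y $ 2)"

definition tau :: "real ^ 2 \<Rightarrow> real ^ 4 \<Rightarrow> real" where
  "tau y z = Arg2pi ((cpt y - ctr z) / (\<i> * mom z))"

lemma uu_rot: "uu y (rot t z) = uu y z"
proof -
  have "(cos t * z $ 1 + sin t * z $ 2)\<^sup>2 + (cos t * z $ 2 - sin t * z $ 1)\<^sup>2 = (z $ 1)\<^sup>2 + (z $ 2)\<^sup>2"
    using sin_cos_squared_add[of t] by algebra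
  moreover have "rot t z $ 3 + rot t z $ 2 = z $ 3 + z $ 2" "rot t z $ 4 - rot t z $ 1 = z $ 4 - z $ 1"
    by (simp_all add: algebra_simps)
  ultimately show ?thesis unfolding uu_def by simp
qed

lemma cpt_q: "cpt (q_part z) = ctr z + \<i> * mom z"
  by (simp add: cpt_def ctr_def mom_def complex_eq_iff)

lemma norm_cpt: "cmod (cpt a - cpt b) = norm (a - b)"
  by (simp add: cpt_def cmod_def norm_vec_def L2_set_def sum_2)

lemma cpt_q_rot: "cpt (q_part (rot (- t) z)) = ctr z + \<i> * (exp (\<i> * of_real t) * mom z)"
  by (simp add: cpt_def ctr_def mom_def complex_eq_iff Re_exp Im_exp algebra_simps)

text \<open>\<open>uu\<close> is the power of the point \<open>y\<close> with respect to the circle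
  of \<open>z\<close>.\<close>

lemma uu_eq: "uu y z = (cmod (cpt y - ctr z))\<^sup>2 - (cmod (mom z))\<^sup>2"
  by (simp add: uu_def cpt_def ctr_def mom_def cmod_power2) (simp add: power2_eq_square algebra_simps)

text \<open>The left side is the squared distance from \<open>y\<close> to the circle: the
  difference of the two lengths is at most their sum, and their product is the power of the
  point.\<close>

lemma circle_distance:
  shows "(cmod (cpt y - ctr z) - cmod (mom z))\<^sup>2 \<le> \<bar>uu y z\<bar>"
proof -
  let ?a = "cmod (cpt y - ctr z)" and ?b = "cmod (mom z)"
  have "(?a - ?b)\<^sup>2 = \<bar>?a - ?b\<bar> * \<bar>?a - ?b\<bar>" by (simp add: power2_eq_square)
  also have "\<dots> \<le> \<bar>?a - ?b\<bar> * \<bar>?a + ?b\<bar>" by (intro mult_left_mono) (smt (verit) norm_ge_zero)+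
  also have "\<dots> = \<bar>uu y z\<bar>" unfolding uu_eq abs_mult[symmetric] by (simp add: power2_eq_square algebra_simps)
  finally show ?thesis .
qed

text \<open>The circle passes within \<open>R / 2\<close> of \<open>y\<close> while \<open>z\<close>
  itself keeps the distance \<open>R\<close>. So the circle is not a point, and \<open>z\<close>
  does not lie on the ray from the centre through \<open>y\<close>; the argument defining
  \<open>tau\<close> therefore stays off its branch cut.\<close>

lemma tau_facts:
  assumes R: "R > 0" and u: "\<bar>uu y z\<bar> \<le> R\<^sup>2 / 4" and q: "norm (q_part z - y) \<ge> R"
  shows "mom z \<noteq> 0" and "(cpt y - ctr z) / (\<i> * mom z) \<notin> \<real>\<^sub>\<ge>\<^sub>0"
    and "norm (q_part (rot (- tau y z) z) - y) \<le> R / 2"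
proof -
  let ?a = "cmod (cpt y - ctr z)" and ?b = "cmod (mom z)"
  have Qy: "R \<le> cmod (ctr z + \<i> * mom z - cpt y)" using q norm_cpt[of "q_part z" y] by (simp add: cpt_q)
  have "(?a - ?b)\<^sup>2 \<le> (R / 2)\<^sup>2" using circle_distance[of y z] u by (simp add: power_divide)
  then have ab: "\<bar>?a - ?b\<bar> \<le> R / 2" using R by (metis abs_le_square_iff abs_of_pos half_gt_zero)
  have tri: "R \<le> ?a + ?b"
    using Qy norm_triangle_ineq4[of "\<i> * mom z" "cpt y - ctr z"] by (simp add: norm_mult algebra_simps)
  show m: "mom z \<noteq> 0" using ab tri R by auto
  have a: "cpt y - ctr z \<noteq> 0" using ab tri R by auto
  show "(cpt y - ctr z) / (\<i> * mom z) \<notin> \<real>\<^sub>\<ge>\<^sub>0"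
  proof
    assume "(cpt y - ctr z) / (\<i> * mom z) \<in> \<real>\<^sub>\<ge>\<^sub>0"
    then obtain l where l: "l \<ge> 0" "(cpt y - ctr z) / (\<i> * mom z) = of_real l" by (auto simp: nonneg_Reals_def)
    then have e: "cpt y - ctr z = of_real l * (\<i> * mom z)" using m by (simp add: field_simps)
    have "ctr z + \<i> * mom z - cpt y = of_real (1 - l) * (\<i> * mom z)" using e by (simp add: algebra_simps)
    then have "cmod (ctr z + \<i> * mom z - cpt y) = \<bar>1 - l\<bar> * ?b" by (simp add: norm_mult flip: of_real_diff)
    also have "\<dots> = \<bar>(1 - l) * ?b\<bar>" by (simp add: abs_mult)
    also have "(1 - l) * ?b = ?b - ?a" using e l(1) by (simp add: norm_mult left_diff_distrib)
    finally show False using Qy ab R by linarith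
  qed
  define w where "w = (cpt y - ctr z) / (\<i> * mom z)"
  have w: "w \<noteq> 0" using a m by (simp add: w_def)
  have "of_real (cmod w) * exp (\<i> * of_real (tau y z)) = w" unfolding tau_def w_def[symmetric] using Arg2pi_eq[of w] by simp
  then have ex: "exp (\<i> * of_real (tau y z)) = w / of_real (cmod w)" using w by (simp add: field_simps)
  have iw: "\<i> * mom z * w = cpt y - ctr z" using m by (simp add: w_def)
  have "\<i> * (exp (\<i> * of_real (tau y z)) * mom z) = (cpt y - ctr z) / of_real (cmod w)"
    unfolding ex iw[symmetric] by (simp add: mult_ac)
  also have "cmod w = ?a / ?b" by (simp add: w_def norm_divide norm_mult)
  finally have "cpt (q_part (rot (- tau y z) z)) - cpt y = (cpt y - ctr z) * of_real (?b / ?a - 1)"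
    unfolding cpt_q_rot by (simp add: field_simps)
  then have "norm (q_part (rot (- tau y z) z) - y) = ?a * \<bar>?b / ?a - 1\<bar>"
    unfolding norm_cpt[symmetric] by (simp only: norm_mult norm_of_real)
  also have "\<dots> = \<bar>?a * (?b / ?a - 1)\<bar>" by (simp add: abs_mult)
  also have "?a * (?b / ?a - 1) = ?b - ?a" using a by (simp add: right_diff_distrib)
  finally show "norm (q_part (rot (- tau y z) z) - y) \<le> R / 2" using ab by linarith
qed

lemma tau_range: "0 \<le> tau y z" "tau y z \<le> 8"
  using Arg2pi_ge_0 Arg2pi_lt_2pi[of "(cpt y - ctr z) / (\<i> * mom z)"] pi_less_4 unfolding tau_def by auto

lemma continuous_on_Complex: "continuous_on A f \<Longrightarrow> continuous_on A g \<Longrightarrow> continuous_on A (\<lambda>x. Complex (f x) (g x))"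
  unfolding complex_eq by (intro continuous_intros)

lemma tau_continuous:
  assumes R: "R > 0" and u: "\<And>z. z \<in> A \<Longrightarrow> \<bar>uu y z\<bar> \<le> R\<^sup>2 / 4" and q: "\<And>z. z \<in> A \<Longrightarrow> norm (q_part z - y) \<ge> R"
  shows "continuous_on A (tau y)"
proof -
  have c: "continuous_on A (\<lambda>z. (cpt y - ctr z) / (\<i> * mom z))"
    unfolding ctr_def mom_def
    by (intro continuous_intros continuous_on_Complex) (use tau_facts(1)[OF R u q] in \<open>auto simp: mom_def\<close>)
  have "continuous_on (- \<real>\<^sub>\<ge>\<^sub>0) Arg2pi" by (intro continuous_at_imp_continuous_on ballI continuous_at_Arg2pi) auto
  then show ?thesis unfolding tau_def[abs_def]
    by (rule continuous_on_compose2[OF _ c]) (use tau_facts(2)[OF R u q] in auto)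
qed

lemma uu_continuous: "continuous_on A (uu y)"
  unfolding uu_def[abs_def] by (intro continuous_intros)

lemma rot_lipschitz_time: "norm (rot a z - rot b z) \<le> 48 * norm z * \<bar>a - b\<bar>" for z :: "real ^ 4"
proof -
  have "norm (rot a z - rot b z) \<le> (48 * norm z) * norm (a - b)"
  proof (rule differentiable_bound[where S = UNIV and f' = "\<lambda>t h. h *\<^sub>R kgen (rot t z)"])
    show "((\<lambda>t. rot t z) has_derivative (\<lambda>h. h *\<^sub>R kgen (rot t z))) (at t within UNIV)" for t
      using rot_has_vector_derivative[of z t UNIV] by (simp add: has_vector_derivative_def)
    fix t :: real
    have "norm (kgen (rot t z)) \<le> 4 * norm (rot t z)" by (rule norm_kgen_le)
    also have "\<dots> \<le> 48 * norm z" using norm_rot_le[of t z] by simp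
    finally show "onorm (\<lambda>h. h *\<^sub>R kgen (rot t z)) \<le> 48 * norm z"
      by (intro onorm_bound) (auto simp: mult.commute[of _ "norm z"] mult_left_mono mult.commute)
  qed auto
  then show ?thesis by simp
qed

text \<open>As long as the orbit of \<open>B\<close> between the times \<open>a\<close> and
  \<open>b\<close> stays where both fields agree, \<open>F\<close> retraces it backwards. Turning at
  \<open>b\<close> or at \<open>a\<close> thus leads to the same end point, which is what frees the
  turning time from a precise choice.\<close>

lemma flow_cancel:
  assumes F: "is_flow sg f \<epsilon> d F" and B: "is_flow (- sg) f' \<epsilon> d' B"
    and lip: "\<And>x y. norm (vf f \<epsilon> x - vf f \<epsilon> y) \<le> 5 * norm (x - y)" and sg: "\<bar>sg\<bar> = 1"
    and ab: "0 \<le> a" "a \<le> b" "b \<le> 8"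
    and eq: "\<And>s. a \<le> s \<Longrightarrow> s \<le> b \<Longrightarrow> vf f \<epsilon> (B z s) = vf f' \<epsilon> (B z s)"
  shows "F (B z b) b = F (B z a) a"
proof -
  have X: "norm (sg *\<^sub>R vf f \<epsilon> x - sg *\<^sub>R vf f \<epsilon> y) \<le> 5 * norm (x - y)" for x y
    using lip[of x y] sg unfolding scaleR_diff_right[symmetric] norm_scaleR by simp
  have Fd: "(F w has_vector_derivative sg *\<^sub>R vf f \<epsilon> (F w t)) (at t within {0..8})" if "t \<in> {0..8}" for w t
    using F that by (auto simp: is_flow_def)
  have Bd: "(B w has_vector_derivative - (sg *\<^sub>R vf f' \<epsilon> (B w t))) (at t within {0..8})" if "t \<in> {0..8}" for w t
    using B that by (auto simp: is_flow_def)
  have 1: "F (B z b) t = B z (b - t)" if t: "t \<in> {0..b - a}" for t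
  proof (rule ode_unique[OF X _ _ _ t])
    show "(F (B z b) has_vector_derivative sg *\<^sub>R vf f \<epsilon> (F (B z b) s)) (at s within {0..b - a})" if "s \<in> {0..b - a}" for s
      by (rule has_vector_derivative_within_subset[OF Fd]) (use that ab in auto)
    show "((\<lambda>t. B z (b - t)) has_vector_derivative sg *\<^sub>R vf f \<epsilon> (B z (b - s))) (at s within {0..b - a})" if s: "s \<in> {0..b - a}" for s
    proof -
      have m: "((\<lambda>t. b - t) has_derivative (\<lambda>h. - h)) (at s within {0..b - a})" by (auto intro!: derivative_eq_intros)
      have "(B z has_derivative (\<lambda>h. h *\<^sub>R - (sg *\<^sub>R vf f' \<epsilon> (B z (b - s))))) (at (b - s) within {0..8})"
        using Bd[of "b - s" z] s ab by (auto simp: has_vector_derivative_def)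
      then have "(B z has_derivative (\<lambda>h. h *\<^sub>R - (sg *\<^sub>R vf f' \<epsilon> (B z (b - s))))) (at (b - s) within (\<lambda>t. b - t) ` {0..b - a})"
        by (rule has_derivative_subset) (use ab in auto)
      from has_derivative_in_compose[OF m this]
      have "((\<lambda>t. B z (b - t)) has_vector_derivative sg *\<^sub>R vf f' \<epsilon> (B z (b - s))) (at s within {0..b - a})"
        by (simp add: has_vector_derivative_def)
      then show ?thesis using eq[of "b - s"] s by simp
    qed
    show "F (B z b) 0 = B z (b - 0)" using F by (simp add: is_flow_def)
  qed
  have 2: "F (B z a) t = F (B z b) (b - a + t)" if t: "t \<in> {0..a}" for t
  proof (rule ode_unique[OF X _ _ _ t])
    show "(F (B z a) has_vector_derivative sg *\<^sub>R vf f \<epsilon> (F (B z a) s)) (at s within {0..a})" if "s \<in> {0..a}" for s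
      by (rule has_vector_derivative_within_subset[OF Fd]) (use that ab in auto)
    show "((\<lambda>t. F (B z b) (b - a + t)) has_vector_derivative sg *\<^sub>R vf f \<epsilon> (F (B z b) (b - a + s))) (at s within {0..a})" if s: "s \<in> {0..a}" for s
    proof -
      have m: "((\<lambda>t. b - a + t) has_derivative (\<lambda>h. h)) (at s within {0..a})" by (auto intro!: derivative_eq_intros)
      have "(F (B z b) has_derivative (\<lambda>h. h *\<^sub>R (sg *\<^sub>R vf f \<epsilon> (F (B z b) (b - a + s))))) (at (b - a + s) within {0..8})"
        using Fd[of "b - a + s" "B z b"] s ab by (auto simp: has_vector_derivative_def)
      then have "(F (B z b) has_derivative (\<lambda>h. h *\<^sub>R (sg *\<^sub>R vf f \<epsilon> (F (B z b) (b - a + s))))) (at (b - a + s) within (\<lambda>t. b - a + t) ` {0..a})"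
        by (rule has_derivative_subset) (use ab in auto)
      from has_derivative_in_compose[OF m this] show ?thesis by (simp add: has_vector_derivative_def)
    qed
    show "F (B z a) 0 = F (B z b) (b - a + 0)" using F 1[of "b - a"] ab by (simp add: is_flow_def)
  qed
  show ?thesis using 2[of a] ab by simp
qed

lemma flow_inverse:
  assumes "is_flow sg f \<epsilon> d F" "is_flow (- sg) f \<epsilon> d' B"
    "\<And>x y. norm (vf f \<epsilon> x - vf f \<epsilon> y) \<le> 5 * norm (x - y)" "\<bar>sg\<bar> = 1" "t \<in> {0..8}"
  shows "F (B z t) t = z"
  using flow_cancel[OF assms(1-4), of 0 t z] assms by (auto simp: is_flow_def)

lemma vf_eq_open:
  assumes "open T" "x \<in> T" "\<And>y. y \<in> T \<Longrightarrow> f y = f' y" "f differentiable (at x)"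
  shows "vf f \<epsilon> x = vf f' \<epsilon> x"
proof -
  have d: "(f has_derivative frechet_derivative f (at x)) (at x)" using assms(4) frechet_derivative_works by blast
  then have "(f' has_derivative frechet_derivative f (at x)) (at x)"
    by (rule has_derivative_transform_within_open[OF _ assms(1,2)]) (use assms(3) in auto)
  then have "pd j f' x = pd j f x" for j unfolding pd_def using frechet_derivative_at by metis
  then show ?thesis by (simp add: vf_def gr_def)
qed

text \<open>\<open>ham (f \<epsilon>)\<close> is constant along \<open>F\<close>,
  \<open>ham (f' \<epsilon>)\<close> along the backward flow \<open>G\<close>, and both agree at the
  turning point near \<open>y\<close>. By \<open>flow_cancel\<close> the time can be frozen locally.
  For \<open>\<bar>uu y z\<bar>\<close> clearly above \<open>c\<close> the orbit of \<open>G\<close>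
  stays in the region of agreement, the time can be moved to 0, and the map joins the identity. The
  bound on \<open>3 * c\<close> makes \<open>tau\<close> continuous on the band
  \<open>Wz\<close>.\<close>

theorem eliminate:
  fixes f f' :: "real \<Rightarrow> real ^ 4 \<Rightarrow> real"
  assumes uf: "UC (Suc (Suc (Suc 0))) I f" and uf': "UC (Suc (Suc (Suc 0))) I f'"
    and supp: "\<And>i x. i \<in> I \<Longrightarrow> norm x > Rs \<Longrightarrow> f i x = 0" "\<And>i x. i \<in> I \<Longrightarrow> norm x > Rs \<Longrightarrow> f' i x = 0"
    and I: "\<And>\<epsilon>. \<epsilon> \<in> I \<Longrightarrow> 0 < \<epsilon>"
    and Wc: "compact Wc" and U: "open U" "U \<subseteq> Wc" and R: "R > 0" and q: "\<And>z. z \<in> Wc \<Longrightarrow> norm (q_part z - y) \<ge> R"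
    and c: "c > 0" "3 * c \<le> R\<^sup>2 / 4"
    and agree: "\<And>\<epsilon> z. \<epsilon> \<in> I \<Longrightarrow> norm (q_part z - y) < R \<or> c < \<bar>uu y z\<bar> \<Longrightarrow> f \<epsilon> z = f' \<epsilon> z"
  shows "\<exists>M>0. \<exists>\<epsilon>1>0. \<forall>\<epsilon>\<in>I. \<epsilon> < \<epsilon>1 \<longrightarrow> (\<exists>\<Psi>. sympC1 \<Psi> U \<and> inj_on \<Psi> U \<and>
     (\<forall>z\<in>U. norm (\<Psi> z - z) \<le> M * \<epsilon> \<and> ham (f \<epsilon>) \<epsilon> (\<Psi> z) = ham (f' \<epsilon>) \<epsilon> z))"
proof -
  obtain C1 e1 where C1: "C1 > 0" "e1 > 0" and fl1: "\<And>\<epsilon>. \<epsilon> \<in> I \<Longrightarrow> \<epsilon> < e1 \<Longrightarrow>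
    (\<forall>x y. norm (vf (f \<epsilon>) \<epsilon> x - vf (f \<epsilon>) \<epsilon> y) \<le> 5 * norm (x - y)) \<and>
    (\<exists>\<Phi>. is_flow 1 (f \<epsilon>) \<epsilon> (C1 * \<epsilon>) \<Phi>) \<and> (\<exists>\<Phi>. is_flow (-1) (f \<epsilon>) \<epsilon> (C1 * \<epsilon>) \<Phi>)"
    using family_flow[OF uf supp(1) I] by metis
  obtain C2 e2 where C2: "C2 > 0" "e2 > 0" and fl2: "\<And>\<epsilon>. \<epsilon> \<in> I \<Longrightarrow> \<epsilon> < e2 \<Longrightarrow>
    (\<forall>x y. norm (vf (f' \<epsilon>) \<epsilon> x - vf (f' \<epsilon>) \<epsilon> y) \<le> 5 * norm (x - y)) \<and>
    (\<exists>\<Phi>. is_flow 1 (f' \<epsilon>) \<epsilon> (C2 * \<epsilon>) \<Phi>) \<and> (\<exists>\<Phi>. is_flow (-1) (f' \<epsilon>) \<epsilon> (C2 * \<epsilon>) \<Phi>)"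
    using family_flow[OF uf' supp(2) I] by metis
  define C where "C = max C1 C2"
  have C: "C > 0" "C1 \<le> C" "C2 \<le> C" using C1 by (auto simp: C_def)
  obtain B where B: "B > 0" "\<And>z. z \<in> Wc \<Longrightarrow> norm z \<le> B"
    using compact_imp_bounded[OF Wc] by (metis bounded_pos)
  have "uniformly_continuous_on (cball 0 (12 * B + 1)) (uu y)"
    by (intro compact_uniformly_continuous uu_continuous) auto
  then obtain d1 where d1: "d1 > 0" "\<And>a b. norm a \<le> 12 * B + 1 \<Longrightarrow> norm b \<le> 12 * B + 1 \<Longrightarrow> dist a b < d1 \<Longrightarrow> \<bar>uu y a - uu y b\<bar> < c / 4"
    using c(1) unfolding uniformly_continuous_on_def dist_real_def
    by (metis divide_pos_pos mem_cball_0 zero_less_numeral dist_commute abs_minus_commute)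
  define Wz where "Wz = {z \<in> Wc. \<bar>uu y z\<bar> \<le> 3 * c}"
  have Wz: "compact Wz"
  proof -
    have "Wz = Wc \<inter> {z. \<bar>uu y z\<bar> \<le> 3 * c}" by (auto simp: Wz_def)
    moreover have "closed {z. \<bar>uu y z\<bar> \<le> 3 * c}" by (intro closed_Collect_le continuous_intros uu_continuous)
    ultimately show ?thesis using Wc by (simp add: compact_Int_closed)
  qed
  have WzR: "\<bar>uu y z\<bar> \<le> R\<^sup>2 / 4" "norm (q_part z - y) \<ge> R" if "z \<in> Wz" for z
    using that c(2) q by (auto simp: Wz_def)
  \<comment> \<open>A time shift \<tau>0 moves a point by at most
    \<open>48 * B * \<tau>0 = R / 8\<close> and its position by \<open>R / 4\<close>.\<close>
  define \<tau>0 where "\<tau>0 = R / (384 * B)"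
  have t0: "\<tau>0 > 0" using R B by (simp add: \<tau>0_def)
  have "uniformly_continuous_on Wz (tau y)"
    by (intro compact_uniformly_continuous tau_continuous[OF R] Wz WzR)
  then obtain d2 where d2: "d2 > 0" "\<And>a b. a \<in> Wz \<Longrightarrow> b \<in> Wz \<Longrightarrow> dist a b < d2 \<Longrightarrow> \<bar>tau y a - tau y b\<bar> < \<tau>0"
    using t0 unfolding uniformly_continuous_on_def dist_real_def by (metis dist_commute abs_minus_commute)
  define lam where "lam = min d1 d2"
  have lam: "lam > 0" using d1 d2 by (simp add: lam_def)
  \<comment> \<open>Bounds on the flow error \<open>C * \<epsilon>\<close>: 1 and \<open>d1\<close>
    keep the change of \<open>uu\<close> below \<open>c / 4\<close>, \<open>R / 8\<close> keeps the
    turn inside the vacuum, and \<open>lam / 26\<close> puts points with equal images within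
    \<open>lam\<close> of each other.\<close>
  define \<epsilon>1 where "\<epsilon>1 = min (min e1 e2) (min (min 1 d1) (min (R / 8) (lam / 26)) / C)"
  have e1: "\<epsilon>1 > 0" using C1 C2 C d1 R lam by (simp add: \<epsilon>1_def)
  show ?thesis
  proof (rule exI[of _ "13 * C"], rule conjI, simp add: C, rule exI[of _ \<epsilon>1], intro conjI e1 ballI impI)
    fix \<epsilon> assume e: "\<epsilon> \<in> I" "\<epsilon> < \<epsilon>1"
    have e0: "\<epsilon> > 0" and ee: "\<epsilon> < e1" "\<epsilon> < e2" using I e by (auto simp: \<epsilon>1_def)
    have "\<epsilon> < min (min 1 d1) (min (R / 8) (lam / 26)) / C" using e by (simp add: \<epsilon>1_def)
    then have "C * \<epsilon> < min (min 1 d1) (min (R / 8) (lam / 26))" using C by (simp add: pos_less_divide_eq mult.commute)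
    then have Ce: "C * \<epsilon> < 1" "C * \<epsilon> < d1" "C * \<epsilon> < R / 8" "26 * (C * \<epsilon>) < lam" by auto
    have lip: "norm (vf (f \<epsilon>) \<epsilon> a - vf (f \<epsilon>) \<epsilon> b) \<le> 5 * norm (a - b)"
      and lip': "norm (vf (f' \<epsilon>) \<epsilon> a - vf (f' \<epsilon>) \<epsilon> b) \<le> 5 * norm (a - b)" for a b
      using fl1[OF e(1) ee(1)] fl2[OF e(1) ee(2)] by blast+
    obtain F Fb where F: "is_flow 1 (f \<epsilon>) \<epsilon> (C1 * \<epsilon>) F" "is_flow (-1) (f \<epsilon>) \<epsilon> (C1 * \<epsilon>) Fb"
      using fl1[OF e(1) ee(1)] by blast
    obtain G Gf where G: "is_flow (-1) (f' \<epsilon>) \<epsilon> (C2 * \<epsilon>) G" "is_flow 1 (f' \<epsilon>) \<epsilon> (C2 * \<epsilon>) Gf"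
      using fl2[OF e(1) ee(2)] by blast
    have CC: "C1 * \<epsilon> \<le> C * \<epsilon>" "C2 * \<epsilon> \<le> C * \<epsilon>" using C e0 by auto
    have nearF: "norm (F z s - rot s z) \<le> C * \<epsilon>" and nearG: "norm (G z s - rot (- s) z) \<le> C * \<epsilon>" if "s \<in> {0..8}" for z s
    proof -
      have "norm (F z s - rot (1 * s) z) \<le> C1 * \<epsilon>" using F(1) that unfolding is_flow_def by blast
      then show "norm (F z s - rot s z) \<le> C * \<epsilon>" using CC by simp
      have "norm (G z s - rot (- 1 * s) z) \<le> C2 * \<epsilon>" using G(1) that unfolding is_flow_def by blast
      then show "norm (G z s - rot (- s) z) \<le> C * \<epsilon>" using CC by simp
    qed
    have Fsymp: "sympC1 (\<lambda>z. F z s) UNIV" and Gsymp: "sympC1 (\<lambda>z. G z s) UNIV" if "s \<in> {0..8}" for s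
      using F(1) G(1) that unfolding is_flow_def by blast+
    have F0: "F z 0 = z" and G0: "G z 0 = z" for z using F(1) G(1) unfolding is_flow_def by blast+
    have Fham: "ham (f \<epsilon>) \<epsilon> (F z s) = ham (f \<epsilon>) \<epsilon> z" and Gham: "ham (f' \<epsilon>) \<epsilon> (G z s) = ham (f' \<epsilon>) \<epsilon> z" if "s \<in> {0..8}" for z s
      using F(1) G(1) that unfolding is_flow_def by blast+
    have vac: "norm (q_part (G z s) - y) < R" if "s \<in> {0..8}" "norm (q_part (rot (- s) z) - y) \<le> 3 * R / 4" for z s
    proof -
      have "norm (q_part (G z s) - q_part (rot (- s) z)) \<le> 2 * (C * \<epsilon>)"
        using norm_q_part_le[of "G z s - rot (- s) z"] nearG[OF that(1), of z] by (simp add: q_part_diff)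
      then show ?thesis using that(2) Ce(3) norm_triangle_ineq[of "q_part (G z s) - q_part (rot (- s) z)" "q_part (rot (- s) z) - y"] by simp
    qed
    have vac2: "c < \<bar>uu y (G z s)\<bar>" if z: "z \<in> U" and s: "s \<in> {0..8}" and u: "\<bar>uu y z\<bar> \<ge> 5 / 4 * c" for z s
    proof -
      have n: "norm (rot (- s) z) \<le> 12 * B" using norm_rot_le[of "- s" z] B(2)[of z] z U by auto
      moreover have "norm (G z s) \<le> 12 * B + 1"
        using norm_triangle_ineq[of "rot (- s) z" "G z s - rot (- s) z"] n nearG[OF s, of z] Ce(1) by simp
      moreover have "dist (G z s) (rot (- s) z) < d1" using nearG[OF s, of z] Ce(2) by (simp add: dist_norm)
      ultimately have "\<bar>uu y (G z s) - uu y (rot (- s) z)\<bar> < c / 4" by (intro d1(2)) auto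
      then show ?thesis using u unfolding uu_rot by linarith
    qed
    have agv: "vf (f \<epsilon>) \<epsilon> x = vf (f' \<epsilon>) \<epsilon> x" if "norm (q_part x - y) < R \<or> c < \<bar>uu y x\<bar>" for x
    proof (rule vf_eq_open[of "{x. norm (q_part x - y) < R} \<union> {x. c < \<bar>uu y x\<bar>}"])
      show "open ({x. norm (q_part x - y) < R} \<union> {x. c < \<bar>uu y x\<bar>})"
        by (intro open_Un open_Collect_less continuous_intros uu_continuous linear_continuous_on bounded_linear_q_part)
      show "f \<epsilon> differentiable at x" using uf e(1) by (simp add: UC_Suc)
    qed (use that agree[OF e(1)] in auto)
    define \<Psi> where "\<Psi> z = (if \<bar>uu y z\<bar> < 2 * c then F (G z (tau y z)) (tau y z) else z)" for z
    have same: "F (G z b) b = F (G z a) a" if ab: "0 \<le> a" "a \<le> b" "b \<le> 8"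
      and v: "\<And>s. a \<le> s \<Longrightarrow> s \<le> b \<Longrightarrow> norm (q_part (G z s) - y) < R \<or> c < \<bar>uu y (G z s)\<bar>" for z a b
      by (rule flow_cancel[OF F(1) _ lip _ ab]) (use G(1) agv v in auto)
    have inj: "z = z'" if "F (G z t) t = F (G z' t) t" "t \<in> {0..8}" for z z' t
    proof -
      have "Fb (F w t) t = w" for w by (rule flow_inverse[OF F(2) _ lip]) (use F(1) that in auto)
      then have "G z t = G z' t" using that(1) by metis
      moreover have "Gf (G w t) t = w" for w by (rule flow_inverse[OF G(2) _ lip']) (use G(1) that in auto)
      ultimately show ?thesis by metis
    qed
    have tr: "tau y z \<in> {0..8}" for z using tau_range by auto
    \<comment> \<open>The time is frozen at \<open>tau y z\<close> if
      \<open>\<bar>uu y z\<bar> < 3 / 2 * c\<close> and at 0 otherwise. The thresholds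
      \<open>c\<close>, \<open>5 / 4 * c\<close>, \<open>3 / 2 * c\<close> and \<open>2 * c\<close>
      are far enough apart for the variation \<open>c / 4\<close> of \<open>uu\<close> over the
      distance \<open>lam\<close> and along the orbit.\<close>
    have loc: "\<exists>t\<in>{0..8}. \<forall>z'\<in>U. dist z z' < lam \<longrightarrow> \<Psi> z' = F (G z' t) t" if z: "z \<in> U" for z
    proof (cases "\<bar>uu y z\<bar> < 3 / 2 * c")
      case True
      show ?thesis
      proof (intro bexI[OF _ tr[of z]] ballI impI)
        fix z' assume z': "z' \<in> U" "dist z z' < lam"
        have zB: "norm z \<le> B" "norm z' \<le> B" using B(2) z z' U by auto
        have "\<bar>uu y z - uu y z'\<bar> < c / 4" using d1(2)[of z z'] zB B(1) z'(2) by (simp add: lam_def)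
        then have u': "\<bar>uu y z'\<bar> < 2 * c" using True by linarith
        have inW: "z \<in> Wz" "z' \<in> Wz" using True u' z z' U c by (auto simp: Wz_def)
        have dt: "\<bar>tau y z - tau y z'\<bar> < \<tau>0" using d2(2)[OF inW] z'(2) by (simp add: lam_def)
        have near: "norm (q_part (G z' s) - y) < R" if s: "s \<in> {0..8}" "\<bar>s - tau y z'\<bar> \<le> \<tau>0" for s
        proof (rule vac[OF s(1)])
          have "norm (rot (- s) z' - rot (- tau y z') z') \<le> 48 * norm z' * \<bar>- s - - tau y z'\<bar>" by (rule rot_lipschitz_time)
          also have "\<dots> \<le> 48 * B * \<tau>0" using zB B(1) s(2) t0 by (intro mult_mono) auto
          also have "\<dots> = R / 8" using B(1) by (simp add: \<tau>0_def)
          finally have "norm (q_part (rot (- s) z') - q_part (rot (- tau y z') z')) \<le> R / 4"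
            using norm_q_part_le[of "rot (- s) z' - rot (- tau y z') z'"] by (simp add: q_part_diff)
          moreover have "norm (q_part (rot (- tau y z') z') - y) \<le> R / 2"
            by (rule tau_facts(3)[OF R WzR[OF inW(2)]])
          ultimately show "norm (q_part (rot (- s) z') - y) \<le> 3 * R / 4"
            using norm_triangle_ineq[of "q_part (rot (- s) z') - q_part (rot (- tau y z') z')" "q_part (rot (- tau y z') z') - y"] by simp
        qed
        have "F (G z' (tau y z')) (tau y z') = F (G z' (tau y z)) (tau y z)"
        proof (cases "tau y z \<le> tau y z'")
          case True
          show ?thesis by (rule same) (use True tr[of z] tr[of z'] dt near in auto)
        next
          case False
          show ?thesis by (rule same[symmetric]) (use False tr[of z] tr[of z'] dt near in auto)
        qed
        then show "\<Psi> z' = F (G z' (tau y z)) (tau y z)" using u' by (simp add: \<Psi>_def)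
      qed
    next
      case False
      have "\<Psi> z' = F (G z' 0) 0" if z': "z' \<in> U" "dist z z' < lam" for z'
      proof -
        have zB: "norm z \<le> B" "norm z' \<le> B" using B(2) z z' U by auto
        have "\<bar>uu y z - uu y z'\<bar> < c / 4" using d1(2)[of z z'] zB B(1) z'(2) by (simp add: lam_def)
        then have u': "\<bar>uu y z'\<bar> \<ge> 5 / 4 * c" using False by linarith
        have "F (G z' (tau y z')) (tau y z') = F (G z' 0) 0"
          by (rule same) (use tr[of z'] vac2[OF z'(1) _ u'] in auto)
        then show ?thesis by (simp add: \<Psi>_def F0 G0)
      qed
      then show ?thesis by (intro bexI[of _ 0]) auto
    qed
    have nearid: "norm (F (G z t) t - z) \<le> 13 * C * \<epsilon>" if "t \<in> {0..8}" for z t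
    proof -
      have "F (G z t) t - z = (F (G z t) t - rot t (G z t)) + rot t (G z t - rot (- t) z)"
        by (simp add: rot_diff rot_rot)
      also have "norm \<dots> \<le> C * \<epsilon> + 12 * (C * \<epsilon>)"
        using nearF[OF that] nearG[OF that, of z] norm_rot_le[of t "G z t - rot (- t) z"]
        by (intro norm_triangle_mono) auto
      finally show ?thesis by simp
    qed
    have nid: "norm (\<Psi> z - z) \<le> 13 * C * \<epsilon>" if z: "z \<in> U" for z
    proof -
      obtain t where "t \<in> {0..8}" "\<Psi> z = F (G z t) t" using loc[OF z] z lam by auto
      then show ?thesis using nearid by simp
    qed
    show "\<exists>\<Psi>. sympC1 \<Psi> U \<and> inj_on \<Psi> U \<and> (\<forall>z\<in>U. norm (\<Psi> z - z) \<le> 13 * C * \<epsilon> \<and> ham (f \<epsilon>) \<epsilon> (\<Psi> z) = ham (f' \<epsilon>) \<epsilon> z)"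
    proof (intro exI[of _ \<Psi>] conjI ballI nid)
      show "sympC1 \<Psi> U"
      proof (rule sympC1_local[OF U(1)])
        fix z assume z: "z \<in> U"
        obtain t where t: "t \<in> {0..8}" "\<forall>z'\<in>U. dist z z' < lam \<longrightarrow> \<Psi> z' = F (G z' t) t" using loc[OF z] by blast
        have "sympC1 (\<lambda>z. F (G z t) t) (U \<inter> ball z lam)"
          by (rule sympC1_subset[OF sympC1_compose[OF Fsymp[OF t(1)] Gsymp[OF t(1)]]]) auto
        then show "\<exists>T \<Phi>. open T \<and> z \<in> T \<and> sympC1 \<Phi> T \<and> (\<forall>x\<in>T. \<Psi> x = \<Phi> x)"
          by (intro exI[of _ "U \<inter> ball z lam"] exI[of _ "\<lambda>z. F (G z t) t"]) (use U z lam t(2) in auto)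
      qed
      show "inj_on \<Psi> U"
      proof (rule inj_onI)
        fix z z' assume z: "z \<in> U" "z' \<in> U" "\<Psi> z = \<Psi> z'"
        \<comment> \<open>Points with equal images are so close that they share one frozen time, and
          for fixed time the composition of flows is injective.\<close>
        have "norm (z - z') \<le> norm (\<Psi> z' - z') + norm (\<Psi> z - z)"
          using norm_triangle_ineq4[of "\<Psi> z' - z'" "\<Psi> z - z"] z(3) by (simp add: norm_minus_commute)
        then have dz: "dist z z' < lam" using nid[OF z(1)] nid[OF z(2)] Ce(4) by (simp add: dist_norm)
        obtain t where t: "t \<in> {0..8}" "\<forall>z'\<in>U. dist z z' < lam \<longrightarrow> \<Psi> z' = F (G z' t) t" using loc[OF z(1)] by blast
        then have "F (G z t) t = F (G z' t) t" using z dz lam by (metis dist_self)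
        then show "z = z'" using inj t(1) by blast
      qed
      fix z assume z: "z \<in> U"
      show "ham (f \<epsilon>) \<epsilon> (\<Psi> z) = ham (f' \<epsilon>) \<epsilon> z"
      proof (cases "\<bar>uu y z\<bar> < 2 * c")
        case True
        then have inW: "z \<in> Wz" using z U c by (auto simp: Wz_def)
        have "norm (q_part (rot (- tau y z) z) - y) \<le> 3 * R / 4"
          using tau_facts(3)[OF R WzR[OF inW]] R by simp
        then have "f \<epsilon> (G z (tau y z)) = f' \<epsilon> (G z (tau y z))" using vac[OF tr] agree[OF e(1)] by blast
        then have "ham (f \<epsilon>) \<epsilon> (G z (tau y z)) = ham (f' \<epsilon>) \<epsilon> (G z (tau y z))" by (simp add: ham_def)
        then show ?thesis using True Fham[OF tr] Gham[OF tr] by (simp add: \<Psi>_def)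
      next
        case False
        then have "f \<epsilon> z = f' \<epsilon> z" using agree[OF e(1)] c by auto
        then show ?thesis using False by (simp add: \<Psi>_def ham_def)
      qed
    qed
  qed
qed

section \<open>Cutoff functions and assembly\<close>

text \<open>The exponent 8 gives class C7; order 6, for the generating function, is the highest that
  is used.\<close>

definition smooth_step :: "real \<Rightarrow> real \<Rightarrow> real \<Rightarrow> real" where
  "smooth_step a b v = max 0 (v - a) ^ 8 / (max 0 (v - a) ^ 8 + max 0 (b - v) ^ 8)"

lemma smooth_step_denominator:
  fixes a b v :: real
  assumes "a < b"
  shows "((b - a) / 2) ^ 8 \<le> max 0 (v - a) ^ 8 + max 0 (b - v) ^ 8"
proof (cases "v \<le> (a + b) / 2")
  case True
  have "((b - a) / 2) ^ 8 \<le> max 0 (b - v) ^ 8" using True assms by (intro power_mono) (auto simp: field_simps)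
  then show ?thesis by (smt (verit) zero_le_power max.cobounded1)
next
  case False
  have "((b - a) / 2) ^ 8 \<le> max 0 (v - a) ^ 8" using False assms by (intro power_mono) (auto simp: field_simps)
  then show ?thesis by (smt (verit) zero_le_power max.cobounded1)
qed

lemma smooth_step_eq_0: "v \<le> a \<Longrightarrow> smooth_step a b v = 0"
  by (simp add: smooth_step_def)

lemma smooth_step_eq_1: "a < b \<Longrightarrow> b \<le> v \<Longrightarrow> smooth_step a b v = 1"
  by (simp add: smooth_step_def)

lemma smooth_step_bounds: "0 \<le> smooth_step a b v" "smooth_step a b v \<le> 1"
proof -
  show "0 \<le> smooth_step a b v" unfolding smooth_step_def by (intro divide_nonneg_nonneg add_nonneg_nonneg) auto
  have "x / (x + y) \<le> 1" if "0 \<le> x" "0 \<le> y" for x y :: real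
    using that by (cases "x + y = 0") (simp_all add: divide_le_eq)
  then show "smooth_step a b v \<le> 1" unfolding smooth_step_def by simp
qed

lemma UC_smooth_step:
  assumes f: "UC k I f" and k: "k < 8" and ab: "a < b"
  shows "UC k I (\<lambda>i x. smooth_step a b (f i x))"
proof -
  have n: "UC k I (\<lambda>i x. max 0 (f i x - a) ^ 8)" "UC k I (\<lambda>i x. max 0 (b - f i x) ^ 8)"
    by (intro UC_pos_power UC_diff UC_const' f k)+
  have "UC k I (\<lambda>i x. 1 / (max 0 (f i x - a) ^ 8 + max 0 (b - f i x) ^ 8))"
  proof (rule UC_inverse[OF UC_add[OF n]])
    show "\<exists>c>0. \<forall>i\<in>I. \<forall>x. norm x \<le> r \<longrightarrow> c \<le> \<bar>max 0 (f i x - a) ^ 8 + max 0 (b - f i x) ^ 8\<bar>" for r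
      using smooth_step_denominator[OF ab] ab
      by (intro exI[of _ "((b - a) / 2) ^ 8"] conjI ballI allI impI order_trans[OF _ abs_ge_self]) auto
  qed
  from UC_mult[OF n(1) this] show ?thesis by (simp add: smooth_step_def)
qed

section \<open>Removal of the perturbation over a finite list of obstacles\<close>

definition nbhd :: "'a::metric_space set \<Rightarrow> real \<Rightarrow> 'a set" where
  "nbhd K s = {z. \<exists>k\<in>K. dist z k < s}"

lemma open_nbhd [simp]: "open (nbhd K s)"
proof -
  have "nbhd K s = (\<Union>k\<in>K. ball k s)" by (auto simp: nbhd_def dist_commute)
  then show ?thesis by (simp add: open_UN)
qed

lemma nbhd_near: "z \<in> nbhd K s \<Longrightarrow> dist w z \<le> s' - s \<Longrightarrow> w \<in> nbhd K s'"
proof -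
  assume "z \<in> nbhd K s" and w: "dist w z \<le> s' - s"
  then obtain k where k: "k \<in> K" "dist z k < s" by (auto simp: nbhd_def)
  have "dist w k < s'" using dist_triangle[of w k z] k w by linarith
  then show ?thesis using k by (auto simp: nbhd_def)
qed

lemma compact_closed_nbhd:
  fixes K :: "(real ^ 4) set"
  assumes "compact K"
  shows "compact {z. \<exists>k\<in>K. dist z k \<le> s}"
proof -
  have "{z. \<exists>k\<in>K. dist z k \<le> s} = {x + y |x y. x \<in> K \<and> y \<in> cball 0 s}" (is "?L = ?R")
  proof
    show "?L \<subseteq> ?R"
    proof
      fix z assume "z \<in> ?L"
      then obtain k where "k \<in> K" "dist z k \<le> s" by blast
      moreover from this have "z = k + (z - k)" "z - k \<in> cball 0 s" by (simp_all add: dist_norm norm_minus_commute)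
      ultimately show "z \<in> ?R" by blast
    qed
    show "?R \<subseteq> ?L" by (force simp: dist_norm)
  qed
  then show ?thesis using compact_sums[OF assms compact_cball[of 0 s]] by simp
qed

text \<open>\<open>E\<close> and \<open>E * cut y\<close> agree near \<open>y\<close>, where both
  vanish, and on circles away from \<open>y\<close>, where \<open>cut y\<close> is 1; so
  \<open>eliminate\<close> exchanges them. After all obstacles the perturbation survives only on
  circles that avoid every one of them.\<close>

theorem eliminate_all:
  fixes h :: "real \<Rightarrow> real ^ 4 \<Rightarrow> real" and cut :: "real ^ 2 \<Rightarrow> real ^ 4 \<Rightarrow> real"
  assumes uh: "UC (Suc (Suc (Suc 0))) I h" and hs: "\<And>i x. i \<in> I \<Longrightarrow> norm x > Rs \<Longrightarrow> h i x = 0"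
    and I: "\<And>\<epsilon>. \<epsilon> \<in> I \<Longrightarrow> 0 < \<epsilon>" and K: "compact K" and R: "R > 0"
    and q: "\<And>y z. y \<in> set ys \<Longrightarrow> \<exists>k\<in>K. dist z k \<le> s0 \<Longrightarrow> norm (q_part z - y) \<ge> R"
    and c: "c > 0" "3 * c \<le> R\<^sup>2 / 4"
    and cut: "\<And>y. UC (Suc (Suc (Suc 0))) I (\<lambda>_. cut y)" and cut1: "\<And>y z. c < \<bar>uu y z\<bar> \<Longrightarrow> cut y z = 1"
    and uE: "UC (Suc (Suc (Suc 0))) I E" and Es: "\<And>i x. i \<in> I \<Longrightarrow> norm x > Rs \<Longrightarrow> E i x = 0"
    and Ev: "\<And>i y z. i \<in> I \<Longrightarrow> y \<in> set ys \<Longrightarrow> norm (q_part z - y) < R \<Longrightarrow> E i z = 0"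
    and s: "s < s0"
  shows "\<exists>M>0. \<exists>\<epsilon>1>0. \<forall>\<epsilon>\<in>I. \<epsilon> < \<epsilon>1 \<longrightarrow> (\<exists>\<Psi>. sympC1 \<Psi> (nbhd K s) \<and> inj_on \<Psi> (nbhd K s) \<and>
     (\<forall>z\<in>nbhd K s. norm (\<Psi> z - z) \<le> M * \<epsilon> \<and>
        ham (\<lambda>z. h \<epsilon> z + E \<epsilon> z) \<epsilon> (\<Psi> z) = ham (\<lambda>z. h \<epsilon> z + E \<epsilon> z * (\<Prod>y\<leftarrow>ys. cut y z)) \<epsilon> z))"
  using q uE Es Ev s
proof (induction ys arbitrary: E s)
  case Nil
  have "sympC1 (\<lambda>z. z) (nbhd K s)" unfolding sympC1_def symp_def
    by (intro exI[of _ "\<lambda>_ h. h"]) (auto intro!: derivative_eq_intros linearI)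
  then show ?case using I
    by (intro exI[of _ 1] conjI ballI impI exI[of _ "\<lambda>z. z"]) (auto intro: less_imp_le)
next
  case (Cons y ys)
  \<comment> \<open>An intermediate neighbourhood: the map for the remaining obstacles sends
    \<open>nbhd K s\<close> into \<open>nbhd K s1\<close>, where the map for \<open>y\<close> is
    defined.\<close>
  define s1 where "s1 = (s + s0) / 2"
  have s1: "s < s1" "s1 < s0" using Cons.prems by (auto simp: s1_def)
  let ?E = "\<lambda>\<epsilon> z. E \<epsilon> z * cut y z"
  have uE': "UC (Suc (Suc (Suc 0))) I ?E" by (intro UC_mult Cons.prems cut)
  have "\<exists>M>0. \<exists>\<epsilon>1>0. \<forall>\<epsilon>\<in>I. \<epsilon> < \<epsilon>1 \<longrightarrow> (\<exists>\<Psi>. sympC1 \<Psi> (nbhd K s1) \<and> inj_on \<Psi> (nbhd K s1) \<and>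
     (\<forall>z\<in>nbhd K s1. norm (\<Psi> z - z) \<le> M * \<epsilon> \<and>
        ham (\<lambda>z. h \<epsilon> z + E \<epsilon> z) \<epsilon> (\<Psi> z) = ham (\<lambda>z. h \<epsilon> z + ?E \<epsilon> z) \<epsilon> z))"
  proof (rule eliminate[where Rs = Rs and Wc = "{z. \<exists>k\<in>K. dist z k \<le> s0}" and R = R and y = y and c = c])
    show "UC (Suc (Suc (Suc 0))) I (\<lambda>\<epsilon> z. h \<epsilon> z + E \<epsilon> z)" by (intro UC_add uh Cons.prems)
    show "UC (Suc (Suc (Suc 0))) I (\<lambda>\<epsilon> z. h \<epsilon> z + ?E \<epsilon> z)" by (intro UC_add uh uE')
    show "nbhd K s1 \<subseteq> {z. \<exists>k\<in>K. dist z k \<le> s0}" unfolding nbhd_def using s1(2) by (auto intro!: bexI)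
    show "R \<le> norm (q_part z - y)" if "z \<in> {z. \<exists>k\<in>K. dist z k \<le> s0}" for z
      using Cons.prems(1)[of y z] that by simp
    show "h i z + E i z = h i z + ?E i z" if "i \<in> I" "norm (q_part z - y) < R \<or> c < \<bar>uu y z\<bar>" for i z
      using that Cons.prems(4)[of i y z] cut1[of y z] by auto
  qed (use compact_closed_nbhd[OF K] hs Cons.prems(3) I R c in auto)
  then obtain M1 e1 where M1: "M1 > 0" "e1 > 0" and P1: "\<And>\<epsilon>. \<epsilon> \<in> I \<Longrightarrow> \<epsilon> < e1 \<Longrightarrow> \<exists>\<Psi>. sympC1 \<Psi> (nbhd K s1) \<and> inj_on \<Psi> (nbhd K s1) \<and>
     (\<forall>z\<in>nbhd K s1. norm (\<Psi> z - z) \<le> M1 * \<epsilon> \<and>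
        ham (\<lambda>z. h \<epsilon> z + E \<epsilon> z) \<epsilon> (\<Psi> z) = ham (\<lambda>z. h \<epsilon> z + ?E \<epsilon> z) \<epsilon> z)" by blast
  have "\<exists>M>0. \<exists>\<epsilon>1>0. \<forall>\<epsilon>\<in>I. \<epsilon> < \<epsilon>1 \<longrightarrow> (\<exists>\<Psi>. sympC1 \<Psi> (nbhd K s) \<and> inj_on \<Psi> (nbhd K s) \<and>
     (\<forall>z\<in>nbhd K s. norm (\<Psi> z - z) \<le> M * \<epsilon> \<and>
        ham (\<lambda>z. h \<epsilon> z + ?E \<epsilon> z) \<epsilon> (\<Psi> z) = ham (\<lambda>z. h \<epsilon> z + ?E \<epsilon> z * (\<Prod>y\<leftarrow>ys. cut y z)) \<epsilon> z))"
  proof (rule Cons.IH[OF _ uE'])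
    show "E i z * cut y z = 0" if "i \<in> I" "y' \<in> set ys" "norm (q_part z - y') < R" for i y' z
      using Cons.prems(4)[of i y' z] that by simp
  qed (use Cons.prems in auto)
  then obtain M2 e2 where M2: "M2 > 0" "e2 > 0" and P2: "\<And>\<epsilon>. \<epsilon> \<in> I \<Longrightarrow> \<epsilon> < e2 \<Longrightarrow> \<exists>\<Psi>. sympC1 \<Psi> (nbhd K s) \<and> inj_on \<Psi> (nbhd K s) \<and>
     (\<forall>z\<in>nbhd K s. norm (\<Psi> z - z) \<le> M2 * \<epsilon> \<and>
        ham (\<lambda>z. h \<epsilon> z + ?E \<epsilon> z) \<epsilon> (\<Psi> z) = ham (\<lambda>z. h \<epsilon> z + ?E \<epsilon> z * (\<Prod>y\<leftarrow>ys. cut y z)) \<epsilon> z)" by blast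
  define \<epsilon>1 where "\<epsilon>1 = min (min e1 e2) ((s1 - s) / M2)"
  have e1: "\<epsilon>1 > 0" using M1 M2 s1 by (simp add: \<epsilon>1_def)
  show ?case
  proof (rule exI[of _ "M1 + M2"], intro conjI, use M1 M2 in simp, rule exI[of _ \<epsilon>1], intro conjI e1 ballI impI)
    fix \<epsilon> assume e: "\<epsilon> \<in> I" "\<epsilon> < \<epsilon>1"
    have ee: "\<epsilon> < e1" "\<epsilon> < e2" "M2 * \<epsilon> \<le> s1 - s" using e M2 by (auto simp: \<epsilon>1_def field_simps)
    obtain A where A: "sympC1 A (nbhd K s1)" "inj_on A (nbhd K s1)" and A': "\<And>z. z \<in> nbhd K s1 \<Longrightarrow> norm (A z - z) \<le> M1 * \<epsilon> \<and>
        ham (\<lambda>z. h \<epsilon> z + E \<epsilon> z) \<epsilon> (A z) = ham (\<lambda>z. h \<epsilon> z + ?E \<epsilon> z) \<epsilon> z" using P1[OF e(1) ee(1)] by blast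
    obtain B where B: "sympC1 B (nbhd K s)" "inj_on B (nbhd K s)" and B': "\<And>z. z \<in> nbhd K s \<Longrightarrow> norm (B z - z) \<le> M2 * \<epsilon> \<and>
        ham (\<lambda>z. h \<epsilon> z + ?E \<epsilon> z) \<epsilon> (B z) = ham (\<lambda>z. h \<epsilon> z + ?E \<epsilon> z * (\<Prod>y\<leftarrow>ys. cut y z)) \<epsilon> z" using P2[OF e(1) ee(2)] by blast
    have im: "B ` nbhd K s \<subseteq> nbhd K s1"
      using B' ee(3) nbhd_near[of _ K s _ s1] by (force simp: dist_norm)
    show "\<exists>\<Psi>. sympC1 \<Psi> (nbhd K s) \<and> inj_on \<Psi> (nbhd K s) \<and>
     (\<forall>z\<in>nbhd K s. norm (\<Psi> z - z) \<le> (M1 + M2) * \<epsilon> \<and>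
        ham (\<lambda>z. h \<epsilon> z + E \<epsilon> z) \<epsilon> (\<Psi> z) = ham (\<lambda>z. h \<epsilon> z + E \<epsilon> z * (\<Prod>y\<leftarrow>y # ys. cut y z)) \<epsilon> z)"
    proof (intro exI[of _ "\<lambda>z. A (B z)"] conjI ballI)
      show "sympC1 (\<lambda>z. A (B z)) (nbhd K s)" by (rule sympC1_compose[OF A(1) B(1) im])
      show "inj_on (\<lambda>z. A (B z)) (nbhd K s)"
        using comp_inj_on[OF B(2) inj_on_subset[OF A(2) im]] by (simp add: o_def)
      fix z assume z: "z \<in> nbhd K s"
      then have Bz: "B z \<in> nbhd K s1" using im by blast
      show "norm (A (B z) - z) \<le> (M1 + M2) * \<epsilon>"
        using A'[OF Bz] B'[OF z] norm_triangle_ineq[of "A (B z) - B z" "B z - z"] by (simp add: algebra_simps)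
      have "ham (\<lambda>z. h \<epsilon> z + E \<epsilon> z) \<epsilon> (A (B z)) = ham (\<lambda>z. h \<epsilon> z + ?E \<epsilon> z * (\<Prod>y\<leftarrow>ys. cut y z)) \<epsilon> z"
        using A'[OF Bz] B'[OF z] by simp
      then show "ham (\<lambda>z. h \<epsilon> z + E \<epsilon> z) \<epsilon> (A (B z)) = ham (\<lambda>z. h \<epsilon> z + E \<epsilon> z * (\<Prod>y\<leftarrow>y # ys. cut y z)) \<epsilon> z"
        by (simp add: ham_def mult.assoc)
    qed
  qed
qed

section \<open>Extension of the potential, invariants and gradients\<close>

definition qdom :: "(real ^ 4) set \<Rightarrow> real \<Rightarrow> (complex ^ 2) set" where
  "qdom K r = (\<Union>k\<in>K. ball (complexify (q_part k)) r)"

lemma open_q_part_preimage: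
  assumes "open D" shows "open {z :: complex ^ 4. q_part z \<in> D}"
proof -
  have "continuous_on UNIV (q_part :: complex ^ 4 \<Rightarrow> _)"
    by (rule linear_continuous_on[OF bounded_linear_q_part])
  from open_vimage[OF assms this] show ?thesis by (simp add: vimage_def)
qed

text \<open>On \<open>qdom K (r / 2)\<close> the momentum of a point may be replaced by that of a nearby point of
  \<open>K\<close>, so the hypothesis on \<open>V\<close>, which restricts the momenta as well, covers all momenta.\<close>

lemma potential_extension:
  assumes K: "compact K" and r: "r > 0" and V: "potential_analytic_in V r K"
  shows "\<exists>Vc B. B > 0 \<and> mv_holomorphic_on Vc {z. q_part z \<in> qdom K (r / 2)} \<and>
    (\<forall>z. q_part z \<in> qdom K (r / 2) \<longrightarrow> norm (Vc z) \<le> B) \<and>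
    (\<forall>x. q_part (complexify x) \<in> qdom K (r / 2) \<longrightarrow> Vc (complexify x) = of_real (V (q_part x)))"
proof -
  obtain W where W: "mv_holomorphic_on (\<lambda>z. W (q_part z)) (complex_nbhd r K)"
    and Wr: "\<And>x. complexify x \<in> complex_nbhd r K \<Longrightarrow> W (q_part (complexify x)) = complex_of_real (V (q_part x))"
    using V unfolding potential_analytic_in_def by blast
  define L :: "complex ^ 4 \<Rightarrow> complex ^ 4" where "L h = vector [0, 0, h $ 3, h $ 4]" for h
  have L: "linear L" by (rule linearI) (simp_all add: L_def vec4_eq_iff)
  define A :: "real ^ 4 \<Rightarrow> complex ^ 4 \<Rightarrow> complex ^ 4"
    where "A k z = vector [complex_of_real (k $ 1), complex_of_real (k $ 2), 0, 0] + L z" for k z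
  have Aq: "q_part (A k z) = q_part z" for k z by (simp add: A_def L_def vec_eq_iff forall_2)
  have An: "norm (A k z - complexify k) = norm (q_part z - complexify (q_part k))" for k z
    by (simp add: A_def L_def norm_vec_def L2_set_def sum_4 sum_2)
  have Ad: "(A k has_derivative L) (at z)" for k z
    unfolding A_def[abs_def] using linear_imp_has_derivative[OF L] by (auto intro!: derivative_eq_intros)
  define T where "T = {x + y |x y. x \<in> complexify ` K \<and> y \<in> cball (0 :: complex ^ 4) (r / 2)}"
  have T: "compact T" unfolding T_def
    by (intro compact_sums compact_continuous_image compact_cball K linear_continuous_on bounded_linear_complexify)
  have Tsub: "T \<subseteq> complex_nbhd r K" using r by (auto simp: T_def complex_nbhd_def dist_norm)
  obtain B where B: "B > 0" "\<And>z. z \<in> T \<Longrightarrow> norm (W (q_part z)) \<le> B"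
  proof -
    have "bounded ((\<lambda>z. W (q_part z)) ` T)"
      by (intro compact_imp_bounded compact_continuous_image T continuous_on_subset[OF mvh_continuous_on[OF W] Tsub])
    then show thesis using that by (force simp: bounded_pos)
  qed
  have inT: "\<exists>k. k \<in> K \<and> A k z \<in> T \<and> (\<forall>x. z = complexify x \<longrightarrow> (\<exists>x'. A k z = complexify x' \<and> q_part x' = q_part x))"
    if z: "q_part z \<in> qdom K (r / 2)" for z
  proof -
    obtain k where k: "k \<in> K" "norm (q_part z - complexify (q_part k)) < r / 2"
      using z by (auto simp: qdom_def dist_norm norm_minus_commute)
    have "A k z = complexify k + (A k z - complexify k)" "A k z - complexify k \<in> cball 0 (r / 2)" using k by (simp_all add: An)
    then have "A k z \<in> T" unfolding T_def using k(1) by blast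
    moreover have "A k (complexify x) = complexify (vector [k $ 1, k $ 2, x $ 3, x $ 4] :: real ^ 4)"
      "q_part (vector [k $ 1, k $ 2, x $ 3, x $ 4] :: real ^ 4) = q_part x" for x
      by (simp_all add: A_def L_def vec4_eq_iff vec_eq_iff forall_2)
    ultimately show ?thesis using k(1) by blast
  qed
  show ?thesis
  proof (rule exI[of _ "\<lambda>z. W (q_part z)"], rule exI[of _ B], intro conjI allI impI)
    show "mv_holomorphic_on (\<lambda>z. W (q_part z)) {z. q_part z \<in> qdom K (r / 2)}" unfolding mv_holomorphic_on_def
    proof
      fix z :: "complex ^ 4" assume "z \<in> {z. q_part z \<in> qdom K (r / 2)}"
      then obtain k where k: "A k z \<in> T" using inT by blast
      obtain D where D: "((\<lambda>z. W (q_part z)) has_derivative D) (at (A k z))" "\<And>c v. D (c *s v) = c * D v"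
        using W k Tsub unfolding mv_holomorphic_on_def by blast
      have "((\<lambda>x. W (q_part (A k x))) has_derivative (\<lambda>x. D (L x))) (at z)"
        using has_derivative_compose[OF Ad D(1)] .
      moreover have "L (c *s v) = c *s L v" for c v by (simp add: L_def vec4_eq_iff)
      ultimately show "\<exists>D. ((\<lambda>z. W (q_part z)) has_derivative D) (at z) \<and> (\<forall>c v. D (c *s v) = c * D v)"
        using D(2) by (auto simp: Aq)
    qed
    show "norm (W (q_part z)) \<le> B" if "q_part z \<in> qdom K (r / 2)" for z
      using inT[OF that] B(2) Aq by metis
    show "W (q_part (complexify x)) = of_real (V (q_part x))" if "q_part (complexify x) \<in> qdom K (r / 2)" for x
      using inT[OF that] Wr Tsub Aq by (metis subsetD)
  qed (rule B)
qed

text \<open>Squared radius plus squared norm of the centre of the circle: a rotation-invariant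
  substitute for the squared norm.\<close>

definition rad2 :: "real ^ 4 \<Rightarrow> real" where
  "rad2 z = (z $ 1)\<^sup>2 + (z $ 2)\<^sup>2 + (z $ 3 + z $ 2)\<^sup>2 + (z $ 4 - z $ 1)\<^sup>2"

lemma rad2_rot: "rad2 (rot t z) = rad2 z"
proof -
  have "(cos t * z $ 1 + sin t * z $ 2)\<^sup>2 + (cos t * z $ 2 - sin t * z $ 1)\<^sup>2 = (z $ 1)\<^sup>2 + (z $ 2)\<^sup>2"
    using sin_cos_squared_add[of t] by algebra
  moreover have "rot t z $ 3 + rot t z $ 2 = z $ 3 + z $ 2" "rot t z $ 4 - rot t z $ 1 = z $ 4 - z $ 1"
    by (simp_all add: algebra_simps)
  ultimately show ?thesis unfolding rad2_def by simp
qed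

lemma norm_square_4: "(norm z)\<^sup>2 = (z $ 1)\<^sup>2 + (z $ 2)\<^sup>2 + (z $ 3)\<^sup>2 + (z $ 4)\<^sup>2" for z :: "real ^ 4"
  unfolding power2_norm_eq_inner inner_4 by (simp add: power2_eq_square)

lemma rad2_bounds: "rad2 z \<le> 3 * (norm z)\<^sup>2" "(norm z)\<^sup>2 \<le> 3 * rad2 z"
proof -
  have "3 * (norm z)\<^sup>2 = rad2 z + ((z $ 3 - z $ 2)\<^sup>2 + (z $ 4 + z $ 1)\<^sup>2 + (z $ 3)\<^sup>2 + (z $ 4)\<^sup>2)"
    unfolding rad2_def norm_square_4 by algebra
  moreover have "0 \<le> (z $ 3 - z $ 2)\<^sup>2 + (z $ 4 + z $ 1)\<^sup>2 + (z $ 3)\<^sup>2 + (z $ 4)\<^sup>2" by simp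
  ultimately show "rad2 z \<le> 3 * (norm z)\<^sup>2" by linarith
  have "3 * rad2 z = (norm z)\<^sup>2 + ((z $ 3 + 2 * z $ 2)\<^sup>2 + (z $ 4 - 2 * z $ 1)\<^sup>2 + (z $ 3 + z $ 2)\<^sup>2 + (z $ 4 - z $ 1)\<^sup>2)"
    unfolding rad2_def norm_square_4 by algebra
  moreover have "0 \<le> (z $ 3 + 2 * z $ 2)\<^sup>2 + (z $ 4 - 2 * z $ 1)\<^sup>2 + (z $ 3 + z $ 2)\<^sup>2 + (z $ 4 - z $ 1)\<^sup>2" by simp
  ultimately show "(norm z)\<^sup>2 \<le> 3 * rad2 z" by linarith
qed

lemma has_derivative_gr: "f differentiable (at x) \<Longrightarrow> (f has_derivative (\<lambda>h. h \<bullet> gr f x)) (at x)"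
  using has_derivative_pd[of f x] by (simp add: inner_vec_def gr_def)

lemma gr_unique:
  assumes "(f has_derivative (\<lambda>h. h \<bullet> D)) (at x)"
  shows "gr f x = D"
proof -
  have "f differentiable (at x)" using assms differentiable_def by blast
  from has_derivative_unique[OF has_derivative_gr[OF this] assms] have e: "h \<bullet> gr f x = h \<bullet> D" for h by (rule fun_cong)
  show ?thesis by (rule vector_eq_ldot[THEN iffD1], rule allI) (rule e)
qed

lemma gradient_eq_gr:
  assumes "f differentiable (at x)"
  shows "gradient f x = gr f x"
  unfolding gradient_def gderiv_def
proof (rule the_equality)
  show "(f has_derivative (\<lambda>h. h \<bullet> gr f x)) (at x)" by (rule has_derivative_gr[OF assms])
  show "D = gr f x" if "(f has_derivative (\<lambda>h. h \<bullet> D)) (at x)" for D using gr_unique[OF that] by simp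
qed

lemma poisson_kinetic:
  assumes "f differentiable (at z)"
  shows "poisson f kinetic z = kgen z \<bullet> gr f z"
proof -
  have "(kinetic has_derivative (\<lambda>h. h \<bullet> vector [z $ 1, z $ 2, 0, 0])) (at z)"
    using kinetic_deriv[of z] by (simp add: inner_4 mult.commute)
  then have "gradient kinetic z = vector [z $ 1, z $ 2, 0, 0]"
    using gradient_eq_gr[of kinetic z] gr_unique[of kinetic "vector [z $ 1, z $ 2, 0, 0]" z] by (auto simp: differentiable_def)
  moreover have "jmul (vector [z $ 1, z $ 2, 0, 0]) = kgen z" by (simp add: vec4_eq_iff)
  ultimately show ?thesis using gradient_eq_gr[OF assms] by (simp add: poisson_def J_mult inner_commute)
qed

text \<open>\<open>kgen z\<close> is the velocity at time 0 of the curve \<open>rot t z\<close>,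
  along which \<open>f\<close> is constant.\<close>

lemma invariant_kgen:
  assumes f: "f differentiable (at z)" and inv: "\<And>t. f (rot t z) = f z"
  shows "kgen z \<bullet> gr f z = 0"
proof -
  have "rot 0 z = z" by (simp add: vec4_eq_iff)
  then have "((\<lambda>t. rot t z) has_derivative (\<lambda>t. t *\<^sub>R kgen z)) (at 0)"
    and "(f has_derivative (\<lambda>h. h \<bullet> gr f z)) (at (rot 0 z))"
    using rot_has_vector_derivative[of z 0 UNIV] has_derivative_gr[OF f] by (simp_all only: has_vector_derivative_def)
  from has_derivative_compose[OF this] have "((\<lambda>_ :: real. f z) has_derivative (\<lambda>t. (t *\<^sub>R kgen z) \<bullet> gr f z)) (at 0)" by (simp add: inv)
  from has_derivative_unique[OF this has_derivative_const] have "(1 *\<^sub>R kgen z) \<bullet> gr f z = 0" by (rule fun_cong)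
  then show ?thesis by simp
qed

lemma gr_locally_constant:
  assumes "open T" "x \<in> T" "\<And>y. y \<in> T \<Longrightarrow> f y = c"
  shows "gr f x = 0"
proof (rule gr_unique)
  have "((\<lambda>_. c) has_derivative (\<lambda>h. h \<bullet> 0)) (at x)" by simp
  then show "(f has_derivative (\<lambda>h. h \<bullet> 0)) (at x)"
    by (rule has_derivative_transform_within_open[OF _ assms(1,2)]) (use assms(3) in auto)
qed

section \<open>Cut-off holomorphic functions and the finite net of obstacles\<close>

lemma cut_holomorphic_deriv:
  assumes F: "mv_holomorphic_on F S" and x: "complexify x \<in> S" and r: "\<rho> differentiable (at x)"
  shows "((\<lambda>x. \<rho> x * Re (F (complexify x))) has_derivative
    (\<lambda>h. \<rho> x * Re (fd F (complexify x) (complexify h)) + (h \<bullet> gr \<rho> x) * Re (F (complexify x)))) (at x)"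
proof -
  have "((\<lambda>x. F (complexify x)) has_derivative (\<lambda>h. fd F (complexify x) (complexify h))) (at x)"
    by (rule has_derivative_compose[OF bounded_linear_imp_has_derivative[OF bounded_linear_complexify] mvh_D(1)[OF F x]])
  then have "((\<lambda>x. Re (F (complexify x))) has_derivative (\<lambda>h. Re (fd F (complexify x) (complexify h)))) (at x)"
    by (rule bounded_linear.has_derivative[OF bounded_linear_Re])
  from has_derivative_mult[OF has_derivative_gr[OF r] this] show ?thesis .
qed

lemma inner_Re_fd:
  fixes x h :: "real ^ 4"
  assumes F: "mv_holomorphic_on F S" and x: "complexify x \<in> S"
  shows "Re (fd F (complexify x) (complexify h)) = h \<bullet> (\<chi> j. Re (fd F (complexify x) (axis j 1)))"
proof -
  have "((\<lambda>x. Re (F (complexify x))) has_derivative (\<lambda>h. Re (fd F (complexify x) (complexify h)))) (at x)"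
    using bounded_linear.has_derivative[OF bounded_linear_Re has_derivative_compose[OF bounded_linear_imp_has_derivative[OF bounded_linear_complexify] mvh_D(1)[OF F x]]] .
  then have "linear (\<lambda>h. Re (fd F (complexify x) (complexify h)))" by (rule has_derivative_linear)
  from linear_expand[OF this, of h] have "Re (fd F (complexify x) (complexify h)) = (\<Sum>j\<in>UNIV. h $ j *\<^sub>R Re (fd F (complexify x) (complexify (axis j 1))))" .
  moreover have "complexify (axis j 1 :: real ^ 4) = axis j 1" for j by (simp add: complexify_def axis_def vec_eq_iff)
  ultimately show ?thesis by (simp add: inner_vec_def)
qed

text \<open>\<open>Y\<close> is a finite \<open>g\<close>-net of the compact set of positions in the
  ball of radius \<open>Z\<close> that keep the distance \<open>d\<close> from all positions of
  \<open>K\<close>. It is taken inside this set, so its own points keep that distance as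
  well.\<close>

lemma finite_cover_of_gaps:
  fixes K :: "(real ^ 4) set"
  assumes g: "g > 0"
  shows "\<exists>Y. finite Y \<and> (\<forall>y\<in>Y. \<forall>k\<in>K. d \<le> norm (q_part k - y)) \<and>
    (\<forall>q. norm q \<le> Z \<and> (\<forall>k\<in>K. d \<le> norm (q - q_part k)) \<longrightarrow> (\<exists>y\<in>Y. norm (q - y) < g))"
proof -
  let ?A = "cball 0 Z \<inter> (\<Inter>k\<in>K. {q. d \<le> norm (q - q_part k)})"
  have "closed (\<Inter>k\<in>K. {q. d \<le> norm (q - q_part k)})"
    by (intro closed_INT ballI closed_Collect_le continuous_intros)
  then have c: "compact ?A" by (intro compact_Int_closed compact_cball)
  from seq_compact_imp_totally_bounded[OF compact_imp_seq_compact[OF c], rule_format, OF g]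
  obtain Y where Y: "finite Y" "Y \<subseteq> ?A" "?A \<subseteq> (\<Union>y\<in>Y. ball y g)" by (elim exE conjE)
  show ?thesis
  proof (intro exI[of _ Y] conjI allI impI)
    show "\<forall>y\<in>Y. \<forall>k\<in>K. d \<le> norm (q_part k - y)"
    proof (intro ballI)
      fix y k assume "y \<in> Y" "k \<in> K"
      then have "d \<le> norm (y - q_part k)" using Y(2) by blast
      then show "d \<le> norm (q_part k - y)" by (simp add: norm_minus_commute)
    qed
    fix q assume "norm q \<le> Z \<and> (\<forall>k\<in>K. d \<le> norm (q - q_part k))"
    then have "q \<in> ?A" by simp
    then obtain y where "y \<in> Y" "q \<in> ball y g" using Y(3) by blast
    then show "\<exists>y\<in>Y. norm (q - y) < g" by (intro bexI[of _ y]) (simp_all add: dist_norm norm_minus_commute)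
  qed (rule Y)
qed

text \<open>\<open>uu\<close> factors into the difference and the sum of the distance from
  \<open>y\<close> to the centre and the radius; the difference is below \<open>g\<close>, the sum
  at most \<open>2 * norm z + g\<close>.\<close>

lemma uu_near_obstacle:
  assumes "norm (q_part z - y) < g"
  shows "\<bar>uu y z\<bar> \<le> g * (2 * norm z + g)"
proof -
  let ?a = "cmod (cpt y - ctr z)" and ?b = "cmod (mom z)"
  have "cmod (cpt y - ctr z - \<i> * mom z) < g" using assms norm_cpt[of "q_part z" y]
    by (simp add: cpt_q norm_minus_commute algebra_simps)
  then have ab: "\<bar>?a - ?b\<bar> < g"
    using norm_triangle_ineq3[of "cpt y - ctr z" "\<i> * mom z"] by (simp add: norm_mult)
  have "?b\<^sup>2 \<le> (norm z)\<^sup>2" unfolding norm_square_4 mom_def cmod_power2 by simp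
  then have b: "?b \<le> norm z" using norm_ge_zero power2_le_imp_le by blast
  have "\<bar>uu y z\<bar> = \<bar>?a - ?b\<bar> * \<bar>?a + ?b\<bar>" unfolding uu_eq abs_mult[symmetric] by (simp add: power2_eq_square algebra_simps)
  also have "\<dots> \<le> g * (2 * norm z + g)" using ab b by (intro mult_mono) auto
  finally show ?thesis .
qed

lemma UC_uu: "UC k I (\<lambda>_. uu y)"
  unfolding uu_def[abs_def] by (intro UC_add UC_diff UC_power UC_coord UC_const')

lemma UC_rad2: "UC k I (\<lambda>_. rad2)"
  unfolding rad2_def[abs_def] by (intro UC_add UC_diff UC_power UC_coord)

definition qd :: "real ^ 2 \<Rightarrow> real ^ 4 \<Rightarrow> real" where
  "qd y z = (z $ 3 - y $ 1)\<^sup>2 + (z $ 4 - y $ 2)\<^sup>2"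

lemma qd_eq: "qd y z = (norm (q_part z - y))\<^sup>2"
  unfolding qd_def power2_norm_eq_inner inner_vec_def sum_2 by (simp add: power2_eq_square)

lemma UC_qd: "UC k I (\<lambda>_. qd y)"
  unfolding qd_def[abs_def] by (intro UC_add UC_diff UC_power UC_coord UC_const')

lemma UC_norm_square: "UC k I (\<lambda>_ z. (norm z)\<^sup>2)"
  unfolding norm_square_4 by (intro UC_add UC_power UC_coord)

lemma uu_uniform:
  assumes "finite Y" "c > 0"
  shows "\<exists>d>0. \<forall>y\<in>Y. \<forall>a b. norm a \<le> B \<longrightarrow> norm b \<le> B \<longrightarrow> norm (a - b) < d \<longrightarrow> \<bar>uu y a - uu y b\<bar> < c"
  using assms(1)
proof (induction rule: finite_induct)
  case (insert y Y)
  have "uniformly_continuous_on (cball 0 B) (uu y)"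
    by (intro compact_uniformly_continuous uu_continuous) auto
  then obtain d1 where d1: "d1 > 0" "\<And>a b. norm a \<le> B \<Longrightarrow> norm b \<le> B \<Longrightarrow> norm (a - b) < d1 \<Longrightarrow> \<bar>uu y a - uu y b\<bar> < c"
    using assms(2) unfolding uniformly_continuous_on_def dist_norm real_norm_def
    by (metis mem_cball_0 norm_minus_commute abs_minus_commute)
  obtain d2 where "d2 > 0" "\<forall>y\<in>Y. \<forall>a b. norm a \<le> B \<longrightarrow> norm b \<le> B \<longrightarrow> norm (a - b) < d2 \<longrightarrow> \<bar>uu y a - uu y b\<bar> < c"
    using insert.IH by blast
  then show ?case using d1 by (intro exI[of _ "min d1 d2"]) auto
qed (auto intro: exI[of _ 1])

text \<open>The finite set \<open>Y\<close> consists of points away from the domain of the potential, so that every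
  circle \<open>t \<mapsto> q_part (rot t x)\<close> leaving the domain comes close to some \<open>y \<in> Y\<close> and then makes
  \<open>uu y x\<close> small. Hence the potential can be averaged along all circles with
  \<open>\<bar>uu y x\<bar> \<ge> c1\<close> for all \<open>y \<in> Y\<close>.\<close>

locale cut_circles =
  fixes K :: "(real ^ 4) set" and r b g :: real and V :: "real ^ 2 \<Rightarrow> real"
    and Vc :: "complex ^ 4 \<Rightarrow> complex" and Bv :: real and Y :: "(real ^ 2) set"
  assumes K: "compact K" and r: "r > 0"
    and Vc_hol: "mv_holomorphic_on Vc {z. q_part z \<in> qdom K (r / 2)}" and Bv: "Bv > 0"
    and Vc_bound: "q_part z \<in> qdom K (r / 2) \<Longrightarrow> norm (Vc z) \<le> Bv"
    and Vc_real: "q_part (complexify x) \<in> qdom K (r / 2) \<Longrightarrow> Vc (complexify x) = of_real (V (q_part x))"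
    and b: "b > 0" "k \<in> K \<Longrightarrow> norm k + r < b"
    and Y: "finite Y" "y \<in> Y \<Longrightarrow> k \<in> K \<Longrightarrow> r / 4 \<le> norm (q_part k - y)"
    and Y_cover: "norm q \<le> 40 * b \<Longrightarrow> (\<And>k. k \<in> K \<Longrightarrow> r / 4 \<le> norm (q - q_part k)) \<Longrightarrow> \<exists>y\<in>Y. norm (q - y) < g"
    and g: "g > 0" "g \<le> r / 8" "g * (2 * (60 * b) + g) < (r / 8)\<^sup>2 / 48"
begin

text \<open>The elimination runs with \<open>c = 4 * c1\<close> and \<open>R = r / 8\<close>; with
  48 its condition \<open>3 * c \<le> R\<^sup>2 / 4\<close> is an equality.\<close>

definition "c1 = (r / 8)\<^sup>2 / 48"

lemma c1: "c1 > 0"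
  using r by (simp add: c1_def)

text \<open>Complex points whose whole circle stays in the domain with a margin. The factor 8 is
  that of \<open>norm_q_part_rot_le\<close>, so that a shift by \<open>s\<close> costs exactly
  \<open>s\<close>; asking for some \<open>s' > s\<close> makes the set open.\<close>

definition Om :: "real \<Rightarrow> (complex ^ 4) set" where
  "Om s = {z. \<exists>s'>s. \<forall>t. cball (q_part (rot t z)) (8 * s') \<subseteq> qdom K (r / 2)}"

lemma Om_shift:
  assumes z: "z \<in> Om s" and v: "norm v \<le> s - s1"
  shows "z + v \<in> Om s1"
proof -
  obtain s' where s': "s' > s" "\<And>t. cball (q_part (rot t z)) (8 * s') \<subseteq> qdom K (r / 2)" using z by (auto simp: Om_def)
  have "cball (q_part (rot t (z + v))) (8 * (s' - (s - s1))) \<subseteq> cball (q_part (rot t z)) (8 * s')" for t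
  proof
    fix w assume "w \<in> cball (q_part (rot t (z + v))) (8 * (s' - (s - s1)))"
    then have w: "norm (w - (q_part (rot t z) + q_part (rot t v))) \<le> 8 * (s' - (s - s1))"
      by (simp add: dist_norm norm_minus_commute rot_add q_part_add)
    have "norm (q_part (rot t v)) \<le> 8 * norm v" by (rule norm_q_part_rot_le)
    also have "\<dots> \<le> 8 * (s - s1)" using v by simp
    finally have "norm (q_part (rot t v)) \<le> 8 * (s - s1)" .
    then have "norm (w - q_part (rot t z)) \<le> 8 * s'"
      using norm_triangle_ineq[of "w - (q_part (rot t z) + q_part (rot t v))" "q_part (rot t v)"] w by simp
    then show "w \<in> cball (q_part (rot t z)) (8 * s')" by (simp add: dist_norm norm_minus_commute)
  qed
  then have "cball (q_part (rot t (z + v))) (8 * (s' - (s - s1))) \<subseteq> qdom K (r / 2)" for t using s'(2) by blast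
  then show ?thesis using s'(1) unfolding Om_def by (intro CollectI exI[of _ "s' - (s - s1)"]) simp
qed

lemma Om_subset: "Om 0 \<subseteq> {z. q_part z \<in> qdom K (r / 2)}"
proof
  fix z assume "z \<in> Om 0"
  then obtain s' where s': "s' > 0" "cball (q_part (rot 0 z)) (8 * s') \<subseteq> qdom K (r / 2)" unfolding Om_def by blast
  moreover have "rot 0 z = z" by (simp add: vec4_eq_iff)
  ultimately show "z \<in> {z. q_part z \<in> qdom K (r / 2)}" using centre_in_cball[of "q_part z" "8 * s'"] by force
qed

sublocale analytic_scale Om Vc Bv
proof
  show "open (Om s)" for s unfolding open_dist
  proof
    fix z assume "z \<in> Om s"
    then obtain s' where s': "s' > s" "\<And>t. cball (q_part (rot t z)) (8 * s') \<subseteq> qdom K (r / 2)" by (auto simp: Om_def)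
    then have z: "z \<in> Om ((s + s') / 2)" unfolding Om_def by (intro CollectI exI[of _ s']) auto
    have "w \<in> Om s" if "dist w z < (s' - s) / 2" for w
      using Om_shift[OF z, of "w - z" s] that by (simp add: dist_norm field_simps)
    then show "\<exists>e>0. \<forall>y. dist y z < e \<longrightarrow> y \<in> Om s" using s' by (intro exI[of _ "(s' - s) / 2"]) auto
  qed
  show "z + v \<in> Om s'" if "z \<in> Om s" "norm v \<le> s - s'" for z v s s' using Om_shift that by blast
  show "rot t z \<in> Om s" if "z \<in> Om s" for z s t using that unfolding Om_def by (auto simp: rot_rot)
  show "mv_holomorphic_on Vc (Om 0)" by (rule mvh_subset[OF Vc_hol Om_subset])
  show "Bv > 0" by (rule Bv)
  show "norm (Vc z) \<le> Bv" if "z \<in> Om 0" for z using Vc_bound that Om_subset by blast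
  show "Vc (complexify x) \<in> \<real>" if "complexify x \<in> Om 0" for x using Vc_real[of x] that Om_subset by force
qed

text \<open>It depends on invariants of the circle only, so it is constant along circles. The square
  of \<open>uu\<close> replaces its absolute value, which is not smooth.\<close>

definition rho :: "real ^ 4 \<Rightarrow> real" where
  "rho x = (\<Prod>y\<in>Y. smooth_step (c1\<^sup>2) ((2 * c1)\<^sup>2) ((uu y x)\<^sup>2)) * (1 - smooth_step (3 * b\<^sup>2) (6 * b\<^sup>2) (rad2 x))"

text \<open>It creates the vacuum of radius \<open>r / 8\<close> around each obstacle. Obstacles
  keep the distance \<open>r / 4\<close> from the positions of \<open>K\<close>, so there is room to
  return to 1 at \<open>5 * r / 32\<close>.\<close>

definition chi :: "real ^ 4 \<Rightarrow> real" where
  "chi x = (\<Prod>y\<in>Y. smooth_step ((r / 8)\<^sup>2) ((5 * r / 32)\<^sup>2) (qd y x)) * (1 - smooth_step ((2 * b)\<^sup>2) ((4 * b)\<^sup>2) (qd 0 x))"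

text \<open>\<open>chi\<close> bounds the positions only; this factor bounds the momenta of the
  perturbation as well.\<close>

definition beta :: "real ^ 4 \<Rightarrow> real" where
  "beta x = 1 - smooth_step (b\<^sup>2) ((2 * b)\<^sup>2) ((norm x)\<^sup>2)"

lemma rho_smooth:
  assumes "k < 8" shows "UC k I (\<lambda>_. rho)"
proof -
  have 1: "c1\<^sup>2 < (2 * c1)\<^sup>2" "3 * b\<^sup>2 < 6 * b\<^sup>2" using c1 b(1) by (simp_all add: power_mult_distrib)
  have "UC k I (\<lambda>_ x. smooth_step (c1\<^sup>2) ((2 * c1)\<^sup>2) ((uu y x)\<^sup>2))" for y
    by (rule UC_smooth_step[OF UC_power[OF UC_uu] assms 1(1)])
  moreover have "UC k I (\<lambda>_ x. smooth_step (3 * b\<^sup>2) (6 * b\<^sup>2) (rad2 x))"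
    by (rule UC_smooth_step[OF UC_rad2 assms 1(2)])
  ultimately show ?thesis unfolding rho_def[abs_def] by (intro UC_mult UC_prod UC_diff UC_const' Y(1))
qed

lemma chi_smooth:
  assumes "k < 8" shows "UC k I (\<lambda>_. chi)"
proof -
  have 1: "(r / 8)\<^sup>2 < (5 * r / 32)\<^sup>2" "(2 * b)\<^sup>2 < (4 * b)\<^sup>2" using r b(1) by (intro power_strict_mono; simp)+
  have "UC k I (\<lambda>_ x. smooth_step ((r / 8)\<^sup>2) ((5 * r / 32)\<^sup>2) (qd y x))" for y
    by (rule UC_smooth_step[OF UC_qd assms 1(1)])
  moreover have "UC k I (\<lambda>_ x. smooth_step ((2 * b)\<^sup>2) ((4 * b)\<^sup>2) (qd 0 x))"
    by (rule UC_smooth_step[OF UC_qd assms 1(2)])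
  ultimately show ?thesis unfolding chi_def[abs_def] by (intro UC_mult UC_prod UC_diff UC_const' Y(1))
qed

lemma beta_smooth:
  assumes "k < 8" shows "UC k I (\<lambda>_. beta)"
proof -
  have "b\<^sup>2 < (2 * b)\<^sup>2" using b(1) by (intro power_strict_mono; simp)
  from UC_smooth_step[OF UC_norm_square assms this] show ?thesis
    unfolding beta_def[abs_def] by (intro UC_diff UC_const')
qed

lemma cutoff_range:
  "0 \<le> rho x" "rho x \<le> 1" "0 \<le> chi x" "chi x \<le> 1" "0 \<le> beta x" "beta x \<le> 1"
proof -
  have p: "0 \<le> (\<Prod>y\<in>Y. smooth_step c d (f y))" "(\<Prod>y\<in>Y. smooth_step c d (f y)) \<le> 1" for c d f
    by (rule prod_nonneg, simp add: smooth_step_bounds) (rule prod_le_1, simp add: smooth_step_bounds)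
  have s: "0 \<le> 1 - smooth_step c d v" "1 - smooth_step c d v \<le> 1" for c d v
    by (simp_all add: smooth_step_bounds)
  show "0 \<le> rho x" "0 \<le> chi x" "0 \<le> beta x" "beta x \<le> 1" unfolding rho_def chi_def beta_def using p s by simp_all
  show "rho x \<le> 1" "chi x \<le> 1" unfolding rho_def chi_def by (rule mult_le_one[OF p(2) s])+
qed

lemma rho_rot: "rho (rot t x) = rho x"
  unfolding rho_def uu_rot rad2_rot ..

definition Trho where "Trho = {x. (\<forall>y\<in>Y. c1 \<le> \<bar>uu y x\<bar>) \<and> rad2 x \<le> 6 * b\<^sup>2}"
definition Tchi where "Tchi = {x. (\<forall>y\<in>Y. r / 8 \<le> norm (q_part x - y)) \<and> norm (q_part x) \<le> 4 * b}"

lemma continuous_rad2: "continuous_on A rad2"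
  using UC_continuous[OF UC_rad2[of 0 "UNIV :: nat set"] UNIV_I] by (rule continuous_on_subset) simp

lemma closed_Trho: "closed Trho"
proof -
  have "Trho = (\<Inter>y\<in>Y. {x. c1 \<le> \<bar>uu y x\<bar>}) \<inter> {x. rad2 x \<le> 6 * b\<^sup>2}" by (auto simp: Trho_def)
  also have "closed \<dots>"
    by (intro closed_Int closed_INT ballI closed_Collect_le continuous_intros uu_continuous continuous_rad2)
  finally show ?thesis .
qed

lemma closed_Tchi: "closed Tchi"
proof -
  have q: "continuous_on UNIV (q_part :: real ^ 4 \<Rightarrow> real ^ 2)" by (rule linear_continuous_on[OF bounded_linear_q_part])
  have "Tchi = (\<Inter>y\<in>Y. {x. r / 8 \<le> norm (q_part x - y)}) \<inter> {x. norm (q_part x) \<le> 4 * b}" by (auto simp: Tchi_def)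
  moreover have "closed {x :: real ^ 4. r / 8 \<le> norm (q_part x - y)}" for y
    by (intro closed_Collect_le continuous_intros q)
  moreover have "closed {x :: real ^ 4. norm (q_part x) \<le> 4 * b}"
    by (intro closed_Collect_le continuous_intros q)
  ultimately show ?thesis by (simp add: closed_INT closed_Int)
qed

lemma rho_outside: assumes "x \<notin> Trho" shows "rho x = 0"
proof (cases "\<exists>y\<in>Y. \<bar>uu y x\<bar> < c1")
  case True
  then obtain y where "y \<in> Y" "\<bar>uu y x\<bar> \<le> c1" by (meson less_imp_le)
  moreover from this have "(uu y x)\<^sup>2 \<le> c1\<^sup>2" using power_mono[of "\<bar>uu y x\<bar>" c1 2] by simp
  ultimately have "(\<Prod>y\<in>Y. smooth_step (c1\<^sup>2) ((2 * c1)\<^sup>2) ((uu y x)\<^sup>2)) = 0"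
    using smooth_step_eq_0 by (intro prod_zero[OF Y(1)]) blast
  then show ?thesis unfolding rho_def by simp
next
  case False
  then have "6 * b\<^sup>2 \<le> rad2 x" using assms by (auto simp: Trho_def not_less)
  then have "smooth_step (3 * b\<^sup>2) (6 * b\<^sup>2) (rad2 x) = 1" using b(1) by (intro smooth_step_eq_1) simp_all
  then show ?thesis by (simp add: rho_def)
qed

lemma chi_outside: assumes "x \<notin> Tchi" shows "chi x = 0"
proof (cases "\<exists>y\<in>Y. norm (q_part x - y) < r / 8")
  case True
  then obtain y where "y \<in> Y" "norm (q_part x - y) < r / 8" by blast
  moreover from this have "qd y x \<le> (r / 8)\<^sup>2" unfolding qd_eq by (intro power_mono) auto
  ultimately have "(\<Prod>y\<in>Y. smooth_step ((r / 8)\<^sup>2) ((5 * r / 32)\<^sup>2) (qd y x)) = 0"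
    using smooth_step_eq_0 by (intro prod_zero[OF Y(1)]) blast
  then show ?thesis unfolding chi_def by simp
next
  case False
  then have "4 * b \<le> norm (q_part x)" using assms by (auto simp: Tchi_def not_less)
  then have "(4 * b)\<^sup>2 \<le> qd 0 x" unfolding qd_eq using b(1) by (intro power_mono) simp_all
  then have "smooth_step ((2 * b)\<^sup>2) ((4 * b)\<^sup>2) (qd 0 x) = 1" using b(1) by (intro smooth_step_eq_1 power_strict_mono) simp_all
  then show ?thesis by (simp add: chi_def)
qed

lemma Trho_norm: assumes "x \<in> Trho" shows "norm x \<le> 5 * b"
proof -
  have "(norm x)\<^sup>2 \<le> 18 * b\<^sup>2" using rad2_bounds(2)[of x] assms by (simp add: Trho_def)
  also have "\<dots> \<le> (5 * b)\<^sup>2" by (simp add: power_mult_distrib)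
  finally show ?thesis by (rule power2_le_imp_le) (use b(1) in simp)
qed

text \<open>If some point of the circle were \<open>r / 4\<close> away from all positions of
  \<open>K\<close>, an obstacle would lie within \<open>g\<close> of it and force
  \<open>\<bar>uu y x\<bar> < c1\<close>. The complex margin fits since
  \<open>r / 4 + 8 * (r / 40) < r / 2\<close>. The radii \<open>40 * b\<close> and
  \<open>60 * b\<close> are 8 and 12 times the bound \<open>5 * b\<close> on
  \<open>norm x\<close>.\<close>

lemma Trho_Om: assumes x: "x \<in> Trho" shows "complexify x \<in> Om (r / 50)"
  unfolding Om_def
proof (intro CollectI exI[of _ "r / 40"] conjI allI)
  fix t
  let ?q = "q_part (rot t x)"
  have n: "norm ?q \<le> 40 * b" "norm (rot t x) \<le> 60 * b"
    by (rule order_trans[OF norm_q_part_rot_le], use Trho_norm[OF x] in simp, rule order_trans[OF norm_rot_le], use Trho_norm[OF x] in simp)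
  have "\<exists>k\<in>K. norm (?q - q_part k) < r / 4"
  proof (rule ccontr)
    assume "\<not> ?thesis"
    then have "r / 4 \<le> norm (?q - q_part k)" if "k \<in> K" for k using that by force
    from Y_cover[OF n(1) this] obtain y where y: "y \<in> Y" "norm (?q - y) < g" by blast
    have "\<bar>uu y (rot t x)\<bar> \<le> g * (2 * norm (rot t x) + g)" by (rule uu_near_obstacle[OF y(2)])
    also have "\<dots> \<le> g * (2 * (60 * b) + g)" using n(2) g(1) by (intro mult_left_mono) simp_all
    also have "\<dots> < c1" using g(3) by (simp only: c1_def)
    finally have "\<bar>uu y x\<bar> < c1" by (simp add: uu_rot)
    then show False using x y(1) by (force simp: Trho_def)
  qed
  then obtain k where k: "k \<in> K" "norm (?q - q_part k) < r / 4" by blast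
  have "cball (complexify ?q) (8 * (r / 40)) \<subseteq> ball (complexify (q_part k)) (r / 2)"
  proof
    fix w assume "w \<in> cball (complexify ?q) (8 * (r / 40))"
    then have w: "norm (w - complexify ?q) \<le> r / 5" by (simp add: dist_norm norm_minus_commute)
    have "norm (complexify ?q - complexify (q_part k)) < r / 4" using k(2) by (simp add: complexify_diff[symmetric])
    then have "norm (w - complexify (q_part k)) < r / 2"
      using norm_triangle_ineq[of "w - complexify ?q" "complexify ?q - complexify (q_part k)"] w r by simp
    then show "w \<in> ball (complexify (q_part k)) (r / 2)" by (simp add: dist_norm norm_minus_commute)
  qed
  then show "cball (q_part (rot t (complexify x))) (8 * (r / 40)) \<subseteq> qdom K (r / 2)"
    using k(1) unfolding qdom_def complexify_rot[symmetric] q_part_complexify by blast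
qed (use r in simp)

lemma Tchi_ball: assumes x: "x \<in> Tchi" shows "cball (complexify x) (r / 16) \<subseteq> {z. q_part z \<in> qdom K (r / 2)}"
proof -
  have "\<exists>k\<in>K. norm (q_part x - q_part k) < r / 4"
  proof (rule ccontr)
    assume "\<not> ?thesis"
    then have 1: "r / 4 \<le> norm (q_part x - q_part k)" if "k \<in> K" for k using that by force
    have "norm (q_part x) \<le> 40 * b" using x b(1) by (simp add: Tchi_def)
    from Y_cover[OF this 1] obtain y where "y \<in> Y" "norm (q_part x - y) < g" by blast
    then show False using x g(2) by (force simp: Tchi_def)
  qed
  then obtain k where k: "k \<in> K" "norm (q_part x - q_part k) < r / 4" by blast
  have "q_part w \<in> ball (complexify (q_part k)) (r / 2)" if "w \<in> cball (complexify x) (r / 16)" for w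
  proof -
    have "norm (w - complexify x) \<le> r / 16" using that by (simp add: dist_norm norm_minus_commute)
    then have "norm (q_part w - complexify (q_part x)) \<le> r / 8"
      using norm_q_part_le[of "w - complexify x"] by (simp add: q_part_diff q_part_complexify)
    moreover have "norm (complexify (q_part x) - complexify (q_part k)) < r / 4" using k(2) by (simp add: complexify_diff[symmetric])
    ultimately have "norm (q_part w - complexify (q_part k)) < r / 2"
      using norm_triangle_ineq[of "q_part w - complexify (q_part x)" "complexify (q_part x) - complexify (q_part k)"] r by simp
    then show ?thesis by (simp add: dist_norm norm_minus_commute)
  qed
  then show ?thesis using k(1) unfolding qdom_def by blast
qed

text \<open>The radius is \<open>r / 32 + r / 64\<close>: the elimination map ends within
  \<open>r / 32\<close> of \<open>K\<close>, and the midpoint map moves by at most another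
  \<open>r / 64\<close>.\<close>

definition near where "near w \<longleftrightarrow> (\<exists>k\<in>K. norm (w - k) \<le> 3 * r / 64)"

lemma near_facts:
  assumes "near w"
  shows "norm w < b" "rad2 w < 3 * b\<^sup>2" "beta w = 1" "chi w = 1" "w \<in> Tchi"
proof -
  obtain k where k: "k \<in> K" "norm (w - k) \<le> 3 * r / 64" using assms by (auto simp: near_def)
  show n: "norm w < b" using b(2)[OF k(1)] k(2) norm_triangle_ineq[of k "w - k"] r by simp
  have n2: "(norm w)\<^sup>2 < b\<^sup>2" using n by (intro power_strict_mono) simp_all
  then show "rad2 w < 3 * b\<^sup>2" using rad2_bounds(1)[of w] by linarith
  show "beta w = 1" unfolding beta_def using n2 by (simp add: smooth_step_eq_0)
  have qk: "norm (q_part w - q_part k) \<le> 3 * r / 32" using norm_q_part_le[of "w - k"] k(2) by (simp add: q_part_diff)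
  have qy: "5 * r / 32 \<le> norm (q_part w - y)" if "y \<in> Y" for y
    using Y(2)[OF that k(1)] qk norm_triangle_ineq[of "q_part k - q_part w" "q_part w - y"] by (simp add: norm_minus_commute)
  have q0: "norm (q_part w) \<le> 2 * b" using norm_q_part_le[of w] n by simp
  have "smooth_step ((r / 8)\<^sup>2) ((5 * r / 32)\<^sup>2) (qd y w) = 1" if "y \<in> Y" for y
    unfolding qd_eq using qy[OF that] r by (intro smooth_step_eq_1 power_strict_mono power_mono) auto
  moreover have "smooth_step ((2 * b)\<^sup>2) ((4 * b)\<^sup>2) (qd 0 w) = 0"
    unfolding qd_eq using q0 by (intro smooth_step_eq_0 power_mono) auto
  ultimately show "chi w = 1" by (simp add: chi_def)
  show "w \<in> Tchi" unfolding Tchi_def using qy q0 r b(1) by force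
qed

lemma rho_eq_1:
  assumes "\<And>y. y \<in> Y \<Longrightarrow> 2 * c1 < \<bar>uu y x\<bar>" "rad2 x < 3 * b\<^sup>2"
  shows "rho x = 1" "gr rho x = 0" "x \<in> Trho"
proof -
  let ?T = "(\<Inter>y\<in>Y. {x. 2 * c1 < \<bar>uu y x\<bar>}) \<inter> {x. rad2 x < 3 * b\<^sup>2}"
  have T: "open ?T"
    by (intro open_Int open_INT ballI open_Collect_less continuous_intros uu_continuous continuous_rad2 Y(1))
  have one: "rho z = 1" if "z \<in> ?T" for z
  proof -
    have "smooth_step (c1\<^sup>2) ((2 * c1)\<^sup>2) ((uu y z)\<^sup>2) = 1" if "y \<in> Y" for y
    proof (rule smooth_step_eq_1)
      show "c1\<^sup>2 < (2 * c1)\<^sup>2" using c1 by (intro power_strict_mono) auto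
      have "2 * c1 \<le> \<bar>uu y z\<bar>" using \<open>z \<in> ?T\<close> that by force
      then have "(2 * c1)\<^sup>2 \<le> \<bar>uu y z\<bar>\<^sup>2" using c1 by (intro power_mono) auto
      then show "(2 * c1)\<^sup>2 \<le> (uu y z)\<^sup>2" by simp
    qed
    moreover have "smooth_step (3 * b\<^sup>2) (6 * b\<^sup>2) (rad2 z) = 0" using that by (intro smooth_step_eq_0) auto
    ultimately show ?thesis by (simp add: rho_def)
  qed
  have x: "x \<in> ?T" using assms by auto
  show "rho x = 1" by (rule one[OF x])
  show "gr rho x = 0" by (rule gr_locally_constant[OF T x one])
  show "x \<in> Trho" using rho_outside[of x] one[OF x] by force
qed

text \<open>Its support begins at \<open>3 * c1\<close>, so that after a small shift to the midpoint
  \<open>uu\<close> still exceeds \<open>2 * c1\<close>, where \<open>rho\<close> is locally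
  1.\<close>

definition cut :: "real ^ 2 \<Rightarrow> real ^ 4 \<Rightarrow> real" where
  "cut y z = smooth_step ((3 * c1)\<^sup>2) ((4 * c1)\<^sup>2) ((uu y z)\<^sup>2)"

lemma cut_smooth: "k < 8 \<Longrightarrow> UC k I (\<lambda>_. cut y)"
  unfolding cut_def[abs_def] using c1 by (intro UC_smooth_step UC_power UC_uu power_strict_mono) auto

lemma cut_eq_1: assumes "4 * c1 < \<bar>uu y z\<bar>" shows "cut y z = 1"
proof -
  have "(4 * c1)\<^sup>2 \<le> \<bar>uu y z\<bar>\<^sup>2" using assms c1 by (intro power_mono) auto
  then show ?thesis unfolding cut_def using c1 by (intro smooth_step_eq_1 power_strict_mono) auto
qed

lemma cut_nonzero: assumes "cut y z \<noteq> 0" shows "3 * c1 < \<bar>uu y z\<bar>"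
proof (rule ccontr)
  assume "\<not> ?thesis"
  then have "\<bar>uu y z\<bar>\<^sup>2 \<le> (3 * c1)\<^sup>2" by (intro power_mono) auto
  then show False using assms by (simp add: cut_def smooth_step_eq_0)
qed

end

section \<open>Assembly: exact invariance, the exponential remainder and the composed map\<close>

context cut_circles
begin

text \<open>The cutoff does not spoil the bracket with \<open>K\<close>, because \<open>rho\<close>
  is constant along circles; this is why cutoffs in other variables would not do for
  \<open>G\<close>.\<close>

lemma averaged_cut_invariant:
  assumes F: "mv_holomorphic_on F (Om (r / 80))" and inv: "\<And>z. z \<in> Om (r / 80) \<Longrightarrow> fd F z (kgen z) = 0"
  shows "kgen z \<bullet> gr (\<lambda>x. rho x * Re (F (complexify x))) z = 0"
proof (cases "z \<in> Trho")
  case True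
  have "Om (r / 50) \<subseteq> Om (r / 80)" using r by (intro Om_mono) simp
  then have zO: "complexify z \<in> Om (r / 80)" using Trho_Om[OF True] by blast
  have d: "rho differentiable (at z)" using rho_smooth[of "Suc 0" "UNIV :: nat set"] by (simp add: UC_Suc)
  have D: "((\<lambda>x. rho x * Re (F (complexify x))) has_derivative
    (\<lambda>h. rho z * Re (fd F (complexify z) (complexify h)) + (h \<bullet> gr rho z) * Re (F (complexify z)))) (at z)"
    by (rule cut_holomorphic_deriv[OF F zO d])
  then have "(\<lambda>x. rho x * Re (F (complexify x))) differentiable (at z)" unfolding differentiable_def by blast
  from fun_cong[OF has_derivative_unique[OF has_derivative_gr[OF this] D], of "kgen z"]
  show ?thesis using inv[OF zO] invariant_kgen[OF d rho_rot] by (simp add: complexify_kgen)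
next
  case False
  have "gr (\<lambda>x. rho x * Re (F (complexify x))) z = 0"
    by (rule gr_locally_constant[of "- Trho" _ _ 0]) (use closed_Trho False rho_outside in auto)
  then show ?thesis by simp
qed

text \<open>Where all cutoffs are 1 the real midpoint map is the one generated by the holomorphic
  \<open>S\<close>, and its defect is the real part of the holomorphic residual at \<open>m\<close>,
  divided by \<epsilon>.\<close>

lemma remainder_estimate:
  fixes m z :: "real ^ 4" and S G :: "complex ^ 4 \<Rightarrow> complex" and s :: "real ^ 4 \<Rightarrow> real" and \<epsilon> \<delta> :: real
  defines "s \<equiv> \<lambda>x. rho x * Re (S (complexify x) / of_real \<epsilon>)"
  assumes S: "mv_holomorphic_on S (Om (r / 80))" and e: "\<epsilon> > 0"
    and S_real: "\<And>x. complexify x \<in> Om (r / 80) \<Longrightarrow> S (complexify x) \<in> \<real>"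
    and res: "\<And>z. z \<in> Om (r / 80) \<Longrightarrow>
      norm (fd S z (kgen z) - of_real \<epsilon> * (Vc (z + half_ham S z) - G (z - half_ham S z))) \<le> \<epsilon> * \<delta>"
    and m: "m = z + (\<epsilon> / 2) *\<^sub>R jmul (gr s m)"
    and far: "\<And>y. y \<in> Y \<Longrightarrow> 2 * c1 < \<bar>uu y m\<bar>" "\<And>y. y \<in> Y \<Longrightarrow> 2 * c1 < \<bar>uu y z\<bar>"
    and near: "near m" "near z" "near (2 *\<^sub>R m - z)"
  shows "\<bar>chi (2 *\<^sub>R m - z) * Re (Vc (complexify (2 *\<^sub>R m - z))) - rho z * Re (G (complexify z)) - kgen m \<bullet> gr s m\<bar> \<le> \<delta>"
proof -
  have "Om (r / 50) \<subseteq> Om (r / 80)" using r by (intro Om_mono) simp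
  then have mO: "complexify m \<in> Om (r / 80)" using Trho_Om rho_eq_1(3)[OF far(1) near_facts(2)[OF near(1)]] by blast
  have rm: "rho m = 1" "gr rho m = 0" using rho_eq_1[OF far(1) near_facts(2)[OF near(1)]] by auto
  have rz: "rho z = 1" using rho_eq_1(1)[OF far(2) near_facts(2)[OF near(2)]] by auto
  define D where "D = (\<chi> j. Re (fd S (complexify m) (axis j 1)))"
  have SD: "Re (fd S (complexify m) (complexify h)) = h \<bullet> D" for h
    unfolding D_def by (rule inner_Re_fd[OF S mO])
  have d: "rho differentiable (at m)" using rho_smooth[of "Suc 0" "UNIV :: nat set"] by (simp add: UC_Suc)
  have "((\<lambda>x. rho x * Re (S (complexify x))) has_derivative (\<lambda>h. h \<bullet> D)) (at m)"
    using cut_holomorphic_deriv[OF S mO d] by (simp add: rm SD)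
  then have "((\<lambda>x. rho x * Re (S (complexify x)) * (1 / \<epsilon>)) has_derivative (\<lambda>h. (h \<bullet> D) * (1 / \<epsilon>))) (at m)"
    by (rule has_derivative_mult_left)
  then have "(s has_derivative (\<lambda>h. h \<bullet> ((1 / \<epsilon>) *\<^sub>R D))) (at m)"
    by (simp add: s_def mult.commute)
  then have gs: "gr s m = (1 / \<epsilon>) *\<^sub>R D" by (rule gr_unique)
  \<comment> \<open>The complex shift at the midpoint is the real half displacement, so the
    arguments of \<open>Vc\<close> and \<open>G\<close> in the residual are the image and the
    initial point.\<close>
  have hh: "half_ham S (complexify m) = complexify (m - z)"
  proof -
    have "half_ham S (complexify m) = complexify ((1 / 2) *\<^sub>R jmul D)"
      unfolding D_def by (rule half_ham_real[OF S open_Om mO S_real])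
    also have "(1 / 2) *\<^sub>R jmul D = (\<epsilon> / 2) *\<^sub>R jmul (gr s m)"
      unfolding gs using e by (simp add: vec4_eq_iff field_simps)
    also have "\<dots> = m - z" using m by (simp add: algebra_simps)
    finally show ?thesis .
  qed
  have p: "complexify m + half_ham S (complexify m) = complexify (2 *\<^sub>R m - z)"
    and q: "complexify m - half_ham S (complexify m) = complexify z"
    unfolding hh by (simp_all add: complexify_add[symmetric] complexify_diff[symmetric] scaleR_2)
  let ?w = "fd S (complexify m) (kgen (complexify m)) - of_real \<epsilon> * (Vc (complexify (2 *\<^sub>R m - z)) - G (complexify z))"
  have "chi (2 *\<^sub>R m - z) * Re (Vc (complexify (2 *\<^sub>R m - z))) - rho z * Re (G (complexify z)) - kgen m \<bullet> gr s m = - (Re ?w / \<epsilon>)"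
    unfolding near_facts(4)[OF near(3)] rz gs using e by (simp add: SD[symmetric] complexify_kgen field_simps)
  also have "\<bar>\<dots>\<bar> = \<bar>Re ?w\<bar> / \<epsilon>" using e by simp
  also have "\<dots> \<le> (\<epsilon> * \<delta>) / \<epsilon>"
    using res[OF mO] abs_Re_le_cmod[of ?w] e unfolding p q by (intro divide_right_mono order_trans[OF abs_Re_le_cmod]) simp_all
  finally show ?thesis using e by simp
qed

text \<open>The midpoint map alone leaves an error \<open>\<epsilon> * e \<epsilon> z\<close> that
  is exponentially small only on circles away from the obstacles. Precomposing with the elimination
  map \<open>\<Phi>\<close> multiplies this error by the cutoffs and leaves \<open>gg\<close>
  untouched.\<close>

theorem change_of_coordinates:
  "\<exists>\<epsilon>0>0. \<exists>c>0. \<exists>C M :: real. \<exists>U. open U \<and> K \<subseteq> U \<and>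
     (\<forall>\<epsilon>. 0 < \<epsilon> \<and> \<epsilon> < \<epsilon>0 \<longrightarrow> (\<exists>\<Psi> G R. symplectic_change_on \<Psi> U \<and>
        (\<forall>z\<in>U. norm (\<Psi> z - z) \<le> M * \<epsilon>) \<and>
        (\<forall>z\<in>U. H0 V \<epsilon> (\<Psi> z) = kinetic z + \<epsilon> * G z + exp (- c / \<epsilon>) * R z) \<and>
        C1_function_on G U \<and> (\<forall>z\<in>U. poisson G kinetic z = 0) \<and>
        (\<forall>z\<in>K. \<bar>G z\<bar> \<le> C \<and> \<bar>R z\<bar> \<le> C)))"
proof -
  have "r / 160 > 0" using r by simp
  from approximate_normal_form[OF this] obtain C c e1 where C: "C > 0" "c > 0" "e1 > 0" and nf: "\<And>\<epsilon>. 0 < \<epsilon> \<and> \<epsilon> < e1 \<Longrightarrow> (\<exists>S G.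
     mv_holomorphic_on S (Om (r / 80)) \<and> mv_holomorphic_on G (Om (r / 80)) \<and>
     (\<forall>z \<in> Om (r / 80). norm (S z) \<le> C * \<epsilon> \<and> norm (G z) \<le> C \<and> norm (half_ham S z) \<le> C * \<epsilon> \<and> fd G z (kgen z) = 0 \<and>
        norm (fd S z (kgen z) - of_real \<epsilon> * (Vc (z + half_ham S z) - G (z - half_ham S z))) \<le> C * \<epsilon> * exp (- c / \<epsilon>)) \<and>
     (\<forall>x. complexify x \<in> Om (r / 80) \<longrightarrow> S (complexify x) \<in> \<real> \<and> G (complexify x) \<in> \<real>))"
    by (auto simp: mult_2[symmetric])
  define I where "I = {\<epsilon>. 0 < \<epsilon> \<and> \<epsilon> < min e1 1}"
  have "\<forall>\<epsilon>\<in>I. \<exists>S G.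
     mv_holomorphic_on S (Om (r / 80)) \<and> mv_holomorphic_on G (Om (r / 80)) \<and>
     (\<forall>z \<in> Om (r / 80). norm (S z) \<le> C * \<epsilon> \<and> norm (G z) \<le> C \<and> norm (half_ham S z) \<le> C * \<epsilon> \<and> fd G z (kgen z) = 0 \<and>
        norm (fd S z (kgen z) - of_real \<epsilon> * (Vc (z + half_ham S z) - G (z - half_ham S z))) \<le> C * \<epsilon> * exp (- c / \<epsilon>)) \<and>
     (\<forall>x. complexify x \<in> Om (r / 80) \<longrightarrow> S (complexify x) \<in> \<real> \<and> G (complexify x) \<in> \<real>)"
    using nf by (simp add: I_def)
  then obtain S G where SG': "\<forall>\<epsilon>\<in>I.
     mv_holomorphic_on (S \<epsilon>) (Om (r / 80)) \<and> mv_holomorphic_on (G \<epsilon>) (Om (r / 80)) \<and>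
     (\<forall>z \<in> Om (r / 80). norm (S \<epsilon> z) \<le> C * \<epsilon> \<and> norm (G \<epsilon> z) \<le> C \<and> norm (half_ham (S \<epsilon>) z) \<le> C * \<epsilon> \<and> fd (G \<epsilon>) z (kgen z) = 0 \<and>
        norm (fd (S \<epsilon>) z (kgen z) - of_real \<epsilon> * (Vc (z + half_ham (S \<epsilon>) z) - G \<epsilon> (z - half_ham (S \<epsilon>) z))) \<le> C * \<epsilon> * exp (- c / \<epsilon>)) \<and>
     (\<forall>x. complexify x \<in> Om (r / 80) \<longrightarrow> S \<epsilon> (complexify x) \<in> \<real> \<and> G \<epsilon> (complexify x) \<in> \<real>)"
    unfolding bchoice_iff by blast
  have SG: "mv_holomorphic_on (S \<epsilon>) (Om (r / 80))" "mv_holomorphic_on (G \<epsilon>) (Om (r / 80))"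
    "\<And>z. z \<in> Om (r / 80) \<Longrightarrow> norm (S \<epsilon> z) \<le> C * \<epsilon>" "\<And>z. z \<in> Om (r / 80) \<Longrightarrow> norm (G \<epsilon> z) \<le> C"
    "\<And>z. z \<in> Om (r / 80) \<Longrightarrow> fd (G \<epsilon>) z (kgen z) = 0"
    "\<And>z. z \<in> Om (r / 80) \<Longrightarrow> norm (fd (S \<epsilon>) z (kgen z) - of_real \<epsilon> * (Vc (z + half_ham (S \<epsilon>) z) - G \<epsilon> (z - half_ham (S \<epsilon>) z))) \<le> \<epsilon> * (C * exp (- c / \<epsilon>))"
    "\<And>x. complexify x \<in> Om (r / 80) \<Longrightarrow> S \<epsilon> (complexify x) \<in> \<real>" if "\<epsilon> \<in> I" for \<epsilon>
    using bspec[OF SG' that] by (simp_all add: mult_ac)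
  have I01: "0 < \<epsilon> \<and> \<epsilon> < 1" if "\<epsilon> \<in> I" for \<epsilon> using that by (simp add: I_def)
  \<comment> \<open>\<open>S \<epsilon>\<close> is of order \<epsilon>; the quotient is a family
    bounded uniformly in \<epsilon>.\<close>
  define s where "s \<epsilon> x = rho x * Re (S \<epsilon> (complexify x) / of_real \<epsilon>)" for \<epsilon> x
  define gg where "gg \<epsilon> x = rho x * Re (G \<epsilon> (complexify x))" for \<epsilon> x
  define v where "v \<epsilon> x = chi x * Re (Vc (complexify x))" for \<epsilon> :: real and x
  have ballT: "cball (complexify x) (r / 50 - r / 80) \<subseteq> Om (r / 80)" if "x \<in> Trho" for x
  proof
    fix w assume "w \<in> cball (complexify x) (r / 50 - r / 80)"
    then show "w \<in> Om (r / 80)" using Om_shift[OF Trho_Om[OF that], of "w - complexify x" "r / 80"] by (simp add: dist_norm norm_minus_commute)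
  qed
  have dpos: "r / 50 - r / 80 > 0" using r by simp
  \<comment> \<open>Order 6 for the generating function: the flows in \<open>eliminate_all\<close>
    need three derivatives of the error, and \<open>midpoint_map\<close> loses three.\<close>
  have smooth: "UC (Suc (Suc (Suc (Suc (Suc (Suc 0)))))) I (\<lambda>_. rho)" "UC (Suc (Suc (Suc 0))) I (\<lambda>_. rho)"
    "UC (Suc (Suc (Suc 0))) I (\<lambda>_. chi)" by (intro rho_smooth chi_smooth, simp)+
  have us: "UC (Suc (Suc (Suc (Suc (Suc (Suc 0)))))) I s" unfolding s_def[abs_def]
  proof (rule UC_holomorphic[where T = Trho and \<delta> = "r / 50 - r / 80" and S = "Om (r / 80)" and B = C and F = "\<lambda>\<epsilon> z. S \<epsilon> z / of_real \<epsilon>"])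
    show "mv_holomorphic_on (\<lambda>z. S i z / of_real i) (Om (r / 80))" if "i \<in> I" for i
    proof (rule mvhI)
      show "((\<lambda>z. S i z / of_real i) has_derivative (\<lambda>h. fd (S i) z h / of_real i)) (at z)" if "z \<in> Om (r / 80)" for z
        unfolding divide_inverse by (intro has_derivative_mult_left mvh_D(1)[OF SG(1)[OF \<open>i \<in> I\<close>] that])
      show "fd (S i) z (a *s h) / of_real i = a * (fd (S i) z h / of_real i)" if "z \<in> Om (r / 80)" for z a h
        using mvh_D(2)[OF SG(1)[OF \<open>i \<in> I\<close>] that] by simp
    qed
    show "norm (S i z / of_real i) \<le> C" if "i \<in> I" "z \<in> Om (r / 80)" for i z
      using SG(3)[OF that] I01[OF that(1)] by (simp add: norm_divide divide_le_eq)
  qed (use smooth closed_Trho rho_outside ballT dpos open_Om in auto)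
  have ug: "UC (Suc (Suc (Suc 0))) I gg" unfolding gg_def[abs_def]
    by (rule UC_holomorphic[where T = Trho and \<delta> = "r / 50 - r / 80" and S = "Om (r / 80)" and B = C])
      (use smooth closed_Trho rho_outside ballT dpos open_Om SG in auto)
  have uv: "UC (Suc (Suc (Suc 0))) I v" unfolding v_def[abs_def]
    by (rule UC_holomorphic[where T = Tchi and \<delta> = "r / 16" and S = "{z. q_part z \<in> qdom K (r / 2)}" and B = Bv])
      (use smooth closed_Tchi chi_outside Tchi_ball r Vc_hol Vc_bound open_q_part_preimage[of "qdom K (r / 2)"] in \<open>auto simp: qdom_def\<close>)
  have far: "rho x = 0" if "norm x > 5 * b" for x using rho_outside Trho_norm that by force
  have "\<exists>C>0. \<exists>\<epsilon>1>0. \<exists>m. UC (Suc (Suc (Suc 0))) {\<epsilon>\<in>I. \<epsilon> < \<epsilon>1} (\<lambda>\<epsilon> z. v \<epsilon> (2 *\<^sub>R m \<epsilon> z - z) - gg \<epsilon> z - kgen (m \<epsilon> z) \<bullet> gr (s \<epsilon>) (m \<epsilon> z)) \<and>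
    (\<forall>\<epsilon>\<in>I. \<epsilon> < \<epsilon>1 \<longrightarrow> (\<forall>z. m \<epsilon> z = z + (\<epsilon> / 2) *\<^sub>R jmul (gr (s \<epsilon>) (m \<epsilon> z)) \<and> norm (m \<epsilon> z - z) \<le> C * \<epsilon> \<and>
       ham (v \<epsilon>) \<epsilon> (2 *\<^sub>R m \<epsilon> z - z) = kinetic z + \<epsilon> * gg \<epsilon> z + \<epsilon> * (v \<epsilon> (2 *\<^sub>R m \<epsilon> z - z) - gg \<epsilon> z - kgen (m \<epsilon> z) \<bullet> gr (s \<epsilon>) (m \<epsilon> z))) \<and>
     sympC1 (\<lambda>z. 2 *\<^sub>R m \<epsilon> z - z) UNIV \<and> inj (\<lambda>z. 2 *\<^sub>R m \<epsilon> z - z))"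
    by (rule midpoint_map[OF us _ uv ug I01]) (use far in \<open>auto simp: s_def\<close>)
  then obtain C4 e4 m where C4: "C4 > 0" "e4 > 0"
    and ue: "UC (Suc (Suc (Suc 0))) {\<epsilon>\<in>I. \<epsilon> < e4} (\<lambda>\<epsilon> z. v \<epsilon> (2 *\<^sub>R m \<epsilon> z - z) - gg \<epsilon> z - kgen (m \<epsilon> z) \<bullet> gr (s \<epsilon>) (m \<epsilon> z))"
    and m': "\<forall>\<epsilon>\<in>I. \<epsilon> < e4 \<longrightarrow> (\<forall>z. m \<epsilon> z = z + (\<epsilon> / 2) *\<^sub>R jmul (gr (s \<epsilon>) (m \<epsilon> z)) \<and> norm (m \<epsilon> z - z) \<le> C4 * \<epsilon> \<and>
       ham (v \<epsilon>) \<epsilon> (2 *\<^sub>R m \<epsilon> z - z) = kinetic z + \<epsilon> * gg \<epsilon> z + \<epsilon> * (v \<epsilon> (2 *\<^sub>R m \<epsilon> z - z) - gg \<epsilon> z - kgen (m \<epsilon> z) \<bullet> gr (s \<epsilon>) (m \<epsilon> z))) \<and>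
     sympC1 (\<lambda>z. 2 *\<^sub>R m \<epsilon> z - z) UNIV \<and> inj (\<lambda>z. 2 *\<^sub>R m \<epsilon> z - z)"
    by (elim exE conjE)
  define e where "e \<epsilon> z = v \<epsilon> (2 *\<^sub>R m \<epsilon> z - z) - gg \<epsilon> z - kgen (m \<epsilon> z) \<bullet> gr (s \<epsilon>) (m \<epsilon> z)" for \<epsilon> z
  have m: "m \<epsilon> z = z + (\<epsilon> / 2) *\<^sub>R jmul (gr (s \<epsilon>) (m \<epsilon> z))" "norm (m \<epsilon> z - z) \<le> C4 * \<epsilon>"
    "ham (v \<epsilon>) \<epsilon> (2 *\<^sub>R m \<epsilon> z - z) = kinetic z + \<epsilon> * gg \<epsilon> z + \<epsilon> * e \<epsilon> z"
    "sympC1 (\<lambda>z. 2 *\<^sub>R m \<epsilon> z - z) UNIV" "inj (\<lambda>z. 2 *\<^sub>R m \<epsilon> z - z)" if "\<epsilon> \<in> I" "\<epsilon> < e4" for \<epsilon> z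
    unfolding e_def using mp[OF bspec[OF m' that(1)] that(2)] by blast+
  define I2 where "I2 = {\<epsilon>\<in>I. \<epsilon> < e4}"
  \<comment> \<open>Near \<open>K\<close> this is the error itself. Elsewhere the factors supply the
    compact support and the vanishing near obstacles that \<open>eliminate_all\<close>
    requires.\<close>
  define E where "E \<epsilon> z = beta z * chi z * e \<epsilon> z" for \<epsilon> z
  have uE: "UC (Suc (Suc (Suc 0))) I2 E"
    unfolding E_def[abs_def] I2_def e_def by (intro UC_mult ue beta_smooth chi_smooth) simp_all
  have ug2: "UC (Suc (Suc (Suc 0))) I2 gg" by (rule UC_shrink[OF ug]) (auto simp: I2_def)
  obtain ys where ys: "set ys = Y" using finite_list[OF Y(1)] by blast
  have beta0: "beta z = 0" if "norm z > 5 * b" for z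
  proof -
    have "(2 * b)\<^sup>2 \<le> (norm z)\<^sup>2" using that b(1) by (intro power_mono) simp_all
    moreover have "b\<^sup>2 < (2 * b)\<^sup>2" using b(1) by (intro power_strict_mono) simp_all
    ultimately show ?thesis by (simp add: beta_def smooth_step_eq_1)
  qed
  have "\<exists>M>0. \<exists>\<epsilon>1>0. \<forall>\<epsilon>\<in>I2. \<epsilon> < \<epsilon>1 \<longrightarrow> (\<exists>\<Psi>. sympC1 \<Psi> (nbhd K (r / 64)) \<and> inj_on \<Psi> (nbhd K (r / 64)) \<and>
     (\<forall>z\<in>nbhd K (r / 64). norm (\<Psi> z - z) \<le> M * \<epsilon> \<and>
        ham (\<lambda>z. gg \<epsilon> z + E \<epsilon> z) \<epsilon> (\<Psi> z) = ham (\<lambda>z. gg \<epsilon> z + E \<epsilon> z * (\<Prod>y\<leftarrow>ys. cut y z)) \<epsilon> z))"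
  proof (rule eliminate_all[where Rs = "5 * b" and R = "r / 8" and c = "4 * c1" and ?s0.0 = "r / 32"])
    show "gg i x = 0" if "norm x > 5 * b" for i x using far[OF that] by (simp add: gg_def)
    show "E i x = 0" if "norm x > 5 * b" for i x using beta0[OF that] by (simp add: E_def)
    show "0 < \<epsilon>" if "\<epsilon> \<in> I2" for \<epsilon> using I01 that by (simp add: I2_def)
    show "r / 8 \<le> norm (q_part z - y)" if y: "y \<in> set ys" and z: "\<exists>k\<in>K. dist z k \<le> r / 32" for y z
    proof -
      obtain k where k: "k \<in> K" "norm (z - k) \<le> r / 32" using z by (auto simp: dist_norm)
      have "norm (q_part k - q_part z) \<le> r / 16" using norm_q_part_le[of "k - z"] k(2) by (simp add: q_part_diff norm_minus_commute)
      then show ?thesis using Y(2)[of y k] y ys k(1) r norm_triangle_ineq[of "q_part k - q_part z" "q_part z - y"] by simp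
    qed
    show "E i z = 0" if y: "y \<in> set ys" and z: "norm (q_part z - y) < r / 8" for i y z
    proof -
      have "z \<notin> Tchi" using y z ys unfolding Tchi_def by force
      then show ?thesis using chi_outside by (simp add: E_def)
    qed
    show "UC (Suc (Suc (Suc 0))) I2 (\<lambda>_. cut y)" for y by (rule cut_smooth) simp
    show "3 * (4 * c1) \<le> (r / 8)\<^sup>2 / 4" by (simp add: c1_def)
  qed (use ug2 uE K r c1 cut_eq_1 in auto)
  then obtain M e5 where M: "M > 0" "e5 > 0" and elim: "\<forall>\<epsilon>\<in>I2. \<epsilon> < e5 \<longrightarrow> (\<exists>\<Psi>. sympC1 \<Psi> (nbhd K (r / 64)) \<and> inj_on \<Psi> (nbhd K (r / 64)) \<and>
     (\<forall>z\<in>nbhd K (r / 64). norm (\<Psi> z - z) \<le> M * \<epsilon> \<and>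
        ham (\<lambda>z. gg \<epsilon> z + E \<epsilon> z) \<epsilon> (\<Psi> z) = ham (\<lambda>z. gg \<epsilon> z + E \<epsilon> z * (\<Prod>y\<leftarrow>ys. cut y z)) \<epsilon> z))"
    by (elim exE conjE)
  obtain d where d: "d > 0" "\<forall>y\<in>Y. \<forall>x x'. norm x \<le> b \<longrightarrow> norm x' \<le> b \<longrightarrow> norm (x - x') < d \<longrightarrow> \<bar>uu y x - uu y x'\<bar> < c1"
    using uu_uniform[OF Y(1) c1] by blast
  \<comment> \<open>The last three bounds limit the midpoint displacement to \<open>r / 64\<close>,
    the change of \<open>uu\<close> between \<open>z\<close> and its midpoint to \<open>c1\<close>,
    and the displacement of \<open>\<Phi>\<close> to \<open>r / 64\<close>.\<close>
  define \<epsilon>0 where "\<epsilon>0 = min (min (min e1 1) (min e4 e5)) (min (min (r / 64 / (2 * C4)) (d / C4)) (r / 64 / M))"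
  have e0: "\<epsilon>0 > 0" using C C4 M d r by (simp add: \<epsilon>0_def)
  show ?thesis
  proof (rule exI[of _ \<epsilon>0], rule conjI[OF e0], rule exI[of _ c], rule conjI[OF C(2)], rule exI[of _ C], rule exI[of _ "2 * C4 + M"],
      rule exI[of _ "nbhd K (r / 64)"], intro conjI allI impI)
    show "open (nbhd K (r / 64))" by simp
    show "K \<subseteq> nbhd K (r / 64)"
    proof
      fix z assume "z \<in> K"
      then show "z \<in> nbhd K (r / 64)" using r unfolding nbhd_def by (intro CollectI bexI[of _ z]) simp_all
    qed
    fix \<epsilon> assume \<epsilon>: "0 < \<epsilon> \<and> \<epsilon> < \<epsilon>0"
    have eI: "\<epsilon> \<in> I" "\<epsilon> < e4" "\<epsilon> \<in> I2" "\<epsilon> < e5" using \<epsilon> by (auto simp: I_def I2_def \<epsilon>0_def)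
    have ep: "\<epsilon> > 0" "\<epsilon> < 1" using I01[OF eI(1)] by auto
    have small: "2 * (C4 * \<epsilon>) \<le> r / 64" "C4 * \<epsilon> < d" "M * \<epsilon> \<le> r / 64"
    proof -
      have "\<epsilon> < r / 64 / (2 * C4)" "\<epsilon> < d / C4" "\<epsilon> < r / 64 / M" using \<epsilon> by (auto simp: \<epsilon>0_def)
      then show "2 * (C4 * \<epsilon>) \<le> r / 64" "C4 * \<epsilon> < d" "M * \<epsilon> \<le> r / 64" using C4 M by (simp_all add: field_simps)
    qed
    note me = m[OF eI(1,2)]
    have mdist: "norm (2 *\<^sub>R m \<epsilon> w - w - w) \<le> 2 * (C4 * \<epsilon>)" for w
    proof -
      have "2 *\<^sub>R m \<epsilon> w - w - w = 2 *\<^sub>R (m \<epsilon> w - w)" by (simp add: algebra_simps scaleR_2)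
      then show ?thesis using me(2)[of w] by simp
    qed
    have nearI: "near x" if w: "w \<in> nbhd K (r / 32)" "norm (x - w) \<le> r / 64" for x w
    proof -
      obtain k where k: "k \<in> K" "norm (w - k) < r / 32" using w(1) by (auto simp: nbhd_def dist_norm)
      have "norm (x - k) \<le> 3 * r / 64" using norm_triangle_ineq[of "x - w" "w - k"] k(2) w(2) by simp
      then show ?thesis using k(1) by (auto simp: near_def)
    qed
    have sub: "nbhd K (r / 64) \<subseteq> nbhd K (r / 32)" using nbhd_near[of _ K "r / 64" _ "r / 32"] r by auto
    have eb: "\<bar>e \<epsilon> z\<bar> \<le> C * exp (- c / \<epsilon>)" if z: "z \<in> nbhd K (r / 32)" and u: "\<And>y. y \<in> Y \<Longrightarrow> 3 * c1 < \<bar>uu y z\<bar>" for z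
    proof -
      have nr: "near z" "near (m \<epsilon> z)" "near (2 *\<^sub>R m \<epsilon> z - z)"
        using me(2)[of z] mdist[of z] small(1) r by (intro nearI[OF z]; simp)+
      have um: "2 * c1 < \<bar>uu y (m \<epsilon> z)\<bar>" if "y \<in> Y" for y
      proof -
        have "\<bar>uu y (m \<epsilon> z) - uu y z\<bar> < c1"
          using bspec[OF d(2) that, rule_format, of "m \<epsilon> z" z] near_facts(1)[OF nr(1)] near_facts(1)[OF nr(2)] me(2)[of z] small(2) by simp
        then show ?thesis using u[OF that] by linarith
      qed
      have uz: "2 * c1 < \<bar>uu y z\<bar>" if "y \<in> Y" for y using u[OF that] c1 by linarith
      have "\<bar>chi (2 *\<^sub>R m \<epsilon> z - z) * Re (Vc (complexify (2 *\<^sub>R m \<epsilon> z - z))) - rho z * Re (G \<epsilon> (complexify z)) -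
          kgen (m \<epsilon> z) \<bullet> gr (\<lambda>x. rho x * Re (S \<epsilon> (complexify x) / of_real \<epsilon>)) (m \<epsilon> z)\<bar> \<le> C * exp (- c / \<epsilon>)"
        by (rule remainder_estimate[OF SG(1)[OF eI(1)] ep(1) SG(7)[OF eI(1)] SG(6)[OF eI(1)] _ um uz nr(2) nr(1) nr(3)])
          (use me(1)[of z] in \<open>simp_all add: s_def[abs_def]\<close>)
      then show ?thesis by (simp add: e_def v_def gg_def s_def[abs_def])
    qed
    obtain \<Phi> where Phi: "sympC1 \<Phi> (nbhd K (r / 64))" "inj_on \<Phi> (nbhd K (r / 64))" and
      Phi': "\<forall>z\<in>nbhd K (r / 64). norm (\<Phi> z - z) \<le> M * \<epsilon> \<and>
        ham (\<lambda>z. gg \<epsilon> z + E \<epsilon> z) \<epsilon> (\<Phi> z) = ham (\<lambda>z. gg \<epsilon> z + E \<epsilon> z * (\<Prod>y\<leftarrow>ys. cut y z)) \<epsilon> z"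
      using mp[OF bspec[OF elim eI(3)] eI(4)] by (elim exE conjE)
    have PhiN: "\<Phi> z \<in> nbhd K (r / 32)" if "z \<in> nbhd K (r / 64)" for z
      using nbhd_near[OF that, of "\<Phi> z" "r / 32"] bspec[OF Phi' that] small(3) by (simp add: dist_norm)
    define \<Psi> where "\<Psi> z = 2 *\<^sub>R m \<epsilon> (\<Phi> z) - \<Phi> z" for z
    define R where "R z = exp (c / \<epsilon>) * \<epsilon> * (E \<epsilon> z * (\<Prod>y\<leftarrow>ys. cut y z))" for z
    have G_diff: "gg \<epsilon> differentiable (at z)" for z using ug eI(1) by (simp add: UC_Suc)
    have gradG: "gradient (gg \<epsilon>) = gr (gg \<epsilon>)" using gradient_eq_gr[OF G_diff] by blast
    show "\<exists>\<Psi> G R. symplectic_change_on \<Psi> (nbhd K (r / 64)) \<and>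
        (\<forall>z\<in>nbhd K (r / 64). norm (\<Psi> z - z) \<le> (2 * C4 + M) * \<epsilon>) \<and>
        (\<forall>z\<in>nbhd K (r / 64). H0 V \<epsilon> (\<Psi> z) = kinetic z + \<epsilon> * G z + exp (- c / \<epsilon>) * R z) \<and>
        C1_function_on G (nbhd K (r / 64)) \<and> (\<forall>z\<in>nbhd K (r / 64). poisson G kinetic z = 0) \<and>
        (\<forall>z\<in>K. \<bar>G z\<bar> \<le> C \<and> \<bar>R z\<bar> \<le> C)"
    proof (rule exI[of _ \<Psi>], rule exI[of _ "gg \<epsilon>"], rule exI[of _ R], intro conjI ballI)
      show "symplectic_change_on \<Psi> (nbhd K (r / 64))"
      proof (rule symplectic_changeI)
        show "sympC1 \<Psi> (nbhd K (r / 64))" unfolding \<Psi>_def[abs_def]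
          by (rule sympC1_compose[OF me(4) Phi(1)]) simp
        show "inj_on \<Psi> (nbhd K (r / 64))"
          using comp_inj_on[OF Phi(2) inj_on_subset[OF me(5) subset_UNIV]] by (simp add: o_def \<Psi>_def[abs_def])
      qed
      show "norm (\<Psi> z - z) \<le> (2 * C4 + M) * \<epsilon>" if z: "z \<in> nbhd K (r / 64)" for z
        using norm_triangle_ineq[of "\<Psi> z - \<Phi> z" "\<Phi> z - z"] mdist[of "\<Phi> z"] bspec[OF Phi' z]
        by (simp add: \<Psi>_def algebra_simps)
      show "H0 V \<epsilon> (\<Psi> z) = kinetic z + \<epsilon> * gg \<epsilon> z + exp (- c / \<epsilon>) * R z" if z: "z \<in> nbhd K (r / 64)" for z
      proof -
        let ?w = "\<Phi> z"
        have nw: "near ?w" "near (\<Psi> z)"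
          using mdist[of ?w] small(1) r unfolding \<Psi>_def by (intro nearI[OF PhiN[OF z]]; simp)+
        have "complexify (\<Psi> z) \<in> cball (complexify (\<Psi> z)) (r / 16)" using r by simp
        then have "q_part (complexify (\<Psi> z)) \<in> qdom K (r / 2)"
          using Tchi_ball[OF near_facts(5)[OF nw(2)]] by blast
        then have "Re (Vc (complexify (\<Psi> z))) = V (q_part (\<Psi> z))" using Vc_real by simp
        then have "H0 V \<epsilon> (\<Psi> z) = ham (v \<epsilon>) \<epsilon> (\<Psi> z)"
          by (simp add: H0_def ham_def v_def near_facts(4)[OF nw(2)])
        also have "\<dots> = ham (\<lambda>z. gg \<epsilon> z + E \<epsilon> z) \<epsilon> ?w"
          unfolding \<Psi>_def me(3) by (simp add: ham_def E_def near_facts(3,4)[OF nw(1)] distrib_left)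
        also have "\<dots> = kinetic z + \<epsilon> * gg \<epsilon> z + \<epsilon> * (E \<epsilon> z * (\<Prod>y\<leftarrow>ys. cut y z))"
          using bspec[OF Phi' z] by (simp add: ham_def distrib_left)
        also have "\<epsilon> * (E \<epsilon> z * (\<Prod>y\<leftarrow>ys. cut y z)) = exp (- c / \<epsilon>) * R z"
        proof -
          have "exp (- c / \<epsilon>) * exp (c / \<epsilon>) = 1" by (simp add: exp_add[symmetric])
          then show ?thesis unfolding R_def by (metis mult.assoc mult_1)
        qed
        finally show ?thesis .
      qed
      show "C1_function_on (gg \<epsilon>) (nbhd K (r / 64))" unfolding C1_function_on_def gradG
      proof (intro conjI ballI G_diff)
        have "continuous_on UNIV (pd j (gg \<epsilon>))" for j using UC_continuous[OF UC_pd[OF ug] eI(1)] .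
        then have "continuous_on UNIV (gr (gg \<epsilon>))" unfolding gr_def[abs_def]
          by (intro continuous_on_vec4) simp
        then show "continuous_on (nbhd K (r / 64)) (gr (gg \<epsilon>))" by (rule continuous_on_subset) simp
      qed
      show "poisson (gg \<epsilon>) kinetic z = 0" for z
        unfolding poisson_kinetic[OF G_diff] unfolding gg_def[abs_def]
        by (rule averaged_cut_invariant[OF SG(2)[OF eI(1)] SG(5)[OF eI(1)]])
      fix z assume zK: "z \<in> K"
      show "\<bar>gg \<epsilon> z\<bar> \<le> C"
      proof (cases "z \<in> Trho")
        case True
        have "complexify z \<in> Om (r / 80)" using ballT[OF True] dpos by (meson centre_in_cball less_imp_le subsetD)
        then have "\<bar>Re (G \<epsilon> (complexify z))\<bar> \<le> C" using SG(4)[OF eI(1)] order_trans[OF abs_Re_le_cmod] by simp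
        then have "\<bar>rho z\<bar> * \<bar>Re (G \<epsilon> (complexify z))\<bar> \<le> 1 * C" using cutoff_range[of z] by (intro mult_mono) simp_all
        then show ?thesis by (simp add: gg_def abs_mult)
      next
        case False
        then show ?thesis using rho_outside[OF False] C by (simp add: gg_def)
      qed
      have z: "z \<in> nbhd K (r / 32)" using zK r unfolding nbhd_def by (intro CollectI bexI[of _ z]) simp_all
      show "\<bar>R z\<bar> \<le> C"
      proof (cases "(\<Prod>y\<leftarrow>ys. cut y z) = 0")
        case True
        then show ?thesis using C by (simp add: R_def)
      next
        case False
        \<comment> \<open>A nonzero product of cutoffs confines \<open>z\<close> to circles avoiding
          all obstacles, which is where \<open>eb\<close> gives the exponential bound.\<close>
        then have "3 * c1 < \<bar>uu y z\<bar>" if "y \<in> Y" for y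
          using that ys cut_nonzero[of y z] by (force simp: prod_list_zero_iff)
        from eb[OF z this] have e: "\<bar>e \<epsilon> z\<bar> \<le> C * exp (- c / \<epsilon>)" by simp
        have p: "0 \<le> (\<Prod>y\<leftarrow>zs. cut y z) \<and> (\<Prod>y\<leftarrow>zs. cut y z) \<le> 1" for zs
          by (induction zs) (auto simp: cut_def smooth_step_bounds intro!: mult_nonneg_nonneg mult_le_one)
        have bc: "0 \<le> beta z * chi z" "beta z * chi z \<le> 1" using cutoff_range[of z] by (auto intro!: mult_le_one)
        have "\<bar>E \<epsilon> z * (\<Prod>y\<leftarrow>ys. cut y z)\<bar> = (beta z * chi z) * (\<bar>e \<epsilon> z\<bar> * (\<Prod>y\<leftarrow>ys. cut y z))"
          using bc(1) p[of ys] by (simp add: E_def abs_mult cutoff_range)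
        also have "\<dots> \<le> 1 * ((C * exp (- c / \<epsilon>)) * 1)"
          using bc p[of ys] e by (intro mult_mono) (auto intro!: mult_nonneg_nonneg)
        finally have "\<epsilon> * \<bar>E \<epsilon> z * (\<Prod>y\<leftarrow>ys. cut y z)\<bar> \<le> 1 * (C * exp (- c / \<epsilon>))"
          using ep by (intro mult_mono) auto
        then have "exp (c / \<epsilon>) * (\<epsilon> * \<bar>E \<epsilon> z * (\<Prod>y\<leftarrow>ys. cut y z)\<bar>) \<le> exp (c / \<epsilon>) * (C * exp (- c / \<epsilon>))" by simp
        also have "\<dots> = C" by (simp add: exp_minus)
        finally show ?thesis using ep(1) by (simp add: R_def abs_mult mult.assoc)
      qed
    qed
  qed
qed

end

section \<open>Choice of the net of obstacles and of the constants\<close>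

theorem theorem2p1:
  fixes K :: "(real ^ 4) set" and V :: "real ^ 2 \<Rightarrow> real" and r \<epsilon>1 :: real
    and T :: "real \<Rightarrow> real set" and \<zeta> :: "real \<Rightarrow> real \<Rightarrow> real ^ 4"
  assumes "compact K"
    and "\<epsilon>1 > 0"
    and "\<And>\<epsilon>. 0 < \<epsilon> \<Longrightarrow> \<epsilon> < \<epsilon>1 \<Longrightarrow>
           is_interval (T \<epsilon>) \<and> interior (T \<epsilon>) \<noteq> {} \<and>
           solves_motion V \<epsilon> (T \<epsilon>) (\<zeta> \<epsilon>) \<and> \<zeta> \<epsilon> ` T \<epsilon> \<subseteq> K"
    and "r > 0"
    and "potential_analytic_in V r K"
  shows "\<exists>\<epsilon>0>0. \<exists>c>0. \<exists>C M :: real. \<exists>U. open U \<and> K \<subseteq> U \<and>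
           (\<forall>\<epsilon>. 0 < \<epsilon> \<and> \<epsilon> < \<epsilon>0 \<longrightarrow>
              (\<exists>\<Psi> G R.
                 symplectic_change_on \<Psi> U \<and>
                 (\<forall>z\<in>U. norm (\<Psi> z - z) \<le> M * \<epsilon>) \<and>
                 (\<forall>z\<in>U. H0 V \<epsilon> (\<Psi> z) = kinetic z + \<epsilon> * G z + exp (- c / \<epsilon>) * R z) \<and>
                 C1_function_on G U \<and>
                 (\<forall>z\<in>U. poisson G kinetic z = 0) \<and>
                 (\<forall>z\<in>K. \<bar>G z\<bar> \<le> C \<and> \<bar>R z\<bar> \<le> C)))"
proof -
  obtain Vc Bv where Vc: "Bv > 0" "mv_holomorphic_on Vc {z. q_part z \<in> qdom K (r / 2)}"
    "\<forall>z. q_part z \<in> qdom K (r / 2) \<longrightarrow> norm (Vc z) \<le> Bv"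
    "\<forall>x. q_part (complexify x) \<in> qdom K (r / 2) \<longrightarrow> Vc (complexify x) = of_real (V (q_part x))"
    using potential_extension[OF assms(1,4,5)] by blast
  obtain B where B: "B > 0" "\<forall>k\<in>K. norm k \<le> B" using compact_imp_bounded[OF assms(1)] by (auto simp: bounded_pos)
  define b where "b = B + r + 1"
  have b: "b > 0" "\<And>k. k \<in> K \<Longrightarrow> norm k + r < b" using B \<open>r > 0\<close> by (force simp: b_def)+
  define c where "c = (r / 8)\<^sup>2 / 48"
  have c: "c > 0" using \<open>r > 0\<close> by (simp add: c_def)
  \<comment> \<open>As \<open>g \<le> 1\<close>, the product in the last condition on
    \<open>g\<close> is at most \<open>g * (120 * b + 1)\<close>, hence at most
    \<open>c / 2\<close>; \<open>c\<close> is the future \<open>c1\<close>.\<close>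
  define g where "g = min (min 1 (r / 8)) (c / (2 * (120 * b + 1)))"
  have g: "g > 0" "g \<le> r / 8" "g \<le> 1" "g \<le> c / (2 * (120 * b + 1))"
    using b(1) c \<open>r > 0\<close> unfolding g_def by (simp, linarith, linarith, linarith)
  have "g * (2 * (60 * b) + g) \<le> c / (2 * (120 * b + 1)) * (120 * b + 1)"
    using g b(1) c by (intro mult_mono) auto
  also have "\<dots> = c / 2" using b(1) by (simp add: field_simps)
  also have "\<dots> < (r / 8)\<^sup>2 / 48" using c by (simp add: c_def)
  finally have g3: "g * (2 * (60 * b) + g) < (r / 8)\<^sup>2 / 48" .
  obtain Y where Y: "finite Y" "\<forall>y\<in>Y. \<forall>k\<in>K. r / 4 \<le> norm (q_part k - y)"
    "\<forall>q. norm q \<le> 40 * b \<and> (\<forall>k\<in>K. r / 4 \<le> norm (q - q_part k)) \<longrightarrow> (\<exists>y\<in>Y. norm (q - y) < g)"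
    using finite_cover_of_gaps[OF g(1), of K "r / 4" "40 * b"] by (elim exE conjE)
  interpret cut_circles K r b g V Vc Bv Y
  proof
    show "compact K" "0 < r" "0 < Bv" "0 < b" "finite Y" "0 < g" "g \<le> r / 8" "g * (2 * (60 * b) + g) < (r / 8)\<^sup>2 / 48"
      "mv_holomorphic_on Vc {z. q_part z \<in> qdom K (r / 2)}" by fact+
    show "norm (Vc z) \<le> Bv" if "q_part z \<in> qdom K (r / 2)" for z using Vc(3) that by blast
    show "Vc (complexify x) = of_real (V (q_part x))" if "q_part (complexify x) \<in> qdom K (r / 2)" for x using Vc(4) that by blast
    show "norm k + r < b" if "k \<in> K" for k by (rule b(2)[OF that])
    show "r / 4 \<le> norm (q_part k - y)" if "y \<in> Y" "k \<in> K" for y k using Y(2) that by blast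
    show "\<exists>y\<in>Y. norm (q - y) < g" if "norm q \<le> 40 * b" "\<And>k. k \<in> K \<Longrightarrow> r / 4 \<le> norm (q - q_part k)" for q
      using Y(3) that by blast
  qed
  show ?thesis by (rule change_of_coordinates)
qed

end
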